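(* Let $\omega$, $\mathbf L$, $Z$, $\tau$, $R$, $\sigma$ and the operator $T_\omega$ be as described in the context. Let $q>2+\sigma$ and let $P\in L^q_{\mathrm{loc}}(\mathbb R^2;\mathbb C)$. Put $$\alpha=\frac{2-r-\mu}{r},\qquad r=\frac{q}{q-1},\qquad \mu=\frac{\sigma}{\sigma+1}.$$ Then $T_\omega P\in C^\alpha(\mathbb R^2)$ and the following hold for all $(x,y)\in\mathbb R^2$: (i) $T_\omega P(x+1,y)=T_\omega P(x,y)$; (ii) $T_\omega P(x,y+1)=T_\omega P(x,y)-\displaystyle\int_R P(s)\,d\mu_s$; (iii) if in addition $P$ is doubly periodic, i.e. $P(x+1,y)=P(x,y+1)=P(x,y)$ for almost every $(x,y)\in\mathbb R^2$, then $\mathbf L\,T_\omega P=P$ in the sense of distributions on $\mathbb R^2$.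
   Context: Setting. Let $\mathbb T^2=\mathbb R^2/\mathbb Z^2$ with coordinates $(x,y)$ and covering map $\Pi:\mathbb R^2\to\mathbb T^2$. Let $\omega=a\,dx+b\,dy$ be a nowhere vanishing closed complex-valued one-form on $\mathbb T^2$ with $a,b\in C^{1+\varepsilon}(\mathbb T^2;\mathbb C)$, $\varepsilon>0$, such that: (a) the set $\Sigma=\{p\in\mathbb T^2:\ \omega(p)\wedge\overline{\omega(p)}=0\}$ is a one-dimensional (embedded) manifold, with connected components $\Sigma_1,\dots,\Sigma_N$; (b) for each $i$ there is a number $\sigma_i>0$ such that every $p\in\Sigma_i$ has a neighborhood in which $\omega\wedge\overline\omega=|\rho_i|^{\sigma_i}g\,dx\wedge dy$, where $\rho_i$ is a (real-valued) defining function of $\Sigma_i$ near $p$ and $g$ is a non-vanishing continuous function; (c) $\omega$ is hypocomplex: every $p\in\mathbb T^2$ has an open neighborhood $U$ with a first integral $\zeta\in C^{1+\varepsilon}(U;\mathbb C)$ (that is, $d\zeta\neq0$ and $d\zeta\wedge\omega=0$ on $U$) such that $\zeta:U\to\zeta(U)\subset\mathbb C$ is a homeomorphism; (d) near each $p\in\Sigma_i$ there are local ($C^1$) coordinates $(s,t)$ in which $\omega$ is a non-vanishing multiple of $ds+i|t|^{\sigma_i}dt$. Put $\sigma=\max_{1\le i\le N}\sigma_i$, $R=[0,1]\times[0,1]\subset\mathbb R^2$, $\Omega=\Pi^\ast\omega$, $\mathbf L=(\Pi^\ast b)\,\partial_x-(\Pi^\ast a)\,\partial_y$ on $\mathbb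 R^2$, and $Z(x,y)=\int_{(0,0)}^{(x,y)}\Omega$. It is assumed (normalization) that $Z(x+1,y)=Z(x,y)+1$ and $Z(x,y+1)=Z(x,y)+\tau$ for all $(x,y)$, where $\tau\in\mathbb C$, $\mathrm{Im}(\tau)>0$. Then $Z:\mathbb R^2\to\mathbb C$ is a homeomorphism. Theta function: $\Theta(z)=\sum_{m\in\mathbb Z}e^{\pi i m^2\tau}e^{2\pi i m z}$, which satisfies $\Theta(z+1)=\Theta(z)$, $\Theta(z+\tau)=e^{-i\pi\tau-2\pi i z}\Theta(z)$, and whose zeros are simple and are exactly the points $z_0+j+k\tau$, $j,k\in\mathbb Z$, with $z_0=(1+\tau)/2$. Operator: $$T_\omega g(p)=\frac1{2\pi i}\int_R\frac{\Theta'(Z(p)-Z(s)+z_0)}{\Theta(Z(p)-Z(s)+z_0)}\,g(s)\,d\mu_s,\qquad p\in\mathbb R^2,$$ where $d\mu_s$ is Lebesgue measure. Conventions: $C^\alpha(\mathbb R^2)$ denotes functions that are Hölder continuous with exponent $\alpha$ on every compact subset of $\mathbb R^2$. Since $\omega$ is closed, $\mathbf L$ is divergence free, and $\mathbf Lu=f$ in the sense of distributions means $-\int u\,\mathbf L\phi\,d\mu=\int f\phi\,d\mu$ for all $\phi\in C_0^\infty(\mathbb R^2)$. *)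

theory Defs
  imports "HOL-Analysis.Analysis"
begin

text \<open>The quotient $R^2/Z^2$ is realised as the product of two unit circles; its covering map is
  the one below. Functions on the torus are functions on \<open>complex \<times> complex\<close> of which only the
  values on \<open>torus\<close> are ever used.\<close>

definition torus_cover :: "real \<times> real \<Rightarrow> complex \<times> complex" where
  "torus_cover p = (cis (2 * pi * fst p), cis (2 * pi * snd p))"

definition torus :: "(complex \<times> complex) set" where
  "torus = range torus_cover"

definition lift_torus :: "(complex \<times> complex \<Rightarrow> 'a) \<Rightarrow> real \<times> real \<Rightarrow> 'a" where
  "lift_torus f = f \<circ> torus_cover"

definition unit_square :: "(real \<times> real) set" where
  "unit_square = {0..1} \<times> {0..1}"

text \<open>Partial derivatives; only meaningful where the function is differentiable, which all
  predicates below demand separately.\<close>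

definition dx :: "(real \<times> real \<Rightarrow> 'a::real_normed_vector) \<Rightarrow> real \<times> real \<Rightarrow> 'a" where
  "dx f p = frechet_derivative f (at p) (1, 0)"

definition dy :: "(real \<times> real \<Rightarrow> 'a::real_normed_vector) \<Rightarrow> real \<times> real \<Rightarrow> 'a" where
  "dy f p = frechet_derivative f (at p) (0, 1)"

definition C1_on :: "(real \<times> real) set \<Rightarrow> (real \<times> real \<Rightarrow> 'a::real_normed_vector) \<Rightarrow> bool" where
  "C1_on U f \<longleftrightarrow> (\<forall>p\<in>U. f differentiable (at p)) \<and>
     continuous_on U (dx f) \<and> continuous_on U (dy f)"

definition holder_on :: "real \<Rightarrow> (real \<times> real) set \<Rightarrow> (real \<times> real \<Rightarrow> complex) \<Rightarrow> bool" where
  "holder_on \<alpha> U f \<longleftrightarrow> (\<forall>K. compact K \<and> K \<subseteq> U \<longrightarrow>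
     (\<exists>C. \<forall>p\<in>K. \<forall>q\<in>K. norm (f p - f q) \<le> C * dist p q powr \<alpha>))"

text \<open>The class \<open>C\<^sup>1\<^sup>+\<^sup>\<epsilon>\<close> on an open set, for \<open>0 < \<epsilon> < 1\<close>.\<close>

definition C1_holder_on :: "real \<Rightarrow> (real \<times> real) set \<Rightarrow> (real \<times> real \<Rightarrow> complex) \<Rightarrow> bool" where
  "C1_holder_on \<epsilon> U f \<longleftrightarrow> C1_on U f \<and> holder_on \<epsilon> U (dx f) \<and> holder_on \<epsilon> U (dy f)"

primrec Ck :: "nat \<Rightarrow> (real \<times> real \<Rightarrow> complex) \<Rightarrow> bool" where
  "Ck 0 f \<longleftrightarrow> continuous_on UNIV f"
| "Ck (Suc k) f \<longleftrightarrow> (\<forall>p. f differentiable (at p)) \<and> Ck k (dx f) \<and> Ck k (dy f)"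

definition test_function :: "(real \<times> real \<Rightarrow> complex) \<Rightarrow> bool" where
  "test_function \<phi> \<longleftrightarrow> (\<forall>k. Ck k \<phi>) \<and> compact (closure {p. \<phi> p \<noteq> 0})"

definition Lq_loc :: "real \<Rightarrow> (real \<times> real \<Rightarrow> complex) \<Rightarrow> bool" where
  "Lq_loc q f \<longleftrightarrow> f \<in> borel_measurable lebesgue \<and>
     (\<forall>K. compact K \<longrightarrow> set_integrable lebesgue K (\<lambda>s. norm (f s) powr q))"

definition nowhere_vanishing_form ::
  "(complex \<times> complex \<Rightarrow> complex) \<Rightarrow> (complex \<times> complex \<Rightarrow> complex) \<Rightarrow> bool" where
  "nowhere_vanishing_form a b \<longleftrightarrow> (\<forall>p\<in>torus. a p \<noteq> 0 \<or> b p \<noteq> 0)"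

definition closed_form ::
  "(complex \<times> complex \<Rightarrow> complex) \<Rightarrow> (complex \<times> complex \<Rightarrow> complex) \<Rightarrow> bool" where
  "closed_form a b \<longleftrightarrow> (\<forall>p. dx (lift_torus b) p = dy (lift_torus a) p)"

text \<open>The coefficient of \<open>dx \<and> dy\<close> in the wedge product of \<open>\<omega>\<close> with its conjugate.\<close>

definition wedge_conj ::
  "(complex \<times> complex \<Rightarrow> complex) \<Rightarrow> (complex \<times> complex \<Rightarrow> complex) \<Rightarrow> complex \<times> complex \<Rightarrow> complex" where
  "wedge_conj a b p = a p * cnj (b p) - b p * cnj (a p)"

definition degeneracy_set ::
  "(complex \<times> complex \<Rightarrow> complex) \<Rightarrow> (complex \<times> complex \<Rightarrow> complex) \<Rightarrow> (complex \<times> complex) set" where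
  "degeneracy_set a b = {p\<in>torus. wedge_conj a b p = 0}"

text \<open>Local statements on the torus are expressed in the charts given by the covering map, i.e. on
  open sets \<open>U\<close> of the plane around a preimage of the point in question.\<close>

definition defining_function ::
  "(complex \<times> complex) set \<Rightarrow> (real \<times> real) set \<Rightarrow> (real \<times> real \<Rightarrow> real) \<Rightarrow> bool" where
  "defining_function S U \<rho> \<longleftrightarrow> open U \<and> C1_on U \<rho> \<and>
     (\<forall>p\<in>U. torus_cover p \<in> S \<longleftrightarrow> \<rho> p = 0) \<and>
     (\<forall>p\<in>U. torus_cover p \<in> S \<longrightarrow> dx \<rho> p \<noteq> 0 \<or> dy \<rho> p \<noteq> 0)"

definition embedded_curve :: "(complex \<times> complex) set \<Rightarrow> bool" where
  "embedded_curve S \<longleftrightarrow> S \<subseteq> torus \<and>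
     (\<forall>p. torus_cover p \<in> S \<longrightarrow> (\<exists>U \<rho>. p \<in> U \<and> defining_function S U \<rho>))"

definition vanishes_to_order ::
  "(complex \<times> complex \<Rightarrow> complex) \<Rightarrow> (complex \<times> complex \<Rightarrow> complex) \<Rightarrow>
   (complex \<times> complex) set \<Rightarrow> real \<Rightarrow> bool" where
  "vanishes_to_order a b S \<sigma> \<longleftrightarrow> (\<forall>p. torus_cover p \<in> S \<longrightarrow>
     (\<exists>U \<rho> g. p \<in> U \<and> defining_function S U \<rho> \<and>
        continuous_on U g \<and> (\<forall>u\<in>U. g u \<noteq> (0::complex)) \<and>
        (\<forall>u\<in>U. wedge_conj a b (torus_cover u) = of_real (\<bar>\<rho> u\<bar> powr \<sigma>) * g u)))"

text \<open>The condition \<open>d\<zeta> \<and> \<omega> = 0\<close> is written out in the coefficient of \<open>dx \<and> dy\<close>.\<close>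

definition first_integral ::
  "(complex \<times> complex \<Rightarrow> complex) \<Rightarrow> (complex \<times> complex \<Rightarrow> complex) \<Rightarrow> real \<Rightarrow>
   (real \<times> real) set \<Rightarrow> (real \<times> real \<Rightarrow> complex) \<Rightarrow> bool" where
  "first_integral a b \<epsilon> U \<zeta> \<longleftrightarrow> C1_holder_on \<epsilon> U \<zeta> \<and>
     (\<forall>p\<in>U. dx \<zeta> p \<noteq> 0 \<or> dy \<zeta> p \<noteq> 0) \<and>
     (\<forall>p\<in>U. dx \<zeta> p * lift_torus b p - dy \<zeta> p * lift_torus a p = 0)"

definition hypocomplex ::
  "(complex \<times> complex \<Rightarrow> complex) \<Rightarrow> (complex \<times> complex \<Rightarrow> complex) \<Rightarrow> real \<Rightarrow> bool" where
  "hypocomplex a b \<epsilon> \<longleftrightarrow> (\<forall>p. \<exists>U \<zeta>. open U \<and> p \<in> U \<and> first_integral a b \<epsilon> U \<zeta> \<and>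
     (\<exists>\<zeta>'. homeomorphism U (\<zeta> ` U) \<zeta> \<zeta>'))"

text \<open>\<open>C\<^sup>1\<close> coordinates \<open>(s, t)\<close> on \<open>U\<close>: an injective \<open>C\<^sup>1\<close> map with nonvanishing Jacobian.\<close>

definition C1_coordinates ::
  "(real \<times> real) set \<Rightarrow> (real \<times> real \<Rightarrow> real) \<Rightarrow> (real \<times> real \<Rightarrow> real) \<Rightarrow> bool" where
  "C1_coordinates U s t \<longleftrightarrow> open U \<and> C1_on U s \<and> C1_on U t \<and> inj_on (\<lambda>p. (s p, t p)) U \<and>
     (\<forall>p\<in>U. dx s p * dy t p - dy s p * dx t p \<noteq> 0)"

text \<open>Near each point of \<open>S\<close>, \<open>\<omega> = m (ds + \<i> |t|\<^sup>\<sigma> dt)\<close> with \<open>m\<close> nonvanishing; the two equations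
  compare the \<open>dx\<close> and the \<open>dy\<close> coefficients.\<close>

definition has_normal_form ::
  "(complex \<times> complex \<Rightarrow> complex) \<Rightarrow> (complex \<times> complex \<Rightarrow> complex) \<Rightarrow>
   (complex \<times> complex) set \<Rightarrow> real \<Rightarrow> bool" where
  "has_normal_form a b S \<sigma> \<longleftrightarrow> (\<forall>p. torus_cover p \<in> S \<longrightarrow>
     (\<exists>U s t m. p \<in> U \<and> C1_coordinates U s t \<and> (\<forall>u\<in>U. m u \<noteq> 0 \<and>
        lift_torus a u = m u * (of_real (dx s u) + \<i> * of_real (\<bar>t u\<bar> powr \<sigma>) * of_real (dx t u)) \<and>
        lift_torus b u = m u * (of_real (dy s u) + \<i> * of_real (\<bar>t u\<bar> powr \<sigma>) * of_real (dy t u)))))"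

definition line_integral ::
  "(real \<times> real \<Rightarrow> complex) \<Rightarrow> (real \<times> real \<Rightarrow> complex) \<Rightarrow> (real \<Rightarrow> real \<times> real) \<Rightarrow> complex" where
  "line_integral A B \<gamma> = integral {0..1} (\<lambda>t.
     A (\<gamma> t) * of_real (fst (vector_derivative \<gamma> (at t within {0..1}))) +
     B (\<gamma> t) * of_real (snd (vector_derivative \<gamma> (at t within {0..1}))))"

text \<open>For a closed form the integral does not depend on the path; the segment is chosen.\<close>

definition primitive ::
  "(complex \<times> complex \<Rightarrow> complex) \<Rightarrow> (complex \<times> complex \<Rightarrow> complex) \<Rightarrow> real \<times> real \<Rightarrow> complex" where
  "primitive a b p = line_integral (lift_torus a) (lift_torus b) (linepath (0, 0) p)"

definition vector_field ::
  "(complex \<times> complex \<Rightarrow> complex) \<Rightarrow> (complex \<times> complex \<Rightarrow> complex) \<Rightarrow>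
   (real \<times> real \<Rightarrow> complex) \<Rightarrow> real \<times> real \<Rightarrow> complex" where
  "vector_field a b \<phi> p = lift_torus b p * dx \<phi> p - lift_torus a p * dy \<phi> p"

text \<open>\<open>L u = f\<close> in the sense of distributions; there is no zeroth order term in the formal
  transpose because \<open>L\<close> is divergence free when the form is closed.\<close>

definition distributional_solution ::
  "(complex \<times> complex \<Rightarrow> complex) \<Rightarrow> (complex \<times> complex \<Rightarrow> complex) \<Rightarrow>
   (real \<times> real \<Rightarrow> complex) \<Rightarrow> (real \<times> real \<Rightarrow> complex) \<Rightarrow> bool" where
  "distributional_solution a b u f \<longleftrightarrow> (\<forall>\<phi>. test_function \<phi> \<longrightarrow>
     - (LINT p|lebesgue. u p * vector_field a b \<phi> p) = (LINT p|lebesgue. f p * \<phi> p))"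

definition Theta :: "complex \<Rightarrow> complex \<Rightarrow> complex" where
  "Theta \<tau> z = (\<Sum>\<^sub>\<infinity>m::int. exp (of_real pi * \<i> * of_int m ^ 2 * \<tau>) *
                              exp (2 * of_real pi * \<i> * of_int m * z))"

definition theta_zero :: "complex \<Rightarrow> complex" where
  "theta_zero \<tau> = (1 + \<tau>) / 2"

text \<open>At the zeros of the theta function (a null set of \<open>s\<close> for each \<open>p\<close>) the kernel takes the
  value \<open>0\<close>, by the convention for division by zero.\<close>

definition theta_kernel ::
  "(complex \<times> complex \<Rightarrow> complex) \<Rightarrow> (complex \<times> complex \<Rightarrow> complex) \<Rightarrow> complex \<Rightarrow>
   real \<times> real \<Rightarrow> real \<times> real \<Rightarrow> complex" where
  "theta_kernel a b \<tau> p s =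
     (let w = primitive a b p - primitive a b s + theta_zero \<tau>
      in deriv (Theta \<tau>) w / Theta \<tau> w)"

definition T_op ::
  "(complex \<times> complex \<Rightarrow> complex) \<Rightarrow> (complex \<times> complex \<Rightarrow> complex) \<Rightarrow> complex \<Rightarrow>
   (real \<times> real \<Rightarrow> complex) \<Rightarrow> real \<times> real \<Rightarrow> complex" where
  "T_op a b \<tau> g p =
     1 / (2 * of_real pi * \<i>) * (LINT s:unit_square|lebesgue. theta_kernel a b \<tau> p s * g s)"

end

theory Submission imports Defs "HOL-Complex_Analysis.Complex_Analysis" begin

text \<open>
  Every zero of \<open>\<Theta>\<close> is simple, so the kernel is locally a finite sum of Cauchy kernels
  \<open>1 / (Z p - Z s - l)\<close> plus a holomorphic function of \<open>Z p - Z s\<close>. In the normal form \<open>Z\<close> behaves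
  like \<open>s + \<i> sgn t |t|\<^sup>\<sigma>\<^sup>+\<^sup>1\<close>, so the set where \<open>|Z - z| < \<delta>\<close> has area at most \<open>C \<delta> powr (2 - \<mu>)\<close> on
  compact sets. Hence \<open>|z - Z| powr (- r)\<close> is integrable for \<open>r < 2 - \<mu>\<close>, uniformly in \<open>z\<close>, and the
  inequality of Hoelder gives the exponent \<open>(2 - r - \<mu>) / r\<close>. The period relations are those of
  \<open>\<Theta>' / \<Theta>\<close>.

  For the equation, \<open>1 / w\<close> is replaced by \<open>cnj w / (|w|\<^sup>2 + \<delta>)\<close>, to which Green's formula applies.
  As \<open>\<delta>\<close> tends to 0, its antiholomorphic derivative, pulled back by \<open>Z\<close>, concentrates at the points
  \<open>p\<close> with \<open>Z p = Z s + l\<close>. The total mass at such a point is read off Green's formula for the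
  constant function 1 on the unit square, which needs only the quasi-periodicity of the kernel: neither
  the degree of \<open>Z\<close> nor a change of variables enters. Fubini's theorem and summation over the
  translates of the unit square then give \<open>\<^bold>L T P = P\<close>.
\<close>

section \<open>Period lattices and theta functions\<close>

text \<open>The number 2 + \<sigma> is the exponent conjugate to 2 - \<mu>, so q > 2 + \<sigma> says
  exactly that r < 2 - \<mu>.

  The obstacle is the degeneracy set, across which Z is a homeomorphism but not a diffeomorphism.
  Almost every source point p0 lies off it, and there |Z p - Z p0| is at least a multiple of |p -
  p0| on compact sets. A function that is O(|p - p0|) therefore turns the regularised mass, of size
  at most 1 / |Z p - Z p0| squared, into an integrand dominated by the integrable 1 / |Z p - Z p0|,
  and the limit is 0 by dominated convergence. Up to such functions a test function is its value at
  the pole times the indicator of a unit square, so the mass of that indicator decides everything.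

  Two global facts locate the poles. The zeros of the theta series are found by comparing it with
  Jacobi's product, whose factors display their zeros. The injectivity of Z, obtained from local
  injectivity and properness, shows that Z p - Z p0 is a period only at the integer translates of
  p0.\<close>

definition period_lattice :: "complex \<Rightarrow> complex set" where
  "period_lattice \<tau> = {of_int j + of_int k * \<tau> | j k. True}"

text \<open>Two-sided induction along each generator. With \<open>P\<close> taken as "is a zero",
  "is a simple zero" or "takes a given value", it reduces statements about all lattice translates to
  one point.\<close>

lemma lattice_invariant:
  fixes P :: "complex \<Rightarrow> bool"
  assumes one: "\<And>w. P (w + 1) \<longleftrightarrow> P w" and tau: "\<And>w. P (w + \<tau>) \<longleftrightarrow> P w"
    and l: "l \<in> period_lattice \<tau>"
  shows "P (w + l) \<longleftrightarrow> P w"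
proof -
  have J: "P (w + of_int j) \<longleftrightarrow> P w" for j w
  proof (induction j rule: int_induct[where k = 0])
    case (step1 i)
    then show ?case using one[of "w + of_int i"] by (simp add: algebra_simps)
  next
    case (step2 i)
    then show ?case using one[of "w + of_int (i - 1)"] by (simp add: algebra_simps)
  qed simp
  have K: "P (w + of_int k * \<tau>) \<longleftrightarrow> P w" for k w
  proof (induction k rule: int_induct[where k = 0])
    case (step1 i)
    then show ?case using tau[of "w + of_int i * \<tau>"] by (simp add: algebra_simps)
  next
    case (step2 i)
    then show ?case using tau[of "w + of_int (i - 1) * \<tau>"] by (simp add: algebra_simps)
  qed simp
  obtain j k where "l = of_int j + of_int k * \<tau>"
    using l by (auto simp: period_lattice_def)
  then have "w + l = (w + of_int j) + of_int k * \<tau>" by simp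
  then show ?thesis using J[of w j] K[of "w + of_int j" k] by metis
qed

lemma zero_in_period_lattice [simp]: "0 \<in> period_lattice \<tau>"
  unfolding period_lattice_def by (rule CollectI, rule exI[of _ 0], rule exI[of _ 0]) simp

lemma period_lattice_add:
  assumes "x \<in> period_lattice \<tau>" "y \<in> period_lattice \<tau>"
  shows "x + y \<in> period_lattice \<tau>"
proof -
  obtain j k where "x = of_int j + of_int k * \<tau>"
    using assms by (auto simp: period_lattice_def)
  moreover obtain j' k' where "y = of_int j' + of_int k' * \<tau>"
    using assms by (auto simp: period_lattice_def)
  ultimately have "x + y = of_int (j + j') + of_int (k + k') * \<tau>"
    by (simp add: algebra_simps)
  then show ?thesis unfolding period_lattice_def by blast
qed

lemma period_lattice_uminus:
  assumes "x \<in> period_lattice \<tau>"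
  shows "- x \<in> period_lattice \<tau>"
proof -
  obtain j k where "x = of_int j + of_int k * \<tau>"
    using assms by (auto simp: period_lattice_def)
  then have "- x = of_int (- j) + of_int (- k) * \<tau>"
    by (simp add: algebra_simps)
  then show ?thesis unfolding period_lattice_def by blast
qed

lemma period_lattice_diff:
  "x \<in> period_lattice \<tau> \<Longrightarrow> y \<in> period_lattice \<tau> \<Longrightarrow> x - y \<in> period_lattice \<tau>"
  using period_lattice_add[OF _ period_lattice_uminus, of x \<tau> y] by simp

lemma period_lattice_generators [simp]: "1 \<in> period_lattice \<tau>" "\<tau> \<in> period_lattice \<tau>"
proof -
  have "1 = of_int 1 + of_int 0 * \<tau>" "\<tau> = of_int 0 + of_int 1 * \<tau>" by auto
  then show "1 \<in> period_lattice \<tau>" "\<tau> \<in> period_lattice \<tau>"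
    unfolding period_lattice_def by blast+
qed

text \<open>As Im \<tau> > 0, the imaginary part bounds the coefficient of \<tau>; the real part
  then bounds the other one.\<close>

lemma finite_period_lattice:
  assumes "Im \<tau> > 0"
  shows "finite {l \<in> period_lattice \<tau>. cmod l \<le> M}"
proof -
  define N where "N = \<lceil>\<bar>M\<bar> / Im \<tau>\<rceil>"
  define N' where "N' = \<lceil>\<bar>M\<bar> + of_int N * \<bar>Re \<tau>\<bar>\<rceil>"
  have "{l \<in> period_lattice \<tau>. cmod l \<le> M} \<subseteq> (\<lambda>(j, k). of_int j + of_int k * \<tau>) ` ({-N'..N'} \<times> {-N..N})"
  proof
    fix l assume "l \<in> {l \<in> period_lattice \<tau>. cmod l \<le> M}"
    then obtain j k where l: "l = of_int j + of_int k * \<tau>" and M: "cmod l \<le> M"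
      by (auto simp: period_lattice_def)
    have "\<bar>of_int k * Im \<tau>\<bar> \<le> \<bar>M\<bar>"
      using abs_Im_le_cmod[of l] M by (simp add: l)
    then have k: "\<bar>of_int k\<bar> \<le> \<bar>M\<bar> / Im \<tau>"
      using assms by (simp add: abs_mult field_simps)
    then have k': "\<bar>k\<bar> \<le> N" unfolding N_def by linarith
    have "\<bar>of_int j + of_int k * Re \<tau>\<bar> \<le> \<bar>M\<bar>"
      using abs_Re_le_cmod[of l] M by (simp add: l)
    moreover have "\<bar>of_int k * Re \<tau>\<bar> \<le> of_int N * \<bar>Re \<tau>\<bar>"
      using k' by (auto simp: abs_mult intro!: mult_right_mono)
    ultimately have "\<bar>of_int j\<bar> \<le> \<bar>M\<bar> + of_int N * \<bar>Re \<tau>\<bar>" by linarith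
    then have "\<bar>j\<bar> \<le> N'" unfolding N'_def by linarith
    then show "l \<in> (\<lambda>(j, k). of_int j + of_int k * \<tau>) ` ({-N'..N'} \<times> {-N..N})"
      using k' l by (auto intro!: image_eqI[of _ _ "(j, k)"])
  qed
  then show ?thesis by (rule finite_subset) auto
qed

lemma lattice_coordinates_unique:
  assumes "Im \<tau> > 0" "of_int j + of_int k * \<tau> = of_int j' + of_int k' * \<tau>"
  shows "j = j' \<and> k = k'"
proof -
  have "of_int k * Im \<tau> = of_int k' * Im \<tau>" using arg_cong[OF assms(2), of Im] by simp
  then have "k = k'" using assms(1) by simp
  then show ?thesis using assms(2) by simp
qed

section \<open>Convergence and functional equations of the theta series\<close>

lemma summable_on_exp_neg_abs: "(\<lambda>m::int. exp (- \<bar>real_of_int m\<bar>)) summable_on UNIV"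
proof -
  have s: "(\<lambda>n::nat. exp (- real n)) summable_on UNIV"
  proof (rule norm_summable_imp_summable_on)
    have "summable (\<lambda>n. (exp (- 1) :: real) ^ n)"
      by (rule summable_geometric) simp
    then show "summable (\<lambda>n. norm (exp (- real n)))"
      using exp_of_nat_mult[of _ "- 1 :: real"] by simp
  qed
  have "(\<lambda>m::int. exp (- \<bar>real_of_int m\<bar>)) summable_on (range int)"
    by (subst summable_on_reindex) (use s in \<open>auto simp: o_def\<close>)
  moreover have "(\<lambda>m::int. exp (- \<bar>real_of_int m\<bar>)) summable_on (range (\<lambda>n. - int n))"
    by (subst summable_on_reindex) (use s in \<open>auto simp: o_def inj_on_def\<close>)
  ultimately have "(\<lambda>m::int. exp (- \<bar>real_of_int m\<bar>)) summable_on (range int \<union> range (\<lambda>n. - int n))"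
    by (rule summable_on_union)
  moreover have "range int \<union> range (\<lambda>n. - int n) = UNIV"
  proof -
    have "m \<in> range int \<union> range (\<lambda>n. - int n)" for m
      by (cases m rule: int_cases2) auto
    then show ?thesis by blast
  qed
  ultimately show ?thesis by simp
qed

text \<open>Completing the square bounds -c m^2 + (B + 1) |m| by a constant, which trades the
  Gaussian for a geometric series in |m|. The linear term is what |Im z| contributes to a theta
  term.\<close>

lemma summable_on_gaussian:
  assumes "c > 0"
  shows "(\<lambda>m::int. exp (- c * (real_of_int m)\<^sup>2 + B * \<bar>real_of_int m\<bar>)) summable_on UNIV"
proof (rule summable_on_comparison_test)
  show "(\<lambda>m::int. exp ((B + 1)\<^sup>2 / (4 * c)) * exp (- \<bar>real_of_int m\<bar>)) summable_on UNIV"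
    by (intro summable_on_cmult_right summable_on_exp_neg_abs)
  fix m :: int
  have "0 \<le> (2 * c * \<bar>real_of_int m\<bar> - (B + 1))\<^sup>2 / (4 * c)" using assms by simp
  also have "\<dots> = c * (real_of_int m)\<^sup>2 - (B + 1) * \<bar>real_of_int m\<bar> + (B + 1)\<^sup>2 / (4 * c)"
    using assms by (simp add: power2_eq_square field_simps)
  finally have "- c * (real_of_int m)\<^sup>2 + B * \<bar>real_of_int m\<bar> \<le> (B + 1)\<^sup>2 / (4 * c) + - \<bar>real_of_int m\<bar>"
    by (simp add: algebra_simps)
  then show "exp (- c * (real_of_int m)\<^sup>2 + B * \<bar>real_of_int m\<bar>)
      \<le> exp ((B + 1)\<^sup>2 / (4 * c)) * exp (- \<bar>real_of_int m\<bar>)"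
    by (simp add: exp_add[symmetric])
qed auto

definition theta_term :: "complex \<Rightarrow> int \<Rightarrow> complex \<Rightarrow> complex" where
  "theta_term \<tau> m z = exp (of_real pi * \<i> * of_int m ^ 2 * \<tau>) * exp (2 * of_real pi * \<i> * of_int m * z)"

lemma Theta_eq: "Theta \<tau> z = (\<Sum>\<^sub>\<infinity>m. theta_term \<tau> m z)"
  by (simp add: Theta_def theta_term_def)

lemma norm_theta_term_le:
  assumes "\<bar>Im z\<bar> \<le> B"
  shows "norm (theta_term \<tau> m z) \<le> exp (- (pi * Im \<tau>) * (real_of_int m)\<^sup>2 + 2 * pi * B * \<bar>real_of_int m\<bar>)"
proof -
  have r: "Re (of_int m ^ 2 * \<tau>) = (real_of_int m)\<^sup>2 * Re \<tau>" "Im (of_int m ^ 2 * \<tau>) = (real_of_int m)\<^sup>2 * Im \<tau>"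
    by (simp_all add: power2_eq_square)
  have "norm (theta_term \<tau> m z) = exp (- (pi * Im \<tau>) * (real_of_int m)\<^sup>2 - 2 * pi * (of_int m * Im z))"
    unfolding theta_term_def norm_mult norm_exp_eq_Re
    by (simp add: exp_add[symmetric] mult.assoc r power2_eq_square algebra_simps)
  also have "\<dots> \<le> exp (- (pi * Im \<tau>) * (real_of_int m)\<^sup>2 + 2 * pi * B * \<bar>real_of_int m\<bar>)"
  proof -
    have "- (of_int m * Im z) \<le> \<bar>of_int m * Im z\<bar>" by simp
    also have "\<dots> \<le> \<bar>real_of_int m\<bar> * B"
      unfolding abs_mult using assms by (intro mult_left_mono) auto
    finally have "2 * pi * (- (of_int m * Im z)) \<le> 2 * pi * (\<bar>real_of_int m\<bar> * B)"
      by (intro mult_left_mono) auto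
    then show ?thesis by (simp add: algebra_simps)
  qed
  finally show ?thesis .
qed

text \<open>Only |Im z| enters the majorant, so the natural domains are horizontal strips. These
  contain both the discs of the holomorphy proof and the real line of
  \<open>Theta_not_zero\<close>.\<close>

lemma uniform_limit_Theta:
  assumes "Im \<tau> > 0" "\<And>z. z \<in> Y \<Longrightarrow> \<bar>Im z\<bar> \<le> B"
  shows "uniform_limit Y (\<lambda>X z. \<Sum>m\<in>X. theta_term \<tau> m z) (Theta \<tau>) (finite_subsets_at_top UNIV)"
proof -
  have "uniform_limit Y (\<lambda>X z. \<Sum>m\<in>X. theta_term \<tau> m z) (\<lambda>z. \<Sum>\<^sub>\<infinity>m\<in>UNIV. theta_term \<tau> m z)
          (finite_subsets_at_top UNIV)"
    by (rule Weierstrass_m_test_general[OF norm_theta_term_le summable_on_gaussian])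
       (use assms in auto)
  then show ?thesis by (simp add: Theta_eq[abs_def])
qed

lemma Theta_holomorphic:
  assumes "Im \<tau> > 0"
  shows "Theta \<tau> holomorphic_on A"
proof -
  have "Theta \<tau> field_differentiable at z0" for z0
  proof -
    have "\<bar>Im z\<bar> \<le> cmod z0 + 1" if "z \<in> cball z0 1" for z
    proof -
      have "cmod (z - z0) \<le> 1" using that by (simp add: dist_norm norm_minus_commute)
      then have "cmod z \<le> cmod z0 + 1"
        using norm_triangle_ineq[of "z - z0" z0] by simp
      then show ?thesis using abs_Im_le_cmod[of z] by linarith
    qed
    from uniform_limit_Theta[OF assms this]
    have u: "uniform_limit (cball z0 1) (\<lambda>X z. \<Sum>m\<in>X. theta_term \<tau> m z) (Theta \<tau>) (finite_subsets_at_top UNIV)"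
      by blast
    have "Theta \<tau> holomorphic_on ball z0 1"
    proof (rule holomorphic_uniform_limit[OF _ u])
      show "\<forall>\<^sub>F X in finite_subsets_at_top UNIV.
          continuous_on (cball z0 1) (\<lambda>z. \<Sum>m\<in>X. theta_term \<tau> m z) \<and>
          (\<lambda>z. \<Sum>m\<in>X. theta_term \<tau> m z) holomorphic_on ball z0 1"
        by (intro always_eventually allI conjI holomorphic_on_imp_continuous_on)
           (auto simp: theta_term_def intro!: holomorphic_intros)
    qed auto
    then show ?thesis
      by (rule holomorphic_on_imp_differentiable_at) auto
  qed
  then show ?thesis
    by (simp add: holomorphic_on_def field_differentiable_at_within)
qed

lemma Theta_plus_1: "Theta \<tau> (z + 1) = Theta \<tau> z"
proof -
  have "theta_term \<tau> m (z + 1) = theta_term \<tau> m z" for m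
  proof -
    have "2 * of_real pi * \<i> * of_int m * (z + 1) =
          2 * of_real pi * \<i> * of_int m * z + of_int (2 * m) * (of_real pi * \<i>)"
      by (simp add: algebra_simps)
    then have "exp (2 * of_real pi * \<i> * of_int m * (z + 1)) =
          exp (2 * of_real pi * \<i> * of_int m * z) * exp (of_int (2 * m) * (of_real pi * \<i>))"
      by (simp only: exp_add)
    also have "exp (of_int (2 * m) * (of_real pi * \<i>)) = 1"
      by (subst exp_eq_1) auto
    finally show ?thesis by (simp add: theta_term_def)
  qed
  then show ?thesis by (simp add: Theta_eq)
qed

text \<open>Since m^2 \<tau> + 2 m \<tau> = (m + 1)^2 \<tau> - \<tau>, the shift by \<tau> is a
  reindexing of the sum up to an exponential factor.\<close>

lemma Theta_plus_tau:
  "Theta \<tau> (z + \<tau>) = exp (- (\<i> * of_real pi * \<tau>) - 2 * of_real pi * \<i> * z) * Theta \<tau> z"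
proof -
  have t: "theta_term \<tau> m (z + \<tau>) = exp (- (\<i> * of_real pi * \<tau>) - 2 * of_real pi * \<i> * z) * theta_term \<tau> (m + 1) z" for m
    unfolding theta_term_def exp_add[symmetric]
    by (simp add: algebra_simps power2_eq_square)
  have "Theta \<tau> (z + \<tau>) = exp (- (\<i> * of_real pi * \<tau>) - 2 * of_real pi * \<i> * z) * (\<Sum>\<^sub>\<infinity>m. theta_term \<tau> (m + 1) z)"
    unfolding Theta_eq t by (rule infsum_cmult_right')
  also have "(\<Sum>\<^sub>\<infinity>m. theta_term \<tau> (m + 1) z) = Theta \<tau> z"
    unfolding Theta_eq
    by (rule infsum_reindex_bij_witness[where i = "\<lambda>m. m - 1" and j = "\<lambda>m. m + 1"]) auto
  finally show ?thesis .
qed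

lemma Theta_uminus: "Theta \<tau> (- z) = Theta \<tau> z"
  unfolding Theta_eq
  by (rule infsum_reindex_bij_witness[where i = "\<lambda>m. - m" and j = "\<lambda>m. - m"])
     (auto simp: theta_term_def)

text \<open>The point is its own mirror image modulo periods, z = -z + 1 + \<tau>. Evenness and the
  functional equations then give Theta z = exp (-pi i) Theta z = -Theta z.\<close>

lemma Theta_theta_zero: "Theta \<tau> (theta_zero \<tau>) = 0"
proof -
  define z where "z = theta_zero \<tau>"
  have "Theta \<tau> z = Theta \<tau> ((- z + 1) + \<tau>)"
    by (rule arg_cong[of _ _ "Theta \<tau>"]) (simp add: z_def theta_zero_def field_simps)
  also have "\<dots> = exp (- (\<i> * of_real pi * \<tau>) - 2 * of_real pi * \<i> * (- z + 1)) * Theta \<tau> z"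
    unfolding Theta_plus_tau Theta_plus_1 Theta_uminus ..
  also have "- (\<i> * of_real pi * \<tau>) - 2 * of_real pi * \<i> * (- z + 1) = - (\<i> * of_real pi)"
    by (simp add: z_def theta_zero_def field_simps)
  also have "exp (- (\<i> * of_real pi)) = -1"
    by (simp add: exp_minus)
  finally have "2 * Theta \<tau> z = 0" by simp
  then show ?thesis unfolding z_def by simp
qed

text \<open>Integration over [0, 1] extracts the zeroth Fourier coefficient, which is 1. This
  excludes the constant 0 in the comparison with the product.\<close>

lemma Theta_not_zero:
  assumes "Im \<tau> > 0"
  shows "\<exists>z. Theta \<tau> z \<noteq> 0"
proof (rule ccontr)
  assume "\<not> (\<exists>z. Theta \<tau> z \<noteq> 0)"
  then have z: "Theta \<tau> z = 0" for z by auto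
  have "uniform_limit (range complex_of_real) (\<lambda>X z. \<Sum>m\<in>X. theta_term \<tau> m z) (Theta \<tau>) (finite_subsets_at_top UNIV)"
    by (rule uniform_limit_Theta[OF assms, where B = 0]) auto
  then have u: "uniform_limit (cbox 0 1) (\<lambda>X x::real. \<Sum>m\<in>X. theta_term \<tau> m (of_real x)) (\<lambda>x. 0) (finite_subsets_at_top UNIV)"
    unfolding uniform_limit_iff using z by (auto elim!: eventually_mono)
  obtain I J where I: "\<And>X. ((\<lambda>x::real. \<Sum>m\<in>X. theta_term \<tau> m (of_real x)) has_integral I X) (cbox 0 1)"
    and J: "((\<lambda>x::real. 0 :: complex) has_integral J) (cbox 0 1)"
    and lim: "(I \<longlongrightarrow> J) (finite_subsets_at_top UNIV)"
    by (rule uniform_limit_integral_cbox[OF u])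
       (auto simp: theta_term_def intro!: continuous_intros)
  have J0: "J = 0" using J by (rule has_integral_unique) simp
  have tm: "((\<lambda>x::real. theta_term \<tau> m (of_real x)) has_integral (if m = 0 then 1 else 0)) {0..1}" for m
  proof (cases "m = 0")
    case True
    show ?thesis using True has_integral_const_real[of "1::complex" 0 1] by (simp add: theta_term_def)
  next
    case False
    define c where "c = 2 * of_real pi * \<i> * (of_int m :: complex)"
    define F where "F = (\<lambda>x::real. exp (of_real pi * \<i> * of_int m ^ 2 * \<tau>) * exp (c * of_real x) / c)"
    have c0: "c \<noteq> 0" using False by (simp add: c_def)
    have "((\<lambda>x::real. theta_term \<tau> m (of_real x)) has_integral (F 1 - F 0)) {0..1}"
    proof (rule fundamental_theorem_of_calculus)
      fix x :: real
      have "((\<lambda>z. exp (of_real pi * \<i> * of_int m ^ 2 * \<tau>) * exp (c * z) / c) has_field_derivative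
             theta_term \<tau> m (of_real x)) (at (of_real x))"
        by (rule derivative_eq_intros refl | use c0 in \<open>simp add: theta_term_def c_def\<close>)+
      then show "(F has_vector_derivative theta_term \<tau> m (of_real x)) (at x within {0..1})"
        unfolding F_def
        by (rule has_vector_derivative_real_field[THEN has_vector_derivative_at_within])
    qed simp
    moreover have "exp c = 1"
      unfolding c_def by (subst exp_eq_1) (auto intro!: exI[of _ m])
    ultimately show ?thesis using False by (simp add: F_def)
  qed
  have "\<forall>\<^sub>F X in finite_subsets_at_top UNIV. I X = 1"
    unfolding eventually_finite_subsets_at_top
  proof (intro exI[of _ "{0}"] conjI allI impI)
    fix X :: "int set" assume X: "finite X \<and> {0} \<subseteq> X \<and> X \<subseteq> UNIV"
    have "((\<lambda>x::real. \<Sum>m\<in>X. theta_term \<tau> m (of_real x)) has_integral (\<Sum>m\<in>X. if m = 0 then 1 else 0)) {0..1}"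
      by (rule has_integral_sum) (use X tm in auto)
    moreover have "(\<Sum>m\<in>X. if m = 0 then 1 else 0 :: complex) = 1"
      using X by (simp add: sum.delta)
    ultimately show "I X = 1" using I[of X] has_integral_unique by (metis cbox_interval)
  qed auto
  then have "(I \<longlongrightarrow> 1) (finite_subsets_at_top UNIV)" by (rule tendsto_eventually)
  then have "J = 1" using lim by (metis tendsto_unique finite_subsets_at_top_neq_bot)
  then show False using J0 by simp
qed

section \<open>The infinite product with the zeros of theta\<close>

definition odd_qprod :: "complex \<Rightarrow> complex \<Rightarrow> complex" where
  "odd_qprod q u = (\<Prod>n. 1 + q ^ (2 * n + 1) * u)"

lemma summable_odd_powers:
  assumes "cmod q < 1"
  shows "summable (\<lambda>n. cmod q ^ (2 * n + 1) * B)"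
proof -
  have "summable (\<lambda>n. (cmod q ^ 2) ^ n)"
    by (rule summable_geometric) (use assms in \<open>simp add: power_less_one_iff\<close>)
  from summable_mult[OF this, of "cmod q * B"] have "summable (\<lambda>n. cmod q * B * (cmod q ^ 2) ^ n)" .
  also have "(\<lambda>n. cmod q * B * (cmod q ^ 2) ^ n) = (\<lambda>n. cmod q ^ (2 * n + 1) * B)"
    unfolding power_add power_mult[of "cmod q" 2] power_one_right by (simp only: mult_ac)
  finally show ?thesis .
qed

lemma odd_qprod_convergent:
  assumes "cmod q < 1"
  shows "convergent_prod (\<lambda>n. 1 + q ^ (2 * n + 1) * u)"
proof -
  have "summable (\<lambda>n. cmod (q ^ (2 * n + 1) * u))"
    using summable_odd_powers[OF assms, of "cmod u"] by (simp add: norm_mult norm_power)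
  then show ?thesis
    by (intro abs_convergent_prod_imp_convergent_prod) (simp add: abs_convergent_prod_conv_summable)
qed

lemma odd_qprod_LIMSEQ:
  assumes "cmod q < 1"
  shows "(\<lambda>N. \<Prod>n\<le>N. 1 + q ^ (2 * n + 1) * u) \<longlonglongrightarrow> odd_qprod q u"
  unfolding odd_qprod_def by (rule convergent_prod_LIMSEQ[OF odd_qprod_convergent[OF assms]])

text \<open>Splitting off the factor n = 0 replaces u by q^2 u in the rest. For u = exp (2 pi i z)
  this is the shift of z by \<tau>, so the quasi-periodicity of the product comes from here.\<close>

lemma odd_qprod_shift:
  assumes "cmod q < 1"
  shows "odd_qprod q u = (1 + q * u) * odd_qprod q (q\<^sup>2 * u)"
proof (rule LIMSEQ_unique)
  show "(\<lambda>N. \<Prod>n\<le>Suc N. 1 + q ^ (2 * n + 1) * u) \<longlonglongrightarrow> odd_qprod q u"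
    by (rule LIMSEQ_Suc[OF odd_qprod_LIMSEQ[OF assms]])
  have "(\<lambda>N. (1 + q * u) * (\<Prod>n\<le>N. 1 + q ^ (2 * n + 1) * (q\<^sup>2 * u))) \<longlonglongrightarrow> (1 + q * u) * odd_qprod q (q\<^sup>2 * u)"
    by (intro tendsto_mult tendsto_const odd_qprod_LIMSEQ[OF assms])
  also have "(\<lambda>N. (1 + q * u) * (\<Prod>n\<le>N. 1 + q ^ (2 * n + 1) * (q\<^sup>2 * u))) = (\<lambda>N. \<Prod>n\<le>Suc N. 1 + q ^ (2 * n + 1) * u)"
    by (subst prod.atMost_Suc_shift) (simp add: power2_eq_square mult_ac)
  finally show "(\<lambda>N. \<Prod>n\<le>Suc N. 1 + q ^ (2 * n + 1) * u) \<longlonglongrightarrow> (1 + q * u) * odd_qprod q (q\<^sup>2 * u)" .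
qed

lemma odd_qprod_eq_0_iff:
  assumes "cmod q < 1"
  shows "odd_qprod q u = 0 \<longleftrightarrow> (\<exists>n. q ^ (2 * n + 1) * u = -1)"
proof -
  have "(\<lambda>n. 1 + q ^ (2 * n + 1) * u) has_prod odd_qprod q u"
    unfolding odd_qprod_def by (rule convergent_prod_has_prod[OF odd_qprod_convergent[OF assms]])
  then have "odd_qprod q u = 0 \<longleftrightarrow> 0 \<in> range (\<lambda>n. 1 + q ^ (2 * n + 1) * u)"
    by (rule has_prod_eq_0_iff)
  also have "\<dots> \<longleftrightarrow> (\<exists>n. q ^ (2 * n + 1) * u = -1)"
    by (auto simp: image_iff eq_neg_iff_add_eq_0 add.commute)
  finally show ?thesis .
qed

lemma odd_qprod_holomorphic:
  assumes "cmod q < 1"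
  shows "odd_qprod q holomorphic_on A"
proof -
  have "odd_qprod q field_differentiable at z0" for z0
  proof -
    have bd: "cmod u \<le> cmod z0 + 1" if "u \<in> cball z0 1" for u
      using norm_triangle_ineq[of "u - z0" z0] that by (simp add: dist_norm norm_minus_commute)
    have "uniformly_convergent_on (cball z0 1) (\<lambda>N u. \<Sum>n<N. norm (q ^ (2 * n + 1) * u))"
      by (rule Weierstrass_m_test'[OF _ summable_odd_powers[OF assms, of "cmod z0 + 1"]])
         (use bd in \<open>auto simp: norm_mult norm_power intro!: mult_mono\<close>)
    then have "uniformly_convergent_on (cball z0 1) (\<lambda>N u. \<Prod>n<N. 1 + q ^ (2 * n + 1) * u)"
      by (rule Infinite_Products.uniformly_convergent_on_prod[rotated 2]) (auto intro!: continuous_intros)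
    then obtain l where l: "uniform_limit (cball z0 1) (\<lambda>N u. \<Prod>n<N. 1 + q ^ (2 * n + 1) * u) l sequentially"
      by (auto simp: uniformly_convergent_on_def)
    have leq: "l u = odd_qprod q u" if "u \<in> cball z0 1" for u
    proof (rule LIMSEQ_unique)
      show "(\<lambda>N. \<Prod>n<N. 1 + q ^ (2 * n + 1) * u) \<longlonglongrightarrow> l u"
        by (rule tendsto_uniform_limitI[OF l that])
      show "(\<lambda>N. \<Prod>n<N. 1 + q ^ (2 * n + 1) * u) \<longlonglongrightarrow> odd_qprod q u"
        using odd_qprod_LIMSEQ[OF assms, of u] LIMSEQ_lessThan_iff_atMost[of "\<lambda>X. \<Prod>n\<in>X. 1 + q ^ (2 * n + 1) * u"] by simp
    qed
    have "l holomorphic_on ball z0 1"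
      by (rule holomorphic_uniform_limit[OF _ l])
         (auto intro!: always_eventually holomorphic_on_imp_continuous_on holomorphic_intros)
    then have "odd_qprod q holomorphic_on ball z0 1"
      by (rule holomorphic_transform) (use leq in auto)
    then show ?thesis
      by (rule holomorphic_on_imp_differentiable_at) auto
  qed
  then show ?thesis
    by (simp add: holomorphic_on_def field_differentiable_at_within)
qed

text \<open>The product of Jacobi's triple product identity, without its constant factor.\<close>

definition jacobi_prod :: "complex \<Rightarrow> complex \<Rightarrow> complex" where
  "jacobi_prod \<tau> z = odd_qprod (exp (of_real pi * \<i> * \<tau>)) (exp (2 * of_real pi * \<i> * z)) *
     odd_qprod (exp (of_real pi * \<i> * \<tau>)) (exp (- (2 * of_real pi * \<i> * z)))"

lemma nome_less_1: "Im \<tau> > 0 \<Longrightarrow> cmod (exp (of_real pi * \<i> * \<tau>)) < 1"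
  by (simp add: norm_exp_eq_Re mult_less_0_iff)

lemma jacobi_prod_holomorphic:
  assumes "Im \<tau> > 0"
  shows "jacobi_prod \<tau> holomorphic_on A"
proof -
  note h = odd_qprod_holomorphic[OF nome_less_1[OF assms], of UNIV]
  have "(odd_qprod (exp (of_real pi * \<i> * \<tau>)) \<circ> (\<lambda>z. exp (2 * of_real pi * \<i> * z))) holomorphic_on A"
    "(odd_qprod (exp (of_real pi * \<i> * \<tau>)) \<circ> (\<lambda>z. exp (- (2 * of_real pi * \<i> * z)))) holomorphic_on A"
    by (rule holomorphic_on_compose_gen[OF _ h], auto intro!: holomorphic_intros)+
  then show ?thesis
    unfolding jacobi_prod_def[abs_def] o_def by (rule holomorphic_on_mult)
qed

lemma exp_2_pi_i_plus_1: "exp (2 * of_real pi * \<i> * (z + 1)) = exp (2 * of_real pi * \<i> * z)"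
proof -
  have "2 * of_real pi * \<i> * (z + 1) = 2 * of_real pi * \<i> * z + 2 * of_real pi * \<i>"
    by (simp add: algebra_simps)
  then show ?thesis by (simp add: exp_add)
qed

lemma jacobi_prod_plus_1: "jacobi_prod \<tau> (z + 1) = jacobi_prod \<tau> z"
  using exp_2_pi_i_plus_1[of z] by (simp only: jacobi_prod_def exp_minus)

text \<open>Adding \<tau> multiplies u by q^2: one half of the product loses the factor 1 + q u, the
  other gains 1 + 1 / (q u), and the quotient of the two is 1 / (q u).\<close>

lemma jacobi_prod_plus_tau:
  assumes "Im \<tau> > 0"
  shows "jacobi_prod \<tau> (z + \<tau>) = exp (- (\<i> * of_real pi * \<tau>) - 2 * of_real pi * \<i> * z) * jacobi_prod \<tau> z"
proof -
  define q where "q = exp (of_real pi * \<i> * \<tau>)"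
  define u where "u = exp (2 * of_real pi * \<i> * z)"
  have q1: "cmod q < 1" unfolding q_def by (rule nome_less_1[OF assms])
  have q0: "q \<noteq> 0" "u \<noteq> 0" by (simp_all add: q_def u_def)
  have e1: "exp (2 * of_real pi * \<i> * (z + \<tau>)) = q\<^sup>2 * u"
    unfolding q_def u_def power2_eq_square exp_add[symmetric] by (rule arg_cong[of _ _ exp]) (simp add: algebra_simps)
  have e2: "exp (- (\<i> * of_real pi * \<tau>) - 2 * of_real pi * \<i> * z) = inverse (q * u)"
    unfolding q_def u_def exp_add[symmetric] exp_minus[symmetric] by (rule arg_cong[of _ _ exp]) (simp add: algebra_simps)
  have A: "jacobi_prod \<tau> (z + \<tau>) = odd_qprod q (q\<^sup>2 * u) * odd_qprod q (inverse (q\<^sup>2 * u))"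
    unfolding jacobi_prod_def exp_minus e1 q_def ..
  have B: "jacobi_prod \<tau> z = odd_qprod q u * odd_qprod q (inverse u)"
    unfolding jacobi_prod_def exp_minus q_def u_def ..
  have s1: "odd_qprod q u = (1 + q * u) * odd_qprod q (q\<^sup>2 * u)"
    by (rule odd_qprod_shift[OF q1])
  have "odd_qprod q (inverse (q\<^sup>2 * u)) = (1 + q * inverse (q\<^sup>2 * u)) * odd_qprod q (q\<^sup>2 * inverse (q\<^sup>2 * u))"
    by (rule odd_qprod_shift[OF q1])
  also have "q\<^sup>2 * inverse (q\<^sup>2 * u) = inverse u" using q0 by (simp add: field_simps)
  also have "1 + q * inverse (q\<^sup>2 * u) = inverse (q * u) * (1 + q * u)"
    using q0 by (simp add: field_simps power2_eq_square)
  finally show ?thesis unfolding A B e2 s1 by (simp add: mult_ac)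
qed

text \<open>Comparing logarithms turns the vanishing of the n-th factor into (2 n + 1) \<tau> + 2 z
  = 1 + 2 m, that is z = \<open>theta_zero \<tau>\<close> + m - (n + 1) \<tau>.\<close>

lemma exp_add_odd_tau_eq:
  assumes "exp (of_real pi * \<i> * \<tau>) ^ (2 * n + 1) * exp (2 * of_real pi * \<i> * z) = -1"
  shows "z - theta_zero \<tau> \<in> period_lattice \<tau>"
proof -
  have "exp (of_real pi * \<i> * \<tau>) ^ (2 * n + 1) * exp (2 * of_real pi * \<i> * z) =
      exp (of_nat (2 * n + 1) * (of_real pi * \<i> * \<tau>) + 2 * of_real pi * \<i> * z)"
    by (simp only: exp_add exp_of_nat_mult)
  then have "exp (of_nat (2 * n + 1) * (of_real pi * \<i> * \<tau>) + 2 * of_real pi * \<i> * z) = exp (of_real pi * \<i>)"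
    using assms by simp
  then obtain m :: int where "of_nat (2 * n + 1) * (of_real pi * \<i> * \<tau>) + 2 * of_real pi * \<i> * z =
      of_real pi * \<i> + (of_int (2 * m) * pi) * \<i>"
    unfolding exp_eq by blast
  then have "of_real pi * \<i> * (of_nat (2 * n + 1) * \<tau> + 2 * z) = of_real pi * \<i> * (1 + of_int (2 * m))"
    by (simp add: algebra_simps)
  then have "of_nat (2 * n + 1) * \<tau> + 2 * z = 1 + of_int (2 * m)"
    by (subst (asm) mult_cancel_left) simp
  moreover have "2 * theta_zero \<tau> = 1 + \<tau>" by (simp add: theta_zero_def)
  ultimately have "2 * (z - theta_zero \<tau>) = 2 * (of_int m + of_int (- int n - 1) * \<tau>)"
    by (simp add: algebra_simps)
  then have "z - theta_zero \<tau> = of_int m + of_int (- int n - 1) * \<tau>"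
    by (subst (asm) mult_cancel_left) simp
  then show ?thesis unfolding period_lattice_def by blast
qed

lemma jacobi_prod_zero_imp:
  assumes "Im \<tau> > 0" "jacobi_prod \<tau> z = 0"
  shows "z - theta_zero \<tau> \<in> period_lattice \<tau>"
proof -
  from assms(2) have "(\<exists>n. exp (of_real pi * \<i> * \<tau>) ^ (2 * n + 1) * exp (2 * of_real pi * \<i> * z) = -1) \<or>
     (\<exists>n. exp (of_real pi * \<i> * \<tau>) ^ (2 * n + 1) * exp (2 * of_real pi * \<i> * (- z)) = -1)"
    unfolding jacobi_prod_def mult_eq_0_iff odd_qprod_eq_0_iff[OF nome_less_1[OF assms(1)]] by simp
  then consider "z - theta_zero \<tau> \<in> period_lattice \<tau>" | "- z - theta_zero \<tau> \<in> period_lattice \<tau>"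
    using exp_add_odd_tau_eq by blast
  then show ?thesis
  proof cases
    case 2
    \<comment> \<open>The second half of the product has -z in place of z;
      \<open>theta_zero \<tau>\<close> and its negative differ by the period 1 + \<tau>.\<close>
    have "- (- z - theta_zero \<tau>) - (1 + \<tau>) \<in> period_lattice \<tau>"
      by (intro period_lattice_diff period_lattice_uminus period_lattice_add 2 period_lattice_generators)
    also have "- (- z - theta_zero \<tau>) - (1 + \<tau>) = z - theta_zero \<tau>"
      by (simp add: theta_zero_def field_simps)
    finally show ?thesis .
  qed
qed

text \<open>At this point u = -q, and the factor 1 + q / u of the second half vanishes to first
  order. All other factors are collected in \<open>F\<close>, which does not vanish there.\<close>

lemma jacobi_prod_simple_zero:
  assumes "Im \<tau> > 0"
  shows "jacobi_prod \<tau> (theta_zero \<tau>) = 0" "deriv (jacobi_prod \<tau>) (theta_zero \<tau>) \<noteq> 0"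
proof -
  define q where "q = exp (of_real pi * \<i> * \<tau>)"
  define u where "u = (\<lambda>z. exp (2 * of_real pi * \<i> * z))"
  define z0 where "z0 = theta_zero \<tau>"
  define F where "F = (\<lambda>z. odd_qprod q (u z) * odd_qprod q (q\<^sup>2 * inverse (u z)))"
  have q1: "cmod q < 1" unfolding q_def by (rule nome_less_1[OF assms])
  have q0: "q \<noteq> 0" "u z \<noteq> 0" for z by (simp_all add: q_def u_def)
  have u0: "u z0 = - q"
  proof -
    have "u z0 = exp (of_real pi * \<i> + of_real pi * \<i> * \<tau>)"
      unfolding u_def by (rule arg_cong[of _ _ exp]) (simp add: z0_def theta_zero_def field_simps)
    then show ?thesis by (simp add: exp_add q_def)
  qed
  have J: "jacobi_prod \<tau> z = (1 + q * inverse (u z)) * F z" for z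
    unfolding jacobi_prod_def exp_minus F_def
    using odd_qprod_shift[OF q1, of "inverse (u z)"] by (simp add: q_def u_def mult_ac)
  then show z: "jacobi_prod \<tau> (theta_zero \<tau>) = 0"
    using u0 q0 by (simp add: z0_def)
  have "F holomorphic_on UNIV"
  proof -
    have "(odd_qprod q \<circ> u) holomorphic_on UNIV" "(odd_qprod q \<circ> (\<lambda>z. q\<^sup>2 * inverse (u z))) holomorphic_on UNIV"
      by (rule holomorphic_on_compose_gen[OF _ odd_qprod_holomorphic[OF q1, of UNIV]];
          auto simp: u_def intro!: holomorphic_intros)+
    then show ?thesis unfolding F_def o_def by (rule holomorphic_on_mult)
  qed
  then have F': "(F has_field_derivative deriv F z0) (at z0)"
    by (auto intro: holomorphic_derivI)
  have F0: "F z0 \<noteq> 0"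
  proof -
    \<comment> \<open>For u = -q the factors of both halves of \<open>F\<close> take the form 1 -
      q^(2 n + 2), and |q| < 1.\<close>
    have ne: "- (q ^ (2 * n + 2)) \<noteq> - 1" for n
    proof -
      have "cmod (q ^ (2 * n + 2)) < 1"
        unfolding norm_power using q1 by (intro power_less_one_iff[THEN iffD2]) auto
      then show ?thesis by (metis add.inverse_inverse norm_one order_less_irrefl)
    qed
    have "q ^ (2 * n + 1) * (- q) \<noteq> - 1" for n
      using ne[of n] by (simp add: mult_ac)
    moreover have "q ^ (2 * n + 1) * (q\<^sup>2 * inverse (- q)) \<noteq> - 1" for n
    proof -
      have e: "q ^ (2 * n + 1) * (q\<^sup>2 * inverse (- q)) = - (q ^ (2 * n + 2))"
        using q0 by (simp add: power2_eq_square)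
      show ?thesis unfolding e by (rule ne)
    qed
    ultimately show ?thesis
      unfolding F_def u0 mult_eq_0_iff odd_qprod_eq_0_iff[OF q1] by blast
  qed
  have u': "(u has_field_derivative (2 * of_real pi * \<i> * u z0)) (at z0)"
    unfolding u_def by (auto intro!: derivative_eq_intros)
  have "((\<lambda>z. (1 + q * inverse (u z)) * F z) has_field_derivative
      (1 + q * inverse (u z0)) * deriv F z0 + (q * (- (inverse (u z0) * (2 * of_real pi * \<i> * u z0) * inverse (u z0)))) * F z0) (at z0)"
    using q0 by (auto intro!: derivative_eq_intros u' F')
  then have "(jacobi_prod \<tau> has_field_derivative (2 * of_real pi * \<i> * F z0)) (at z0)"
    unfolding J[abs_def] by (rule DERIV_cong) (use q0 in \<open>simp add: u0\<close>)
  then show "deriv (jacobi_prod \<tau>) (theta_zero \<tau>) \<noteq> 0"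
    using F0 by (simp add: DERIV_imp_deriv z0_def)
qed

lemma lattice_isolated_0:
  assumes "Im \<tau> > 0" "l \<in> period_lattice \<tau>" "cmod l < min 1 (Im \<tau>)"
  shows "l = 0"
proof -
  obtain j k where l: "l = of_int j + of_int k * \<tau>"
    using assms by (auto simp: period_lattice_def)
  have "\<bar>of_int k * Im \<tau>\<bar> < 1 * Im \<tau>"
    using abs_Im_le_cmod[of l] assms(3) by (simp add: l)
  then have "\<bar>real_of_int k\<bar> < 1"
    unfolding abs_mult using assms(1) by simp
  then have k: "k = 0" by linarith
  have "\<bar>real_of_int j\<bar> < 1"
    using assms(3) by (simp add: l k)
  then show ?thesis using k l by simp
qed

lemma jacobi_prod_eq_0_iff:
  assumes "Im \<tau> > 0"
  shows "jacobi_prod \<tau> z = 0 \<longleftrightarrow> z - theta_zero \<tau> \<in> period_lattice \<tau>"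
proof
  assume l: "z - theta_zero \<tau> \<in> period_lattice \<tau>"
  have "jacobi_prod \<tau> (theta_zero \<tau> + (z - theta_zero \<tau>)) = 0 \<longleftrightarrow> jacobi_prod \<tau> (theta_zero \<tau>) = 0"
    by (rule lattice_invariant[OF _ _ l]) (simp_all add: jacobi_prod_plus_1 jacobi_prod_plus_tau assms)
  then show "jacobi_prod \<tau> z = 0"
    using jacobi_prod_simple_zero(1)[OF assms] by simp
qed (rule jacobi_prod_zero_imp[OF assms])

lemma fundamental_parallelogram:
  assumes "Im \<tau> > 0"
  shows "\<exists>w. cmod w \<le> 1 + cmod \<tau> \<and> z - w \<in> period_lattice \<tau>"
proof -
  define b where "b = Im z / Im \<tau>"
  define a where "a = Re z - b * Re \<tau>"
  have z: "z = of_real a + of_real b * \<tau>"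
    using assms by (simp add: a_def b_def complex_eq_iff)
  define w where "w = of_real (frac a) + of_real (frac b) * \<tau>"
  have "cmod w \<le> cmod (of_real (frac a)) + cmod (of_real (frac b) * \<tau>)"
    unfolding w_def by (rule norm_triangle_ineq)
  also have "\<dots> = frac a + frac b * cmod \<tau>"
    by (simp add: norm_mult frac_ge_0)
  also have "\<dots> \<le> 1 + 1 * cmod \<tau>"
    by (intro add_mono mult_right_mono) (simp_all add: frac_lt_1 less_imp_le)
  finally have "cmod w \<le> 1 + cmod \<tau>" by simp
  moreover have "z - w = of_int \<lfloor>a\<rfloor> + of_int \<lfloor>b\<rfloor> * \<tau>"
    unfolding z w_def frac_def by (simp add: algebra_simps)
  ultimately show ?thesis unfolding period_lattice_def by blast
qed

text \<open>The quotient of the two sides is entire and doubly periodic, hence constant.\<close>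

lemma Theta_eq_jacobi_prod:
  assumes "Im \<tau> > 0"
  shows "\<exists>c. c \<noteq> 0 \<and> (\<forall>z. Theta \<tau> z = c * jacobi_prod \<tau> z)"
proof -
  define z0 where "z0 = theta_zero \<tau>"
  define J where "J = jacobi_prod \<tau>"
  \<comment> \<open>The value at \<open>z0\<close> demanded by L'Hopital's rule; by periodicity the
    same value is right at every other zero of \<open>J\<close>.\<close>
  define c0 where "c0 = deriv (Theta \<tau>) z0 / deriv J z0"
  define f where "f = (\<lambda>z. if J z = 0 then c0 else Theta \<tau> z / J z)"
  have J0: "J z = 0 \<longleftrightarrow> z - z0 \<in> period_lattice \<tau>" for z
    unfolding J_def z0_def by (rule jacobi_prod_eq_0_iff[OF assms])
  have J1: "J (z + 1) = J z" for z
    unfolding J_def by (rule jacobi_prod_plus_1)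
  have Jt: "J (z + \<tau>) = exp (- (\<i> * of_real pi * \<tau>) - 2 * of_real pi * \<i> * z) * J z" for z
    unfolding J_def by (rule jacobi_prod_plus_tau[OF assms])
  have per1: "f (z + 1) = f z" for z
    by (simp add: f_def J1 Theta_plus_1)
  have pert: "f (z + \<tau>) = f z" for z
    by (simp add: f_def Jt Theta_plus_tau)
  have per: "f (z + l) = f z" if "l \<in> period_lattice \<tau>" for l z
    by (rule lattice_invariant[where P = "\<lambda>w. f w = f z" and w = z, OF _ _ that, THEN iffD2])
       (simp_all add: per1 pert)
  have Jh: "J holomorphic_on A" and Th: "Theta \<tau> holomorphic_on A" for A
    unfolding J_def by (rule jacobi_prod_holomorphic[OF assms], rule Theta_holomorphic[OF assms])
  have Jd: "(J has_field_derivative deriv J z) (at z)"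
    and Td: "(Theta \<tau> has_field_derivative deriv (Theta \<tau>) z) (at z)" for z
    using Jh[of UNIV] Th[of UNIV] by (auto intro: holomorphic_derivI)
  define d where "d = min 1 (Im \<tau>)"
  have d: "d > 0" using assms by (simp add: d_def)
  have iso: "J z \<noteq> 0" if "z \<in> ball z0 d - {z0}" for z
    using lattice_isolated_0[OF assms, of "z - z0"] that
    by (auto simp: J0 d_def dist_norm norm_minus_commute)
  have fz0: "f field_differentiable at z0"
  proof -
    have "(\<lambda>w. Theta \<tau> w / J w) \<midarrow>z0\<rightarrow> c0"
      by (rule lhopital_complex_simple[OF Td Jd])
         (use jacobi_prod_simple_zero[OF assms] Theta_theta_zero in \<open>simp_all add: z0_def J_def c0_def\<close>)
    moreover have "\<forall>\<^sub>F w in at z0. Theta \<tau> w / J w = f w"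
      unfolding eventually_at by (rule exI[of _ d]) (use d iso in \<open>auto simp: f_def dist_commute\<close>)
    ultimately have "f \<midarrow>z0\<rightarrow> c0" by (rule Lim_transform_eventually)
    moreover have "f z0 = c0" by (simp add: f_def J0)
    ultimately have c1: "isCont f z0" by (simp add: isCont_def)
    have h: "f holomorphic_on ball z0 d - {z0}"
      by (rule holomorphic_transform[of "\<lambda>w. Theta \<tau> w / J w"])
         (use iso in \<open>auto intro!: holomorphic_on_divide Th Jh simp: f_def\<close>)
    have "continuous_on (ball z0 d) f"
    proof (rule continuous_at_imp_continuous_on, rule ballI)
      fix z assume z: "z \<in> ball z0 d"
      show "isCont f z"
      proof (cases "z = z0")
        case False
        have "open (ball z0 d - {z0})" by auto
        then show ?thesis
          using holomorphic_on_imp_continuous_on[OF h] z False by (auto simp: continuous_on_eq_continuous_at)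
      qed (use c1 in simp)
    qed
    then have "f holomorphic_on ball z0 d"
      by (rule no_isolated_singularity[OF _ h]) auto
    then show ?thesis
      by (rule holomorphic_on_imp_differentiable_at) (use d in auto)
  qed
  have "f field_differentiable at z" for z
  proof (cases "J z = 0")
    case True
    \<comment> \<open>Differentiability at an arbitrary zero of \<open>J\<close> is carried over
      from \<open>z0\<close> by a lattice translation, under which \<open>f\<close> is
      invariant.\<close>
    then have l: "z - z0 \<in> period_lattice \<tau>" by (simp add: J0)
    obtain D where "(f has_field_derivative D) (at z0)"
      using fz0 by (auto simp: field_differentiable_def)
    then have "((\<lambda>x. f (x + (z0 - z))) has_field_derivative D) (at z)"
      using DERIV_at_within_shift by (metis diff_add_cancel DERIV_shift add.commute)
    moreover have "(\<lambda>x. f (x + (z0 - z))) = f"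
      using per[OF period_lattice_uminus[OF l]] by auto
    ultimately show ?thesis by (auto simp: field_differentiable_def)
  next
    case False
    have op: "open (- (J -` {0}))"
      using continuous_closed_vimage[of "{0}" J] holomorphic_on_imp_continuous_on[OF Jh[of UNIV]]
      by (auto simp: continuous_on_eq_continuous_at closed_def[symmetric] open_Compl)
    have "f holomorphic_on - (J -` {0})"
      by (rule holomorphic_transform[of "\<lambda>w. Theta \<tau> w / J w"])
         (auto intro!: holomorphic_on_divide Th Jh simp: f_def)
    then show ?thesis
      by (rule holomorphic_on_imp_differentiable_at[OF _ op]) (use False in auto)
  qed
  then have fh: "f holomorphic_on UNIV"
    by (simp add: holomorphic_on_def)
  \<comment> \<open>The disc contains a fundamental parallelogram, so periodicity reduces
    boundedness of \<open>f\<close> to continuity on a compact set.\<close>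
  have "f ` UNIV \<subseteq> f ` cball 0 (1 + cmod \<tau>)"
  proof clarify
    fix z
    obtain w where "cmod w \<le> 1 + cmod \<tau>" "z - w \<in> period_lattice \<tau>"
      using fundamental_parallelogram[OF assms] by blast
    then show "f z \<in> f ` cball 0 (1 + cmod \<tau>)"
      using per[of "z - w" w] by (auto intro!: image_eqI[of _ _ w])
  qed
  moreover have "bounded (f ` cball 0 (1 + cmod \<tau>))"
    by (intro compact_imp_bounded compact_continuous_image holomorphic_on_imp_continuous_on
        holomorphic_on_subset[OF fh]) auto
  ultimately have "bounded (range f)" by (rule bounded_subset[rotated])
  with fh have "f constant_on UNIV" by (rule Liouville_theorem)
  then obtain c where c: "f z = c" for z by (auto simp: constant_on_def)
  have main: "Theta \<tau> z = c * J z" for z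
  proof (cases "J z = 0")
    case True
    then have l: "z - z0 \<in> period_lattice \<tau>" by (simp add: J0)
    have "Theta \<tau> (z0 + (z - z0)) = 0 \<longleftrightarrow> Theta \<tau> z0 = 0"
      by (rule lattice_invariant[OF _ _ l]) (simp_all add: Theta_plus_1 Theta_plus_tau)
    then show ?thesis using True Theta_theta_zero by (simp add: z0_def)
  next
    case False
    then show ?thesis using c[of z] by (simp add: f_def field_simps)
  qed
  moreover have "c \<noteq> 0"
    using Theta_not_zero[OF assms] main by auto
  ultimately show ?thesis unfolding J_def by blast
qed

section \<open>Simple zeros and logarithmic derivative of theta\<close>

lemma Theta_eq_0_iff:
  assumes "Im \<tau> > 0"
  shows "Theta \<tau> (w + theta_zero \<tau>) = 0 \<longleftrightarrow> w \<in> period_lattice \<tau>"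
  using Theta_eq_jacobi_prod[OF assms] jacobi_prod_eq_0_iff[OF assms, of "w + theta_zero \<tau>"] by auto

lemma Theta_has_deriv:
  assumes "Im \<tau> > 0"
  shows "(Theta \<tau> has_field_derivative deriv (Theta \<tau>) z) (at z)"
  using Theta_holomorphic[OF assms, of UNIV] by (auto intro: holomorphic_derivI)

lemma deriv_Theta_plus_1:
  assumes "Im \<tau> > 0"
  shows "deriv (Theta \<tau>) (z + 1) = deriv (Theta \<tau>) z"
proof (rule DERIV_unique)
  show "(Theta \<tau> has_field_derivative deriv (Theta \<tau>) z) (at z)" by (rule Theta_has_deriv[OF assms])
  have "((\<lambda>w. Theta \<tau> (w + 1)) has_field_derivative deriv (Theta \<tau>) (z + 1)) (at z)"
    using Theta_has_deriv[OF assms, of "z + 1"] by (simp add: DERIV_shift)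
  then show "(Theta \<tau> has_field_derivative deriv (Theta \<tau>) (z + 1)) (at z)"
    by (simp add: Theta_plus_1)
qed

lemma deriv_Theta_plus_tau:
  assumes "Im \<tau> > 0"
  shows "deriv (Theta \<tau>) (z + \<tau>) = exp (- (\<i> * of_real pi * \<tau>) - 2 * of_real pi * \<i> * z) *
           (deriv (Theta \<tau>) z - 2 * of_real pi * \<i> * Theta \<tau> z)"
proof (rule DERIV_unique)
  have "((\<lambda>w. Theta \<tau> (w + \<tau>)) has_field_derivative deriv (Theta \<tau>) (z + \<tau>)) (at z)"
    using Theta_has_deriv[OF assms, of "z + \<tau>"] by (simp add: DERIV_shift)
  then show "((\<lambda>w. exp (- (\<i> * of_real pi * \<tau>) - 2 * of_real pi * \<i> * w) * Theta \<tau> w) has_field_derivative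
      deriv (Theta \<tau>) (z + \<tau>)) (at z)"
    by (simp add: Theta_plus_tau)
  show "((\<lambda>w. exp (- (\<i> * of_real pi * \<tau>) - 2 * of_real pi * \<i> * w) * Theta \<tau> w) has_field_derivative
      exp (- (\<i> * of_real pi * \<tau>) - 2 * of_real pi * \<i> * z) *
           (deriv (Theta \<tau>) z - 2 * of_real pi * \<i> * Theta \<tau> z)) (at z)"
    by (rule derivative_eq_intros refl Theta_has_deriv[OF assms] | simp add: algebra_simps)+
qed

text \<open>At a zero the additional term -2 pi i Theta in the derivative of the functional equation
  disappears, so being a simple zero is invariant under the lattice; at
  \<open>theta_zero \<tau>\<close> it is read off the product.\<close>

lemma deriv_Theta_at_zero:
  assumes "Im \<tau> > 0" "l \<in> period_lattice \<tau>"
  shows "deriv (Theta \<tau>) (l + theta_zero \<tau>) \<noteq> 0"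
proof -
  let ?P = "\<lambda>w. Theta \<tau> w = 0 \<and> deriv (Theta \<tau>) w \<noteq> 0"
  have "?P (theta_zero \<tau> + l) \<longleftrightarrow> ?P (theta_zero \<tau>)"
    by (rule lattice_invariant[OF _ _ assms(2)])
       (auto simp: Theta_plus_1 Theta_plus_tau deriv_Theta_plus_1 deriv_Theta_plus_tau assms(1))
  moreover have "deriv (Theta \<tau>) (theta_zero \<tau>) \<noteq> 0"
  proof -
    obtain c where c: "c \<noteq> 0" "\<And>z. Theta \<tau> z = c * jacobi_prod \<tau> z"
      using Theta_eq_jacobi_prod[OF assms(1)] by blast
    have "(jacobi_prod \<tau> has_field_derivative deriv (jacobi_prod \<tau>) (theta_zero \<tau>)) (at (theta_zero \<tau>))"
      using jacobi_prod_holomorphic[OF assms(1), of UNIV] by (auto intro: holomorphic_derivI)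
    from DERIV_cmult[OF this, of c] have "deriv (Theta \<tau>) (theta_zero \<tau>) = c * deriv (jacobi_prod \<tau>) (theta_zero \<tau>)"
      unfolding c(2)[abs_def] by (rule DERIV_imp_deriv)
    then show ?thesis using c(1) jacobi_prod_simple_zero(2)[OF assms(1)] by simp
  qed
  ultimately show ?thesis
    using Theta_theta_zero[of \<tau>] by (simp add: add.commute)
qed

text \<open>The shift by \<open>theta_zero \<tau>\<close> moves the poles to the lattice points, so
  the kernel is singular exactly where Z p - Z s is a period.\<close>

definition theta_logder :: "complex \<Rightarrow> complex \<Rightarrow> complex" where
  "theta_logder \<tau> w = deriv (Theta \<tau>) (w + theta_zero \<tau>) / Theta \<tau> (w + theta_zero \<tau>)"

lemma theta_logder_plus_1:
  assumes "Im \<tau> > 0"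
  shows "theta_logder \<tau> (w + 1) = theta_logder \<tau> w"
proof -
  have e: "w + 1 + theta_zero \<tau> = (w + theta_zero \<tau>) + 1" by simp
  show ?thesis
    unfolding theta_logder_def e Theta_plus_1 deriv_Theta_plus_1[OF assms] ..
qed

text \<open>The constant is the logarithmic derivative of the exponential factor of the theta
  relation. At lattice points both quotients have the default value 0 and the relation fails; hence
  the almost-everywhere arguments below.\<close>

lemma theta_logder_plus_tau:
  assumes "Im \<tau> > 0" "w \<notin> period_lattice \<tau>"
  shows "theta_logder \<tau> (w + \<tau>) = theta_logder \<tau> w - 2 * of_real pi * \<i>"
proof -
  have e: "w + \<tau> + theta_zero \<tau> = (w + theta_zero \<tau>) + \<tau>" by simp
  show ?thesis
    unfolding theta_logder_def e Theta_plus_tau deriv_Theta_plus_tau[OF assms(1)]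
    using assms(2) Theta_eq_0_iff[OF assms(1), of w] by (simp add: field_simps)
qed

lemma theta_logder_measurable:
  assumes "Im \<tau> > 0"
  shows "theta_logder \<tau> \<in> borel_measurable borel"
proof -
  have "deriv (Theta \<tau>) holomorphic_on UNIV"
    using Theta_holomorphic[OF assms, of UNIV] by (auto intro: holomorphic_deriv)
  then have "continuous_on UNIV (deriv (Theta \<tau>))" "continuous_on UNIV (Theta \<tau>)"
    using Theta_holomorphic[OF assms, of UNIV] by (auto intro: holomorphic_on_imp_continuous_on)
  then have [measurable]: "deriv (Theta \<tau>) \<in> borel_measurable borel" "Theta \<tau> \<in> borel_measurable borel"
    by (auto intro: borel_measurable_continuous_onI)
  show ?thesis unfolding theta_logder_def[abs_def] by measurable
qed

text \<open>One removable singularity per step: as the points of \<open>F\<close> are distinct, the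
  factors already split off do not vanish at the next point, so the cofactor does.\<close>

lemma entire_divide_zeros:
  assumes "finite F" "f holomorphic_on UNIV" "\<And>l. l \<in> F \<Longrightarrow> f l = 0"
  shows "\<exists>g. g holomorphic_on UNIV \<and> (\<forall>w. f w = (\<Prod>l\<in>F. w - l) * g w)"
  using assms
proof (induction F rule: finite_induct)
  case empty
  then show ?case by auto
next
  case (insert l F)
  then obtain g where g: "g holomorphic_on UNIV" "\<And>w. f w = (\<Prod>l\<in>F. w - l) * g w"
    by auto
  have "f l = 0" using insert by auto
  then have gl: "g l = 0"
    using g(2)[of l] insert by auto
  define h where "h = (\<lambda>w. if w = l then deriv g l else (g w - g l) / (w - l))"
  have "h holomorphic_on UNIV"
    using pole_lemma_open[OF g(1), of l] by (simp add: h_def)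
  moreover have "g w = (w - l) * h w" for w
    using gl by (auto simp: h_def)
  then have "f w = (\<Prod>l\<in>insert l F. w - l) * h w" for w
    unfolding g(2) using insert by (simp add: mult_ac)
  ultimately show ?case by blast
qed

text \<open>All zeros of the theta function are simple, so each contributes \<open>1 / (w - l)\<close> to the
  logarithmic derivative.\<close>

lemma theta_logder_partial_fractions:
  fixes M :: real
  assumes "Im \<tau> > 0"
  defines "F \<equiv> {l \<in> period_lattice \<tau>. cmod l \<le> M}"
  shows "\<exists>k. k holomorphic_on ball 0 M \<and>
     (\<forall>w \<in> ball 0 M - period_lattice \<tau>. theta_logder \<tau> w = (\<Sum>l\<in>F. 1 / (w - l)) + k w)"
proof -
  define f where "f = (\<lambda>w. Theta \<tau> (w + theta_zero \<tau>))"
  have fin: "finite F" unfolding F_def by (rule finite_period_lattice[OF assms(1)])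
  have fh: "f holomorphic_on UNIV"
    unfolding f_def by (rule holomorphic_on_compose_gen[of "\<lambda>w. w + theta_zero \<tau>" UNIV "Theta \<tau>" UNIV, unfolded o_def])
      (auto intro!: holomorphic_intros Theta_holomorphic assms)
  have fd: "(f has_field_derivative deriv (Theta \<tau>) (w + theta_zero \<tau>)) (at w)" for w
    unfolding f_def using Theta_has_deriv[OF assms(1), of "w + theta_zero \<tau>"] by (simp add: DERIV_shift)
  have f0: "f w = 0 \<longleftrightarrow> w \<in> period_lattice \<tau>" for w
    unfolding f_def by (rule Theta_eq_0_iff[OF assms(1)])
  obtain g where g: "g holomorphic_on UNIV" "\<And>w. f w = (\<Prod>l\<in>F. w - l) * g w"
    using entire_divide_zeros[OF fin fh] f0 by (auto simp: F_def)
  have gd: "(g has_field_derivative deriv g w) (at w)" for w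
    using g by (auto intro: holomorphic_derivI)
  have pd: "((\<lambda>w. \<Prod>l\<in>G. w - l) has_field_derivative (\<Sum>l\<in>G. \<Prod>m\<in>G - {l}. w - m)) (at w)" if "finite G" for G w
    by (rule DERIV_cong, rule has_field_derivative_prod[where f' = "\<lambda>_. 1"])
       (auto intro!: derivative_eq_intros)
  have der: "deriv (Theta \<tau>) (w + theta_zero \<tau>) = (\<Prod>l\<in>F. w - l) * deriv g w + (\<Sum>l\<in>F. \<Prod>m\<in>F - {l}. w - m) * g w" for w
  proof (rule DERIV_unique[OF fd])
    show "(f has_field_derivative (\<Prod>l\<in>F. w - l) * deriv g w + (\<Sum>l\<in>F. \<Prod>m\<in>F - {l}. w - m) * g w) (at w)"
      unfolding g(2)[abs_def] using DERIV_mult[OF pd[OF fin] gd, of w] by (simp add: add.commute mult.commute)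
  qed
  \<comment> \<open>A zero of the cofactor inside the disc would be a zero of theta, hence a point
    of \<open>F\<close>, and would make that zero a multiple one.\<close>
  have gnz: "g w \<noteq> 0" if "w \<in> ball 0 M" for w
  proof
    assume gw: "g w = 0"
    then have w: "w \<in> period_lattice \<tau>" using g(2)[of w] f0 by simp
    then have "w \<in> F" using that by (auto simp: F_def)
    then have "(\<Prod>l\<in>F. w - l) = 0" using fin by auto
    then have "deriv (Theta \<tau>) (w + theta_zero \<tau>) = 0" using der[of w] gw by simp
    then show False using deriv_Theta_at_zero[OF assms(1) w] by simp
  qed
  have "(\<lambda>w. deriv g w / g w) holomorphic_on ball 0 M"
    by (intro holomorphic_on_divide holomorphic_deriv holomorphic_on_subset[OF g(1)]) (use gnz in auto)
  moreover have "theta_logder \<tau> w = (\<Sum>l\<in>F. 1 / (w - l)) + deriv g w / g w"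
    if w: "w \<in> ball 0 M - period_lattice \<tau>" for w
  proof -
    have ne: "w - l \<noteq> 0" if "l \<in> F" for l using w that by (auto simp: F_def)
    have pz: "(\<Prod>l\<in>F. w - l) \<noteq> 0" using ne fin by auto
    have "(\<Sum>l\<in>F. \<Prod>m\<in>F - {l}. w - m) = (\<Sum>l\<in>F. (\<Prod>l\<in>F. w - l) * (1 / (w - l)))"
      by (rule sum.cong) (use ne fin in \<open>auto simp: prod.remove[of F]\<close>)
    also have "\<dots> = (\<Prod>l\<in>F. w - l) * (\<Sum>l\<in>F. 1 / (w - l))"
      by (rule sum_distrib_left[symmetric])
    finally have S: "(\<Sum>l\<in>F. \<Prod>m\<in>F - {l}. w - m) = (\<Prod>l\<in>F. w - l) * (\<Sum>l\<in>F. 1 / (w - l))" .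
    have "theta_logder \<tau> w = ((\<Prod>l\<in>F. w - l) * deriv g w + (\<Sum>l\<in>F. \<Prod>m\<in>F - {l}. w - m) * g w) / ((\<Prod>l\<in>F. w - l) * g w)"
      unfolding theta_logder_def der using g(2)[of w] by (simp add: f_def)
    also have "\<dots> = (\<Sum>l\<in>F. 1 / (w - l)) + deriv g w / g w"
      unfolding S using pz gnz[of w] w by (simp add: field_simps)
    finally show ?thesis .
  qed
  ultimately show ?thesis by blast
qed

section \<open>Cauchy potentials\<close>

lemma exists_dyadic_small:
  fixes t :: real
  assumes "0 < t" "t < 1"
  shows "\<exists>k. (1 / 2) ^ Suc k \<le> t \<and> t < (1 / 2) ^ k"
proof -
  define n where "n = (LEAST n. (1 / 2 :: real) ^ n \<le> t)"
  obtain m where "(1 / 2 :: real) ^ m < t"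
    using real_arch_pow_inv[of t "1 / 2"] assms(1) by auto
  then have ex: "\<exists>n. (1 / 2 :: real) ^ n \<le> t" by (intro exI[of _ m]) simp
  then have 1: "(1 / 2 :: real) ^ n \<le> t" unfolding n_def by (rule LeastI_ex)
  then have "n \<noteq> 0" using assms(2) by (intro notI) simp
  then obtain k where k: "n = Suc k" by (cases n) auto
  have "\<not> (1 / 2 :: real) ^ k \<le> t"
    using not_less_Least[of k "\<lambda>n. (1 / 2 :: real) ^ n \<le> t"] k by (simp add: n_def)
  then show ?thesis using 1 k by auto
qed

lemma exists_dyadic_large:
  fixes t :: real
  assumes "1 \<le> t"
  shows "\<exists>k. 2 ^ k \<le> t \<and> t < 2 ^ Suc k"
proof -
  define n where "n = (LEAST n. t < (2 :: real) ^ n)"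
  have ex: "\<exists>n. t < (2 :: real) ^ n" using real_arch_pow[of 2 t] by auto
  then have 1: "t < 2 ^ n" unfolding n_def by (rule LeastI_ex)
  then have "n \<noteq> 0" using assms by (intro notI) simp
  then obtain k where k: "n = Suc k" by (cases n) auto
  have "\<not> t < (2 :: real) ^ k"
    using not_less_Least[of k "\<lambda>n. t < (2 :: real) ^ n"] k by (simp add: n_def)
  then show ?thesis using 1 k by (intro exI[of _ k]) auto
qed

lemma powr_add_le:
  fixes a b r :: real
  assumes "0 \<le> a" "0 \<le> b" "0 \<le> r"
  shows "(a + b) powr r \<le> 2 powr r * (a powr r + b powr r)"
proof -
  have "(a + b) powr r \<le> (2 * max a b) powr r"
    using assms by (intro powr_mono2) auto
  also have "\<dots> = 2 powr r * max a b powr r" using assms by (simp add: powr_mult)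
  also have "\<dots> \<le> 2 powr r * (a powr r + b powr r)"
    by (intro mult_left_mono) (auto simp: max_def)
  finally show ?thesis .
qed

text \<open>Valid for w = 0 as well, where both sides are 0 by the conventions for division and
  \<open>powr\<close>.\<close>

lemma norm_inverse_powr: "(cmod (1 / w)) powr r = cmod w powr - r"
  by (simp add: norm_divide powr_minus_divide powr_divide)

text \<open>The image measure of \<open>M\<close> under \<open>f\<close> is upper Ahlfors regular of
  dimension \<beta>: discs of radius \<delta> carry mass at most C \<delta>^\<beta>. The potential
  estimates rest on this alone and require neither injectivity nor smoothness of
  \<open>f\<close>.\<close>

locale upper_regular_map =
  fixes M :: "'a measure" and f :: "'a \<Rightarrow> complex" and C \<beta> :: real
  assumes finite_space: "emeasure M (space M) < \<infinity>"
    and f_measurable [measurable]: "f \<in> borel_measurable M"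
    and C_nonneg: "0 \<le> C"
    and regular: "\<And>z \<delta>. 0 < \<delta> \<Longrightarrow> emeasure M {x \<in> space M. cmod (f x - z) < \<delta>} \<le> ennreal (C * \<delta> powr \<beta>)"
begin

text \<open>\<open>A k\<close> bounds the integrand on the k-th shell and \<open>R k\<close> is the
  radius of a disc containing that shell. Overlapping shells do no harm, because the integrand is
  only majorised by the sum over all shells.\<close>

lemma dyadic_bound:
  fixes A R :: "nat \<Rightarrow> real"
  assumes bound: "\<And>x. x \<in> space M \<Longrightarrow> g x \<noteq> 0 \<Longrightarrow> \<exists>k. g x \<le> ennreal (A k) \<and> cmod (f x - z) < R k"
    and A: "\<And>k. 0 \<le> A k" and R: "\<And>k. 0 < R k"
    and geom: "\<And>k. A k * (C * R k powr \<beta>) \<le> B * t ^ k"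
    and t: "0 \<le> t" "t < 1" and B: "0 \<le> B"
  shows "(\<integral>\<^sup>+ x. g x \<partial>M) \<le> ennreal (B / (1 - t))"
proof -
  let ?S = "\<lambda>k. {x \<in> space M. cmod (f x - z) < R k}"
  have "(\<integral>\<^sup>+ x. g x \<partial>M) \<le> (\<integral>\<^sup>+ x. (\<Sum>k. ennreal (A k) * indicator (?S k) x) \<partial>M)"
  proof (rule nn_integral_mono)
    fix x assume x: "x \<in> space M"
    show "g x \<le> (\<Sum>k. ennreal (A k) * indicator (?S k) x)"
    proof (cases "g x = 0")
      case False
      then obtain k where k: "g x \<le> ennreal (A k)" "cmod (f x - z) < R k"
        using bound x by blast
      have "ennreal (A k) = (\<Sum>k\<in>{k}. ennreal (A k) * indicator (?S k) x)"
        using k x by simp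
      also have "\<dots> \<le> (\<Sum>k. ennreal (A k) * indicator (?S k) x)"
        by (rule sum_le_suminf[OF summableI]) auto
      finally show ?thesis using k by (meson order_trans)
    qed simp
  qed
  also have "\<dots> = (\<Sum>k. \<integral>\<^sup>+ x. ennreal (A k) * indicator (?S k) x \<partial>M)"
    by (rule nn_integral_suminf) measurable
  also have "\<dots> = (\<Sum>k. ennreal (A k) * emeasure M (?S k))"
    by (subst nn_integral_cmult_indicator) auto
  also have "\<dots> \<le> (\<Sum>k. ennreal (B * t ^ k))"
  proof (rule suminf_le)
    fix k
    have "ennreal (A k) * emeasure M (?S k) \<le> ennreal (A k) * ennreal (C * R k powr \<beta>)"
      by (intro mult_left_mono regular R) auto
    also have "\<dots> = ennreal (A k * (C * R k powr \<beta>))"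
      using A C_nonneg by (simp add: ennreal_mult)
    also have "\<dots> \<le> ennreal (B * t ^ k)" by (rule ennreal_leI[OF geom])
    finally show "ennreal (A k) * emeasure M (?S k) \<le> ennreal (B * t ^ k)" .
  qed auto
  also have "\<dots> = ennreal (B * (1 / (1 - t)))"
  proof (rule suminf_ennreal_eq)
    show "(\<lambda>k. B * t ^ k) sums (B * (1 / (1 - t)))"
      by (intro sums_mult geometric_sums) (use t in auto)
  qed (use t B in auto)
  finally show ?thesis by simp
qed

text \<open>The shell at distance about \<rho> / 2^k contributes a multiple of (\<rho> /
  2^k)^(\<beta> - r), a geometric series because r < \<beta>. The power of \<rho> on the right is
  the origin of the Hoelder exponent.\<close>

lemma potential_near:
  assumes "0 \<le> r" "r < \<beta>"
  shows "\<exists>K\<ge>0. \<forall>z \<rho>. 0 < \<rho> \<longrightarrow>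
    (\<integral>\<^sup>+ x. ennreal (cmod (f x - z) powr - r) * indicator {x. cmod (f x - z) < \<rho>} x \<partial>M) \<le> ennreal (K * \<rho> powr (\<beta> - r))"
proof -
  define t :: real where "t = (1 / 2) powr (\<beta> - r)"
  have t: "0 \<le> t" "t < 1"
    using assms powr_less_mono[of "- (\<beta> - r)" 0 "2::real"] by (auto simp: t_def powr_minus powr_divide inverse_eq_divide)
  define K where "K = 2 powr r * C / (1 - t)"
  have K: "0 \<le> K" using C_nonneg t by (simp add: K_def)
  have "(\<integral>\<^sup>+ x. ennreal (cmod (f x - z) powr - r) * indicator {x. cmod (f x - z) < \<rho>} x \<partial>M) \<le> ennreal (K * \<rho> powr (\<beta> - r))"
    if \<rho>: "0 < \<rho>" for z \<rho>
  proof -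
    have "(\<integral>\<^sup>+ x. ennreal (cmod (f x - z) powr - r) * indicator {x. cmod (f x - z) < \<rho>} x \<partial>M)
        \<le> ennreal ((2 powr r * C * \<rho> powr (\<beta> - r)) / (1 - t))"
    proof (rule dyadic_bound[where A = "\<lambda>k. (\<rho> * (1 / 2) ^ Suc k) powr - r" and R = "\<lambda>k. \<rho> * (1 / 2) ^ k" and z = z])
      fix x
      assume nz: "ennreal (cmod (f x - z) powr - r) * indicator {x. cmod (f x - z) < \<rho>} x \<noteq> 0"
      then have d: "cmod (f x - z) < \<rho>" by (auto split: split_indicator_asm)
      \<comment> \<open>At the centre the integrand is 0 by the convention for \<open>powr\<close>,
        so only positive distances have to be placed in a shell.\<close>
      have d0: "0 < cmod (f x - z)" using nz by (cases "f x = z") auto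
      obtain k where k: "(1 / 2) ^ Suc k \<le> cmod (f x - z) / \<rho>" "cmod (f x - z) / \<rho> < (1 / 2) ^ k"
        using exists_dyadic_small[of "cmod (f x - z) / \<rho>"] d d0 \<rho> by auto
      have "cmod (f x - z) powr - r \<le> (\<rho> * (1 / 2) ^ Suc k) powr - r"
        by (rule powr_mono2') (use k \<rho> assms d0 in \<open>auto simp: field_simps\<close>)
      moreover have "cmod (f x - z) < \<rho> * (1 / 2) ^ k"
        using k \<rho> by (simp add: field_simps)
      ultimately show "\<exists>k. ennreal (cmod (f x - z) powr - r) * indicator {x. cmod (f x - z) < \<rho>} x
            \<le> ennreal ((\<rho> * (1 / 2) ^ Suc k) powr - r) \<and> cmod (f x - z) < \<rho> * (1 / 2) ^ k"
        using d by (intro exI[of _ k]) (auto intro: ennreal_leI)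
    next
      fix k
      have h: "(1 / 2 :: real) ^ k = (1 / 2) powr (real k)" by (simp add: powr_realpow)
      have "(\<rho> * (1 / 2) ^ Suc k) powr - r * (C * (\<rho> * (1 / 2) ^ k) powr \<beta>)
          = (1 / 2) powr - r * C * ((\<rho> * (1 / 2) ^ k) powr - r * (\<rho> * (1 / 2) ^ k) powr \<beta>)"
        using \<rho> powr_mult[of "1 / 2" "\<rho> * (1 / 2) ^ k" "- r"] by (simp add: mult_ac del: powr_mult)
      also have "(\<rho> * (1 / 2) ^ k) powr - r * (\<rho> * (1 / 2) ^ k) powr \<beta> = (\<rho> * (1 / 2) ^ k) powr (\<beta> - r)"
        by (simp add: powr_add[symmetric])
      also have "\<dots> = \<rho> powr (\<beta> - r) * t ^ k"
        unfolding h t_def using \<rho> by (simp add: powr_mult powr_powr powr_realpow[symmetric] mult.commute)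
      also have "(1 / 2 :: real) powr - r = 2 powr r"
        by (simp add: powr_minus powr_divide)
      finally show "(\<rho> * (1 / 2) ^ Suc k) powr - r * (C * (\<rho> * (1 / 2) ^ k) powr \<beta>)
          \<le> 2 powr r * C * \<rho> powr (\<beta> - r) * t ^ k" by (simp only: mult.assoc order_refl)
    qed (use \<rho> t C_nonneg in auto)
    then show ?thesis by (simp add: K_def)
  qed
  then show ?thesis using K by blast
qed

text \<open>The counterpart with shells growing outwards, summable because \<beta> < s. It is
  applied with s = 2 r.\<close>

lemma potential_far:
  assumes "0 \<le> s" "\<beta> < s"
  shows "\<exists>K\<ge>0. \<forall>z \<rho>. 0 < \<rho> \<longrightarrow>
    (\<integral>\<^sup>+ x. ennreal (cmod (f x - z) powr - s) * indicator {x. \<rho> \<le> cmod (f x - z)} x \<partial>M) \<le> ennreal (K * \<rho> powr (\<beta> - s))"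
proof -
  define t :: real where "t = 2 powr (\<beta> - s)"
  have t: "0 \<le> t" "t < 1"
    using assms powr_less_mono[of "\<beta> - s" 0 "2::real"] by (auto simp: t_def)
  define K where "K = 2 powr \<beta> * C / (1 - t)"
  have K: "0 \<le> K" using C_nonneg t by (simp add: K_def)
  have "(\<integral>\<^sup>+ x. ennreal (cmod (f x - z) powr - s) * indicator {x. \<rho> \<le> cmod (f x - z)} x \<partial>M) \<le> ennreal (K * \<rho> powr (\<beta> - s))"
    if \<rho>: "0 < \<rho>" for z \<rho>
  proof -
    have "(\<integral>\<^sup>+ x. ennreal (cmod (f x - z) powr - s) * indicator {x. \<rho> \<le> cmod (f x - z)} x \<partial>M)
        \<le> ennreal ((2 powr \<beta> * C * \<rho> powr (\<beta> - s)) / (1 - t))"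
    proof (rule dyadic_bound[where A = "\<lambda>k. (\<rho> * 2 ^ k) powr - s" and R = "\<lambda>k. \<rho> * 2 ^ Suc k" and z = z])
      fix x
      assume "ennreal (cmod (f x - z) powr - s) * indicator {x. \<rho> \<le> cmod (f x - z)} x \<noteq> 0"
      then have d: "\<rho> \<le> cmod (f x - z)" by (auto split: split_indicator_asm)
      obtain k where k: "2 ^ k \<le> cmod (f x - z) / \<rho>" "cmod (f x - z) / \<rho> < 2 ^ Suc k"
        using exists_dyadic_large[of "cmod (f x - z) / \<rho>"] d \<rho> by auto
      have "cmod (f x - z) powr - s \<le> (\<rho> * 2 ^ k) powr - s"
        by (rule powr_mono2') (use k \<rho> assms in \<open>auto simp: field_simps\<close>)
      moreover have "cmod (f x - z) < \<rho> * 2 ^ Suc k"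
        using k \<rho> by (simp add: field_simps)
      ultimately show "\<exists>k. ennreal (cmod (f x - z) powr - s) * indicator {x. \<rho> \<le> cmod (f x - z)} x
            \<le> ennreal ((\<rho> * 2 ^ k) powr - s) \<and> cmod (f x - z) < \<rho> * 2 ^ Suc k"
        using d by (intro exI[of _ k]) (auto intro: ennreal_leI)
    next
      fix k
      have h: "(2 :: real) ^ k = 2 powr (real k)" by (simp add: powr_realpow)
      have "(\<rho> * 2 ^ k) powr - s * (C * (\<rho> * 2 ^ Suc k) powr \<beta>)
          = 2 powr \<beta> * C * ((\<rho> * 2 ^ k) powr - s * (\<rho> * 2 ^ k) powr \<beta>)"
        using \<rho> powr_mult[of 2 "\<rho> * 2 ^ k" \<beta>] by (simp add: mult_ac del: powr_mult)
      also have "(\<rho> * 2 ^ k) powr - s * (\<rho> * 2 ^ k) powr \<beta> = (\<rho> * 2 ^ k) powr (\<beta> - s)"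
        by (simp add: powr_add[symmetric])
      also have "\<dots> = \<rho> powr (\<beta> - s) * t ^ k"
        unfolding h t_def using \<rho> by (simp add: powr_mult powr_powr powr_realpow[symmetric] mult.commute)
      finally show "(\<rho> * 2 ^ k) powr - s * (C * (\<rho> * 2 ^ Suc k) powr \<beta>)
          \<le> 2 powr \<beta> * C * \<rho> powr (\<beta> - s) * t ^ k" by (simp only: mult.assoc order_refl)
    qed (use \<rho> t C_nonneg in auto)
    then show ?thesis by (simp add: K_def)
  qed
  then show ?thesis using K by blast
qed

text \<open>Within distance 1 of \<open>z\<close> the near estimate applies; beyond it the integrand
  is at most 1 and the total mass is finite.\<close>

lemma potential_finite:
  assumes "0 \<le> r" "r < \<beta>"
  shows "\<exists>K\<ge>0. \<forall>z. (\<integral>\<^sup>+ x. ennreal (cmod (1 / (z - f x)) powr r) \<partial>M) \<le> ennreal K"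
proof -
  obtain K where K: "0 \<le> K" "\<And>z \<rho>. 0 < \<rho> \<Longrightarrow>
    (\<integral>\<^sup>+ x. ennreal (cmod (f x - z) powr - r) * indicator {x. cmod (f x - z) < \<rho>} x \<partial>M) \<le> ennreal (K * \<rho> powr (\<beta> - r))"
    using potential_near[OF assms] by blast
  define m where "m = measure M (space M)"
  have m: "emeasure M (space M) = ennreal m" "0 \<le> m"
    unfolding m_def using finite_space by (auto simp: emeasure_eq_ennreal_measure)
  have "(\<integral>\<^sup>+ x. ennreal (cmod (1 / (z - f x)) powr r) \<partial>M) \<le> ennreal (K + m)" for z
  proof -
    have "(\<integral>\<^sup>+ x. ennreal (cmod (1 / (z - f x)) powr r) \<partial>M) \<le>
      (\<integral>\<^sup>+ x. ennreal (cmod (f x - z) powr - r) * indicator {x. cmod (f x - z) < 1} x + 1 \<partial>M)"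
    proof (rule nn_integral_mono)
      fix x
      have e: "cmod (1 / (z - f x)) powr r = cmod (f x - z) powr - r"
        by (simp only: norm_inverse_powr norm_minus_commute)
      show "ennreal (cmod (1 / (z - f x)) powr r) \<le>
          ennreal (cmod (f x - z) powr - r) * indicator {x. cmod (f x - z) < 1} x + 1"
      proof (cases "cmod (f x - z) < 1")
        case True
        then show ?thesis unfolding e by simp
      next
        case False
        then have "cmod (f x - z) powr - r \<le> 1 powr - r"
          by (intro powr_mono2') (use assms in auto)
        then show ?thesis unfolding e using False by simp
      qed
    qed
    also have "\<dots> = (\<integral>\<^sup>+ x. ennreal (cmod (f x - z) powr - r) * indicator {x. cmod (f x - z) < 1} x \<partial>M) + emeasure M (space M)"
      by (subst nn_integral_add) auto
    also have "\<dots> \<le> ennreal (K * 1 powr (\<beta> - r)) + ennreal m"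
      unfolding m by (intro add_mono K) auto
    also have "\<dots> = ennreal (K + m)" using K(1) m(2) by (simp add: ennreal_plus)
    finally show ?thesis .
  qed
  then show ?thesis using K(1) m(2) by (intro exI[of _ "K + m"]) auto
qed

text \<open>With h = |z - z'|, split where |f x - z| = 2 h. On the near part both kernels are
  estimated separately, each on a disc of radius 3 h. On the far part 1 / (z - f) - 1 / (z' - f) =
  (z' - z) / ((z - f) (z' - f)) gains a factor h and decays quadratically, which is integrable to
  the power r because \<beta> < 2 r.\<close>

lemma potential_diff:
  assumes "0 \<le> r" "r < \<beta>" "\<beta> < 2 * r"
  shows "\<exists>K\<ge>0. \<forall>z z'. z \<noteq> z' \<longrightarrow>
    (\<integral>\<^sup>+ x. ennreal (cmod (1 / (z - f x) - 1 / (z' - f x)) powr r) \<partial>M) \<le> ennreal (K * cmod (z - z') powr (\<beta> - r))"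
proof -
  obtain K1 where K1: "0 \<le> K1" "\<And>z \<rho>. 0 < \<rho> \<Longrightarrow>
    (\<integral>\<^sup>+ x. ennreal (cmod (f x - z) powr - r) * indicator {x. cmod (f x - z) < \<rho>} x \<partial>M) \<le> ennreal (K1 * \<rho> powr (\<beta> - r))"
    using potential_near[OF assms(1,2)] by blast
  obtain K2 where K2: "0 \<le> K2" "\<And>z \<rho>. 0 < \<rho> \<Longrightarrow>
    (\<integral>\<^sup>+ x. ennreal (cmod (f x - z) powr - (2 * r)) * indicator {x. \<rho> \<le> cmod (f x - z)} x \<partial>M) \<le> ennreal (K2 * \<rho> powr (\<beta> - 2 * r))"
    using potential_far[of "2 * r"] assms by auto
  define K where "K = 2 powr r * (K1 * 3 powr (\<beta> - r)) + 2 powr r * (K1 * 3 powr (\<beta> - r)) + 2 powr r * K2"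
  have "(\<integral>\<^sup>+ x. ennreal (cmod (1 / (z - f x) - 1 / (z' - f x)) powr r) \<partial>M) \<le> ennreal (K * cmod (z - z') powr (\<beta> - r))"
    if ne: "z \<noteq> z'" for z z'
  proof -
    define h where "h = cmod (z - z')"
    have h: "0 < h" using ne by (simp add: h_def)
    let ?N = "\<lambda>z x. ennreal (cmod (f x - z) powr - r) * indicator {x. cmod (f x - z) < 3 * h} x"
    let ?F = "\<lambda>x. ennreal (cmod (f x - z) powr - (2 * r)) * indicator {x. h \<le> cmod (f x - z)} x"
    have "(\<integral>\<^sup>+ x. ennreal (cmod (1 / (z - f x) - 1 / (z' - f x)) powr r) \<partial>M) \<le>
      (\<integral>\<^sup>+ x. ennreal (2 powr r) * ?N z x + ennreal (2 powr r) * ?N z' x + ennreal (2 powr r * h powr r) * ?F x \<partial>M)"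
    proof (rule nn_integral_mono)
      fix x
      define d where "d = cmod (f x - z)"
      define d' where "d' = cmod (f x - z')"
      have tri: "d' \<le> d + h" "d \<le> d' + h"
        unfolding d_def d'_def h_def
        using norm_triangle_ineq[of "f x - z" "z - z'"] norm_triangle_ineq[of "f x - z'" "z' - z"]
        by (simp_all add: norm_minus_commute)
      have e: "cmod (1 / (z - f x)) powr r = d powr - r" "cmod (1 / (z' - f x)) powr r = d' powr - r"
        unfolding d_def d'_def by (simp_all only: norm_inverse_powr norm_minus_commute)
      show "ennreal (cmod (1 / (z - f x) - 1 / (z' - f x)) powr r) \<le>
        ennreal (2 powr r) * ?N z x + ennreal (2 powr r) * ?N z' x + ennreal (2 powr r * h powr r) * ?F x"
      proof (cases "d < 2 * h")
        case True
        have "cmod (1 / (z - f x) - 1 / (z' - f x)) powr r \<le> (cmod (1 / (z - f x)) + cmod (1 / (z' - f x))) powr r"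
          by (intro powr_mono2 norm_triangle_ineq4) (use assms in auto)
        also have "\<dots> \<le> 2 powr r * (cmod (1 / (z - f x)) powr r + cmod (1 / (z' - f x)) powr r)"
          by (rule powr_add_le) (use assms in auto)
        finally have "cmod (1 / (z - f x) - 1 / (z' - f x)) powr r \<le> 2 powr r * d powr - r + 2 powr r * d' powr - r"
          unfolding e by (simp add: algebra_simps)
        then have "ennreal (cmod (1 / (z - f x) - 1 / (z' - f x)) powr r) \<le>
            ennreal (2 powr r) * ennreal (d powr - r) + ennreal (2 powr r) * ennreal (d' powr - r)"
          by (simp add: ennreal_mult[symmetric] ennreal_plus[symmetric] ennreal_leI del: ennreal_plus)
        also have "\<dots> = ennreal (2 powr r) * ?N z x + ennreal (2 powr r) * ?N z' x"
          using True tri h by (simp add: d_def d'_def)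
        finally show ?thesis by (simp add: add_increasing2)
      next
        case False
        then have d: "h \<le> d" "0 < d" "d / 2 \<le> d'" "0 < d'" using h tri by auto
        then have nz: "z - f x \<noteq> 0" "z' - f x \<noteq> 0" by (auto simp: d_def d'_def)
        have "cmod (1 / (z - f x) - 1 / (z' - f x)) = cmod ((z' - z) / ((z - f x) * (z' - f x)))"
          using nz by (simp add: field_simps)
        also have "\<dots> = h / (d * d')"
          by (simp add: norm_divide norm_mult h_def d_def d'_def norm_minus_commute)
        also have "\<dots> \<le> h / (d * (d / 2))"
          using d h by (intro divide_left_mono mult_left_mono mult_pos_pos) auto
        also have "\<dots> = 2 * h * d powr - 2"
          using d by (simp add: powr_minus powr_numeral power2_eq_square field_simps)
        finally have "cmod (1 / (z - f x) - 1 / (z' - f x)) powr r \<le> (2 * h * d powr - 2) powr r"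
          by (intro powr_mono2) (use assms in auto)
        also have "\<dots> = 2 powr r * h powr r * d powr - (2 * r)"
          using h d by (simp add: powr_mult powr_powr)
        finally have "ennreal (cmod (1 / (z - f x) - 1 / (z' - f x)) powr r) \<le> ennreal (2 powr r * h powr r) * ennreal (d powr - (2 * r))"
          by (simp add: ennreal_mult[symmetric] ennreal_leI)
        also have "\<dots> = ennreal (2 powr r * h powr r) * ?F x"
          using d by (simp add: d_def)
        finally show ?thesis by (simp add: add_increasing)
      qed
    qed
    also have "\<dots> = ennreal (2 powr r) * (\<integral>\<^sup>+ x. ?N z x \<partial>M) + ennreal (2 powr r) * (\<integral>\<^sup>+ x. ?N z' x \<partial>M)
        + ennreal (2 powr r * h powr r) * (\<integral>\<^sup>+ x. ?F x \<partial>M)"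
      by (simp add: nn_integral_add nn_integral_cmult)
    also have "\<dots> \<le> ennreal (2 powr r) * ennreal (K1 * (3 * h) powr (\<beta> - r)) + ennreal (2 powr r) * ennreal (K1 * (3 * h) powr (\<beta> - r))
        + ennreal (2 powr r * h powr r) * ennreal (K2 * h powr (\<beta> - 2 * r))"
      by (intro add_mono mult_left_mono K1 K2) (use h in auto)
    also have "\<dots> = ennreal (2 powr r * (K1 * (3 * h) powr (\<beta> - r)) + 2 powr r * (K1 * (3 * h) powr (\<beta> - r)) + 2 powr r * h powr r * (K2 * h powr (\<beta> - 2 * r)))"
      using K1(1) K2(1) by (simp add: ennreal_mult[symmetric] ennreal_plus[symmetric] del: ennreal_plus)
    also have "2 powr r * (K1 * (3 * h) powr (\<beta> - r)) + 2 powr r * (K1 * (3 * h) powr (\<beta> - r)) + 2 powr r * h powr r * (K2 * h powr (\<beta> - 2 * r)) = K * h powr (\<beta> - r)"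
    proof -
      have "h powr r * h powr (\<beta> - 2 * r) = h powr (\<beta> - r)"
        by (simp add: powr_add[symmetric])
      then have "2 powr r * h powr r * (K2 * h powr (\<beta> - 2 * r)) = 2 powr r * K2 * h powr (\<beta> - r)"
        by (metis mult.assoc mult.left_commute)
      then show ?thesis using h by (simp add: K_def powr_mult algebra_simps)
    qed
    finally show ?thesis unfolding h_def .
  qed
  moreover have "0 \<le> K" using K1(1) K2(1) by (simp add: K_def)
  ultimately show ?thesis by blast
qed

lemma cauchy_potential:
  assumes r: "1 < r" "1 < q" "1 / r + 1 / q = 1" "r < \<beta>" "\<beta> < 2 * r"
    and g [measurable]: "g \<in> borel_measurable M"
    and gq: "integrable M (\<lambda>x. cmod (g x) powr q)"
  shows "\<And>z. integrable M (\<lambda>x. g x / (z - f x))"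
    and "\<exists>K\<ge>0. \<forall>z z'. cmod ((LINT x|M. g x / (z - f x)) - (LINT x|M. g x / (z' - f x))) \<le> K * cmod (z - z') powr ((\<beta> - r) / r)"
proof -
  define G where "G = (LINT x|M. cmod (g x) powr q)"
  have G: "(\<integral>\<^sup>+ x. ennreal (cmod (g x) powr q) \<partial>M) = ennreal G" "0 \<le> G"
    unfolding G_def using gq by (auto intro!: nn_integral_eq_integral)
  obtain K0 where K0: "\<And>z. (\<integral>\<^sup>+ x. ennreal (cmod (1 / (z - f x)) powr r) \<partial>M) \<le> ennreal K0"
    using potential_finite[of r] r by auto
  obtain K1 where K1: "0 \<le> K1" "\<And>z z'. z \<noteq> z' \<Longrightarrow>
    (\<integral>\<^sup>+ x. ennreal (cmod (1 / (z - f x) - 1 / (z' - f x)) powr r) \<partial>M) \<le> ennreal (K1 * cmod (z - z') powr (\<beta> - r))"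
    using potential_diff[of r] r by auto
  show int: "integrable M (\<lambda>x. g x / (z - f x))" for z
  proof (rule integrableI_bounded)
    have "(\<integral>\<^sup>+ x. ennreal (cmod (g x / (z - f x))) \<partial>M) \<le>
      (\<integral>\<^sup>+ x. ennreal (cmod (1 / (z - f x)) powr r) + ennreal (cmod (g x) powr q) \<partial>M)"
    proof (rule nn_integral_mono)
      fix x
      have "cmod (g x / (z - f x)) = cmod (1 / (z - f x)) * cmod (g x)"
        by (simp add: norm_divide)
      also have "\<dots> \<le> cmod (1 / (z - f x)) powr r / r + cmod (g x) powr q / q"
        by (rule Youngs_inequality) (use r in auto)
      also have "\<dots> \<le> cmod (1 / (z - f x)) powr r / 1 + cmod (g x) powr q / 1"
        by (intro add_mono divide_left_mono) (use r in auto)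
      finally show "ennreal (cmod (g x / (z - f x))) \<le> ennreal (cmod (1 / (z - f x)) powr r) + ennreal (cmod (g x) powr q)"
        by (simp add: ennreal_plus[symmetric] ennreal_leI del: ennreal_plus)
    qed
    also have "\<dots> = (\<integral>\<^sup>+ x. ennreal (cmod (1 / (z - f x)) powr r) \<partial>M) + ennreal G"
      by (subst nn_integral_add) (auto simp: G)
    also have "\<dots> \<le> ennreal K0 + ennreal G" by (intro add_mono K0) auto
    also have "\<dots> < \<infinity>" by simp
    finally show "(\<integral>\<^sup>+ x. ennreal (norm (g x / (z - f x))) \<partial>M) < \<infinity>" .
  qed measurable
  define K where "K = K1 / r + G / q"
  have "cmod ((LINT x|M. g x / (z - f x)) - (LINT x|M. g x / (z' - f x))) \<le> K * cmod (z - z') powr ((\<beta> - r) / r)" for z z'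
  proof (cases "z = z'")
    case False
    \<comment> \<open>The size of the kernel difference in L^r. Dividing by it before applying
      Young's inequality yields what Hoelder's inequality would, up to the constant.\<close>
    define h where "h = cmod (z - z') powr ((\<beta> - r) / r)"
    have h: "0 < h" using False by (simp add: h_def)
    have hr: "h powr r = cmod (z - z') powr (\<beta> - r)" unfolding h_def using r by (simp add: powr_powr)
    let ?D = "\<lambda>x. cmod (1 / (z - f x) - 1 / (z' - f x))"
    have "(LINT x|M. g x / (z - f x)) - (LINT x|M. g x / (z' - f x)) = (LINT x|M. g x / (z - f x) - g x / (z' - f x))"
      by (rule Bochner_Integration.integral_diff[symmetric]; rule int)
    then have "ennreal (cmod ((LINT x|M. g x / (z - f x)) - (LINT x|M. g x / (z' - f x)))) \<le>
        (\<integral>\<^sup>+ x. ennreal (cmod (g x / (z - f x) - g x / (z' - f x))) \<partial>M)"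
      using integral_norm_bound_ennreal[OF Bochner_Integration.integrable_diff[OF int int], of z z'] by simp
    also have "\<dots> \<le> (\<integral>\<^sup>+ x. ennreal (h / (h powr r * r)) * ennreal (?D x powr r) + ennreal (h / q) * ennreal (cmod (g x) powr q) \<partial>M)"
    proof (rule nn_integral_mono)
      fix x
      have "cmod (g x / (z - f x) - g x / (z' - f x)) = cmod (g x * (1 / (z - f x) - 1 / (z' - f x)))"
        by (simp add: algebra_simps)
      also have "\<dots> = h * ((?D x / h) * cmod (g x))"
        unfolding norm_mult using h by simp
      also have "\<dots> \<le> h * ((?D x / h) powr r / r + cmod (g x) powr q / q)"
        by (intro mult_left_mono Youngs_inequality) (use r h in auto)
      also have "\<dots> = h / (h powr r * r) * ?D x powr r + h / q * cmod (g x) powr q"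
        using h by (simp add: powr_divide field_simps)
      finally show "ennreal (cmod (g x / (z - f x) - g x / (z' - f x))) \<le>
         ennreal (h / (h powr r * r)) * ennreal (?D x powr r) + ennreal (h / q) * ennreal (cmod (g x) powr q)"
        using h r by (simp add: ennreal_mult[symmetric] ennreal_plus[symmetric] ennreal_leI del: ennreal_plus)
    qed
    also have "\<dots> = ennreal (h / (h powr r * r)) * (\<integral>\<^sup>+ x. ennreal (?D x powr r) \<partial>M) + ennreal (h / q) * ennreal G"
      by (simp add: nn_integral_add nn_integral_cmult G(1))
    also have "\<dots> \<le> ennreal (h / (h powr r * r)) * ennreal (K1 * h powr r) + ennreal (h / q) * ennreal G"
      unfolding hr by (intro add_mono mult_left_mono K1 False) auto
    also have "\<dots> = ennreal (h / (h powr r * r) * (K1 * h powr r) + h / q * G)"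
      using h r K1(1) G(2) by (simp add: ennreal_mult[symmetric] ennreal_plus[symmetric] del: ennreal_plus)
    also have "h / (h powr r * r) * (K1 * h powr r) + h / q * G = K * h"
      using h r by (simp add: K_def field_simps)
    finally show ?thesis
      using K1(1) G(2) r h by (simp add: h_def K_def)
  qed simp
  moreover have "0 \<le> K" using K1(1) G(2) r by (simp add: K_def)
  ultimately show "\<exists>K\<ge>0. \<forall>z z'. cmod ((LINT x|M. g x / (z - f x)) - (LINT x|M. g x / (z' - f x))) \<le> K * cmod (z - z') powr ((\<beta> - r) / r)"
    by blast
qed

end

section \<open>The primitive of a closed form\<close>

lemma has_derivative_dx_dy:
  fixes f :: "real \<times> real \<Rightarrow> 'a::real_normed_vector"
  assumes "f differentiable (at p)"
  shows "(f has_derivative (\<lambda>h. fst h *\<^sub>R dx f p + snd h *\<^sub>R dy f p)) (at p)"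
proof -
  have d: "(f has_derivative frechet_derivative f (at p)) (at p)"
    using assms by (simp add: frechet_derivative_works)
  then have lin: "linear (frechet_derivative f (at p))"
    by (rule has_derivative_linear)
  have "frechet_derivative f (at p) h = fst h *\<^sub>R dx f p + snd h *\<^sub>R dy f p" for h
  proof -
    have "h = fst h *\<^sub>R (1, 0) + snd h *\<^sub>R (0, 1)" by (simp add: prod_eq_iff)
    then have "frechet_derivative f (at p) h = frechet_derivative f (at p) (fst h *\<^sub>R (1, 0) + snd h *\<^sub>R (0, 1))"
      by simp
    also have "\<dots> = fst h *\<^sub>R dx f p + snd h *\<^sub>R dy f p"
      by (simp add: linear_add[OF lin] linear_cmul[OF lin] dx_def dy_def del: scaleR_Pair)
    finally show ?thesis .
  qed
  then have "frechet_derivative f (at p) = (\<lambda>h. fst h *\<^sub>R dx f p + snd h *\<^sub>R dy f p)" by blast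
  then show ?thesis using d by simp
qed

lemma dx_dy_eqI:
  assumes "(f has_derivative D) (at p)"
  shows "dx f p = D (1, 0)" "dy f p = D (0, 1)"
  using frechet_derivative_at[OF assms] by (simp_all add: dx_def dy_def)

lemma C1_on_subset: "C1_on U f \<Longrightarrow> V \<subseteq> U \<Longrightarrow> C1_on V f"
  unfolding C1_on_def by (meson continuous_on_subset subsetD)

lemma C1_on_has_derivative:
  assumes "C1_on U f" "p \<in> U"
  shows "(f has_derivative (\<lambda>h. fst h *\<^sub>R dx f p + snd h *\<^sub>R dy f p)) (at p)"
  using assms by (intro has_derivative_dx_dy) (auto simp: C1_on_def)

lemma C1_on_imp_continuous_on:
  assumes "C1_on U f"
  shows "continuous_on U f"
  using assms unfolding C1_on_def
  by (intro differentiable_imp_continuous_on) (auto simp: differentiable_on_def intro: differentiable_at_withinI)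

text \<open>The segment from the origin and closedness turn the derivative of the integral into the
  integral of a derivative along the segment.\<close>

lemma segment_integral_has_derivative:
  fixes A B :: "real \<times> real \<Rightarrow> complex"
  assumes A: "C1_on UNIV A" and B: "C1_on UNIV B" and closed: "\<And>p. dx B p = dy A p"
  shows "((\<lambda>p. integral {0..1} (\<lambda>t. A (t *\<^sub>R p) * of_real (fst p) + B (t *\<^sub>R p) * of_real (snd p)))
     has_derivative (\<lambda>h. of_real (fst h) * A p + of_real (snd h) * B p)) (at p)"
proof -
  \<comment> \<open>\<open>E F p t\<close> is the derivative in t of t F (t p). Closedness brings
    the derivative of the integrand into this form, and the integral over [0, 1] is then F
    p.\<close>
  define E where "E = (\<lambda>F p t. F (t *\<^sub>R p) + t *\<^sub>R (fst p *\<^sub>R dx F (t *\<^sub>R p) + snd p *\<^sub>R dy F (t *\<^sub>R p)) :: complex)"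
  define g where "g = (\<lambda>p t. A (t *\<^sub>R p) * of_real (fst p) + B (t *\<^sub>R p) * of_real (snd p))"
  define L where "L = (\<lambda>p t. Blinfun (\<lambda>h. of_real (fst h) * E A p t + of_real (snd h) * E B p t))"
  have bl: "bounded_linear (\<lambda>h::real \<times> real. of_real (fst h) * x + of_real (snd h) * y :: complex)" for x y
    using bounded_linear_add[OF bounded_linear_scaleR_left[THEN bounded_linear_compose, OF bounded_linear_fst, of x]
        bounded_linear_scaleR_left[THEN bounded_linear_compose, OF bounded_linear_snd, of y]]
    by (simp add: scaleR_conv_of_real)
  have L: "blinfun_apply (L p t) h = of_real (fst h) * E A p t + of_real (snd h) * E B p t" for p t h
    unfolding L_def by (simp add: bounded_linear_Blinfun_apply[OF bl])
  have cA: "continuous_on UNIV A" "continuous_on UNIV (dx A)" "continuous_on UNIV (dy A)"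
    and cB: "continuous_on UNIV B" "continuous_on UNIV (dx B)" "continuous_on UNIV (dy B)"
    using C1_on_imp_continuous_on[OF A] C1_on_imp_continuous_on[OF B] A B unfolding C1_on_def by blast+
  have cE: "continuous_on X (\<lambda>(p, t). E F p t)" if "continuous_on UNIV F" "continuous_on UNIV (dx F)" "continuous_on UNIV (dy F)" for F X
    unfolding E_def split_beta
    by (intro continuous_intros continuous_on_compose2[OF that(1)] continuous_on_compose2[OF that(2)]
        continuous_on_compose2[OF that(3)]) auto
  have EF: "((\<lambda>t. t *\<^sub>R F (t *\<^sub>R p)) has_vector_derivative E F p t) (at t within S)" if "C1_on UNIV F" for F p t S
  proof -
    have 1: "((\<lambda>t. t *\<^sub>R p) has_vector_derivative p) (at t within S)"
      by (auto intro!: derivative_eq_intros simp: has_vector_derivative_def)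
    have "((F \<circ> (\<lambda>t. t *\<^sub>R p)) has_vector_derivative (fst p *\<^sub>R dx F (t *\<^sub>R p) + snd p *\<^sub>R dy F (t *\<^sub>R p))) (at t within S)"
      by (rule vector_derivative_diff_chain_within[OF 1 has_derivative_at_withinI])
         (rule C1_on_has_derivative[OF that UNIV_I])
    from has_vector_derivative_scaleR[OF DERIV_ident this]
    show ?thesis by (simp add: o_def E_def add.commute)
  qed
  have "((\<lambda>p. integral (cbox 0 1) (g p)) has_derivative integral (cbox 0 1) (L p)) (at p within UNIV)"
  proof (rule leibniz_rule)
    show "continuous_on (UNIV \<times> cbox 0 1) (\<lambda>(p, t). L p t)"
    proof (rule continuous_on_blinfun_componentwise)
      fix i :: "real \<times> real"
      show "continuous_on (UNIV \<times> cbox 0 1) (\<lambda>x. blinfun_apply (case x of (p, t) \<Rightarrow> L p t) i)"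
        using cE[OF cA, of "UNIV \<times> cbox 0 1"] cE[OF cB, of "UNIV \<times> cbox 0 1"]
        by (simp add: split_beta L) (intro continuous_intros; simp add: split_beta)
    qed
    show "g p integrable_on cbox 0 1" for p
      unfolding g_def
      by (intro integrable_continuous continuous_intros continuous_on_compose2[OF cA(1)] continuous_on_compose2[OF cB(1)]) auto
    fix p :: "real \<times> real" and t :: real
    have dF: "((\<lambda>p. F (t *\<^sub>R p)) has_derivative (\<lambda>h. (t * fst h) *\<^sub>R dx F (t *\<^sub>R p) + (t * snd h) *\<^sub>R dy F (t *\<^sub>R p))) (at p)"
      if "C1_on UNIV F" for F :: "real \<times> real \<Rightarrow> complex"
    proof -
      have "((\<lambda>p. t *\<^sub>R p) has_derivative (\<lambda>h. t *\<^sub>R h)) (at p)"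
        by (auto intro!: derivative_eq_intros)
      from diff_chain_at[OF this C1_on_has_derivative[OF that UNIV_I]]
      show ?thesis by (simp add: o_def)
    qed
    show "((\<lambda>p. g p t) has_derivative blinfun_apply (L p t)) (at p within UNIV)"
      unfolding g_def
      by (rule has_derivative_eq_rhs)
         (auto intro!: derivative_eq_intros dF[OF A] dF[OF B] ext
           simp: L E_def closed scaleR_conv_of_real algebra_simps)
  qed auto
  moreover have "blinfun_apply (integral (cbox 0 1) (L p)) h = of_real (fst h) * A p + of_real (snd h) * B p" for h
  proof -
    have Lint: "L p integrable_on cbox 0 1"
    proof (intro integrable_continuous continuous_on_blinfun_componentwise)
      fix i :: "real \<times> real"
      have "continuous_on ({p} \<times> cbox 0 1) (\<lambda>(p, t). blinfun_apply (L p t) i)"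
        using cE[OF cA, of "{p} \<times> cbox 0 1"] cE[OF cB, of "{p} \<times> cbox 0 1"]
        by (simp add: split_beta L) (intro continuous_intros; simp add: split_beta)
      from continuous_on_compose2[OF this, of "cbox 0 1" "\<lambda>t. (p, t)", OF continuous_on_Pair[OF continuous_on_const continuous_on_id]]
      show "continuous_on (cbox 0 1) (\<lambda>t. blinfun_apply (L p t) i)"
        by auto
    qed
    have I: "(E F p has_integral F p) {0..1}" if "C1_on UNIV F" for F
      using fundamental_theorem_of_calculus[OF _ EF[OF that], of 0 1 p] by simp
    have "((\<lambda>t. of_real (fst h) * E A p t + of_real (snd h) * E B p t) has_integral
        of_real (fst h) * A p + of_real (snd h) * B p) {0..1}"
      by (intro has_integral_add has_integral_mult_right I A B)
    then have "integral {0..1} (\<lambda>t. blinfun_apply (L p t) h) = of_real (fst h) * A p + of_real (snd h) * B p"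
      unfolding L by (rule integral_unique)
    then show ?thesis
      using blinfun_apply_integral[OF Lint, of h] by simp
  qed
  ultimately show ?thesis
    unfolding g_def by (auto elim!: has_derivative_eq_rhs)
qed

lemma primitive_has_derivative:
  assumes "C1_on UNIV (lift_torus a)" "C1_on UNIV (lift_torus b)" "closed_form a b"
  shows "(primitive a b has_derivative (\<lambda>h. of_real (fst h) * lift_torus a p + of_real (snd h) * lift_torus b p)) (at p)"
proof -
  have "primitive a b = (\<lambda>p. integral {0..1} (\<lambda>t. lift_torus a (t *\<^sub>R p) * of_real (fst p) + lift_torus b (t *\<^sub>R p) * of_real (snd p)))"
  proof
    fix p :: "real \<times> real"
    have "linepath (0, 0) p t = t *\<^sub>R p" for t
      by (simp add: linepath_def zero_prod_def[symmetric])
    moreover have "vector_derivative (linepath (0, 0) p) (at t within {0..1}) = p" if "t \<in> {0..1}" for t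
      using vector_derivative_linepath_within[of t "(0, 0)" p] that by (simp add: zero_prod_def[symmetric])
    ultimately show "primitive a b p = integral {0..1} (\<lambda>t. lift_torus a (t *\<^sub>R p) * of_real (fst p) + lift_torus b (t *\<^sub>R p) * of_real (snd p))"
      unfolding primitive_def line_integral_def by (intro integral_cong) simp
  qed
  then show ?thesis
    using segment_integral_has_derivative[OF assms(1,2), of p] assms(3) unfolding closed_form_def by metis
qed

text \<open>After subtraction of the derivative at \<open>p0\<close>, what remains has on a small
  ball a Lipschitz constant of at most half the lower bound of the injective linear part.\<close>

lemma local_lower_lipschitz:
  fixes f fx fy :: "real \<times> real \<Rightarrow> 'b::euclidean_space"
  assumes "open U" "p0 \<in> U"
    and der: "\<And>p. p \<in> U \<Longrightarrow> (f has_derivative (\<lambda>h. fst h *\<^sub>R fx p + snd h *\<^sub>R fy p)) (at p)"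
    and cont: "continuous_on U fx" "continuous_on U fy"
    and inj: "inj (\<lambda>h. fst h *\<^sub>R fx p0 + snd h *\<^sub>R fy p0)"
  obtains \<rho> c where "0 < \<rho>" "0 < c" "ball p0 \<rho> \<subseteq> U"
    "\<And>p p'. p \<in> ball p0 \<rho> \<Longrightarrow> p' \<in> ball p0 \<rho> \<Longrightarrow> c * norm (p - p') \<le> norm (f p - f p')"
proof -
  define L where "L = (\<lambda>h. fst h *\<^sub>R fx p0 + snd h *\<^sub>R fy p0)"
  have blL: "bounded_linear L"
    unfolding L_def using der[OF assms(2)] by (rule has_derivative_bounded_linear)
  then have linL: "linear L" by (rule bounded_linear.linear)
  obtain B where B: "B > 0" "\<And>h. B * norm h \<le> norm (L h)"
    using linear_inj_bounded_below_pos[OF linL] inj unfolding L_def by blast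
  have n: "(fx \<longlongrightarrow> fx p0) (nhds p0)" "(fy \<longlongrightarrow> fy p0) (nhds p0)"
    using cont assms(1,2) by (auto simp: continuous_on_eq_continuous_at isCont_def tendsto_at_iff_tendsto_nhds)
  have "\<forall>\<^sub>F p in nhds p0. dist (fx p) (fx p0) < B / 4" "\<forall>\<^sub>F p in nhds p0. dist (fy p) (fy p0) < B / 4"
    by (rule tendstoD[OF n(1)] tendstoD[OF n(2)], use B(1) in simp)+
  moreover have "\<forall>\<^sub>F p in nhds p0. p \<in> U"
    using assms(1,2) by (rule eventually_nhds_in_open)
  ultimately have "\<forall>\<^sub>F p in nhds p0. p \<in> U \<and> dist (fx p) (fx p0) < B / 4 \<and> dist (fy p) (fy p0) < B / 4"
    by eventually_elim auto
  then obtain \<rho> where \<rho>: "\<rho> > 0" "\<And>p. dist p p0 < \<rho> \<Longrightarrow> p \<in> U \<and> dist (fx p) (fx p0) < B / 4 \<and> dist (fy p) (fy p0) < B / 4"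
    unfolding eventually_nhds_metric by blast
  have sub: "ball p0 \<rho> \<subseteq> U" using \<rho>(2) by (auto simp: dist_commute)
  have "B / 2 * norm (p - p') \<le> norm (f p - f p')" if p: "p \<in> ball p0 \<rho>" "p' \<in> ball p0 \<rho>" for p p'
  proof -
    define F where "F = (\<lambda>p. f p - L p)"
    have "norm (F p - F p') \<le> B / 2 * norm (p - p')"
    proof (rule differentiable_bound[OF convex_ball _ _ p])
      fix x assume x: "x \<in> ball p0 \<rho>"
      show "(F has_derivative (\<lambda>h. (fst h *\<^sub>R fx x + snd h *\<^sub>R fy x) - L h)) (at x within ball p0 \<rho>)"
        unfolding F_def using x sub
        by (intro has_derivative_diff has_derivative_at_withinI[OF der] bounded_linear_imp_has_derivative blL) auto
      show "onorm (\<lambda>h. (fst h *\<^sub>R fx x + snd h *\<^sub>R fy x) - L h) \<le> B / 2"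
      proof (rule onorm_bound)
        fix h :: "real \<times> real"
        have "fst h *\<^sub>R fx x + snd h *\<^sub>R fy x - L h = fst h *\<^sub>R (fx x - fx p0) + snd h *\<^sub>R (fy x - fy p0)"
          by (simp add: L_def algebra_simps)
        also have "norm \<dots> \<le> norm (fst h *\<^sub>R (fx x - fx p0)) + norm (snd h *\<^sub>R (fy x - fy p0))"
          by (rule norm_triangle_ineq)
        also have "\<dots> \<le> norm h * (B / 4) + norm h * (B / 4)"
          unfolding norm_scaleR
          using \<rho>(2)[of x] x norm_fst_le[of "fst h" "snd h"] norm_snd_le[of "snd h" "fst h"]
          by (intro add_mono mult_mono) (auto simp: dist_norm dist_commute norm_minus_commute less_imp_le)
        finally show "norm (fst h *\<^sub>R fx x + snd h *\<^sub>R fy x - L h) \<le> B / 2 * norm h" by simp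
      qed (use B in auto)
    qed
    moreover have "f p - f p' = (F p - F p') + L (p - p')"
      by (simp add: F_def linear_diff[OF linL])
    then have "norm (L (p - p')) \<le> norm (f p - f p') + norm (F p - F p')"
      by (metis add_diff_cancel_left' norm_triangle_ineq4)
    ultimately show ?thesis using B(2)[of "p - p'"] by (simp add: field_simps)
  qed
  then show thesis using that[of \<rho> "B / 2"] \<rho>(1) B(1) sub by auto
qed

text \<open>Cut the longer side into pieces of length \<open>\<delta>\<close>: the preimage of each small square has diameter
  at most \<open>2 C \<delta>\<close>.\<close>

lemma rectangle_preimage_measure:
  fixes X :: "(real \<times> real) set" and u w :: "real \<times> real \<Rightarrow> real"
  assumes lip: "\<And>p p'. p \<in> X \<Longrightarrow> p' \<in> X \<Longrightarrow> norm (p - p') \<le> C * (\<bar>u p - u p'\<bar> + \<bar>w p - w p'\<bar>)"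
    and u: "\<And>p. p \<in> X \<Longrightarrow> a \<le> u p \<and> u p \<le> a + \<delta>"
    and w: "\<And>p. p \<in> X \<Longrightarrow> b \<le> w p \<and> w p \<le> b + \<eta>"
    and pos: "0 < \<delta>" "\<delta> \<le> \<eta>" "0 \<le> C"
  shows "\<exists>S. S \<in> sets lborel \<and> X \<subseteq> S \<and> emeasure lborel S \<le> ennreal (8 * pi * C\<^sup>2 * (\<delta> * \<eta>))"
proof -
  \<comment> \<open>The pieces are numbered 0 to n, possibly one more than \<eta> / \<delta>;
    because \<delta> \<le> \<eta>, the surplus piece is absorbed by a factor 2.\<close>
  define n where "n = nat \<lfloor>\<eta> / \<delta>\<rfloor>"
  define Y where "Y = (\<lambda>j::nat. {p \<in> X. nat \<lfloor>(w p - b) / \<delta>\<rfloor> = j})"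
  \<comment> \<open>Any point of the piece serves as centre. Covering by balls yields a Borel set
    although \<open>X\<close> is arbitrary.\<close>
  define T where "T = (\<lambda>j. if Y j = {} then {} else cball (SOME p. p \<in> Y j) (2 * C * \<delta>))"
  have n: "real (Suc n) \<le> 2 * (\<eta> / \<delta>)"
  proof -
    have "1 \<le> \<eta> / \<delta>" using pos by simp
    then have "real n \<le> \<eta> / \<delta>" unfolding n_def by linarith
    then show ?thesis using \<open>1 \<le> \<eta> / \<delta>\<close> by simp
  qed
  have YT: "Y j \<subseteq> T j" for j
  proof
    fix p assume p: "p \<in> Y j"
    define x where "x = (SOME p. p \<in> Y j)"
    have x: "x \<in> Y j" unfolding x_def using p by (rule someI)
    have pX: "p \<in> X" "x \<in> X" using p x by (auto simp: Y_def)
    have "nat \<lfloor>(w p - b) / \<delta>\<rfloor> = nat \<lfloor>(w x - b) / \<delta>\<rfloor>" using p x by (auto simp: Y_def)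
    moreover have "0 \<le> (w p - b) / \<delta>" "0 \<le> (w x - b) / \<delta>" using w[OF pX(1)] w[OF pX(2)] pos by auto
    ultimately have "\<bar>(w p - b) / \<delta> - (w x - b) / \<delta>\<bar> \<le> 1" by linarith
    then have "\<bar>w x - w p\<bar> \<le> \<delta>"
      using pos by (simp add: diff_divide_distrib[symmetric] abs_minus_commute)
    moreover have "\<bar>u x - u p\<bar> \<le> \<delta>" using u[OF pX(1)] u[OF pX(2)] by auto
    ultimately have "C * (\<bar>u x - u p\<bar> + \<bar>w x - w p\<bar>) \<le> C * (\<delta> + \<delta>)"
      using pos by (intro mult_left_mono add_mono) auto
    then have "norm (x - p) \<le> 2 * C * \<delta>" using lip[OF pX(2,1)] by simp
    then show "p \<in> T j" using p by (auto simp: T_def x_def[symmetric] dist_norm)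
  qed
  have cover: "X \<subseteq> (\<Union>j\<in>{..n}. T j)"
  proof
    fix p assume p: "p \<in> X"
    have "(w p - b) / \<delta> \<le> \<eta> / \<delta>" using w[OF p] pos by (intro divide_right_mono) auto
    then have "nat \<lfloor>(w p - b) / \<delta>\<rfloor> \<le> n" unfolding n_def by (intro nat_mono floor_mono)
    then show "p \<in> (\<Union>j\<in>{..n}. T j)"
      using YT[of "nat \<lfloor>(w p - b) / \<delta>\<rfloor>"] p by (auto simp: Y_def)
  qed
  have Tm: "T j \<in> sets lborel" for j by (auto simp: T_def)
  have Te: "emeasure lborel (T j) \<le> ennreal (pi * (2 * C * \<delta>)\<^sup>2)" for j
    using pos by (auto simp: T_def emeasure_cball unit_ball_vol_2 power2_eq_square)
  have "emeasure lborel (\<Union>j\<in>{..n}. T j) \<le> (\<Sum>j\<in>{..n}. emeasure lborel (T j))"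
    by (rule emeasure_subadditive_finite) (use Tm in auto)
  also have "\<dots> \<le> (\<Sum>j\<in>{..n}. ennreal (pi * (2 * C * \<delta>)\<^sup>2))"
    by (intro sum_mono Te)
  also have "\<dots> = ennreal (real (Suc n) * (pi * (2 * C * \<delta>)\<^sup>2))"
    by (simp add: ennreal_of_nat_eq_real_of_nat ennreal_mult)
  also have "\<dots> \<le> ennreal (2 * (\<eta> / \<delta>) * (pi * (2 * C * \<delta>)\<^sup>2))"
    by (intro ennreal_leI mult_right_mono n) auto
  also have "2 * (\<eta> / \<delta>) * (pi * (2 * C * \<delta>)\<^sup>2) = 8 * pi * C\<^sup>2 * (\<delta> * \<eta>)"
    using pos by (simp add: power2_eq_square field_simps)
  finally show ?thesis
    using cover Tm by (intro exI[of _ "\<Union>j\<in>{..n}. T j"]) auto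
qed

text \<open>The primitive of |x|^\<kappa> that vanishes at 0, so that s + i
  \<open>odd_power \<kappa> t\<close> is a first integral of ds + i |t|^\<kappa> dt.\<close>

definition odd_power :: "real \<Rightarrow> real \<Rightarrow> real" where
  "odd_power \<kappa> x = x * \<bar>x\<bar> powr \<kappa> / (\<kappa> + 1)"

lemma odd_power_minus: "odd_power \<kappa> (- x) = - odd_power \<kappa> x"
  by (simp add: odd_power_def)

lemma odd_power_nonneg_eq: "0 \<le> x \<Longrightarrow> odd_power \<kappa> x = x powr (\<kappa> + 1) / (\<kappa> + 1)"
  by (cases "x = 0") (simp_all add: odd_power_def powr_add)

lemma odd_power_has_derivative:
  assumes "0 < \<kappa>"
  shows "(odd_power \<kappa> has_real_derivative \<bar>x\<bar> powr \<kappa>) (at x)"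
proof -
  have pos: "(odd_power \<kappa> has_real_derivative y powr \<kappa>) (at y)" if "0 < y" for y
  proof -
    have "((\<lambda>y. y powr (\<kappa> + 1) / (\<kappa> + 1)) has_real_derivative ((\<kappa> + 1) * y powr \<kappa>) / (\<kappa> + 1)) (at y)"
      by (rule DERIV_cdivide) (use has_real_derivative_powr[OF that, of "\<kappa> + 1"] in simp)
    then have "((\<lambda>y. y powr (\<kappa> + 1) / (\<kappa> + 1)) has_real_derivative y powr \<kappa>) (at y)"
      using assms by simp
    then show ?thesis
      by (rule has_field_derivative_transform_within_open[of _ _ _ "{0<..}"])
         (use that in \<open>auto simp: odd_power_nonneg_eq\<close>)
  qed
  consider "0 < x" | "x = 0" | "x < 0" by linarith
  then show ?thesis
  proof cases
    case 1
    then show ?thesis using pos[of x] by simp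
  next
    case 2
    have "(\<lambda>h. \<bar>h\<bar> powr \<kappa> / (\<kappa> + 1)) \<midarrow>0\<rightarrow> \<bar>0\<bar> powr \<kappa> / (\<kappa> + 1)"
      by (intro tendsto_intros tendsto_powr') (use assms in auto)
    moreover have "\<forall>\<^sub>F h in at 0. \<bar>h\<bar> powr \<kappa> / (\<kappa> + 1) = (odd_power \<kappa> (0 + h) - odd_power \<kappa> 0) / h"
      by (auto simp: eventually_at_filter odd_power_def)
    ultimately have "(\<lambda>h. (odd_power \<kappa> (0 + h) - odd_power \<kappa> 0) / h) \<midarrow>0\<rightarrow> 0"
      by (simp add: tendsto_cong)
    then show ?thesis using 2 by (simp add: DERIV_def)
  next
    case 3
    have "((\<lambda>y. - odd_power \<kappa> (- y)) has_real_derivative - ((- x) powr \<kappa> * - 1)) (at x)"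
      using 3 by (intro DERIV_minus DERIV_chain2[OF pos]) (auto intro!: derivative_eq_intros)
    then show ?thesis using 3 by (simp add: odd_power_minus)
  qed
qed

lemma powr_superadditive:
  fixes a b p :: real
  assumes "0 \<le> a" "0 \<le> b" "0 \<le> p"
  shows "a powr (p + 1) + b powr (p + 1) \<le> (a + b) powr (p + 1)"
proof -
  have e: "x powr (p + 1) = x * x powr p" if "0 \<le> x" for x :: real
    using that by (cases "x = 0") (auto simp: powr_add)
  have "a * a powr p + b * b powr p \<le> a * (a + b) powr p + b * (a + b) powr p"
    using assms by (intro add_mono mult_left_mono powr_mono2) auto
  then show ?thesis
    unfolding e[OF assms(1)] e[OF assms(2)] e[OF add_nonneg_nonneg[OF assms(1,2)]]
    by (simp add: algebra_simps)
qed

text \<open>On one side of 0 this is superadditivity of x^(\<kappa> + 1). On opposite sides one of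
  |x|, |y| is at least half the distance, which is the reason for the factor 1/2.\<close>

lemma odd_power_diff_ge:
  assumes "0 < \<kappa>" "y \<le> x"
  shows "((x - y) / 2) powr (\<kappa> + 1) / (\<kappa> + 1) \<le> odd_power \<kappa> x - odd_power \<kappa> y"
proof -
  have half: "((x - y) / 2) powr (\<kappa> + 1) \<le> (x - y) powr (\<kappa> + 1)" if "y \<le> x" for x y
    using that assms(1) by (intro powr_mono2) auto
  have nonneg: "((x - y) / 2) powr (\<kappa> + 1) / (\<kappa> + 1) \<le> odd_power \<kappa> x - odd_power \<kappa> y" if "0 \<le> y" "y \<le> x" for x y
  proof -
    have "(x - y) powr (\<kappa> + 1) + y powr (\<kappa> + 1) \<le> x powr (\<kappa> + 1)"
      using powr_superadditive[of "x - y" y \<kappa>] that assms(1) by simp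
    then have "((x - y) / 2) powr (\<kappa> + 1) \<le> x powr (\<kappa> + 1) - y powr (\<kappa> + 1)"
      using half[OF that(2)] by linarith
    then have "((x - y) / 2) powr (\<kappa> + 1) / (\<kappa> + 1) \<le> (x powr (\<kappa> + 1) - y powr (\<kappa> + 1)) / (\<kappa> + 1)"
      using assms(1) by (intro divide_right_mono) auto
    then show ?thesis using that by (simp add: odd_power_nonneg_eq diff_divide_distrib)
  qed
  consider "0 \<le> y" | "x \<le> 0" | "y < 0" "0 < x" by linarith
  then show ?thesis
  proof cases
    case 1
    then show ?thesis using nonneg assms(2) by blast
  next
    case 2
    then show ?thesis using nonneg[of "- x" "- y"] assms(2) by (simp add: odd_power_minus)
  next
    case 3
    have "((x - y) / 2) powr (\<kappa> + 1) \<le> max x (- y) powr (\<kappa> + 1)"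
      using 3 assms(1) by (intro powr_mono2) auto
    also have "\<dots> \<le> x powr (\<kappa> + 1) + (- y) powr (\<kappa> + 1)"
      by (auto simp: max_def)
    finally have "((x - y) / 2) powr (\<kappa> + 1) / (\<kappa> + 1) \<le> (x powr (\<kappa> + 1) + (- y) powr (\<kappa> + 1)) / (\<kappa> + 1)"
      using assms(1) by (intro divide_right_mono) auto
    then show ?thesis
      using 3 odd_power_nonneg_eq[of x \<kappa>] odd_power_nonneg_eq[of "- y" \<kappa>]
      by (simp add: odd_power_minus add_divide_distrib)
  qed
qed

section \<open>The normal form near the degeneracy set\<close>

text \<open>In the coordinate \<open>W = s + \<i> odd_power \<kappa> t\<close> the form is \<open>m dW\<close>. Two points are joined by a path
  along which \<open>W\<close> moves monotonically on a segment; on it \<open>dZ = m dW\<close> with \<open>m\<close> almost constant.\<close>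

lemma normal_form_lower_bound:
  fixes A B Z m :: "real \<times> real \<Rightarrow> complex" and s t :: "real \<times> real \<Rightarrow> real"
  assumes \<kappa>: "0 < \<kappa>" and coord: "C1_coordinates U s t" and p0: "p0 \<in> U" and t0: "t p0 = 0"
    and cA: "continuous_on U A" and cB: "continuous_on U B"
    and derZ: "\<And>p. p \<in> U \<Longrightarrow> (Z has_derivative (\<lambda>h. of_real (fst h) * A p + of_real (snd h) * B p)) (at p)"
    and m0: "\<And>u. u \<in> U \<Longrightarrow> m u \<noteq> 0"
    and nA: "\<And>u. u \<in> U \<Longrightarrow> A u = m u * (of_real (dx s u) + \<i> * of_real (\<bar>t u\<bar> powr \<kappa>) * of_real (dx t u))"
    and nB: "\<And>u. u \<in> U \<Longrightarrow> B u = m u * (of_real (dy s u) + \<i> * of_real (\<bar>t u\<bar> powr \<kappa>) * of_real (dy t u))"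
  obtains V c C where "open V" "p0 \<in> V" "V \<subseteq> U" "0 < c" "0 \<le> C"
    "\<And>p p'. p \<in> V \<Longrightarrow> p' \<in> V \<Longrightarrow>
       c * cmod (Complex (s p - s p') (odd_power \<kappa> (t p) - odd_power \<kappa> (t p'))) \<le> cmod (Z p - Z p')"
    "\<And>p p'. p \<in> V \<Longrightarrow> p' \<in> V \<Longrightarrow> norm (p - p') \<le> C * (\<bar>s p - s p'\<bar> + \<bar>t p - t p'\<bar>)"
    "\<And>p. p \<in> V \<Longrightarrow> \<bar>s p - s p0\<bar> < 1"
proof -
  have U: "open U" "C1_on U s" "C1_on U t"
    and jac: "\<And>p. p \<in> U \<Longrightarrow> dx s p * dy t p - dy s p * dx t p \<noteq> 0"
    using coord by (auto simp: C1_coordinates_def)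
  note cs = C1_on_imp_continuous_on[OF U(2)] and ct = C1_on_imp_continuous_on[OF U(3)]
  have cd: "continuous_on U (dx s)" "continuous_on U (dy s)" "continuous_on U (dx t)" "continuous_on U (dy t)"
    using U by (auto simp: C1_on_def)
  have ds: "(s has_derivative (\<lambda>h. fst h * dx s p + snd h * dy s p)) (at p)" if "p \<in> U" for p
    using C1_on_has_derivative[OF U(2) that] by simp
  have dt: "(t has_derivative (\<lambda>h. fst h * dx t p + snd h * dy t p)) (at p)" if "p \<in> U" for p
    using C1_on_has_derivative[OF U(3) that] by simp
  define \<psi> where "\<psi> = (\<lambda>p. (s p, t p))"
  define D where "D = (\<lambda>p h. fst h *\<^sub>R (dx s p, dx t p) + snd h *\<^sub>R (dy s p, dy t p))"
  have d\<psi>: "(\<psi> has_derivative D p) (at p)" if "p \<in> U" for p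
    unfolding \<psi>_def D_def by (rule has_derivative_eq_rhs[OF has_derivative_Pair[OF ds[OF that] dt[OF that]]]) auto
  have injD: "inj (D p)" if "p \<in> U" for p
  proof -
    have lin: "linear (D p)" using d\<psi>[OF that] by (rule has_derivative_linear)
    have "h = 0" if h: "D p h = 0" for h
    proof -
      have e: "fst h * dx s p + snd h * dy s p = 0" "fst h * dx t p + snd h * dy t p = 0"
        using h by (simp_all add: D_def zero_prod_def)
      have "fst h * (dx s p * dy t p - dy s p * dx t p) =
          dy t p * (fst h * dx s p + snd h * dy s p) - dy s p * (fst h * dx t p + snd h * dy t p)"
        "snd h * (dx s p * dy t p - dy s p * dx t p) =
          dx s p * (fst h * dx t p + snd h * dy t p) - dx t p * (fst h * dx s p + snd h * dy s p)"
        by (simp_all add: algebra_simps)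
      then show ?thesis unfolding e using jac[OF \<open>p \<in> U\<close>] by (simp add: prod_eq_iff)
    qed
    then show ?thesis by (simp add: linear_injective_0[OF lin])
  qed
  obtain \<rho> c1 where \<rho>: "0 < \<rho>" "0 < c1" "ball p0 \<rho> \<subseteq> U"
    "\<And>p p'. p \<in> ball p0 \<rho> \<Longrightarrow> p' \<in> ball p0 \<rho> \<Longrightarrow> c1 * norm (p - p') \<le> norm (\<psi> p - \<psi> p')"
    by (rule local_lower_lipschitz[OF U(1) p0, of \<psi> "\<lambda>p. (dx s p, dx t p)" "\<lambda>p. (dy s p, dy t p)"])
       (use d\<psi> injD[OF p0] cd in \<open>auto simp: D_def intro!: continuous_on_Pair\<close>)
  define W where "W = ball p0 \<rho>"
  have W: "open W" "W \<subseteq> U" "p0 \<in> W" using \<rho> by (auto simp: W_def)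
  have inj\<psi>: "inj_on \<psi> W"
  proof (rule inj_onI)
    fix p p' assume "p \<in> W" "p' \<in> W" "\<psi> p = \<psi> p'"
    then have "c1 * norm (p - p') \<le> 0" using \<rho>(4)[of p p'] by (simp add: W_def)
    then show "p = p'" using \<rho>(2) by (simp add: mult_le_0_iff)
  qed
  have c\<psi>: "continuous_on W \<psi>"
    unfolding \<psi>_def using W(2) by (intro continuous_on_Pair continuous_on_subset[OF cs] continuous_on_subset[OF ct])
  have o\<psi>: "open (\<psi> ` W)" by (rule invariance_of_domain[OF c\<psi> W(1) inj\<psi>])
  obtain g where g: "homeomorphism W (\<psi> ` W) \<psi> g"
    using invariance_of_domain_homeomorphism[OF W(1) c\<psi> _ inj\<psi>] by auto
  have gW: "g y \<in> W" and \<psi>g: "\<psi> (g y) = y" if "y \<in> \<psi> ` W" for y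
    using g that by (auto simp: homeomorphism_def)
  have g\<psi>: "g (\<psi> p) = p" if "p \<in> W" for p using g that by (auto simp: homeomorphism_def)
  have cg: "continuous_on (\<psi> ` W) g" using g by (simp add: homeomorphism_def)
  have dg: "\<exists>g'. (g has_derivative g') (at y)" if y: "y \<in> \<psi> ` W" for y
  proof -
    have gy: "g y \<in> U" using gW[OF y] W(2) by auto
    have "linear (D (g y))" using d\<psi>[OF gy] by (rule has_derivative_linear)
    then obtain g' where g': "linear g'" "g' \<circ> D (g y) = id"
      using linear_injective_left_inverse[OF _ injD[OF gy]] by blast
    have "(g has_derivative g') (at y)"
    proof (rule has_derivative_inverse_basic[OF d\<psi>[OF gy] _ g'(2) _ o\<psi> y \<psi>g])
      show "bounded_linear g'" using g'(1) by (simp add: linear_conv_bounded_linear)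
      show "isCont g y" using cg o\<psi> y continuous_on_eq_continuous_at by blast
    qed
    then show ?thesis by blast
  qed
  define E where "E = (\<lambda>u. of_real (dx s u) + \<i> * of_real (\<bar>t u\<bar> powr \<kappa>) * of_real (dx t u) :: complex)"
  define F where "F = (\<lambda>u. of_real (dy s u) + \<i> * of_real (\<bar>t u\<bar> powr \<kappa>) * of_real (dy t u) :: complex)"
  have cE: "continuous_on U E" "continuous_on U F"
    unfolding E_def F_def using \<kappa> by (intro continuous_intros cd ct continuous_on_powr'; auto)+
  have EF: "E u * cnj (E u) + F u * cnj (F u) \<noteq> 0" if "u \<in> U" for u
  proof
    assume "E u * cnj (E u) + F u * cnj (F u) = 0"
    then have "of_real ((cmod (E u))\<^sup>2 + (cmod (F u))\<^sup>2) = (0::complex)"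
      by (simp only: complex_norm_square[symmetric] of_real_add)
    then have "(cmod (E u))\<^sup>2 + (cmod (F u))\<^sup>2 = 0" by (simp only: of_real_eq_0_iff)
    then have "E u = 0" "F u = 0" by (simp_all add: sum_power2_eq_zero_iff)
    then have "dx s u = 0" "dy s u = 0" by (auto simp: E_def F_def complex_eq_iff)
    then show False using jac[OF that] by simp
  qed
  \<comment> \<open>\<open>m\<close> is given only pointwise. Projecting (A, B) onto the nowhere
    vanishing pair (E, F) recovers it as a continuous function.\<close>
  have cm: "continuous_on U m"
  proof -
    have "continuous_on U (\<lambda>u. (A u * cnj (E u) + B u * cnj (F u)) / (E u * cnj (E u) + F u * cnj (F u)))"
      by (intro continuous_intros cA cB cE) (use EF in auto)
    moreover have "(A u * cnj (E u) + B u * cnj (F u)) / (E u * cnj (E u) + F u * cnj (F u)) = m u" if "u \<in> U" for u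
    proof -
      have "A u * cnj (E u) + B u * cnj (F u) = m u * (E u * cnj (E u) + F u * cnj (F u))"
        using nA[OF that] nB[OF that] by (simp add: E_def F_def algebra_simps)
      then show ?thesis using EF[OF that] by simp
    qed
    ultimately show ?thesis by (simp cong: continuous_on_cong)
  qed
  have cmg: "continuous_on (\<psi> ` W) (\<lambda>y. m (g y))"
    by (rule continuous_on_compose2[OF cm cg]) (use gW W(2) in blast)
  have "isCont (\<lambda>y. m (g y)) (\<psi> p0)"
    using cmg o\<psi> W(3) continuous_on_eq_continuous_at by blast
  then have "((\<lambda>y. m (g y)) \<longlongrightarrow> m (g (\<psi> p0))) (nhds (\<psi> p0))"
    using tendsto_at_iff_tendsto_nhds[of "\<lambda>y. m (g y)" "\<psi> p0"] by (simp only: isCont_def)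
  then have lim: "((\<lambda>y. m (g y)) \<longlongrightarrow> m p0) (nhds (\<psi> p0))"
    unfolding g\<psi>[OF W(3)] .
  have "\<forall>\<^sub>F y in nhds (\<psi> p0). dist (m (g y)) (m p0) < cmod (m p0) / 2"
    by (rule tendstoD[OF lim]) (use m0[OF p0] in simp)
  then obtain e1 where e1: "e1 > 0" "\<And>y. dist y (\<psi> p0) < e1 \<Longrightarrow> dist (m (g y)) (m p0) < cmod (m p0) / 2"
    unfolding eventually_nhds_metric by blast
  obtain e2 where e2: "e2 > 0" "ball (\<psi> p0) e2 \<subseteq> \<psi> ` W"
    using o\<psi> imageI[OF W(3), of \<psi>] unfolding open_contains_ball by blast
  \<comment> \<open>Half the radius, because the distance in the (s, t)-plane is estimated by the
    sum of two coordinates; the cap 1 gives the last claim of the lemma.\<close>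
  define \<eta> where "\<eta> = min (min e1 e2 / 2) 1"
  have \<eta>: "0 < \<eta>" "\<eta> \<le> 1" using e1 e2 by (auto simp: \<eta>_def)
  have box: "(x, y) \<in> \<psi> ` W \<and> cmod (m (g (x, y)) - m p0) < cmod (m p0) / 2"
    if "\<bar>x - s p0\<bar> < \<eta>" "\<bar>y\<bar> < \<eta>" for x y
  proof -
    have "dist (x, y) (\<psi> p0) \<le> \<bar>x - s p0\<bar> + \<bar>y\<bar>"
      using norm_Pair_le[of "x - s p0" y] by (simp add: \<psi>_def t0 dist_norm)
    also have "\<dots> < min e1 e2" using that by (simp add: \<eta>_def)
    finally show ?thesis using e1(2)[of "(x, y)"] e2(2) by (auto simp: dist_commute dist_norm[symmetric])
  qed
  define V where "V = {p \<in> W. \<bar>s p - s p0\<bar> < \<eta> \<and> \<bar>t p\<bar> < \<eta>}"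
  have "open V"
  proof -
    have op: "open {p \<in> W. \<bar>f p\<bar> < \<eta>}" if "continuous_on W f" for f :: "real \<times> real \<Rightarrow> real"
    proof -
      have "{p \<in> W. \<bar>f p\<bar> < \<eta>} = W \<inter> (\<lambda>p. \<bar>f p\<bar>) -` {..<\<eta>}" by auto
      then show ?thesis
        using continuous_open_preimage[OF continuous_on_rabs[OF that] W(1) open_lessThan, of \<eta>] by simp
    qed
    have "open {p \<in> W. \<bar>s p - s p0\<bar> < \<eta>}"
      by (rule op[OF continuous_on_diff[OF continuous_on_subset[OF cs W(2)] continuous_on_const]])
    moreover have "open {p \<in> W. \<bar>t p\<bar> < \<eta>}"
      by (rule op[OF continuous_on_subset[OF ct W(2)]])
    ultimately have "open ({p \<in> W. \<bar>s p - s p0\<bar> < \<eta>} \<inter> {p \<in> W. \<bar>t p\<bar> < \<eta>})" by (rule open_Int)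
    moreover have "{p \<in> W. \<bar>s p - s p0\<bar> < \<eta>} \<inter> {p \<in> W. \<bar>t p\<bar> < \<eta>} = V" by (auto simp: V_def)
    ultimately show ?thesis by simp
  qed
  moreover have "p0 \<in> V" using W(3) \<eta> by (simp add: V_def t0)
  moreover have "V \<subseteq> U" using W(2) by (auto simp: V_def)
  moreover have "0 < cmod (m p0) / 2" using m0[OF p0] by simp
  moreover have "0 \<le> 1 / c1" using \<rho>(2) by simp
  moreover have "norm (p - p') \<le> 1 / c1 * (\<bar>s p - s p'\<bar> + \<bar>t p - t p'\<bar>)" if "p \<in> V" "p' \<in> V" for p p'
  proof -
    have "c1 * norm (p - p') \<le> norm (\<psi> p - \<psi> p')" using that \<rho>(4) by (auto simp: V_def W_def)
    also have "\<dots> \<le> \<bar>s p - s p'\<bar> + \<bar>t p - t p'\<bar>"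
      using norm_Pair_le[of "s p - s p'" "t p - t p'"] by (simp add: \<psi>_def)
    finally show ?thesis using \<rho>(2) by (simp add: field_simps)
  qed
  moreover have "cmod (m p0) / 2 * cmod (Complex (s p' - s p) (odd_power \<kappa> (t p') - odd_power \<kappa> (t p))) \<le> cmod (Z p' - Z p)"
    if p: "p \<in> V" "p' \<in> V" for p p'
  proof -
    define \<Delta> where "\<Delta> = Complex (s p' - s p) (odd_power \<kappa> (t p') - odd_power \<kappa> (t p))"
    \<comment> \<open>Along a path whose W-velocity is a nonnegative multiple \<open>dl\<close> of
      the fixed vector \<Delta>, the form dZ - m(p0) dW has size at most |m(p0)| / 2 times dl
      |\<Delta>|, and \<open>dl\<close> integrates to 1.\<close>
    have path: "cmod (Z p' - Z p - m p0 * \<Delta>) \<le> cmod (m p0) / 2 * cmod \<Delta>"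
      if ends: "S 0 = s p" "S 1 = s p'" "T 0 = t p" "T 1 = t p'"
        and inbox: "\<And>\<theta>. \<theta> \<in> {0..1} \<Longrightarrow> \<bar>S \<theta> - s p0\<bar> < \<eta> \<and> \<bar>T \<theta>\<bar> < \<eta>"
        and dS: "\<And>\<theta>. (S has_real_derivative S' \<theta>) (at \<theta>)"
        and dT: "\<And>\<theta>. (T has_real_derivative T' \<theta>) (at \<theta>)"
        and d\<Lambda>: "\<And>\<theta>. (\<Lambda> has_real_derivative dl \<theta>) (at \<theta>)"
        and dl: "\<And>\<theta>. 0 \<le> dl \<theta>" and \<Lambda>: "\<Lambda> 0 = 0" "\<Lambda> 1 = 1"
        and velocity: "\<And>\<theta>. Complex (S' \<theta>) (\<bar>T \<theta>\<bar> powr \<kappa> * T' \<theta>) = of_real (dl \<theta>) * \<Delta>"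
      for S T S' T' \<Lambda> dl :: "real \<Rightarrow> real"
    proof -
      define \<gamma> where "\<gamma> = (\<lambda>\<theta>. g (S \<theta>, T \<theta>))"
      define G where "G = (\<lambda>\<theta>. Z (\<gamma> \<theta>) - m p0 * (of_real (\<Lambda> \<theta>) * \<Delta>))"
      have inW: "(S \<theta>, T \<theta>) \<in> \<psi> ` W" if "\<theta> \<in> {0..1}" for \<theta> using box inbox[OF that] by blast
      have \<gamma>W: "\<gamma> \<theta> \<in> W" "\<psi> (\<gamma> \<theta>) = (S \<theta>, T \<theta>)" if "\<theta> \<in> {0..1}" for \<theta>
        unfolding \<gamma>_def using gW \<psi>g inW[OF that] by auto
      have cST: "continuous_on {0..1} (\<lambda>\<theta>. (S \<theta>, T \<theta>))"
        by (intro continuous_on_Pair DERIV_continuous_on[of _ S S'] DERIV_continuous_on[of _ T T'])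
           (auto intro: has_field_derivative_at_within dS dT)
      have c\<gamma>: "continuous_on {0..1} \<gamma>"
        unfolding \<gamma>_def by (rule continuous_on_compose2[OF cg cST]) (use inW in auto)
      have cZ: "continuous_on U Z"
        by (rule has_derivative_continuous_on[OF has_derivative_at_withinI[OF derZ]])
      have c\<Lambda>: "continuous_on {0..1} \<Lambda>"
        by (rule DERIV_continuous_on[of _ \<Lambda> dl]) (auto intro: has_field_derivative_at_within d\<Lambda>)
      have cG: "continuous_on {0..1} G"
        unfolding G_def
        by (intro continuous_intros continuous_on_compose2[OF cZ c\<gamma>] c\<Lambda>) (use \<gamma>W W(2) in auto)
      have dG: "(G has_vector_derivative (m (\<gamma> \<theta>) - m p0) * (of_real (dl \<theta>) * \<Delta>)) (at \<theta>)"
        if \<theta>: "0 < \<theta>" "\<theta> < 1" for \<theta>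
      proof -
        have \<gamma>U: "\<gamma> \<theta> \<in> U" using \<gamma>W(1)[of \<theta>] \<theta> W(2) by auto
        have "((\<lambda>\<theta>. (S \<theta>, T \<theta>)) has_vector_derivative (S' \<theta>, T' \<theta>)) (at \<theta>)"
          using dS[of \<theta>] dT[of \<theta>]
          by (intro has_vector_derivative_Pair) (auto simp: has_real_derivative_iff_has_vector_derivative)
        moreover obtain g' where "(g has_derivative g') (at (S \<theta>, T \<theta>))"
          using dg[OF inW[of \<theta>]] \<theta> by auto
        ultimately have "(g \<circ> (\<lambda>\<theta>. (S \<theta>, T \<theta>)) has_vector_derivative g' (S' \<theta>, T' \<theta>)) (at \<theta>)"
          using vector_derivative_diff_chain_within[of "\<lambda>\<theta>. (S \<theta>, T \<theta>)" "(S' \<theta>, T' \<theta>)" \<theta> UNIV g g']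
          by (auto intro: has_derivative_at_withinI)
        then have d\<gamma>: "(\<gamma> has_vector_derivative g' (S' \<theta>, T' \<theta>)) (at \<theta>)"
          by (simp add: \<gamma>_def o_def)
        \<comment> \<open>No formula for \<open>g'\<close> is required: differentiating s and t
          along \<gamma> shows that \<open>v\<close> has the coordinate velocities S' and T', and
          the normal form then gives dZ of \<open>v\<close>.\<close>
        define v where "v = g' (S' \<theta>, T' \<theta>)"
        have chain: "((\<lambda>\<theta>. f (\<gamma> \<theta>)) has_vector_derivative f' v) (at \<theta>)"
          if "(f has_derivative f') (at (\<gamma> \<theta>))" for f :: "real \<times> real \<Rightarrow> 'z::real_normed_vector" and f'
          using vector_derivative_diff_chain_within[OF d\<gamma>, of f f'] that
          by (auto simp: o_def v_def intro: has_derivative_at_withinI)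
        have near: "\<forall>\<^sub>F x in nhds \<theta>. x \<in> {0<..<1}"
          using \<theta> by (intro eventually_nhds_in_open) auto
        have "((\<lambda>\<theta>. s (\<gamma> \<theta>)) has_vector_derivative S' \<theta>) (at \<theta>)"
        proof (rule has_vector_derivative_transform_within_open[of S _ _ "{0<..<1}"])
          show "(S has_vector_derivative S' \<theta>) (at \<theta>)"
            using dS by (simp add: has_real_derivative_iff_has_vector_derivative)
          show "S x = s (\<gamma> x)" if "x \<in> {0<..<1}" for x using \<gamma>W(2)[of x] that by (simp add: \<psi>_def)
        qed (use \<theta> in auto)
        from vector_derivative_unique_at[OF this chain[OF ds[OF \<gamma>U]]]
        have s: "S' \<theta> = fst v * dx s (\<gamma> \<theta>) + snd v * dy s (\<gamma> \<theta>)" .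
        have "((\<lambda>\<theta>. t (\<gamma> \<theta>)) has_vector_derivative T' \<theta>) (at \<theta>)"
        proof (rule has_vector_derivative_transform_within_open[of T _ _ "{0<..<1}"])
          show "(T has_vector_derivative T' \<theta>) (at \<theta>)"
            using dT by (simp add: has_real_derivative_iff_has_vector_derivative)
          show "T x = t (\<gamma> x)" if "x \<in> {0<..<1}" for x using \<gamma>W(2)[of x] that by (simp add: \<psi>_def)
        qed (use \<theta> in auto)
        from vector_derivative_unique_at[OF this chain[OF dt[OF \<gamma>U]]]
        have t: "T' \<theta> = fst v * dx t (\<gamma> \<theta>) + snd v * dy t (\<gamma> \<theta>)" .
        have T: "t (\<gamma> \<theta>) = T \<theta>" using \<gamma>W(2)[of \<theta>] \<theta> by (simp add: \<psi>_def)
        have "of_real (fst v) * A (\<gamma> \<theta>) + of_real (snd v) * B (\<gamma> \<theta>) = m (\<gamma> \<theta>) * Complex (S' \<theta>) (\<bar>T \<theta>\<bar> powr \<kappa> * T' \<theta>)"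
          unfolding nA[OF \<gamma>U] nB[OF \<gamma>U] T s t by (simp add: Complex_eq algebra_simps)
        then have "((\<lambda>\<theta>. Z (\<gamma> \<theta>)) has_vector_derivative m (\<gamma> \<theta>) * (of_real (dl \<theta>) * \<Delta>)) (at \<theta>)"
          using chain[OF derZ[OF \<gamma>U]] velocity by simp
        moreover have "((\<lambda>\<theta>. m p0 * (of_real (\<Lambda> \<theta>) * \<Delta>)) has_vector_derivative m p0 * (of_real (dl \<theta>) * \<Delta>)) (at \<theta>)"
          using d\<Lambda>[of \<theta>] by (auto intro!: derivative_eq_intros has_vector_derivative_of_real simp: has_real_derivative_iff_has_vector_derivative)
        ultimately show ?thesis
          unfolding G_def left_diff_distrib by (rule has_vector_derivative_diff)
      qed
      have "norm (G 1 - G 0) \<le> cmod (m p0) / 2 * cmod \<Delta> * \<Lambda> 1 - cmod (m p0) / 2 * cmod \<Delta> * \<Lambda> 0"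
      proof (rule differentiable_bound_general[OF _ cG _ dG])
        show "continuous_on {0..1} (\<lambda>\<theta>. cmod (m p0) / 2 * cmod \<Delta> * \<Lambda> \<theta>)"
          by (intro continuous_intros c\<Lambda>)
        fix \<theta> :: real assume \<theta>: "0 < \<theta>" "\<theta> < 1"
        show "((\<lambda>\<theta>. cmod (m p0) / 2 * cmod \<Delta> * \<Lambda> \<theta>) has_vector_derivative cmod (m p0) / 2 * cmod \<Delta> * dl \<theta>) (at \<theta>)"
          using d\<Lambda>[of \<theta>] by (auto intro!: derivative_eq_intros simp: has_real_derivative_iff_has_vector_derivative[symmetric])
        have "cmod (m (\<gamma> \<theta>) - m p0) \<le> cmod (m p0) / 2"
          using box inbox[of \<theta>] \<theta> by (simp add: \<gamma>_def less_imp_le)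
        then have "cmod (m (\<gamma> \<theta>) - m p0) * (dl \<theta> * cmod \<Delta>) \<le> cmod (m p0) / 2 * (dl \<theta> * cmod \<Delta>)"
          by (intro mult_right_mono) (auto simp: dl)
        then show "norm ((m (\<gamma> \<theta>) - m p0) * (of_real (dl \<theta>) * \<Delta>)) \<le> cmod (m p0) / 2 * cmod \<Delta> * dl \<theta>"
          using dl[of \<theta>] by (simp add: norm_mult mult_ac)
      qed auto
      moreover have "\<gamma> 0 = p" "\<gamma> 1 = p'"
        unfolding \<gamma>_def ends using g\<psi> p by (auto simp: \<psi>_def V_def)
      ultimately show ?thesis by (simp add: G_def \<Lambda> algebra_simps)
    qed
    have small: "\<bar>s p - s p0\<bar> < \<eta>" "\<bar>s p' - s p0\<bar> < \<eta>" "\<bar>t p\<bar> < \<eta>" "\<bar>t p'\<bar> < \<eta>"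
      using p by (auto simp: V_def)
    have segment: "\<bar>(x + l * (y - x)) - z\<bar> < \<eta>" if "\<bar>x - z\<bar> < \<eta>" "\<bar>y - z\<bar> < \<eta>" "0 \<le> l" "l \<le> 1" for x y z l :: real
    proof -
      have "(x + l * (y - x)) - z = (1 - l) * (x - z) + l * (y - z)" by (simp add: algebra_simps)
      moreover have "\<bar>(1 - l) * (x - z) + l * (y - z)\<bar> < \<eta>"
        using convex_bound_lt[of "\<bar>x - z\<bar>" \<eta> "\<bar>y - z\<bar>" "1 - l" l] that
          abs_triangle_ineq[of "(1 - l) * (x - z)" "l * (y - z)"] by (simp add: abs_mult)
      ultimately show ?thesis by simp
    qed
    have bound: "cmod (Z p' - Z p - m p0 * \<Delta>) \<le> cmod (m p0) / 2 * cmod \<Delta>"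
    \<comment> \<open>For equal values of t the total increment of \<open>odd_power\<close> is 0 and
      cannot be normalised; a motion in s alone does the job.\<close>
    proof (cases "t p' = t p")
      case True
      show ?thesis
      proof (rule path[of "\<lambda>\<theta>. s p + \<theta> * (s p' - s p)" "\<lambda>_. t p" "\<lambda>_. s p' - s p" "\<lambda>_. 0" "\<lambda>\<theta>. \<theta>" "\<lambda>_. 1"])
        show "\<bar>s p + \<theta> * (s p' - s p) - s p0\<bar> < \<eta> \<and> \<bar>t p\<bar> < \<eta>" if "\<theta> \<in> {0..1}" for \<theta>
          using segment small that by simp
      qed (use True in \<open>auto intro!: derivative_eq_intros simp: \<Delta>_def\<close>)
    next
      case False
      define v where "v = odd_power \<kappa>"
      define \<delta> where "\<delta> = t p' - t p"
      have vmono: "v y < v x" if "y < x" for x y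
      proof -
        have "0 < ((x - y) / 2) powr (\<kappa> + 1) / (\<kappa> + 1)" using that \<kappa> by simp
        then show ?thesis using odd_power_diff_ge[OF \<kappa>, of y x] that by (simp add: v_def)
      qed
      have vmono': "v y \<le> v x" if "y \<le> x" for x y using vmono[of y x] that by (cases "y = x") auto
      have \<delta>: "\<delta> \<noteq> 0" and tp': "t p' = t p + \<delta>" using False by (auto simp: \<delta>_def)
      define \<nu> where "\<nu> = v (t p') - v (t p)"
      have sign: "0 < \<delta> / \<nu>"
        using vmono[of "t p" "t p'"] vmono[of "t p'" "t p"] \<delta>
        by (auto simp: \<nu>_def \<delta>_def zero_less_divide_iff linorder_neq_iff)
      then have \<nu>0: "\<nu> \<noteq> 0" by auto
      define T where "T = (\<lambda>\<theta>. t p + \<theta> * \<delta>)"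
      \<comment> \<open>The fraction of the increment of \<open>odd_power\<close> covered so far.
        Driving s by it instead of by \<theta> keeps W on a straight segment while t moves
        linearly.\<close>
      define \<Lambda> where "\<Lambda> = (\<lambda>\<theta>. (v (T \<theta>) - v (t p)) / \<nu>)"
      define dl where "dl = (\<lambda>\<theta>. \<bar>T \<theta>\<bar> powr \<kappa> * (\<delta> / \<nu>))"
      have dT: "(T has_real_derivative \<delta>) (at \<theta>)" for \<theta>
        unfolding T_def by (auto intro!: derivative_eq_intros)
      have d\<Lambda>: "(\<Lambda> has_real_derivative dl \<theta>) (at \<theta>)" for \<theta>
        unfolding \<Lambda>_def dl_def
        using DERIV_cdivide[OF DERIV_diff[OF DERIV_chain2[OF odd_power_has_derivative[OF \<kappa>] dT] DERIV_const], of "v (t p)" \<nu> \<theta>]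
        by (simp add: v_def)
      have ends: "T 0 = t p" "T 1 = t p'" "\<Lambda> 0 = 0" "\<Lambda> 1 = 1"
        using \<nu>0 by (simp_all add: T_def tp' \<Lambda>_def \<nu>_def)
      have \<Lambda>01: "0 \<le> \<Lambda> \<theta>" "\<Lambda> \<theta> \<le> 1" if "\<theta> \<in> {0..1}" for \<theta>
      proof -
        consider "0 < \<delta>" "0 < \<nu>" | "\<delta> < 0" "\<nu> < 0" using sign by (auto simp: zero_less_divide_iff)
        then have "0 \<le> \<Lambda> \<theta> \<and> \<Lambda> \<theta> \<le> 1"
        proof cases
          case 1
          have "\<theta> * \<delta> \<le> 1 * \<delta>" using that 1 by (intro mult_right_mono) auto
          then have "t p \<le> T \<theta>" "T \<theta> \<le> t p'" using that 1 by (auto simp: T_def tp')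
          then have "v (t p) \<le> v (T \<theta>)" "v (T \<theta>) \<le> v (t p')" using vmono' by auto
          then show ?thesis using 1 by (simp add: \<Lambda>_def \<nu>_def)
        next
          case 2
          have "1 * \<delta> \<le> \<theta> * \<delta>" using that 2 by (intro mult_right_mono_neg) auto
          moreover have "\<theta> * \<delta> \<le> 0" using that 2 by (intro mult_nonneg_nonpos) auto
          ultimately have "T \<theta> \<le> t p" "t p' \<le> T \<theta>" by (auto simp: T_def tp')
          then have "v (T \<theta>) \<le> v (t p)" "v (t p') \<le> v (T \<theta>)" using vmono' by auto
          then show ?thesis using 2 by (simp add: \<Lambda>_def \<nu>_def divide_le_eq zero_le_divide_iff)
        qed
        then show "0 \<le> \<Lambda> \<theta>" "\<Lambda> \<theta> \<le> 1" by auto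
      qed
      show ?thesis
      proof (rule path[of "\<lambda>\<theta>. s p + \<Lambda> \<theta> * (s p' - s p)" T "\<lambda>\<theta>. dl \<theta> * (s p' - s p)" "\<lambda>_. \<delta>" \<Lambda> dl])
        show "\<bar>s p + \<Lambda> \<theta> * (s p' - s p) - s p0\<bar> < \<eta> \<and> \<bar>T \<theta>\<bar> < \<eta>" if "\<theta> \<in> {0..1}" for \<theta>
          using segment[OF small(1,2) \<Lambda>01[OF that]] segment[of "t p" 0 "t p'" \<theta>] small that
          by (simp add: T_def \<delta>_def)
        show "((\<lambda>\<theta>. s p + \<Lambda> \<theta> * (s p' - s p)) has_real_derivative dl \<theta> * (s p' - s p)) (at \<theta>)" for \<theta>
          by (auto intro!: derivative_eq_intros d\<Lambda>)
        show "Complex (dl \<theta> * (s p' - s p)) (\<bar>T \<theta>\<bar> powr \<kappa> * \<delta>) = of_real (dl \<theta>) * \<Delta>" for \<theta>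
        proof -
          have "dl \<theta> * \<nu> = \<bar>T \<theta>\<bar> powr \<kappa> * \<delta>" using \<nu>0 by (simp add: dl_def)
          then show ?thesis by (simp add: \<Delta>_def complex_eq_iff \<nu>_def v_def)
        qed
        show "0 \<le> dl \<theta>" for \<theta> unfolding dl_def using sign by (intro mult_nonneg_nonneg) auto
      qed (simp_all add: ends dT d\<Lambda>)
    qed
    have "cmod (m p0) * cmod \<Delta> \<le> cmod (Z p' - Z p) + cmod (Z p' - Z p - m p0 * \<Delta>)"
      using norm_triangle_ineq4[of "Z p' - Z p" "Z p' - Z p - m p0 * \<Delta>"] by (simp add: norm_mult)
    then show ?thesis using bound by (simp add: \<Delta>_def)
  qed
  moreover have "\<bar>s p - s p0\<bar> < 1" if "p \<in> V" for p using that \<eta> by (auto simp: V_def)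
  ultimately show thesis using that[of V "cmod (m p0) / 2" "1 / c1"] by blast
qed

text \<open>The exponent \<open>\<beta>\<close> makes \<open>\<bar>z - Z\<bar> powr (- r)\<close> locally integrable for \<open>r < \<beta>\<close>, uniformly in \<open>z\<close>.\<close>

definition locally_regular :: "(real \<times> real \<Rightarrow> complex) \<Rightarrow> real \<Rightarrow> real \<times> real \<Rightarrow> bool" where
  "locally_regular Z \<beta> p0 \<longleftrightarrow> (\<exists>V K. open V \<and> p0 \<in> V \<and> inj_on Z V \<and> 0 \<le> K \<and>
     (\<forall>z \<delta>. 0 < \<delta> \<and> \<delta> \<le> 1 \<longrightarrow> emeasure lborel {p \<in> V. cmod (Z p - z) < \<delta>} \<le> ennreal (K * \<delta> powr \<beta>)))"

text \<open>A real vector killed by dZ is killed by its conjugate as well, and the assumed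
  nonvanishing number is the determinant of these two equations. So dZ is injective at
  \<open>p0\<close>.\<close>

lemma nondegenerate_lower_bound:
  fixes A B Z :: "real \<times> real \<Rightarrow> complex"
  assumes "continuous_on UNIV A" "continuous_on UNIV B"
    and derZ: "\<And>p. (Z has_derivative (\<lambda>h. of_real (fst h) * A p + of_real (snd h) * B p)) (at p)"
    and nd: "A p0 * cnj (B p0) - B p0 * cnj (A p0) \<noteq> 0"
  obtains \<rho> c where "0 < \<rho>" "0 < c"
    "\<And>p p'. p \<in> ball p0 \<rho> \<Longrightarrow> p' \<in> ball p0 \<rho> \<Longrightarrow> c * norm (p - p') \<le> cmod (Z p - Z p')"
proof -
  have der: "(Z has_derivative (\<lambda>h. fst h *\<^sub>R A p + snd h *\<^sub>R B p)) (at p)" for p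
    using derZ by (simp add: scaleR_conv_of_real)
  have lin: "linear (\<lambda>h. fst h *\<^sub>R A p0 + snd h *\<^sub>R B p0)"
    using der by (rule has_derivative_linear)
  have "h = 0" if "fst h *\<^sub>R A p0 + snd h *\<^sub>R B p0 = 0" for h
  proof -
    let ?x = "of_real (fst h) :: complex" and ?y = "of_real (snd h) :: complex"
    have e: "?x * A p0 + ?y * B p0 = 0" using that by (simp add: scaleR_conv_of_real)
    then have e': "?x * cnj (A p0) + ?y * cnj (B p0) = 0"
      by (metis complex_cnj_add complex_cnj_complex_of_real complex_cnj_mult complex_cnj_zero)
    have "?x * (A p0 * cnj (B p0) - B p0 * cnj (A p0)) =
        cnj (B p0) * (?x * A p0 + ?y * B p0) - B p0 * (?x * cnj (A p0) + ?y * cnj (B p0))"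
      "?y * (A p0 * cnj (B p0) - B p0 * cnj (A p0)) =
        A p0 * (?x * cnj (A p0) + ?y * cnj (B p0)) - cnj (A p0) * (?x * A p0 + ?y * B p0)"
      by (simp_all add: algebra_simps)
    then have "?x = 0" "?y = 0" unfolding e e' using nd by auto
    then show ?thesis by (simp add: prod_eq_iff)
  qed
  then have inj: "inj (\<lambda>h. fst h *\<^sub>R A p0 + snd h *\<^sub>R B p0)"
    by (simp add: linear_injective_0[OF lin])
  show thesis
    by (rule local_lower_lipschitz[OF open_UNIV UNIV_I der assms(1,2) inj]) (rule that; blast)
qed

text \<open>The preimage of a disc of radius \<delta> lies in a disc of radius 2 \<delta> / c, with
  area of order \<delta>^2; this is at most \<delta>^\<beta> since \<delta> \<le> 1 and \<beta>
  \<le> 2.\<close>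

lemma nondegenerate_locally_regular:
  fixes A B Z :: "real \<times> real \<Rightarrow> complex"
  assumes "continuous_on UNIV A" "continuous_on UNIV B"
    and "\<And>p. (Z has_derivative (\<lambda>h. of_real (fst h) * A p + of_real (snd h) * B p)) (at p)"
    and "A p0 * cnj (B p0) - B p0 * cnj (A p0) \<noteq> 0" and \<beta>: "\<beta> \<le> 2"
  shows "locally_regular Z \<beta> p0"
proof -
  obtain \<rho> c where \<rho>: "0 < \<rho>" "0 < c"
    "\<And>p p'. p \<in> ball p0 \<rho> \<Longrightarrow> p' \<in> ball p0 \<rho> \<Longrightarrow> c * norm (p - p') \<le> cmod (Z p - Z p')"
    using nondegenerate_lower_bound[OF assms(1-4)] by blast
  have "inj_on Z (ball p0 \<rho>)"
  proof (rule inj_onI)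
    fix p p' assume "p \<in> ball p0 \<rho>" "p' \<in> ball p0 \<rho>" "Z p = Z p'"
    then have "c * norm (p - p') \<le> 0" using \<rho>(3)[of p p'] by simp
    then show "p = p'" using \<rho>(2) by (simp add: mult_le_0_iff)
  qed
  moreover have "emeasure lborel {p \<in> ball p0 \<rho>. cmod (Z p - z) < \<delta>} \<le> ennreal (pi * (2 / c)\<^sup>2 * \<delta> powr \<beta>)"
    if \<delta>: "0 < \<delta>" "\<delta> \<le> 1" for z \<delta>
  proof (cases "{p \<in> ball p0 \<rho>. cmod (Z p - z) < \<delta>} = {}")
    case True
    then show ?thesis by (metis emeasure_empty zero_le)
  next
    case False
    then obtain x where x: "x \<in> ball p0 \<rho>" "cmod (Z x - z) < \<delta>" by blast
    have sub: "{p \<in> ball p0 \<rho>. cmod (Z p - z) < \<delta>} \<subseteq> cball x (2 / c * \<delta>)"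
    proof
      fix p assume p: "p \<in> {p \<in> ball p0 \<rho>. cmod (Z p - z) < \<delta>}"
      have "c * norm (x - p) \<le> cmod ((Z x - z) - (Z p - z))" using \<rho>(3)[OF x(1), of p] p by simp
      also have "\<dots> \<le> cmod (Z x - z) + cmod (Z p - z)" by (rule norm_triangle_ineq4)
      also have "\<dots> \<le> 2 * \<delta>" using x p by simp
      finally show "p \<in> cball x (2 / c * \<delta>)" using \<rho>(2) by (simp add: dist_norm field_simps)
    qed
    have "emeasure lborel {p \<in> ball p0 \<rho>. cmod (Z p - z) < \<delta>} \<le> emeasure lborel (cball x (2 / c * \<delta>))"
      by (rule emeasure_mono[OF sub]) simp
    also have "\<dots> = ennreal (pi * (2 / c)\<^sup>2 * \<delta> powr 2)"
      using \<delta> \<rho>(2) by (simp add: emeasure_cball unit_ball_vol_2 power2_eq_square powr_numeral mult_ac)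
    also have "\<dots> \<le> ennreal (pi * (2 / c)\<^sup>2 * \<delta> powr \<beta>)"
      using \<delta> \<beta> by (intro ennreal_leI mult_left_mono powr_mono') auto
    finally show ?thesis .
  qed
  ultimately show ?thesis
    unfolding locally_regular_def using \<rho>(1)
    by (intro exI[of _ "ball p0 \<rho>"] exI[of _ "pi * (2 / c)\<^sup>2"]) auto
qed

text \<open>A disc of radius \<delta> confines s to an interval of length O(\<delta>) and t to one
  of length O(\<delta>^e) with e = 1 / (\<kappa> + 1). The area is O(\<delta>^(1 + e)), and 1 + e =
  2 - \<kappa> / (\<kappa> + 1). The same covering argument shows that the curve t = 0 is a null
  set.\<close>

lemma normal_form_locally_regular:
  fixes A B Z m :: "real \<times> real \<Rightarrow> complex" and s t :: "real \<times> real \<Rightarrow> real"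
  assumes \<kappa>: "0 < \<kappa>" and coord: "C1_coordinates U s t" and p0: "p0 \<in> U" and t0: "t p0 = 0"
    and cA: "continuous_on U A" and cB: "continuous_on U B"
    and derZ: "\<And>p. p \<in> U \<Longrightarrow> (Z has_derivative (\<lambda>h. of_real (fst h) * A p + of_real (snd h) * B p)) (at p)"
    and m0: "\<And>u. u \<in> U \<Longrightarrow> m u \<noteq> 0"
    and nA: "\<And>u. u \<in> U \<Longrightarrow> A u = m u * (of_real (dx s u) + \<i> * of_real (\<bar>t u\<bar> powr \<kappa>) * of_real (dx t u))"
    and nB: "\<And>u. u \<in> U \<Longrightarrow> B u = m u * (of_real (dy s u) + \<i> * of_real (\<bar>t u\<bar> powr \<kappa>) * of_real (dy t u))"
    and \<beta>: "\<beta> \<le> 2 - \<kappa> / (\<kappa> + 1)"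
  shows "locally_regular Z \<beta> p0" and "\<exists>V. open V \<and> p0 \<in> V \<and> V \<subseteq> U \<and> negligible {p \<in> V. t p = 0}"
proof -
  obtain V c C where V: "open V" "p0 \<in> V" "V \<subseteq> U" and c: "0 < c" and C: "0 \<le> C"
    and low: "\<And>p p'. p \<in> V \<Longrightarrow> p' \<in> V \<Longrightarrow>
       c * cmod (Complex (s p - s p') (odd_power \<kappa> (t p) - odd_power \<kappa> (t p'))) \<le> cmod (Z p - Z p')"
    and lip: "\<And>p p'. p \<in> V \<Longrightarrow> p' \<in> V \<Longrightarrow> norm (p - p') \<le> C * (\<bar>s p - s p'\<bar> + \<bar>t p - t p'\<bar>)"
    and s1: "\<And>p. p \<in> V \<Longrightarrow> \<bar>s p - s p0\<bar> < 1"
    using normal_form_lower_bound[OF \<kappa> coord p0 t0 cA cB derZ m0 nA nB] by blast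
  define e where "e = 1 / (\<kappa> + 1)"
  have e: "0 < e" "e \<le> 1" using \<kappa> by (auto simp: e_def)
  have \<beta>e: "\<beta> \<le> 1 + e" using \<beta> \<kappa> by (simp add: e_def field_simps)
  \<comment> \<open>Obtained by solving (|t p - t p'| / 2)^(\<kappa> + 1) / (\<kappa> + 1) \<le> d /
    c for |t p - t p'|.\<close>
  define T0 where "T0 = 2 * ((\<kappa> + 1) / c) powr e"
  have ds: "\<bar>s p - s p'\<bar> \<le> d / c" and dt: "\<bar>t p - t p'\<bar> \<le> T0 * d powr e"
    if "p \<in> V" "p' \<in> V" "cmod (Z p - Z p') \<le> d" for p p' d
  proof -
    have d0: "0 \<le> d" using that(3) norm_ge_zero order_trans by blast
    have cm: "cmod (Complex (s p - s p') (odd_power \<kappa> (t p) - odd_power \<kappa> (t p'))) \<le> d / c"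
      using low[OF that(1,2)] that(3) c by (simp add: field_simps)
    then show "\<bar>s p - s p'\<bar> \<le> d / c"
      using abs_Re_le_cmod[of "Complex (s p - s p') (odd_power \<kappa> (t p) - odd_power \<kappa> (t p'))"] by simp
    have dv: "\<bar>odd_power \<kappa> (t p) - odd_power \<kappa> (t p')\<bar> \<le> d / c"
      using cm abs_Im_le_cmod[of "Complex (s p - s p') (odd_power \<kappa> (t p) - odd_power \<kappa> (t p'))"] by simp
    have "(\<bar>t p - t p'\<bar> / 2) powr (\<kappa> + 1) / (\<kappa> + 1) \<le> \<bar>odd_power \<kappa> (t p) - odd_power \<kappa> (t p')\<bar>"
      using odd_power_diff_ge[OF \<kappa>, of "t p'" "t p"] odd_power_diff_ge[OF \<kappa>, of "t p" "t p'"]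
      by (cases "t p' \<le> t p") (auto simp: abs_if)
    then have "(\<bar>t p - t p'\<bar> / 2) powr (\<kappa> + 1) / (\<kappa> + 1) \<le> d / c"
      using dv by linarith
    then have "(\<bar>t p - t p'\<bar> / 2) powr (\<kappa> + 1) \<le> d / c * (\<kappa> + 1)"
      using \<kappa> by (simp only: pos_divide_le_eq)
    then have "(\<bar>t p - t p'\<bar> / 2) powr (\<kappa> + 1) \<le> (\<kappa> + 1) / c * d"
      by (simp add: mult.commute)
    then have "((\<bar>t p - t p'\<bar> / 2) powr (\<kappa> + 1)) powr e \<le> ((\<kappa> + 1) / c * d) powr e"
      using e by (intro powr_mono2) auto
    also have "((\<bar>t p - t p'\<bar> / 2) powr (\<kappa> + 1)) powr e = \<bar>t p - t p'\<bar> / 2"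
      using \<kappa> by (simp add: powr_powr e_def)
    also have "((\<kappa> + 1) / c * d) powr e = ((\<kappa> + 1) / c) powr e * d powr e"
      by (rule powr_mult)
    finally show "\<bar>t p - t p'\<bar> \<le> T0 * d powr e" by (simp add: T0_def)
  qed
  have inj: "inj_on Z V"
  proof (rule inj_onI)
    fix p p' assume p: "p \<in> V" "p' \<in> V" "Z p = Z p'"
    have "\<bar>s p - s p'\<bar> \<le> 0" "\<bar>t p - t p'\<bar> \<le> 0"
      using ds[OF p(1,2), of 0] dt[OF p(1,2), of 0] p(3) by auto
    then show "p = p'" using lip[OF p(1,2)] by simp
  qed
  \<comment> \<open>The second entry ensures that the s-side of the box is not longer than the
    t-side, as \<open>rectangle_preimage_measure\<close> demands.\<close>
  define T where "T = max (T0 * 2 powr e) (2 / c)"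
  have T: "T0 * 2 powr e \<le> T" "2 / c \<le> T" "0 < T"
    using c by (auto simp: T_def less_max_iff_disj)
  define K where "K = 8 * pi * C\<^sup>2 * (4 / c * (2 * T))"
  have K: "0 \<le> K" using c T by (simp add: K_def)
  have "emeasure lborel {p \<in> V. cmod (Z p - z) < \<delta>} \<le> ennreal (K * \<delta> powr \<beta>)"
    if \<delta>: "0 < \<delta>" "\<delta> \<le> 1" for z \<delta>
  proof (cases "{p \<in> V. cmod (Z p - z) < \<delta>} = {}")
    case True
    then show ?thesis by (metis emeasure_empty zero_le)
  next
    case False
    then obtain x where x: "x \<in> V" "cmod (Z x - z) < \<delta>" by blast
    have near: "cmod (Z x - Z p) \<le> 2 * \<delta>" if "cmod (Z p - z) < \<delta>" for p
      using norm_triangle_ineq4[of "Z x - z" "Z p - z"] x(2) that by simp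
    have "\<delta> powr 1 \<le> \<delta> powr e" using \<delta> e by (intro powr_mono') auto
    then have de: "\<delta> \<le> \<delta> powr e" using \<delta> by simp
    have "\<exists>S. S \<in> sets lborel \<and> {p \<in> V. cmod (Z p - z) < \<delta>} \<subseteq> S \<and>
        emeasure lborel S \<le> ennreal (8 * pi * C\<^sup>2 * ((4 / c * \<delta>) * (2 * T * \<delta> powr e)))"
    proof (rule rectangle_preimage_measure[where u = s and w = t])
      fix p p' assume "p \<in> {p \<in> V. cmod (Z p - z) < \<delta>}" "p' \<in> {p \<in> V. cmod (Z p - z) < \<delta>}"
      then show "norm (p - p') \<le> C * (\<bar>s p - s p'\<bar> + \<bar>t p - t p'\<bar>)" using lip by auto
    next
      fix p assume p: "p \<in> {p \<in> V. cmod (Z p - z) < \<delta>}"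
      have "\<bar>s x - s p\<bar> \<le> 2 * \<delta> / c" using ds[OF x(1) _ near, of p] p by auto
      then show "s x - 2 / c * \<delta> \<le> s p \<and> s p \<le> s x - 2 / c * \<delta> + 4 / c * \<delta>"
        by (auto simp: abs_le_iff field_simps)
      have "\<bar>t x - t p\<bar> \<le> T0 * (2 * \<delta>) powr e" using dt[OF x(1) _ near, of p] p by auto
      also have "\<dots> = T0 * 2 powr e * \<delta> powr e" using \<delta> by (simp add: powr_mult)
      also have "\<dots> \<le> T * \<delta> powr e" by (intro mult_right_mono T) auto
      finally show "t x - T * \<delta> powr e \<le> t p \<and> t p \<le> t x - T * \<delta> powr e + 2 * T * \<delta> powr e"
        by (auto simp: abs_le_iff)
    next
      have "2 / c * \<delta> \<le> T * \<delta> powr e" using T de \<delta> by (intro mult_mono) auto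
      then show "4 / c * \<delta> \<le> 2 * T * \<delta> powr e" by simp
    qed (use c \<delta> C in auto)
    then obtain S where S: "S \<in> sets lborel" "{p \<in> V. cmod (Z p - z) < \<delta>} \<subseteq> S"
        "emeasure lborel S \<le> ennreal (8 * pi * C\<^sup>2 * ((4 / c * \<delta>) * (2 * T * \<delta> powr e)))" by blast
    have "emeasure lborel {p \<in> V. cmod (Z p - z) < \<delta>} \<le> emeasure lborel S"
      by (rule emeasure_mono[OF S(2,1)])
    also note S(3)
    also have "8 * pi * C\<^sup>2 * ((4 / c * \<delta>) * (2 * T * \<delta> powr e)) = K * \<delta> powr (1 + e)"
      using \<delta> by (simp add: K_def powr_add mult_ac)
    also have "ennreal \<dots> \<le> ennreal (K * \<delta> powr \<beta>)"
      using \<delta> \<beta>e K by (intro ennreal_leI mult_left_mono powr_mono') auto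
    finally show ?thesis .
  qed
  then show "locally_regular Z \<beta> p0"
    unfolding locally_regular_def using V inj K by blast
  have "negligible {p \<in> V. t p = 0}"
    unfolding negligible_outer_le
  proof (intro allI impI)
    fix \<epsilon> :: real assume \<epsilon>: "0 < \<epsilon>"
    \<comment> \<open>The bound 2 is the length of the s-interval, which must not be the shorter
      side; the summand 1 keeps the denominator positive.\<close>
    define \<delta> where "\<delta> = min 2 (\<epsilon> / (16 * pi * C\<^sup>2 + 1))"
    have pos: "0 < 16 * pi * C\<^sup>2 + 1" by (simp add: add_nonneg_pos)
    have \<delta>: "0 < \<delta>" "\<delta> \<le> 2" using \<epsilon> pos by (auto simp: \<delta>_def)
    \<comment> \<open>The roles of s and t are exchanged: t = 0 fits into an interval of arbitrarily
      small length \<delta>, while s stays in one of length 2.\<close>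
    have "\<exists>S. S \<in> sets lborel \<and> {p \<in> V. t p = 0} \<subseteq> S \<and> emeasure lborel S \<le> ennreal (8 * pi * C\<^sup>2 * (\<delta> * 2))"
    proof (rule rectangle_preimage_measure[where u = t and w = s])
      fix p p' assume "p \<in> {p \<in> V. t p = 0}" "p' \<in> {p \<in> V. t p = 0}"
      then show "norm (p - p') \<le> C * (\<bar>t p - t p'\<bar> + \<bar>s p - s p'\<bar>)" using lip[of p p'] by (auto simp: add.commute)
    next
      fix p assume "p \<in> {p \<in> V. t p = 0}"
      then show "0 \<le> t p \<and> t p \<le> 0 + \<delta>" "s p0 - 1 \<le> s p \<and> s p \<le> s p0 - 1 + 2"
        using s1[of p] \<delta> by (auto simp: abs_less_iff)
    qed (use \<delta> C in auto)
    then obtain S where S: "S \<in> sets lborel" "{p \<in> V. t p = 0} \<subseteq> S" "emeasure lborel S \<le> ennreal (8 * pi * C\<^sup>2 * (\<delta> * 2))"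
      by blast
    have "8 * pi * C\<^sup>2 * (\<delta> * 2) \<le> (16 * pi * C\<^sup>2 + 1) * \<delta>" using \<delta> by (simp add: algebra_simps)
    also have "\<dots> \<le> (16 * pi * C\<^sup>2 + 1) * (\<epsilon> / (16 * pi * C\<^sup>2 + 1))"
      using pos by (intro mult_left_mono) (auto simp: \<delta>_def)
    also have "\<dots> = \<epsilon>" using pos by simp
    finally have "emeasure lborel S \<le> ennreal \<epsilon>" using S(3) ennreal_leI order_trans by blast
    then have "emeasure lebesgue S \<le> ennreal \<epsilon>" "emeasure lebesgue S < \<infinity>"
      using S(1) by (auto simp: le_less_trans)
    then have "S \<in> lmeasurable" "measure lebesgue S \<le> \<epsilon>"
      using S(1) \<epsilon> by (auto simp: fmeasurable_def measure_def enn2real_leI)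
    then show "\<exists>T. {p \<in> V. t p = 0} \<subseteq> T \<and> T \<in> lmeasurable \<and> measure lebesgue T \<le> \<epsilon>"
      using S(2) by blast
  qed
  then show "\<exists>V. open V \<and> p0 \<in> V \<and> V \<subseteq> U \<and> negligible {p \<in> V. t p = 0}"
    using V by blast
qed

text \<open>For \<delta> \<le> 1 a finite subcover adds up the local constants; for larger \<delta>
  the area of \<open>K\<close> suffices because then \<delta>^\<beta> \<ge> 1.\<close>

lemma locally_regular_compact:
  assumes K: "compact K" and reg: "\<And>p. p \<in> K \<Longrightarrow> locally_regular Z \<beta> p" and \<beta>: "0 \<le> \<beta>"
    and cont: "continuous_on UNIV Z"
  shows "\<exists>C\<ge>0. \<forall>z \<delta>. 0 < \<delta> \<longrightarrow> emeasure lborel {p \<in> K. cmod (Z p - z) < \<delta>} \<le> ennreal (C * \<delta> powr \<beta>)"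
proof -
  define Q where "Q = (\<lambda>p W. open (fst W) \<and> p \<in> fst W \<and> 0 \<le> snd W \<and>
     (\<forall>z \<delta>. 0 < \<delta> \<and> \<delta> \<le> 1 \<longrightarrow> emeasure lborel {x \<in> fst W. cmod (Z x - z) < \<delta>} \<le> ennreal (snd W * \<delta> powr \<beta>)))"
  have "\<exists>W. Q p W" if p: "p \<in> K" for p
  proof -
    obtain V k where "open V" "p \<in> V" "0 \<le> k"
      "\<forall>z \<delta>. 0 < \<delta> \<and> \<delta> \<le> 1 \<longrightarrow> emeasure lborel {x \<in> V. cmod (Z x - z) < \<delta>} \<le> ennreal (k * \<delta> powr \<beta>)"
      using reg[OF p] unfolding locally_regular_def by blast
    then have "Q p (V, k)" unfolding Q_def fst_conv snd_conv by blast
    then show ?thesis by blast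
  qed
  then have "\<forall>p\<in>K. \<exists>W. Q p W" by blast
  from bchoice[OF this] obtain W where W: "\<And>p. p \<in> K \<Longrightarrow> Q p (W p)" by blast
  define V where "V = (\<lambda>p. fst (W p))"
  define k where "k = (\<lambda>p. snd (W p))"
  have V: "open (V p)" "p \<in> V p" "0 \<le> k p"
     "\<And>z \<delta>. 0 < \<delta> \<Longrightarrow> \<delta> \<le> 1 \<Longrightarrow> emeasure lborel {x \<in> V p. cmod (Z x - z) < \<delta>} \<le> ennreal (k p * \<delta> powr \<beta>)"
    if "p \<in> K" for p
    using W[OF that] by (simp_all add: Q_def V_def k_def)
  have "\<exists>I\<subseteq>K. finite I \<and> K \<subseteq> (\<Union>p\<in>I. V p)"
  proof (rule compactE_image[OF K, of K V])
    show "open (V p)" if "p \<in> K" for p by (rule V(1)[OF that])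
    show "K \<subseteq> (\<Union>p\<in>K. V p)" using V(2) by auto
  qed auto
  then obtain I where I: "I \<subseteq> K" "finite I" "K \<subseteq> (\<Union>p\<in>I. V p)" by auto
  define C where "C = (\<Sum>p\<in>I. k p) + measure lborel K"
  have kI: "0 \<le> k p" if "p \<in> I" for p using V I(1) that by blast
  have S0: "0 \<le> (\<Sum>p\<in>I. k p)" using kI by (rule sum_nonneg)
  have Kf: "emeasure lborel K = ennreal (measure lborel K)"
    using emeasure_compact_finite[OF K] by (intro emeasure_eq_ennreal_measure) auto
  have Kb: "K \<in> sets lborel" using K by (simp add: compact_imp_closed)
  have "emeasure lborel {p \<in> K. cmod (Z p - z) < \<delta>} \<le> ennreal (C * \<delta> powr \<beta>)" if \<delta>: "0 < \<delta>" for z \<delta>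
  proof (cases "\<delta> \<le> 1")
    case True
    have Sm: "{x \<in> V p. cmod (Z x - z) < \<delta>} \<in> sets lborel" if "p \<in> I" for p
    proof -
      have "open (V p)" using V I(1) that by blast
      moreover have "open {x. cmod (Z x - z) < \<delta>}"
        by (intro open_Collect_less continuous_intros cont)
      ultimately have "open (V p \<inter> {x. cmod (Z x - z) < \<delta>})" by (rule open_Int)
      moreover have "V p \<inter> {x. cmod (Z x - z) < \<delta>} = {x \<in> V p. cmod (Z x - z) < \<delta>}" by auto
      ultimately show ?thesis by simp
    qed
    have "emeasure lborel {p \<in> K. cmod (Z p - z) < \<delta>} \<le> emeasure lborel (\<Union>p\<in>I. {x \<in> V p. cmod (Z x - z) < \<delta>})"
      using I(2,3) Sm by (intro emeasure_mono sets.finite_UN) auto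
    also have "\<dots> \<le> (\<Sum>p\<in>I. emeasure lborel {x \<in> V p. cmod (Z x - z) < \<delta>})"
      using I(2) Sm by (intro emeasure_subadditive_finite) auto
    also have "\<dots> \<le> (\<Sum>p\<in>I. ennreal (k p * \<delta> powr \<beta>))"
      by (intro sum_mono V(4) \<delta> True) (use I(1) in blast)
    also have "\<dots> = ennreal ((\<Sum>p\<in>I. k p) * \<delta> powr \<beta>)"
      using kI by (subst sum_ennreal) (auto simp: sum_distrib_right)
    also have "\<dots> \<le> ennreal (C * \<delta> powr \<beta>)"
      by (intro ennreal_leI mult_right_mono) (auto simp: C_def)
    finally show ?thesis .
  next
    case False
    have "emeasure lborel {p \<in> K. cmod (Z p - z) < \<delta>} \<le> emeasure lborel K"
      using Kb by (intro emeasure_mono) auto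
    also have "\<dots> = ennreal (measure lborel K * 1)" by (simp add: Kf)
    also have "\<dots> \<le> ennreal (C * \<delta> powr \<beta>)"
      using S0 False \<beta> by (intro ennreal_leI mult_mono ge_one_powr_ge_zero) (auto simp: C_def)
    finally show ?thesis .
  qed
  moreover have "0 \<le> C" using S0 by (simp add: C_def)
  ultimately show ?thesis by blast
qed

section \<open>Global injectivity\<close>

text \<open>Invariance of domain makes Z open; properness makes its range closed and, with local
  injectivity, its fibres finite. Surjectivity then follows from connectedness of the
  target.\<close>

lemma proper_locally_injective_imp_covering_space:
  fixes Z :: "'a::euclidean_space \<Rightarrow> 'b::euclidean_space"
  assumes cont: "continuous_on UNIV Z" and dim: "DIM('b) = DIM('a)"
    and loc: "\<And>p. \<exists>V. open V \<and> p \<in> V \<and> inj_on Z V"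
    and proper: "\<And>K. compact K \<Longrightarrow> compact (Z -` K)"
  shows "covering_space UNIV Z UNIV"
proof -
  have cS: "continuous_on S Z" for S using cont by (rule continuous_on_subset) simp
  have opmap: "open (Z ` S)" if "open S" for S
  proof (subst open_subopen, rule ballI)
    fix y assume "y \<in> Z ` S"
    then obtain p where p: "p \<in> S" "y = Z p" by auto
    obtain V where V: "open V" "p \<in> V" "inj_on Z V" using loc by blast
    have "open (Z ` (V \<inter> S))"
      by (rule invariance_of_domain_gen) (use V that dim in \<open>auto intro: cS inj_on_subset\<close>)
    then show "\<exists>T. open T \<and> y \<in> T \<and> T \<subseteq> Z ` S"
      using p V by (intro exI[of _ "Z ` (V \<inter> S)"]) auto
  qed
  have clrange: "closed (range Z)"
    unfolding closed_sequential_limits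
  proof (intro allI impI, elim conjE)
    fix f l assume f: "\<forall>n. f n \<in> range Z" "f \<longlonglongrightarrow> l"
    have K: "compact (insert l (range f))"
      using f(2) by (rule compact_sequence_with_limit)
    have "\<forall>n. \<exists>x. f n = Z x" using f(1) by auto
    then obtain g where g: "\<And>n. f n = Z (g n)" by metis
    have "\<forall>n. g n \<in> Z -` insert l (range f)" using g by auto
    then obtain p r where p: "strict_mono r" "(g \<circ> r) \<longlonglongrightarrow> p"
      using seq_compactE[OF compact_imp_seq_compact[OF proper[OF K]]] by metis
    have "isCont Z p" using cont by (simp add: continuous_on_eq_continuous_at)
    then have "(\<lambda>n. Z ((g \<circ> r) n)) \<longlonglongrightarrow> Z p" using p(2) by (rule isCont_tendsto_compose)
    moreover have "(\<lambda>n. Z ((g \<circ> r) n)) \<longlonglongrightarrow> l"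
      using LIMSEQ_subseq_LIMSEQ[OF f(2) p(1)] by (simp add: o_def g)
    ultimately show "l \<in> range Z" using LIMSEQ_unique by blast
  qed
  have surj: "range Z = UNIV"
    using opmap[OF open_UNIV] clrange clopen[of "range Z"] by auto
  show ?thesis
    unfolding covering_space_def
  proof (intro conjI ballI)
    fix z :: 'b
    define F where "F = Z -` {z}"
    have compF: "compact F" unfolding F_def by (rule proper) simp
    have "\<forall>p. \<exists>V. open V \<and> p \<in> V \<and> inj_on Z V" using loc by blast
    then obtain V where V: "\<And>p. open (V p) \<and> p \<in> V p \<and> inj_on Z (V p)" by metis
    have "finite F"
    proof -
      have op: "\<And>p. p \<in> F \<Longrightarrow> open (V p)" using V by blast
      have cov: "F \<subseteq> (\<Union>p\<in>F. V p)" using V by blast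
      obtain I where I: "I \<subseteq> F" "finite I" "F \<subseteq> (\<Union>p\<in>I. V p)"
        using compactE_image[OF compF op cov] by metis
      have "F \<subseteq> I"
      proof
        fix p assume p: "p \<in> F"
        then obtain x where x: "x \<in> I" "p \<in> V x" using I(3) by blast
        then have "Z p = Z x" using p I(1) by (auto simp: F_def)
        then have "p = x" using V[of x] x(2) by (meson inj_onD)
        then show "p \<in> I" using x(1) by simp
      qed
      then show ?thesis using I(2) by (rule finite_subset)
    qed
    have "\<exists>d>0. \<forall>p\<in>F. \<forall>p'\<in>F. p \<noteq> p' \<longrightarrow> d \<le> dist p p'"
    proof -
      \<comment> \<open>The element 1 keeps the minimum defined for a fibre with at most one
        point.\<close>
      define D where "D = insert 1 {dist p p' |p p'. p \<in> F \<and> p' \<in> F \<and> p \<noteq> p'}"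
      have "{dist p p' |p p'. p \<in> F \<and> p' \<in> F \<and> p \<noteq> p'} \<subseteq> (\<lambda>(p, p'). dist p p') ` (F \<times> F)" by auto
      then have fin: "finite D" unfolding D_def using \<open>finite F\<close> finite_subset by blast
      have "Min D \<in> D" using fin by (intro Min_in) (auto simp: D_def)
      then have "0 < Min D" by (auto simp: D_def)
      moreover have "Min D \<le> dist p p'" if "p \<in> F" "p' \<in> F" "p \<noteq> p'" for p p'
        using fin that by (intro Min_le) (auto simp: D_def)
      ultimately show ?thesis by blast
    qed
    then obtain d where d: "0 < d" "\<And>p p'. p \<in> F \<Longrightarrow> p' \<in> F \<Longrightarrow> p \<noteq> p' \<Longrightarrow> d \<le> dist p p'" by blast
    define U where "U = (\<lambda>p. V p \<inter> ball p (d / 2))"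
    have U: "open (U p)" "p \<in> U p" "inj_on Z (U p)" for p
      using V[of p] d(1) by (auto simp: U_def intro: inj_on_subset)
    have disjU: "U p \<inter> U p' = {}" if "p \<in> F" "p' \<in> F" "p \<noteq> p'" for p p'
    proof -
      have False if "x \<in> U p" "x \<in> U p'" for x
      proof -
        have "dist p x < d / 2" "dist p' x < d / 2" using that by (auto simp: U_def)
        then have "dist p p' < d" using dist_triangle2[of p p' x] by linarith
        then show False using d(2) \<open>p \<in> F\<close> \<open>p' \<in> F\<close> \<open>p \<noteq> p'\<close> by fastforce
      qed
      then show ?thesis by blast
    qed
    \<comment> \<open>The values over the disc that are attained outside the chosen sheets. By
      properness they form a closed set missing z, so after removing them nothing but the sheets
      lies over the neighbourhood.\<close>
    define R where "R = Z ` (Z -` cball z 1 - (\<Union>p\<in>F. U p))"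
    have "compact (Z -` cball z 1 - (\<Union>p\<in>F. U p))"
      by (rule compact_diff) (auto intro: proper U)
    then have "closed R" unfolding R_def by (intro compact_imp_closed compact_continuous_image cS)
    define T where "T = ball z 1 \<inter> (\<Inter>p\<in>F. Z ` U p) - R"
    have oT: "open T"
      unfolding T_def using \<open>finite F\<close> \<open>closed R\<close> by (intro open_Diff open_Int open_INT) (auto intro: opmap U)
    have zT: "z \<in> T"
    proof -
      have "z \<in> Z ` U p" if "p \<in> F" for p using that U(2)[of p] by (auto simp: F_def)
      moreover have "z \<notin> R" using U(2) by (auto simp: R_def F_def)
      ultimately show ?thesis by (simp add: T_def)
    qed
    define S where "S = (\<lambda>p. U p \<inter> Z -` T)"
    have oS: "open (S p)" for p
      unfolding S_def using U(1) oT continuous_open_vimage[OF oT] cont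
      by (metis continuous_on_open_vimage open_Int open_UNIV Int_UNIV_right)
    have ZS: "Z ` S p = T" if "p \<in> F" for p
    proof
      show "T \<subseteq> Z ` S p"
      proof
        fix y assume y: "y \<in> T"
        then obtain x where "x \<in> U p" "y = Z x" using \<open>p \<in> F\<close> by (auto simp: T_def)
        then show "y \<in> Z ` S p" using y by (auto simp: S_def)
      qed
    qed (auto simp: S_def)
    have un: "(\<Union>p\<in>F. S p) = Z -` T"
    proof
      show "Z -` T \<subseteq> (\<Union>p\<in>F. S p)"
      proof
        fix x assume x: "x \<in> Z -` T"
        then have "x \<in> Z -` cball z 1" "Z x \<notin> R" by (auto simp: T_def)
        then have "x \<in> (\<Union>p\<in>F. U p)" by (auto simp: R_def)
        then show "x \<in> (\<Union>p\<in>F. S p)" using x by (auto simp: S_def)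
      qed
    qed (auto simp: S_def)
    show "\<exists>T. z \<in> T \<and> openin (top_of_set UNIV) T \<and>
      (\<exists>v. \<Union> v = UNIV \<inter> Z -` T \<and> (\<forall>u\<in>v. openin (top_of_set UNIV) u) \<and> disjoint v \<and>
        (\<forall>u\<in>v. \<exists>q. homeomorphism u T Z q))"
    proof (intro exI[of _ T] conjI zT exI[of _ "S ` F"])
      show "openin (top_of_set UNIV) T" using oT by simp
      show "\<Union> (S ` F) = UNIV \<inter> Z -` T" using un by simp
      show "\<forall>u\<in>S ` F. openin (top_of_set UNIV) u" using oS by simp
      show "disjoint (S ` F)"
        using disjU by (auto simp: disjoint_def S_def)
      show "\<forall>u\<in>S ` F. \<exists>q. homeomorphism u T Z q"
      proof
        fix u assume "u \<in> S ` F"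
        then obtain p where p: "p \<in> F" "u = S p" by auto
        have "inj_on Z (S p)" by (rule inj_on_subset[OF U(3)[of p]]) (auto simp: S_def)
        then obtain q where "homeomorphism (S p) (Z ` S p) Z q"
          using invariance_of_domain_homeomorphism[OF oS cS] dim by (metis order_refl)
        then show "\<exists>q. homeomorphism u T Z q" using ZS[OF p(1)] p(2) by auto
      qed
    qed
  qed (use cont surj in auto)
qed

text \<open>A section of the covering exists because the plane is simply connected; its image is open and
  closed.\<close>

lemma proper_locally_injective_imp_inj:
  fixes Z :: "'a::euclidean_space \<Rightarrow> 'b::euclidean_space"
  assumes cont: "continuous_on UNIV Z" and dim: "DIM('b) = DIM('a)"
    and loc: "\<And>p. \<exists>V. open V \<and> p \<in> V \<and> inj_on Z V"
    and proper: "\<And>K. compact K \<Longrightarrow> compact (Z -` K)"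
  shows "inj Z"
proof -
  have cov: "covering_space UNIV Z UNIV"
    by (rule proper_locally_injective_imp_covering_space[OF assms])
  obtain g where g: "continuous_on UNIV g" "\<And>y. Z (g y) = y"
    by (rule covering_space_lift[OF cov, of UNIV "\<lambda>y. y"])
       (auto intro: convex_imp_simply_connected convex_imp_locally_path_connected)
  have "inj g" using g(2) by (metis injI)
  then have "open (range g)"
    by (intro invariance_of_domain_gen) (use g dim in auto)
  moreover have "closed (range g)"
  proof -
    have "range g = {p. g (Z p) = p}" using g(2) by (auto, metis rangeI)
    moreover have "closed {p. g (Z p) = p}"
      by (intro closed_Collect_eq continuous_intros continuous_on_compose2[OF g(1) cont]) auto
    ultimately show ?thesis by simp
  qed
  ultimately have "range g = UNIV" using clopen[of "range g"] by auto
  then show "inj Z" using g(2) by (metis injI rangeE UNIV_I)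
qed

text \<open>The increments are left general: 1 and \<tau> describe the primitive, 0 and 0 the
  periodic coefficients of the form.\<close>

lemma quasi_periodic_shift:
  fixes Z :: "real \<times> real \<Rightarrow> complex"
  assumes 1: "\<And>x y. Z (x + 1, y) = Z (x, y) + c" and 2: "\<And>x y. Z (x, y + 1) = Z (x, y) + d"
  shows "Z (x + of_int j, y + of_int k) = Z (x, y) + of_int j * c + of_int k * d"
proof -
  have X: "Z (x + of_int j, y) = Z (x, y) + of_int j * c" for x y j
  proof (induction j rule: int_induct[where k = 0])
    case (step1 i)
    then show ?case using 1[of "x + of_int i" y] by (simp add: algebra_simps)
  next
    case (step2 i)
    then show ?case using 1[of "x + of_int (i - 1)" y] by (simp add: algebra_simps)
  qed simp
  have Y: "Z (x, y + of_int k) = Z (x, y) + of_int k * d" for x y k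
  proof (induction k rule: int_induct[where k = 0])
    case (step1 i)
    then show ?case using 2[of x "y + of_int i"] by (simp add: algebra_simps)
  next
    case (step2 i)
    then show ?case using 2[of x "y + of_int (i - 1)"] by (simp add: algebra_simps)
  qed simp
  show ?thesis by (simp add: X Y)
qed

text \<open>Up to a bounded error coming from the unit square, Z maps (x, y) to the lattice point of
  the integer parts. A bound on Z thus bounds first the integer part of y, through Im \<tau> > 0,
  and then that of x.\<close>

lemma quasi_periodic_proper:
  fixes Z :: "real \<times> real \<Rightarrow> complex"
  assumes cont: "continuous_on UNIV Z" and \<tau>: "Im \<tau> > 0"
    and 1: "\<And>x y. Z (x + 1, y) = Z (x, y) + 1" and 2: "\<And>x y. Z (x, y + 1) = Z (x, y) + \<tau>"
    and K: "compact K"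
  shows "compact (Z -` K)"
proof -
  have "closed (Z -` K)"
    by (rule closed_vimage[OF compact_imp_closed[OF K] cont])
  moreover have "bounded (Z -` K)"
  proof -
    have "bounded (Z ` ({0..1} \<times> {0..1}))"
      by (intro compact_imp_bounded compact_continuous_image continuous_on_subset[OF cont] compact_Times) auto
    then obtain M where M: "\<And>p. p \<in> {0..1} \<times> {0..1} \<Longrightarrow> cmod (Z p) \<le> M"
      by (auto simp: bounded_iff)
    obtain N where N: "\<And>z. z \<in> K \<Longrightarrow> cmod z \<le> N" using compact_imp_bounded[OF K] by (auto simp: bounded_iff)
    define B2 where "B2 = (N + M) / Im \<tau> + 1"
    define B1 where "B1 = N + M + B2 * \<bar>Re \<tau>\<bar> + 1 + \<bar>Re \<tau>\<bar>"
    have "norm p \<le> B1 + B2" if "p \<in> Z -` K" for p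
    proof -
      obtain x y where p: "p = (x, y)" by fastforce
      have e: "Z (x, y) = Z (frac x, frac y) + of_int \<lfloor>x\<rfloor> + of_int \<lfloor>y\<rfloor> * \<tau>"
        using quasi_periodic_shift[of Z 1 \<tau> "frac x" "\<lfloor>x\<rfloor>" "frac y" "\<lfloor>y\<rfloor>"] 1 2
        by (simp add: frac_def)
      define w where "w = of_int \<lfloor>x\<rfloor> + of_int \<lfloor>y\<rfloor> * \<tau>"
      have "w = Z p - Z (frac x, frac y)" using e by (simp add: w_def p)
      then have "cmod w \<le> cmod (Z p) + cmod (Z (frac x, frac y))"
        using norm_triangle_ineq4[of "Z p" "Z (frac x, frac y)"] by simp
      also have "\<dots> \<le> N + M"
        using that N M[of "(frac x, frac y)"] by (intro add_mono) (auto simp: frac_ge_0 frac_lt_1 less_imp_le)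
      finally have w: "cmod w \<le> N + M" .
      have "\<bar>of_int \<lfloor>y\<rfloor> * Im \<tau>\<bar> \<le> N + M" using abs_Im_le_cmod[of w] w by (simp add: w_def)
      then have "\<bar>real_of_int \<lfloor>y\<rfloor>\<bar> \<le> (N + M) / Im \<tau>" using \<tau> by (simp add: abs_mult field_simps)
      then have y: "\<bar>y\<bar> \<le> B2" unfolding B2_def by linarith
      have "\<bar>of_int \<lfloor>x\<rfloor> + of_int \<lfloor>y\<rfloor> * Re \<tau>\<bar> \<le> N + M" using abs_Re_le_cmod[of w] w by (simp add: w_def)
      moreover have "\<bar>of_int \<lfloor>y\<rfloor> * Re \<tau>\<bar> \<le> (B2 + 1) * \<bar>Re \<tau>\<bar>"
      proof -
        have "\<bar>real_of_int \<lfloor>y\<rfloor>\<bar> \<le> B2 + 1" using y by linarith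
        then show ?thesis unfolding abs_mult by (rule mult_right_mono) simp
      qed
      ultimately have "\<bar>real_of_int \<lfloor>x\<rfloor>\<bar> \<le> N + M + (B2 + 1) * \<bar>Re \<tau>\<bar>" by linarith
      then have "\<bar>x\<bar> \<le> B1" unfolding B1_def distrib_right by linarith
      then show ?thesis using y norm_Pair_le[of x y] by (simp add: p)
    qed
    then show ?thesis unfolding bounded_iff by blast
  qed
  ultimately show ?thesis by (simp add: compact_eq_bounded_closed)
qed

section \<open>Green's formula in the coordinate Z\<close>

lemma integral_dx_cbox:
  fixes F :: "real \<times> real \<Rightarrow> complex"
  assumes C1: "C1_on (cbox (x0, y0) (x1, y1)) F" and le: "x0 \<le> x1"
  shows "integral (cbox (x0, y0) (x1, y1)) (dx F) = integral {y0..y1} (\<lambda>y. F (x1, y) - F (x0, y))"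
proof -
  have c: "continuous_on (cbox (x0, y0) (x1, y1)) (dx F)" using C1 by (simp add: C1_on_def)
  have "integral (cbox (x0, y0) (x1, y1)) (dx F) = integral (cbox x0 x1) (\<lambda>x. integral (cbox y0 y1) (\<lambda>y. dx F (x, y)))"
    by (rule integral_prod_continuous[OF c])
  also have "\<dots> = integral (cbox y0 y1) (\<lambda>y. integral (cbox x0 x1) (\<lambda>x. dx F (x, y)))"
    by (rule integral_swap_continuous) (use c in \<open>simp add: case_prod_eta\<close>)
  also have "\<dots> = integral (cbox y0 y1) (\<lambda>y. F (x1, y) - F (x0, y))"
  proof (rule integral_cong)
    fix y assume y: "y \<in> cbox y0 y1"
    have "((\<lambda>x. dx F (x, y)) has_integral F (x1, y) - F (x0, y)) {x0..x1}"
    proof (rule fundamental_theorem_of_calculus[OF le])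
      fix x assume "x \<in> {x0..x1}"
      then have "(x, y) \<in> cbox (x0, y0) (x1, y1)" using y by simp
      then have d: "(F has_derivative (\<lambda>h. fst h *\<^sub>R dx F (x, y) + snd h *\<^sub>R dy F (x, y))) (at (x, y))"
        by (rule C1_on_has_derivative[OF C1])
      have "((\<lambda>x. (x, y)) has_vector_derivative (1, 0)) (at x within {x0..x1})"
        by (intro has_vector_derivative_Pair) (auto intro!: derivative_eq_intros)
      from vector_derivative_diff_chain_within[OF this has_derivative_at_withinI[OF d]]
      show "((\<lambda>x. F (x, y)) has_vector_derivative dx F (x, y)) (at x within {x0..x1})"
        by (simp add: o_def)
    qed
    then show "integral (cbox x0 x1) (\<lambda>x. dx F (x, y)) = F (x1, y) - F (x0, y)"
      by (simp add: integral_unique)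
  qed
  finally show ?thesis by simp
qed

lemma integral_dy_cbox:
  fixes F :: "real \<times> real \<Rightarrow> complex"
  assumes C1: "C1_on (cbox (x0, y0) (x1, y1)) F" and le: "y0 \<le> y1"
  shows "integral (cbox (x0, y0) (x1, y1)) (dy F) = integral {x0..x1} (\<lambda>x. F (x, y1) - F (x, y0))"
proof -
  have c: "continuous_on (cbox (x0, y0) (x1, y1)) (dy F)" using C1 by (simp add: C1_on_def)
  have "integral (cbox (x0, y0) (x1, y1)) (dy F) = integral (cbox x0 x1) (\<lambda>x. integral (cbox y0 y1) (\<lambda>y. dy F (x, y)))"
    by (rule integral_prod_continuous[OF c])
  also have "\<dots> = integral (cbox x0 x1) (\<lambda>x. F (x, y1) - F (x, y0))"
  proof (rule integral_cong)
    fix x assume x: "x \<in> cbox x0 x1"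
    have "((\<lambda>y. dy F (x, y)) has_integral F (x, y1) - F (x, y0)) {y0..y1}"
    proof (rule fundamental_theorem_of_calculus[OF le])
      fix y assume "y \<in> {y0..y1}"
      then have "(x, y) \<in> cbox (x0, y0) (x1, y1)" using x by simp
      then have d: "(F has_derivative (\<lambda>h. fst h *\<^sub>R dx F (x, y) + snd h *\<^sub>R dy F (x, y))) (at (x, y))"
        by (rule C1_on_has_derivative[OF C1])
      have "((\<lambda>y. (x, y)) has_vector_derivative (0, 1)) (at y within {y0..y1})"
        by (intro has_vector_derivative_Pair) (auto intro!: derivative_eq_intros)
      from vector_derivative_diff_chain_within[OF this has_derivative_at_withinI[OF d]]
      show "((\<lambda>y. F (x, y)) has_vector_derivative dy F (x, y)) (at y within {y0..y1})"
        by (simp add: o_def)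
    qed
    then show "integral (cbox y0 y1) (\<lambda>y. dy F (x, y)) = F (x, y1) - F (x, y0)"
      by (simp add: integral_unique)
  qed
  finally show ?thesis by simp
qed

lemma C1_onI:
  fixes f :: "real \<times> real \<Rightarrow> complex"
  assumes der: "\<And>p. p \<in> U \<Longrightarrow> (f has_derivative (\<lambda>h. of_real (fst h) * fx p + of_real (snd h) * fy p)) (at p)"
    and cont: "continuous_on U fx" "continuous_on U fy"
  shows "C1_on U f" "\<And>p. p \<in> U \<Longrightarrow> dx f p = fx p" "\<And>p. p \<in> U \<Longrightarrow> dy f p = fy p"
proof -
  show e: "\<And>p. p \<in> U \<Longrightarrow> dx f p = fx p" "\<And>p. p \<in> U \<Longrightarrow> dy f p = fy p"
    using dx_dy_eqI[OF der] by auto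
  have "continuous_on U (dx f)" "continuous_on U (dy f)"
    using cont e by (simp_all cong: continuous_on_cong)
  moreover have "f differentiable (at p)" if "p \<in> U" for p
    using der[OF that] by (auto simp: differentiable_def)
  ultimately show "C1_on U f" by (simp add: C1_on_def)
qed

lemma C1_on_has_derivative':
  fixes f :: "real \<times> real \<Rightarrow> complex"
  assumes "C1_on U f" "p \<in> U"
  shows "(f has_derivative (\<lambda>h. of_real (fst h) * dx f p + of_real (snd h) * dy f p)) (at p)"
  using C1_on_has_derivative[OF assms] by (simp add: scaleR_conv_of_real)

lemma C1_on_mult:
  fixes f g :: "real \<times> real \<Rightarrow> complex"
  assumes f: "C1_on U f" and g: "C1_on U g"
  shows "C1_on U (\<lambda>p. f p * g p)"
    "\<And>p. p \<in> U \<Longrightarrow> dx (\<lambda>p. f p * g p) p = f p * dx g p + dx f p * g p"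
    "\<And>p. p \<in> U \<Longrightarrow> dy (\<lambda>p. f p * g p) p = f p * dy g p + dy f p * g p"
proof -
  have d: "((\<lambda>p. f p * g p) has_derivative (\<lambda>h. of_real (fst h) * (f p * dx g p + dx f p * g p) +
      of_real (snd h) * (f p * dy g p + dy f p * g p))) (at p)" if "p \<in> U" for p
    by (rule has_derivative_eq_rhs[OF has_derivative_mult[OF C1_on_has_derivative'[OF f that] C1_on_has_derivative'[OF g that]]])
       (simp add: fun_eq_iff algebra_simps)
  have c: "continuous_on U (\<lambda>p. f p * dx g p + dx f p * g p)" "continuous_on U (\<lambda>p. f p * dy g p + dy f p * g p)"
    using f g C1_on_imp_continuous_on[OF f] C1_on_imp_continuous_on[OF g]
    unfolding C1_on_def by (auto intro!: continuous_intros)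
  show "C1_on U (\<lambda>p. f p * g p)" by (rule C1_onI(1)[OF d c])
  show "dx (\<lambda>p. f p * g p) p = f p * dx g p + dx f p * g p" if "p \<in> U" for p by (rule C1_onI(2)[OF d c that])
  show "dy (\<lambda>p. f p * g p) p = f p * dy g p + dy f p * g p" if "p \<in> U" for p by (rule C1_onI(3)[OF d c that])
qed

lemma C1_on_add:
  fixes f g :: "real \<times> real \<Rightarrow> complex"
  assumes f: "C1_on U f" and g: "C1_on U g"
  shows "C1_on U (\<lambda>p. f p + g p)"
    "\<And>p. p \<in> U \<Longrightarrow> dx (\<lambda>p. f p + g p) p = dx f p + dx g p"
    "\<And>p. p \<in> U \<Longrightarrow> dy (\<lambda>p. f p + g p) p = dy f p + dy g p"
proof -
  have d: "((\<lambda>p. f p + g p) has_derivative (\<lambda>h. of_real (fst h) * (dx f p + dx g p) +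
      of_real (snd h) * (dy f p + dy g p))) (at p)" if "p \<in> U" for p
    by (rule has_derivative_eq_rhs[OF has_derivative_add[OF C1_on_has_derivative'[OF f that] C1_on_has_derivative'[OF g that]]])
       (simp add: fun_eq_iff algebra_simps)
  have c: "continuous_on U (\<lambda>p. dx f p + dx g p)" "continuous_on U (\<lambda>p. dy f p + dy g p)"
    using f g unfolding C1_on_def by (auto intro!: continuous_intros)
  show "C1_on U (\<lambda>p. f p + g p)" by (rule C1_onI(1)[OF d c])
  show "dx (\<lambda>p. f p + g p) p = dx f p + dx g p" if "p \<in> U" for p by (rule C1_onI(2)[OF d c that])
  show "dy (\<lambda>p. f p + g p) p = dy f p + dy g p" if "p \<in> U" for p by (rule C1_onI(3)[OF d c that])
qed

lemma C1_on_const: "C1_on U (\<lambda>p. c :: complex)" "dx (\<lambda>p. c :: complex) p = 0" "dy (\<lambda>p. c :: complex) p = 0"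
  using C1_onI[of U "\<lambda>_. c" "\<lambda>_. 0" "\<lambda>_. 0"] C1_onI(2,3)[of UNIV "\<lambda>_. c" "\<lambda>_. 0" "\<lambda>_. 0"]
  by (auto intro!: derivative_eq_intros)

text \<open>\<open>cauchy_reg \<delta>\<close> is a smooth approximation of \<open>1 / w\<close>; its antiholomorphic derivative is
  \<open>reg_mass \<delta>\<close>, an approximation of \<open>pi\<close> times the delta function.\<close>

definition cauchy_reg :: "real \<Rightarrow> complex \<Rightarrow> complex" where
  "cauchy_reg \<delta> w = cnj w / of_real ((cmod w)\<^sup>2 + \<delta>)"

definition reg_mass :: "real \<Rightarrow> complex \<Rightarrow> complex" where
  "reg_mass \<delta> w = of_real (\<delta> / ((cmod w)\<^sup>2 + \<delta>)\<^sup>2)"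

locale closed_form_primitive =
  fixes A B Z :: "real \<times> real \<Rightarrow> complex"
  assumes A_C1: "C1_on UNIV A" and B_C1: "C1_on UNIV B"
    and closed: "\<And>p. dx B p = dy A p"
    and Z_deriv: "\<And>p. (Z has_derivative (\<lambda>h. of_real (fst h) * A p + of_real (snd h) * B p)) (at p)"
begin

definition field :: "(real \<times> real \<Rightarrow> complex) \<Rightarrow> real \<times> real \<Rightarrow> complex" where
  "field \<phi> p = B p * dx \<phi> p - A p * dy \<phi> p"

text \<open>The coefficient of dZ wedged with its conjugate, which is -2 i times the real Jacobian
  determinant of Z. This explains why the masses below tend to -2 pi i although
  \<open>reg_mass\<close> approximates pi times a delta function.\<close>

definition jacobian :: "real \<times> real \<Rightarrow> complex" where
  "jacobian p = A p * cnj (B p) - B p * cnj (A p)"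

lemma A_cont: "continuous_on S A" and B_cont: "continuous_on S B" and Z_cont: "continuous_on S Z"
proof -
  have "continuous_on UNIV Z"
    by (rule has_derivative_continuous_on[OF has_derivative_at_withinI[OF Z_deriv]])
  then show "continuous_on S A" "continuous_on S B" "continuous_on S Z"
    using C1_on_imp_continuous_on[OF A_C1] C1_on_imp_continuous_on[OF B_C1]
    by (auto intro: continuous_on_subset)
qed

lemma jacobian_cont: "continuous_on S jacobian"
  unfolding jacobian_def by (intro continuous_intros A_cont B_cont)

text \<open>Closedness makes the field divergence free, so the integrand is the divergence of G
  \<phi> (B, -A).\<close>

lemma green_product:
  assumes G: "C1_on (cbox (x0, y0) (x1, y1)) G" and \<phi>: "C1_on (cbox (x0, y0) (x1, y1)) \<phi>"
    and le: "x0 \<le> x1" "y0 \<le> y1"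
  shows "integral (cbox (x0, y0) (x1, y1)) (\<lambda>p. G p * field \<phi> p + \<phi> p * field G p) =
    integral {y0..y1} (\<lambda>y. B (x1, y) * (G (x1, y) * \<phi> (x1, y)) - B (x0, y) * (G (x0, y) * \<phi> (x0, y))) -
    integral {x0..x1} (\<lambda>x. A (x, y1) * (G (x, y1) * \<phi> (x, y1)) - A (x, y0) * (G (x, y0) * \<phi> (x, y0)))"
proof -
  let ?R = "cbox (x0, y0) (x1, y1)"
  have A: "C1_on ?R A" and B: "C1_on ?R B"
    using A_C1 B_C1 by (auto intro: C1_on_subset)
  note G\<phi> = C1_on_mult[OF G \<phi>]
  note BG = C1_on_mult[OF B G\<phi>(1)] and AG = C1_on_mult[OF A G\<phi>(1)]
  have "integral ?R (\<lambda>p. G p * field \<phi> p + \<phi> p * field G p) =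
      integral ?R (\<lambda>p. dx (\<lambda>p. B p * (G p * \<phi> p)) p - dy (\<lambda>p. A p * (G p * \<phi> p)) p)"
  proof (rule integral_cong)
    fix p assume p: "p \<in> ?R"
    show "G p * field \<phi> p + \<phi> p * field G p = dx (\<lambda>p. B p * (G p * \<phi> p)) p - dy (\<lambda>p. A p * (G p * \<phi> p)) p"
      unfolding BG(2)[OF p] AG(3)[OF p] G\<phi>(2)[OF p] G\<phi>(3)[OF p] closed field_def
      by (simp add: algebra_simps)
  qed
  also have "\<dots> = integral ?R (dx (\<lambda>p. B p * (G p * \<phi> p))) - integral ?R (dy (\<lambda>p. A p * (G p * \<phi> p)))"
    using BG(1) AG(1) by (intro Henstock_Kurzweil_Integration.integral_diff integrable_continuous) (auto simp: C1_on_def)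
  also have "integral ?R (dx (\<lambda>p. B p * (G p * \<phi> p))) =
      integral {y0..y1} (\<lambda>y. B (x1, y) * (G (x1, y) * \<phi> (x1, y)) - B (x0, y) * (G (x0, y) * \<phi> (x0, y)))"
    by (rule integral_dx_cbox[OF BG(1) le(1)])
  also have "integral ?R (dy (\<lambda>p. A p * (G p * \<phi> p))) =
      integral {x0..x1} (\<lambda>x. A (x, y1) * (G (x, y1) * \<phi> (x, y1)) - A (x, y0) * (G (x, y0) * \<phi> (x, y0)))"
    by (rule integral_dy_cbox[OF AG(1) le(2)])
  finally show ?thesis .
qed

text \<open>The field annihilates Z and sends the conjugate of Z to -\<open>jacobian\<close>, so
  only the antiholomorphic derivative of the regularised kernel survives.\<close>

lemma cauchy_reg_Z:
  assumes \<delta>: "0 < \<delta>"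
  shows "C1_on U (\<lambda>p. cauchy_reg \<delta> (Z p - c))"
    and "field (\<lambda>p. cauchy_reg \<delta> (Z p - c)) p = - (jacobian p * reg_mass \<delta> (Z p - c))"
proof -
  define D where "D = (\<lambda>p. (Z p - c) * cnj (Z p - c) + of_real \<delta>)"
  define N where "N = (\<lambda>p. cnj (Z p - c))"
  define g where "g = (\<lambda>V p. (of_real \<delta> * cnj (V p) - (N p)\<^sup>2 * V p) / (D p)\<^sup>2)"
  have D: "D p = of_real ((cmod (Z p - c))\<^sup>2 + \<delta>)" for p
    unfolding D_def of_real_add complex_norm_square ..
  have D0: "D p \<noteq> 0" for p
    unfolding D of_real_eq_0_iff using \<delta> by (simp add: add_nonneg_pos less_imp_neq[symmetric])
  have G: "cauchy_reg \<delta> (Z p - c) = N p / D p" for p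
    unfolding cauchy_reg_def N_def D ..
  have dN: "(N has_derivative (\<lambda>h. of_real (fst h) * cnj (A p) + of_real (snd h) * cnj (B p))) (at p)" for p
    unfolding N_def
    by (rule has_derivative_eq_rhs[OF has_derivative_cnj[OF has_derivative_diff[OF Z_deriv has_derivative_const]]]) (simp add: fun_eq_iff)
  have dD: "(D has_derivative (\<lambda>h. (Z p - c) * (of_real (fst h) * cnj (A p) + of_real (snd h) * cnj (B p)) +
       (of_real (fst h) * A p + of_real (snd h) * B p) * N p)) (at p)" for p
    unfolding D_def
    by (rule has_derivative_eq_rhs[OF has_derivative_add[OF has_derivative_mult[OF has_derivative_diff[OF Z_deriv has_derivative_const] dN[unfolded N_def]] has_derivative_const]])
       (simp add: fun_eq_iff N_def)
  have "((\<lambda>p. N p / D p) has_derivative (\<lambda>h. of_real (fst h) * g A p + of_real (snd h) * g B p)) (at p)" for p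
  proof (rule has_derivative_eq_rhs[OF has_derivative_divide'[OF dN dD D0]])
    have e: "D p = (Z p - c) * N p + of_real \<delta>" by (simp add: D_def N_def)
    show "(\<lambda>h. ((of_real (fst h) * cnj (A p) + of_real (snd h) * cnj (B p)) * D p -
        N p * ((Z p - c) * (of_real (fst h) * cnj (A p) + of_real (snd h) * cnj (B p)) +
       (of_real (fst h) * A p + of_real (snd h) * B p) * N p)) / (D p * D p)) =
       (\<lambda>h. of_real (fst h) * g A p + of_real (snd h) * g B p)"
    proof
      fix h :: "real \<times> real"
      have "(of_real (fst h) * cnj (A p) + of_real (snd h) * cnj (B p)) * D p -
        N p * ((Z p - c) * (of_real (fst h) * cnj (A p) + of_real (snd h) * cnj (B p)) +
       (of_real (fst h) * A p + of_real (snd h) * B p) * N p) =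
        of_real (fst h) * (of_real \<delta> * cnj (A p) - (N p)\<^sup>2 * A p) + of_real (snd h) * (of_real \<delta> * cnj (B p) - (N p)\<^sup>2 * B p)"
        unfolding e by (simp add: algebra_simps power2_eq_square)
      then show "((of_real (fst h) * cnj (A p) + of_real (snd h) * cnj (B p)) * D p -
        N p * ((Z p - c) * (of_real (fst h) * cnj (A p) + of_real (snd h) * cnj (B p)) +
       (of_real (fst h) * A p + of_real (snd h) * B p) * N p)) / (D p * D p) =
       of_real (fst h) * g A p + of_real (snd h) * g B p"
        by (simp add: g_def add_divide_distrib power2_eq_square)
    qed
  qed
  then have d: "((\<lambda>p. cauchy_reg \<delta> (Z p - c)) has_derivative (\<lambda>h. of_real (fst h) * g A p + of_real (snd h) * g B p)) (at p)" for p
    unfolding G .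
  have c: "continuous_on S (g V)" if "continuous_on S V" for S V
    unfolding g_def N_def D_def
    by (intro continuous_intros that Z_cont) (use D0 in \<open>simp add: D_def\<close>)
  show "C1_on U (\<lambda>p. cauchy_reg \<delta> (Z p - c))"
    by (rule C1_onI(1)[OF d c c]) (intro A_cont B_cont)+
  have e: "dx (\<lambda>p. cauchy_reg \<delta> (Z p - c)) p = g A p"
    by (rule C1_onI(2)[OF d c[OF A_cont] c[OF B_cont] UNIV_I])
  have e': "dy (\<lambda>p. cauchy_reg \<delta> (Z p - c)) p = g B p"
    by (rule C1_onI(3)[OF d c[OF A_cont] c[OF B_cont] UNIV_I])
  have "B p * g A p - A p * g B p = - ((A p * cnj (B p) - B p * cnj (A p)) * (of_real \<delta> / (D p)\<^sup>2))"
    using D0[of p] by (simp add: g_def field_simps)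
  then show "field (\<lambda>p. cauchy_reg \<delta> (Z p - c)) p = - (jacobian p * reg_mass \<delta> (Z p - c))"
    unfolding field_def e e' jacobian_def reg_mass_def D by simp
qed

text \<open>By the chain rule the gradient of k(Z - c) is a multiple of (A, B), which the field
  annihilates.\<close>

lemma holomorphic_Z:
  assumes "k holomorphic_on S" "open S" "\<And>p. p \<in> U \<Longrightarrow> Z p - c \<in> S"
  shows "C1_on U (\<lambda>p. k (Z p - c))" and "\<And>p. p \<in> U \<Longrightarrow> field (\<lambda>p. k (Z p - c)) p = 0"
proof -
  have d: "((\<lambda>p. k (Z p - c)) has_derivative (\<lambda>h. of_real (fst h) * (deriv k (Z p - c) * A p) + of_real (snd h) * (deriv k (Z p - c) * B p))) (at p)"
    if "p \<in> U" for p
  proof -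
    have "(k has_field_derivative deriv k (Z p - c)) (at (Z p - c))"
      by (rule holomorphic_derivI[OF assms(1,2) assms(3)[OF that]])
    then have "(k has_derivative (\<lambda>h. deriv k (Z p - c) * h)) (at (Z p - c))"
      by (simp add: has_field_derivative_def)
    from diff_chain_at[OF has_derivative_diff[OF Z_deriv has_derivative_const] this]
    have "((\<lambda>p. k (Z p - c)) has_derivative
        (\<lambda>h. deriv k (Z p - c) * (of_real (fst h) * A p + of_real (snd h) * B p - 0))) (at p)"
      by (simp add: o_def)
    then show ?thesis by (rule has_derivative_eq_rhs) (simp add: fun_eq_iff algebra_simps)
  qed
  have "continuous_on S (deriv k)"
    using holomorphic_deriv[OF assms(1,2)] by (rule holomorphic_on_imp_continuous_on)
  then have "continuous_on U (\<lambda>p. deriv k (Z p - c))"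
    by (rule continuous_on_compose2) (use assms(3) in \<open>auto intro!: continuous_intros Z_cont\<close>)
  then have c: "continuous_on U (\<lambda>p. deriv k (Z p - c) * A p)" "continuous_on U (\<lambda>p. deriv k (Z p - c) * B p)"
    by (auto intro!: continuous_intros A_cont B_cont)
  show "C1_on U (\<lambda>p. k (Z p - c))" by (rule C1_onI(1)[OF d c])
  show "field (\<lambda>p. k (Z p - c)) p = 0" if "p \<in> U" for p
  proof -
    have "dx (\<lambda>p. k (Z p - c)) p = deriv k (Z p - c) * A p" by (rule C1_onI(2)[OF d c that])
    moreover have "dy (\<lambda>p. k (Z p - c)) p = deriv k (Z p - c) * B p" by (rule C1_onI(3)[OF d c that])
    ultimately show ?thesis by (simp add: field_def)
  qed
qed

text \<open>The partial fraction form of \<open>theta_logder\<close>, with each 1 / (w - l) replaced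
  by its regularisation and the holomorphic remainder \<open>k\<close> kept.\<close>

definition reg_kernel :: "complex set \<Rightarrow> (complex \<Rightarrow> complex) \<Rightarrow> real \<Rightarrow> complex \<Rightarrow> complex" where
  "reg_kernel F k \<delta> w = (\<Sum>l\<in>F. cauchy_reg \<delta> (w - l)) + k w"

lemma reg_kernel_Z:
  assumes "finite F" "0 < \<delta>" "k holomorphic_on S" "open S" "\<And>p. p \<in> U \<Longrightarrow> Z p - z \<in> S"
  shows "C1_on U (\<lambda>p. reg_kernel F k \<delta> (Z p - z))"
    and "\<And>p. p \<in> U \<Longrightarrow> field (\<lambda>p. reg_kernel F k \<delta> (Z p - z)) p = - (jacobian p * (\<Sum>l\<in>F. reg_mass \<delta> (Z p - z - l)))"
proof -
  have s: "C1_on U (\<lambda>p. \<Sum>l\<in>F. cauchy_reg \<delta> (Z p - z - l)) \<and>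
      (\<forall>p\<in>U. field (\<lambda>p. \<Sum>l\<in>F. cauchy_reg \<delta> (Z p - z - l)) p = - (jacobian p * (\<Sum>l\<in>F. reg_mass \<delta> (Z p - z - l))))"
    using assms(1)
  proof (induction F rule: finite_induct)
    case empty
    then show ?case by (simp add: C1_on_const field_def)
  next
    case (insert l F)
    have r: "C1_on U (\<lambda>p. cauchy_reg \<delta> (Z p - z - l))"
      "field (\<lambda>p. cauchy_reg \<delta> (Z p - z - l)) p = - (jacobian p * reg_mass \<delta> (Z p - z - l))" for p
      using cauchy_reg_Z(1)[OF assms(2), where U = U and c = "z + l"] cauchy_reg_Z(2)[OF assms(2), where c = "z + l"]
      by (simp_all add: diff_diff_eq)
    note a = C1_on_add[OF r(1) conjunct1[OF insert.IH]]
    have "field (\<lambda>p. cauchy_reg \<delta> (Z p - z - l) + (\<Sum>l\<in>F. cauchy_reg \<delta> (Z p - z - l))) p =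
        - (jacobian p * (reg_mass \<delta> (Z p - z - l) + (\<Sum>l\<in>F. reg_mass \<delta> (Z p - z - l))))" if "p \<in> U" for p
    proof -
      have "field (\<lambda>p. cauchy_reg \<delta> (Z p - z - l) + (\<Sum>l\<in>F. cauchy_reg \<delta> (Z p - z - l))) p =
        field (\<lambda>p. cauchy_reg \<delta> (Z p - z - l)) p + field (\<lambda>p. \<Sum>l\<in>F. cauchy_reg \<delta> (Z p - z - l)) p"
        unfolding field_def a(2)[OF that] a(3)[OF that] by (simp add: algebra_simps)
      also have "\<dots> = - (jacobian p * reg_mass \<delta> (Z p - z - l)) + - (jacobian p * (\<Sum>l\<in>F. reg_mass \<delta> (Z p - z - l)))"
        using r(2) insert.IH that by simp
      finally show ?thesis by (simp add: algebra_simps)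
    qed
    then show ?case using a(1) insert.hyps by simp
  qed
  have h: "C1_on U (\<lambda>p. k (Z p - z))" by (rule holomorphic_Z(1)[OF assms(3,4,5)])
  have h': "field (\<lambda>p. k (Z p - z)) p = 0" if "p \<in> U" for p by (rule holomorphic_Z(2)[OF assms(3,4,5) that])
  note a = C1_on_add[OF conjunct1[OF s] h]
  show "C1_on U (\<lambda>p. reg_kernel F k \<delta> (Z p - z))" unfolding reg_kernel_def by (rule a(1))
  show "field (\<lambda>p. reg_kernel F k \<delta> (Z p - z)) p = - (jacobian p * (\<Sum>l\<in>F. reg_mass \<delta> (Z p - z - l)))" if "p \<in> U" for p
  proof -
    have "field (\<lambda>p. reg_kernel F k \<delta> (Z p - z)) p = field (\<lambda>p. \<Sum>l\<in>F. cauchy_reg \<delta> (Z p - z - l)) p + field (\<lambda>p. k (Z p - z)) p"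
      unfolding reg_kernel_def field_def a(2)[OF that] a(3)[OF that] by (simp add: algebra_simps)
    then show ?thesis using s h'[OF that] that by simp
  qed
qed

lemma reg_mass_cont:
  assumes "0 < \<delta>"
  shows "continuous_on S (reg_mass \<delta>)"
proof -
  have "(cmod w)\<^sup>2 + \<delta> \<noteq> 0" for w using assms by (simp add: add_nonneg_pos less_imp_neq[symmetric])
  then show ?thesis unfolding reg_mass_def by (intro continuous_intros) auto
qed

lemma green_regularised:
  assumes F: "finite F" and \<delta>: "0 < \<delta>" and k: "k holomorphic_on S" "open S"
    and sub: "\<And>p. p \<in> cbox (x0, y0) (x1, y1) \<Longrightarrow> Z p - z \<in> S"
    and \<phi>: "C1_on (cbox (x0, y0) (x1, y1)) \<phi>" and le: "x0 \<le> x1" "y0 \<le> y1"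
  defines "G \<equiv> \<lambda>p. reg_kernel F k \<delta> (Z p - z)"
  shows "integral (cbox (x0, y0) (x1, y1)) (\<lambda>p. G p * field \<phi> p) =
    (\<Sum>l\<in>F. integral (cbox (x0, y0) (x1, y1)) (\<lambda>p. \<phi> p * jacobian p * reg_mass \<delta> (Z p - z - l))) +
    integral {y0..y1} (\<lambda>y. B (x1, y) * (G (x1, y) * \<phi> (x1, y)) - B (x0, y) * (G (x0, y) * \<phi> (x0, y))) -
    integral {x0..x1} (\<lambda>x. A (x, y1) * (G (x, y1) * \<phi> (x, y1)) - A (x, y0) * (G (x, y0) * \<phi> (x, y0)))"
proof -
  let ?R = "cbox (x0, y0) (x1, y1)"
  have g: "C1_on ?R G"
    unfolding G_def by (rule reg_kernel_Z(1)[OF F \<delta> k sub])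
  have g': "field G p = - (jacobian p * (\<Sum>l\<in>F. reg_mass \<delta> (Z p - z - l)))" if "p \<in> ?R" for p
    unfolding G_def by (rule reg_kernel_Z(2)[OF F \<delta> k sub that])
  have cf: "continuous_on ?R (\<lambda>p. G p * field \<phi> p)"
    unfolding field_def using \<phi> C1_on_imp_continuous_on[OF g]
    by (intro continuous_intros A_cont B_cont) (auto simp: C1_on_def)
  have cm: "continuous_on ?R (\<lambda>p. \<phi> p * jacobian p * reg_mass \<delta> (Z p - z - l))" for l
    by (intro continuous_intros jacobian_cont C1_on_imp_continuous_on[OF \<phi>]
        continuous_on_compose2[OF reg_mass_cont[OF \<delta>, of UNIV]] Z_cont) auto
  have "integral ?R (\<lambda>p. G p * field \<phi> p + \<phi> p * field G p) =
      integral ?R (\<lambda>p. G p * field \<phi> p - (\<Sum>l\<in>F. \<phi> p * jacobian p * reg_mass \<delta> (Z p - z - l)))"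
    by (rule integral_cong) (simp add: g' sum_distrib_left mult.assoc)
  also have "\<dots> = integral ?R (\<lambda>p. G p * field \<phi> p) - integral ?R (\<lambda>p. \<Sum>l\<in>F. \<phi> p * jacobian p * reg_mass \<delta> (Z p - z - l))"
    by (intro Henstock_Kurzweil_Integration.integral_diff integrable_continuous cf continuous_on_sum cm)
  also have "integral ?R (\<lambda>p. \<Sum>l\<in>F. \<phi> p * jacobian p * reg_mass \<delta> (Z p - z - l)) =
      (\<Sum>l\<in>F. integral ?R (\<lambda>p. \<phi> p * jacobian p * reg_mass \<delta> (Z p - z - l)))"
    by (intro Henstock_Kurzweil_Integration.integral_sum F integrable_continuous cm)
  finally show ?thesis using green_product[OF g \<phi> le] by (simp add: algebra_simps)
qed

end

section \<open>Periodic forms and the theta kernel\<close>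

definition int_vec :: "int \<times> int \<Rightarrow> real \<times> real" where
  "int_vec n = (of_int (fst n), of_int (snd n))"

lemma lborel_integral_translate:
  fixes g :: "'a::euclidean_space \<Rightarrow> 'b::{banach, second_countable_topology}"
  assumes "g \<in> borel_measurable borel"
  shows "(LINT q|lborel. g (c + q)) = (LINT p|lborel. g p)"
proof -
  have "(LINT p|lborel. g p) = (LINT p|distr lborel borel ((+) c). g p)"
    by (simp add: lborel_distr_plus)
  also have "\<dots> = (LINT q|lborel. g (c + q))"
    by (rule integral_distr) (use assms in auto)
  finally show ?thesis by simp
qed

section \<open>Bounds and limits of the regularised Cauchy kernel\<close>

lemma norm_cauchy_reg_le:
  assumes "0 < \<delta>"
  shows "cmod (cauchy_reg \<delta> w) \<le> cmod (1 / w)"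
proof (cases "w = 0")
  case False
  have "cmod (cauchy_reg \<delta> w) = cmod w / \<bar>(cmod w)\<^sup>2 + \<delta>\<bar>"
    unfolding cauchy_reg_def norm_divide norm_of_real by simp
  also have "\<dots> \<le> cmod w / (cmod w)\<^sup>2"
    using False assms by (intro divide_left_mono mult_pos_pos) (auto simp: abs_if add_nonneg_pos)
  also have "\<dots> = cmod (1 / w)" using False by (simp add: norm_divide power2_eq_square)
  finally show ?thesis .
qed (simp add: cauchy_reg_def)

text \<open>The difference is exactly -\<delta> / (w (|w|^2 + \<delta>)). It provides uniform
  convergence on the boundary of the unit square, which stays away from the poles.\<close>

lemma cauchy_reg_diff_le:
  assumes "0 < \<delta>" "0 < m" "m \<le> cmod w"
  shows "cmod (cauchy_reg \<delta> w - 1 / w) \<le> \<delta> / m ^ 3"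
proof -
  have w: "w \<noteq> 0" "0 < cmod w" using assms by auto
  define D where "D = (cmod w)\<^sup>2 + \<delta>"
  have D: "0 < D" "(cmod w)\<^sup>2 \<le> D" using assms by (auto simp: D_def add_nonneg_pos)
  have "w * cnj w = of_real ((cmod w)\<^sup>2)" by (simp only: complex_norm_square)
  then have "cnj w * w - 1 * of_real D = - of_real \<delta>" by (simp add: D_def mult.commute)
  moreover have "cauchy_reg \<delta> w - 1 / w = (cnj w * w - 1 * of_real D) / (of_real D * w)"
    unfolding cauchy_reg_def D_def[symmetric] by (rule diff_frac_eq) (use w D in auto)
  ultimately have "cauchy_reg \<delta> w - 1 / w = - of_real \<delta> / (w * of_real D)"
    by (simp add: mult.commute)
  then have "cmod (cauchy_reg \<delta> w - 1 / w) = \<delta> / (cmod w * D)"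
    using assms D by (simp add: norm_divide norm_mult)
  also have "\<dots> \<le> \<delta> / (m * m\<^sup>2)"
  proof -
    have "m\<^sup>2 \<le> D" using power_mono[OF assms(3), of 2] assms(2) D(2) by linarith
    then show ?thesis
      using assms D w by (intro divide_left_mono mult_mono mult_pos_pos) auto
  qed
  finally show ?thesis by (simp add: power3_eq_cube power2_eq_square)
qed

lemma cauchy_reg_tendsto: "(\<lambda>n. cauchy_reg (inverse (real (Suc n))) w) \<longlonglongrightarrow> 1 / w"
proof (cases "w = 0")
  case False
  have "(\<lambda>n. cnj w / of_real ((cmod w)\<^sup>2 + inverse (real (Suc n)))) \<longlonglongrightarrow> cnj w / of_real ((cmod w)\<^sup>2 + 0)"
    by (intro tendsto_intros LIMSEQ_inverse_real_of_nat) (use False in auto)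
  moreover have "cnj w / of_real ((cmod w)\<^sup>2 + 0) = 1 / w"
    using False by (simp add: complex_norm_square[symmetric] power2_eq_square field_simps flip: of_real_mult)
  ultimately show ?thesis by (simp only: cauchy_reg_def)
qed (simp add: cauchy_reg_def)

text \<open>From 4 |w|^2 \<delta> \<le> (|w|^2 + \<delta>)^2. The bound is free of \<delta>, as
  dominated convergence requires.\<close>

lemma norm_reg_mass_le:
  assumes "0 < \<delta>" "w \<noteq> 0"
  shows "cmod (reg_mass \<delta> w) \<le> 1 / (4 * (cmod w)\<^sup>2)"
proof -
  define W where "W = (cmod w)\<^sup>2"
  have W: "0 < W" using assms(2) by (simp add: W_def)
  define Q where "Q = (W + \<delta>)\<^sup>2"
  have Q: "0 < Q" using W assms(1) by (simp add: Q_def zero_less_power)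
  have "0 \<le> (W - \<delta>)\<^sup>2" by simp
  then have "4 * W * \<delta> \<le> Q" by (simp add: Q_def power2_eq_square algebra_simps)
  then have "\<delta> / Q \<le> 1 / (4 * W)" using W Q by (simp add: field_simps)
  moreover have "cmod (reg_mass \<delta> w) = \<delta> / Q"
    unfolding reg_mass_def norm_of_real using assms(1) Q by (simp add: Q_def W_def)
  ultimately show ?thesis by (simp add: W_def)
qed

lemma reg_mass_tendsto:
  assumes "w \<noteq> 0"
  shows "(\<lambda>n. reg_mass (inverse (real (Suc n))) w) \<longlonglongrightarrow> 0"
proof -
  have "(\<lambda>n. inverse (real (Suc n)) / ((cmod w)\<^sup>2 + inverse (real (Suc n)))\<^sup>2) \<longlonglongrightarrow> 0 / ((cmod w)\<^sup>2 + 0)\<^sup>2"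
    by (intro tendsto_intros LIMSEQ_inverse_real_of_nat) (use assms in auto)
  then have "(\<lambda>n. of_real (inverse (real (Suc n)) / ((cmod w)\<^sup>2 + inverse (real (Suc n)))\<^sup>2) :: complex) \<longlonglongrightarrow> of_real 0"
    by (intro tendsto_of_real) simp
  then show ?thesis by (simp add: reg_mass_def)
qed

text \<open>Here \<beta> is the exponent of the area bound; 1 < \<beta> is what makes 1 / |z - Z|
  locally integrable. Injectivity of Z locates the poles of the kernel.\<close>

locale periodic_primitive = closed_form_primitive +
  fixes \<tau> :: complex and \<beta> :: real
  assumes Im_tau: "0 < Im \<tau>"
    and A_periodic: "\<And>x y. A (x + 1, y) = A (x, y)" "\<And>x y. A (x, y + 1) = A (x, y)"
    and B_periodic: "\<And>x y. B (x + 1, y) = B (x, y)" "\<And>x y. B (x, y + 1) = B (x, y)"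
    and Z_periodic: "\<And>x y. Z (x + 1, y) = Z (x, y) + 1" "\<And>x y. Z (x, y + 1) = Z (x, y) + \<tau>"
    and Z_inj: "inj Z"
    and \<beta>: "1 < \<beta>"
    and regular: "\<And>K. compact K \<Longrightarrow>
      \<exists>C\<ge>0. \<forall>z \<delta>. 0 < \<delta> \<longrightarrow> emeasure lborel {p \<in> K. cmod (Z p - z) < \<delta>} \<le> ennreal (C * \<delta> powr \<beta>)"
begin

definition lattice_point :: "int \<times> int \<Rightarrow> complex" where
  "lattice_point n = of_int (fst n) + of_int (snd n) * \<tau>"

lemma Z_translate: "Z (int_vec n + p) = Z p + lattice_point n"
proof (cases p)
  case (Pair x y)
  then show ?thesis
    using quasi_periodic_shift[of Z 1 \<tau> x "fst n" y "snd n"] Z_periodic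
    by (simp add: int_vec_def lattice_point_def add.commute)
qed

lemma jacobian_translate: "jacobian (int_vec n + p) = jacobian p"
proof (cases p)
  case (Pair x y)
  then show ?thesis
    using quasi_periodic_shift[of A 0 0 x "fst n" y "snd n"] quasi_periodic_shift[of B 0 0 x "fst n" y "snd n"]
      A_periodic B_periodic
    by (simp add: int_vec_def jacobian_def add.commute)
qed

lemma range_lattice_point: "range lattice_point = period_lattice \<tau>"
proof -
  have "period_lattice \<tau> = {lattice_point (j, k) |j k. True}"
    by (simp add: period_lattice_def lattice_point_def)
  then show ?thesis by auto
qed

lemma inj_lattice_point: "inj lattice_point"
  using lattice_coordinates_unique[OF Im_tau] by (auto simp: inj_def lattice_point_def)

text \<open>An integer translation realises any period, and injectivity of Z does the rest. Hence
  the poles of the kernel in \<open>p\<close> are precisely the integer translates of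
  \<open>q\<close>.\<close>

lemma Z_diff_in_lattice_iff: "Z p - Z q \<in> period_lattice \<tau> \<longleftrightarrow> (\<exists>n. p = int_vec n + q)"
proof
  assume "Z p - Z q \<in> period_lattice \<tau>"
  then obtain n where "Z p - Z q = lattice_point n" unfolding range_lattice_point[symmetric] by auto
  then have "Z p = Z q + lattice_point n" by (simp add: diff_eq_eq add.commute)
  then have "Z p = Z (int_vec n + q)" unfolding Z_translate .
  then show "\<exists>n. p = int_vec n + q" using injD[OF Z_inj] by blast
next
  assume "\<exists>n. p = int_vec n + q"
  then show "Z p - Z q \<in> period_lattice \<tau>" unfolding range_lattice_point[symmetric] by (auto simp: Z_translate)
qed

lemma Z_measurable [measurable]: "Z \<in> borel_measurable borel"
  and jacobian_measurable [measurable]: "jacobian \<in> borel_measurable borel"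
  using Z_cont jacobian_cont by (auto intro: borel_measurable_continuous_onI)

lemma reg_mass_measurable [measurable]: "reg_mass \<delta> \<in> borel_measurable borel"
  and cauchy_reg_measurable [measurable]: "cauchy_reg \<delta> \<in> borel_measurable borel"
proof -
  have c: "cnj \<in> borel_measurable borel" by (intro borel_measurable_continuous_onI continuous_intros)
  show "reg_mass \<delta> \<in> borel_measurable borel" unfolding reg_mass_def by measurable
  show "cauchy_reg \<delta> \<in> borel_measurable borel"
    unfolding cauchy_reg_def using c by measurable
qed

lemma upper_regular_map_compact:
  assumes K: "compact K"
  shows "\<exists>C. upper_regular_map (restrict_space lborel K) Z C \<beta>"
proof -
  obtain C where C: "0 \<le> C" "\<And>z \<delta>. 0 < \<delta> \<Longrightarrow> emeasure lborel {p \<in> K. cmod (Z p - z) < \<delta>} \<le> ennreal (C * \<delta> powr \<beta>)"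
    using regular[OF K] by blast
  have Kb: "K \<in> sets borel" using K by (simp add: compact_imp_closed)
  have "upper_regular_map (restrict_space lborel K) Z C \<beta>"
  proof
    show "emeasure (restrict_space lborel K) (space (restrict_space lborel K)) < \<infinity>"
      using emeasure_compact_finite[OF K] Kb by (simp add: emeasure_restrict_space space_restrict_space)
    show "Z \<in> borel_measurable (restrict_space lborel K)"
      by (rule measurable_restrict_space1) simp
    show "emeasure (restrict_space lborel K) {x \<in> space (restrict_space lborel K). cmod (Z x - z) < \<delta>} \<le> ennreal (C * \<delta> powr \<beta>)"
      if "0 < \<delta>" for z \<delta>
      using C(2)[OF that, of z] Kb by (subst emeasure_restrict_space) (auto simp: space_restrict_space)
  qed (rule C(1))
  then show ?thesis by blast
qed

lemma inverse_Z_bound: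
  assumes K: "compact K"
  shows "\<exists>C\<ge>0. \<forall>z. (\<integral>\<^sup>+ p. ennreal (cmod (1 / (z - Z p))) * indicator K p \<partial>lborel) \<le> ennreal C"
proof -
  obtain C0 where "upper_regular_map (restrict_space lborel K) Z C0 \<beta>"
    using upper_regular_map_compact[OF K] by blast
  then interpret R: upper_regular_map "restrict_space lborel K" Z C0 \<beta> .
  obtain C where C: "0 \<le> C" "\<And>z. (\<integral>\<^sup>+ p. ennreal (cmod (1 / (z - Z p)) powr 1) \<partial>restrict_space lborel K) \<le> ennreal C"
    using R.potential_finite[of 1] \<beta> by auto
  have "(\<integral>\<^sup>+ p. ennreal (cmod (1 / (z - Z p))) * indicator K p \<partial>lborel) \<le> ennreal C" for z
    using C(2)[of z] K by (subst (asm) nn_integral_restrict_space) (auto simp: compact_imp_closed)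
  then show ?thesis using C(1) by blast
qed

lemma inverse_Z_integrable:
  assumes K: "compact K"
  shows "integrable lborel (\<lambda>p. indicator K p * cmod (1 / (z - Z p)))"
proof (rule integrableI_bounded)
  have [measurable]: "K \<in> sets borel" using K by (simp add: compact_imp_closed)
  show "(\<lambda>p. indicator K p * cmod (1 / (z - Z p))) \<in> borel_measurable lborel" by measurable
  obtain C where "(\<integral>\<^sup>+ p. ennreal (cmod (1 / (z - Z p))) * indicator K p \<partial>lborel) \<le> ennreal C"
    using inverse_Z_bound[OF K] by blast
  moreover have "(\<integral>\<^sup>+ p. ennreal (norm (indicator K p * cmod (1 / (z - Z p)))) \<partial>lborel) =
      (\<integral>\<^sup>+ p. ennreal (cmod (1 / (z - Z p))) * indicator K p \<partial>lborel)"
    by (intro nn_integral_cong) (auto split: split_indicator)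
  ultimately show "(\<integral>\<^sup>+ p. ennreal (norm (indicator K p * cmod (1 / (z - Z p)))) \<partial>lborel) < \<infinity>"
    by (simp add: le_less_trans)
qed

text \<open>Near \<open>p0\<close> the nonvanishing Jacobian gives the linear bound. On the compact
  remainder injectivity gives a positive minimum, which is converted into a linear bound by the
  finite diameter.\<close>

lemma Z_lower_bound:
  assumes K: "compact K" and p0: "jacobian p0 \<noteq> 0"
  shows "\<exists>c>0. \<forall>p\<in>K. c * norm (p - p0) \<le> cmod (Z p - Z p0)"
proof -
  obtain \<rho> c where \<rho>: "0 < \<rho>" "0 < c"
    "\<And>p p'. p \<in> ball p0 \<rho> \<Longrightarrow> p' \<in> ball p0 \<rho> \<Longrightarrow> c * norm (p - p') \<le> cmod (Z p - Z p')"
    using nondegenerate_lower_bound[OF A_cont B_cont Z_deriv, of p0] p0 unfolding jacobian_def by blast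
  have cK: "compact (K - ball p0 \<rho>)" using K by (rule compact_diff) simp
  have "\<exists>m>0. \<forall>p\<in>K - ball p0 \<rho>. m \<le> cmod (Z p - Z p0)"
  proof (cases "K - ball p0 \<rho> = {}")
    case False
    have cc: "continuous_on (K - ball p0 \<rho>) (\<lambda>p. cmod (Z p - Z p0))"
      by (intro continuous_intros Z_cont)
    obtain x where x: "x \<in> K - ball p0 \<rho>" "\<And>y. y \<in> K - ball p0 \<rho> \<Longrightarrow> cmod (Z x - Z p0) \<le> cmod (Z y - Z p0)"
      using continuous_attains_inf[OF cK False cc] by blast
    have "x \<noteq> p0" using x(1) \<rho>(1) by auto
    then have "0 < cmod (Z x - Z p0)" using Z_inj by (auto dest: injD)
    then show ?thesis using x(2) by blast
  qed (auto intro: exI[of _ 1])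
  then obtain m where m: "0 < m" "\<And>p. p \<in> K - ball p0 \<rho> \<Longrightarrow> m \<le> cmod (Z p - Z p0)" by blast
  obtain D where D: "0 < D" "\<And>p. p \<in> K \<Longrightarrow> norm p \<le> D"
    using compact_imp_bounded[OF K] bounded_pos by metis
  define E where "E = D + norm p0 + 1"
  have E: "0 < E" using D(1) by (simp add: E_def add_pos_nonneg)
  define c0 where "c0 = min c (m / E)"
  have "c0 * norm (p - p0) \<le> cmod (Z p - Z p0)" if p: "p \<in> K" for p
  proof (cases "p \<in> ball p0 \<rho>")
    case True
    have "c0 * norm (p - p0) \<le> c * norm (p - p0)" by (intro mult_right_mono) (auto simp: c0_def)
    then show ?thesis using \<rho>(3)[OF True, of p0] \<rho>(1) by simp
  next
    case False
    have "norm (p - p0) \<le> E" using norm_triangle_ineq4[of p p0] D(2)[OF p] by (simp add: E_def)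
    then have "c0 * norm (p - p0) \<le> m / E * E"
      using m(1) E by (intro mult_mono) (auto simp: c0_def)
    then show ?thesis using m(2)[of p] p False E by simp
  qed
  moreover have "0 < c0" using \<rho>(2) m(1) E by (simp add: c0_def)
  ultimately show ?thesis by blast
qed

text \<open>Since |f| is at most a multiple of |Z p - Z p0| on \<open>K\<close> and
  \<open>reg_mass\<close> is at most 1 / (4 |Z p - Z p0|^2), the integrands are dominated by the
  integrable 1 / |Z p - Z p0|. Pointwise they tend to 0 off \<open>p0\<close>, and \<open>f\<close>
  vanishes at \<open>p0\<close>.\<close>

lemma concentration:
  fixes f :: "real \<times> real \<Rightarrow> complex"
  assumes K: "compact K" and p0: "jacobian p0 \<noteq> 0" and f [measurable]: "f \<in> borel_measurable borel"
    and supp: "\<And>p. p \<notin> K \<Longrightarrow> f p = 0" and lip: "\<And>p. cmod (f p) \<le> C * norm (p - p0)"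
  shows "(\<lambda>n. LINT p|lborel. f p * jacobian p * reg_mass (inverse (real (Suc n))) (Z p - Z p0)) \<longlonglongrightarrow> 0"
proof -
  obtain c where c: "0 < c" "\<And>p. p \<in> K \<Longrightarrow> c * norm (p - p0) \<le> cmod (Z p - Z p0)"
    using Z_lower_bound[OF K p0] by blast
  obtain J where J: "0 < J" "\<And>p. p \<in> K \<Longrightarrow> cmod (jacobian p) \<le> J"
    using compact_imp_bounded[OF compact_continuous_image[OF jacobian_cont K]] bounded_pos[of "jacobian ` K"] by auto
  have f0: "f p0 = 0" using lip[of p0] by simp
  have "(\<lambda>n. LINT p|lborel. f p * jacobian p * reg_mass (inverse (real (Suc n))) (Z p - Z p0)) \<longlonglongrightarrow> (LINT p|(lborel :: (real \<times> real) measure). 0 :: complex)"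
  proof (rule integral_dominated_convergence[where w = "\<lambda>p. \<bar>C\<bar> * J / (4 * c) * (indicator K p * cmod (1 / (Z p0 - Z p)))"])
    show "integrable lborel (\<lambda>p. \<bar>C\<bar> * J / (4 * c) * (indicator K p * cmod (1 / (Z p0 - Z p))))"
      by (intro integrable_mult_right inverse_Z_integrable K)
    show "AE p in lborel. (\<lambda>n. f p * jacobian p * reg_mass (inverse (real (Suc n))) (Z p - Z p0)) \<longlonglongrightarrow> 0"
    proof (rule AE_I2)
      fix p
      show "(\<lambda>n. f p * jacobian p * reg_mass (inverse (real (Suc n))) (Z p - Z p0)) \<longlonglongrightarrow> 0"
      proof (cases "p = p0")
        case False
        then have "Z p - Z p0 \<noteq> 0" using Z_inj by (auto dest: injD)
        from tendsto_mult_right_zero[OF reg_mass_tendsto[OF this]] show ?thesis .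
      qed (simp add: f0)
    qed
    show "AE p in lborel. norm (f p * jacobian p * reg_mass (inverse (real (Suc n))) (Z p - Z p0)) \<le>
        \<bar>C\<bar> * J / (4 * c) * (indicator K p * cmod (1 / (Z p0 - Z p)))" for n
    proof (rule AE_I2)
      fix p
      show "norm (f p * jacobian p * reg_mass (inverse (real (Suc n))) (Z p - Z p0)) \<le>
        \<bar>C\<bar> * J / (4 * c) * (indicator K p * cmod (1 / (Z p0 - Z p)))"
      proof (cases "p \<in> K \<and> p \<noteq> p0")
        case True
        define d where "d = cmod (Z p - Z p0)"
        have d: "0 < d" "Z p - Z p0 \<noteq> 0" using True Z_inj by (auto simp: d_def dest: injD)
        have "norm (p - p0) \<le> d / c" using c(1) c(2)[of p] True by (simp add: d_def field_simps)
        then have "\<bar>C\<bar> * norm (p - p0) \<le> \<bar>C\<bar> * (d / c)" by (intro mult_left_mono) auto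
        moreover have "C * norm (p - p0) \<le> \<bar>C\<bar> * norm (p - p0)" by (intro mult_right_mono) auto
        ultimately have "cmod (f p) \<le> \<bar>C\<bar> * (d / c)" using lip[of p] by linarith
        then have "cmod (f p) * cmod (jacobian p) * cmod (reg_mass (inverse (real (Suc n))) (Z p - Z p0)) \<le>
            \<bar>C\<bar> * (d / c) * J * (1 / (4 * d\<^sup>2))"
          using J(1) J(2)[of p] True norm_reg_mass_le[OF _ d(2), of "inverse (real (Suc n))"] d(1) c(1)
          by (intro mult_mono) (auto simp: d_def)
        also have "\<dots> = \<bar>C\<bar> * J / (4 * c) * (1 / d)"
          using d(1) by (simp add: power2_eq_square)
        finally show ?thesis using True by (simp add: norm_mult d_def norm_divide norm_minus_commute)
      next
        case False
        then have "f p = 0" using supp[of p] f0 by (cases "p = p0") auto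
        then show ?thesis using J(1) c(1) by simp
      qed
    qed
  qed measurable
  then show ?thesis by simp
qed

end

text \<open>Green's formula is stated with the gauge integral, whereas dominated convergence and
  Fubini speak of the Lebesgue integral; this passes between the two.\<close>

lemma lborel_integral_cbox_eq:
  fixes g :: "'a::euclidean_space \<Rightarrow> complex"
  assumes "continuous_on (cbox a b) g"
  shows "integrable lborel (\<lambda>p. indicator (cbox a b) p * g p)"
    and "(LINT p|lborel. indicator (cbox a b) p * g p) = integral (cbox a b) g"
proof -
  have e: "indicator (cbox a b) p * g p = indicator (cbox a b) p *\<^sub>R g p" for p
    by (simp split: split_indicator)
  have "set_integrable lborel (cbox a b) g"
    unfolding set_integrable_def by (rule borel_integrable_compact[OF compact_cbox assms])
  then show "integrable lborel (\<lambda>p. indicator (cbox a b) p * g p)"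
    "(LINT p|lborel. indicator (cbox a b) p * g p) = integral (cbox a b) g"
    using set_borel_integral_eq_integral(2)[of "cbox a b" g]
    unfolding e set_integrable_def set_lebesgue_integral_def by auto
qed

lemma continuous_on_compact_norm_bound:
  fixes g :: "'a::topological_space \<Rightarrow> 'b::real_normed_vector"
  assumes "compact K" "continuous_on K g"
  shows "\<exists>M>0. \<forall>p\<in>K. norm (g p) \<le> M"
proof -
  have "bounded (g ` K)" using assms by (intro compact_imp_bounded compact_continuous_image)
  then show ?thesis unfolding bounded_pos by blast
qed

lemma dx_dy_eq_0:
  fixes \<phi> :: "real \<times> real \<Rightarrow> complex"
  assumes "open V" "p \<in> V" "\<And>x. x \<in> V \<Longrightarrow> \<phi> x = 0"
  shows "dx \<phi> p = 0" "dy \<phi> p = 0"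
proof -
  have "((\<lambda>_. 0) has_derivative (\<lambda>_. 0)) (at p)" by simp
  then have "(\<phi> has_derivative (\<lambda>_. 0)) (at p)"
    by (rule has_derivative_transform_within_open[OF _ assms(1,2)]) (simp add: assms(3))
  from dx_dy_eqI[OF this] show "dx \<phi> p = 0" "dy \<phi> p = 0" by simp_all
qed

lemma C1_compact_support_Lipschitz:
  fixes \<phi> :: "real \<times> real \<Rightarrow> complex"
  assumes \<phi>: "C1_on UNIV \<phi>" and Q: "compact Q" and supp: "\<And>p. p \<notin> Q \<Longrightarrow> \<phi> p = 0"
  shows "\<exists>L\<ge>0. \<forall>p q. cmod (\<phi> p - \<phi> q) \<le> L * norm (p - q)"
proof -
  have bd: "\<exists>M\<ge>0. \<forall>p. cmod (g p) \<le> M" if g: "continuous_on UNIV g" "\<And>p. p \<notin> Q \<Longrightarrow> g p = 0" for g :: "real \<times> real \<Rightarrow> complex"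
  proof -
    obtain M where M: "0 < M" "\<And>p. p \<in> Q \<Longrightarrow> cmod (g p) \<le> M"
      using continuous_on_compact_norm_bound[OF Q continuous_on_subset[OF g(1) subset_UNIV]] by blast
    have "cmod (g p) \<le> M" for p using M g(2)[of p] by (cases "p \<in> Q") auto
    then show ?thesis using M(1) by (intro exI[of _ M]) auto
  qed
  have op: "open (- Q)" using Q by (simp add: compact_imp_closed open_Compl)
  have z: "dx \<phi> p = 0" "dy \<phi> p = 0" if "p \<notin> Q" for p
    using dx_dy_eq_0[OF op, of p \<phi>] that supp by auto
  obtain M1 where M1: "0 \<le> M1" "\<And>p. cmod (dx \<phi> p) \<le> M1"
    using bd[of "dx \<phi>"] \<phi> z by (auto simp: C1_on_def)
  obtain M2 where M2: "0 \<le> M2" "\<And>p. cmod (dy \<phi> p) \<le> M2"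
    using bd[of "dy \<phi>"] \<phi> z by (auto simp: C1_on_def)
  have "norm (\<phi> p - \<phi> q) \<le> (M1 + M2) * norm (p - q)" for p q
  proof (rule differentiable_bound[OF convex_UNIV])
    fix x :: "real \<times> real"
    show "(\<phi> has_derivative (\<lambda>h. of_real (fst h) * dx \<phi> x + of_real (snd h) * dy \<phi> x)) (at x within UNIV)"
      by (rule C1_on_has_derivative'[OF \<phi> UNIV_I])
    show "onorm (\<lambda>h. of_real (fst h) * dx \<phi> x + of_real (snd h) * dy \<phi> x) \<le> M1 + M2"
    proof (rule onorm_bound)
      fix h :: "real \<times> real"
      have "norm (of_real (fst h) * dx \<phi> x + of_real (snd h) * dy \<phi> x) \<le>
          norm (of_real (fst h) * dx \<phi> x) + norm (of_real (snd h) * dy \<phi> x)" by (rule norm_triangle_ineq)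
      also have "\<dots> \<le> norm h * M1 + norm h * M2"
        unfolding norm_mult norm_of_real
        using norm_fst_le[of "fst h" "snd h"] norm_snd_le[of "snd h" "fst h"] M1 M2
        by (intro add_mono mult_mono) auto
      finally show "norm (of_real (fst h) * dx \<phi> x + of_real (snd h) * dy \<phi> x) \<le> (M1 + M2) * norm h"
        by (simp add: algebra_simps)
    qed (use M1 M2 in simp)
  qed auto
  then show ?thesis using M1(1) M2(1) by (intro exI[of _ "M1 + M2"]) auto
qed

lemma int_vec_0 [simp]: "int_vec (0, 0) + p = p"
  by (cases p) (simp add: int_vec_def)

lemma int_vec_unit_box:
  assumes "p \<in> box (0, 0) (1, 1)" "int_vec n + p \<in> cbox (0, 0) (1, 1)"
  shows "n = (0, 0)"
proof -
  obtain x y where p: "p = (x, y)" by fastforce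
  have xy: "0 < x" "x < 1" "0 < y" "y < 1"
    using assms(1) by (auto simp: p mem_box Basis_prod_def)
  have "0 \<le> of_int (fst n) + x" "of_int (fst n) + x \<le> 1" "0 \<le> of_int (snd n) + y" "of_int (snd n) + y \<le> 1"
    using assms(2) by (auto simp: p int_vec_def)
  then have "-1 < real_of_int (fst n)" "real_of_int (fst n) < 1" "-1 < real_of_int (snd n)" "real_of_int (snd n) < 1"
    using xy by linarith+
  then have "fst n = 0" "snd n = 0" by linarith+
  then show ?thesis by (simp add: prod_eq_iff)
qed

section \<open>The mass carried by a single pole\<close>

context periodic_primitive
begin

text \<open>The Jacobian and Lebesgue measure are invariant under integer translations, so a pole at
  a lattice point is moved to the origin at the price of translating \<phi>.\<close>

lemma mass_translate:
  fixes \<phi> :: "real \<times> real \<Rightarrow> complex"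
  assumes [measurable]: "\<phi> \<in> borel_measurable borel"
  shows "(LINT p|lborel. \<phi> p * jacobian p * reg_mass \<delta> (Z p - z - lattice_point n)) =
    (LINT q|lborel. \<phi> (int_vec n + q) * jacobian q * reg_mass \<delta> (Z q - z))"
proof -
  define g where "g = (\<lambda>p. \<phi> p * jacobian p * reg_mass \<delta> (Z p - z - lattice_point n))"
  have "(LINT q|lborel. g (int_vec n + q)) = (LINT p|lborel. g p)"
    by (rule lborel_integral_translate) (simp add: g_def)
  moreover have "g (int_vec n + q) = \<phi> (int_vec n + q) * jacobian q * reg_mass \<delta> (Z q - z)" for q
    unfolding g_def jacobian_translate Z_translate by (simp add: algebra_simps)
  ultimately show ?thesis unfolding g_def by simp
qed

lemma unit_box_margin:
  assumes "p0 \<in> box (0, 0) (1, 1 :: real)"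
  shows "\<exists>\<eta>>0. \<forall>q. q \<notin> box (0, 0) (1, 1 :: real) \<longrightarrow> \<eta> \<le> norm (q - p0)"
proof -
  obtain \<eta> where \<eta>: "0 < \<eta>" "ball p0 \<eta> \<subseteq> box (0, 0) (1, 1)"
    using open_box assms open_contains_ball by blast
  have "\<eta> \<le> norm (q - p0)" if "q \<notin> box (0, 0) (1, 1)" for q
    using \<eta>(2) that by (metis dist_commute dist_norm mem_ball not_le subsetD)
  then show ?thesis using \<eta>(1) by blast
qed

text \<open>After translation the indicator belongs to a shifted square that misses the open unit
  square. Having distance at least \<eta> from \<open>p0\<close>, it is bounded by |q - p0| /
  \<eta>, so \<open>concentration\<close> applies.\<close>

lemma mass_other_periods:
  assumes p0: "p0 \<in> box (0, 0) (1, 1)" "jacobian p0 \<noteq> 0" and n: "n \<noteq> (0, 0)"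
  shows "(\<lambda>m. LINT p|lborel. indicator (cbox (0, 0) (1, 1)) p * jacobian p *
     reg_mass (inverse (real (Suc m))) (Z p - Z p0 - lattice_point n)) \<longlonglongrightarrow> 0"
proof -
  let ?S = "cbox (0, 0) (1, 1) :: (real \<times> real) set"
  obtain \<eta> where \<eta>: "0 < \<eta>" "\<And>q. q \<notin> box (0, 0) (1, 1) \<Longrightarrow> \<eta> \<le> norm (q - p0)"
    using unit_box_margin[OF p0(1)] by blast
  have "(\<lambda>m. LINT q|lborel. indicator ?S (int_vec n + q) * jacobian q * reg_mass (inverse (real (Suc m))) (Z q - Z p0)) \<longlonglongrightarrow> 0"
  proof (rule concentration[where K = "(\<lambda>p. - int_vec n + p) ` ?S" and C = "1 / \<eta>", OF _ p0(2)])
    show "compact ((\<lambda>p. - int_vec n + p) ` ?S)"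
      by (intro compact_continuous_image continuous_intros compact_cbox)
    show "(\<lambda>q. indicator ?S (int_vec n + q) :: complex) \<in> borel_measurable borel" by measurable
    show "indicator ?S (int_vec n + q) = (0 :: complex)" if "q \<notin> (\<lambda>p. - int_vec n + p) ` ?S" for q
    proof -
      have "int_vec n + q \<notin> ?S"
      proof
        assume "int_vec n + q \<in> ?S"
        then have "- int_vec n + (int_vec n + q) \<in> (\<lambda>p. - int_vec n + p) ` ?S" by (rule imageI)
        then show False using that by simp
      qed
      then show ?thesis by simp
    qed
    show "cmod (indicator ?S (int_vec n + q)) \<le> 1 / \<eta> * norm (q - p0)" for q
    proof (cases "int_vec n + q \<in> ?S")
      case True
      then have "q \<notin> box (0, 0) (1, 1)" using int_vec_unit_box n by blast
      then show ?thesis using \<eta>(1) \<eta>(2)[of q] True by simp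
    qed (use \<eta>(1) in simp)
  qed
  then show ?thesis by (subst mass_translate) auto
qed

text \<open>Integer translates of an interior point never lie on the boundary of the square, so the
  contour of Green's formula avoids all poles.\<close>

lemma unit_box_frontier_separated:
  assumes p0: "p0 \<in> box (0, 0) (1, 1)" and F: "finite F" "F \<subseteq> period_lattice \<tau>"
  shows "\<exists>m>0. \<forall>p\<in>cbox (0, 0) (1, 1) - box (0, 0) (1, 1). \<forall>l\<in>F. m \<le> cmod (Z p - Z p0 - l)"
    and "\<And>p. p \<in> cbox (0, 0) (1, 1) - box (0, 0) (1, 1) \<Longrightarrow> Z p - Z p0 \<notin> period_lattice \<tau>"
proof -
  let ?D = "cbox (0, 0) (1, 1) - box (0, 0) (1, 1) :: (real \<times> real) set"
  show nl: "Z p - Z p0 \<notin> period_lattice \<tau>" if "p \<in> ?D" for p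
  proof
    assume "Z p - Z p0 \<in> period_lattice \<tau>"
    then obtain n where n: "p = int_vec n + p0" unfolding Z_diff_in_lattice_iff by blast
    then have "n = (0, 0)" using int_vec_unit_box[OF p0] that by blast
    then show False using n p0 that by simp
  qed
  have c: "compact ((\<lambda>p. Z p - Z p0) ` ?D)"
    by (intro compact_continuous_image continuous_intros Z_cont compact_diff compact_cbox open_box)
  have d: "(\<lambda>p. Z p - Z p0) ` ?D \<inter> F = {}" using nl F(2) by blast
  obtain m where m: "0 < m" "\<And>x y. x \<in> (\<lambda>p. Z p - Z p0) ` ?D \<Longrightarrow> y \<in> F \<Longrightarrow> m \<le> dist x y"
    using separate_compact_closed[OF c finite_imp_closed[OF F(1)] d] by blast
  have "m \<le> cmod (Z p - Z p0 - l)" if "p \<in> ?D" "l \<in> F" for p l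
    using m(2)[OF imageI[OF that(1)] that(2)] by (simp add: dist_norm)
  then show "\<exists>m>0. \<forall>p\<in>?D. \<forall>l\<in>F. m \<le> cmod (Z p - Z p0 - l)" using m(1) by blast
qed

text \<open>Green's formula on the unit square with the constant function 1: by quasi-periodicity of the
  logarithmic derivative the boundary terms reduce to \<open>-2 pi \<i>\<close> times the integral of \<open>dZ\<close> over the
  bottom side, which is 1.\<close>

lemma mass_limit:
  assumes p0: "p0 \<in> box (0, 0) (1, 1)" "jacobian p0 \<noteq> 0"
  shows "(\<lambda>m. LINT p|lborel. indicator (cbox (0, 0) (1, 1)) p * jacobian p *
     reg_mass (inverse (real (Suc m))) (Z p - Z p0)) \<longlonglongrightarrow> - (2 * of_real pi * \<i>)"
proof -
  let ?S = "cbox (0, 0) (1, 1) :: (real \<times> real) set"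
  let ?D = "?S - box (0, 0) (1, 1)"
  define z where "z = Z p0"
  define d where "d = (\<lambda>m. inverse (real (Suc m)))"
  have d: "0 < d m" for m by (simp add: d_def)
  have cZ: "continuous_on ?S (\<lambda>p. Z p - z)" by (intro continuous_intros Z_cont)
  obtain R0 where R0: "0 < R0" "\<And>p. p \<in> ?S \<Longrightarrow> cmod (Z p - z) \<le> R0"
    using continuous_on_compact_norm_bound[OF compact_cbox cZ] by blast
  define R where "R = R0 + 1"
  have R: "0 < R" using R0(1) by (simp add: R_def)
  have RS: "Z p - z \<in> ball 0 R" if "p \<in> ?S" for p
    using R0(2)[OF that] by (simp add: R_def)
  define F where "F = {l \<in> period_lattice \<tau>. cmod l \<le> R}"
  have F: "finite F" "F \<subseteq> period_lattice \<tau>" "0 \<in> F"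
    using finite_period_lattice[OF Im_tau] R by (auto simp: F_def)
  obtain k where k: "k holomorphic_on ball 0 R"
    "\<And>w. w \<in> ball 0 R - period_lattice \<tau> \<Longrightarrow> theta_logder \<tau> w = (\<Sum>l\<in>F. 1 / (w - l)) + k w"
    using theta_logder_partial_fractions[OF Im_tau, of R] unfolding F_def by blast
  define G where "G = (\<lambda>m p. reg_kernel F k (d m) (Z p - z))"
  define \<theta> where "\<theta> = (\<lambda>p. theta_logder \<tau> (Z p - z))"
  obtain b where b: "0 < b" "\<And>p l. p \<in> ?D \<Longrightarrow> l \<in> F \<Longrightarrow> b \<le> cmod (Z p - z - l)"
    using unit_box_frontier_separated(1)[OF p0(1) F(1,2)] unfolding z_def by blast
  note nl = unit_box_frontier_separated(2)[OF p0(1) F(1,2), folded z_def]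
  define E where "E = of_nat (card F) / b ^ 3"
  have E: "0 \<le> E" using b by (simp add: E_def)
  \<comment> \<open>The regularised kernel is not quasi-periodic, but on the boundary it is within
    O(\<delta>) of the logarithmic derivative, whose jump relations can therefore be used in the
    limit.\<close>
  have err: "cmod (G m p - \<theta> p) \<le> E * d m" if p: "p \<in> ?D" for m p
  proof -
    have "Z p - z \<in> ball 0 R - period_lattice \<tau>" using RS nl[OF p] p by blast
    from k(2)[OF this] have "\<theta> p = (\<Sum>l\<in>F. 1 / (Z p - z - l)) + k (Z p - z)" unfolding \<theta>_def .
    then have "G m p - \<theta> p = (\<Sum>l\<in>F. cauchy_reg (d m) (Z p - z - l) - 1 / (Z p - z - l))"
      unfolding G_def reg_kernel_def by (simp add: sum_subtractf)
    also have "cmod \<dots> \<le> (\<Sum>l\<in>F. cmod (cauchy_reg (d m) (Z p - z - l) - 1 / (Z p - z - l)))"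
      by (rule norm_sum)
    also have "\<dots> \<le> (\<Sum>l\<in>F. d m / b ^ 3)"
      by (intro sum_mono cauchy_reg_diff_le d b p)
    also have "\<dots> = E * d m" by (simp add: E_def)
    finally show ?thesis .
  qed
  obtain MA where MA: "0 < MA" "\<And>p. p \<in> ?S \<Longrightarrow> cmod (A p) \<le> MA"
    using continuous_on_compact_norm_bound[OF compact_cbox A_cont] by blast
  obtain MB where MB: "0 < MB" "\<And>p. p \<in> ?S \<Longrightarrow> cmod (B p) \<le> MB"
    using continuous_on_compact_norm_bound[OF compact_cbox B_cont] by blast
  have corner: "(1, y) \<in> ?D" "(0, y) \<in> ?D" "(y, 1) \<in> ?D" "(y, 0) \<in> ?D" if "y \<in> {0..1}" for y
    using that by (auto simp: mem_box Basis_prod_def)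
  have per: "A (x, 1) = A (x, 0)" "B (1, x) = B (0, x)" "Z (1, x) = Z (0, x) + 1" "Z (x, 1) = Z (x, 0) + \<tau>" for x
    using A_periodic(2)[of x 0] B_periodic(1)[of 0 x] Z_periodic(1)[of 0 x] Z_periodic(2)[of x 0] by simp_all
  have cG: "continuous_on ?S (G m)" for m
    unfolding G_def using C1_on_imp_continuous_on[OF reg_kernel_Z(1)[OF F(1) d k(1) open_ball RS]] by simp
  define Ix where "Ix = (\<lambda>m. integral {0..1} (\<lambda>x. A (x, 1) * G m (x, 1) - A (x, 0) * G m (x, 0)))"
  define Iy where "Iy = (\<lambda>m. integral {0..1} (\<lambda>y. B (1, y) * G m (1, y) - B (0, y) * G m (0, y)))"
  have cedge: "continuous_on {0..1} (\<lambda>x. g (x, c))" "continuous_on {0..1} (\<lambda>x. g (c, x))"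
    if "continuous_on ?S g" "c \<in> {0..1}" for g :: "real \<times> real \<Rightarrow> complex" and c
    by (rule continuous_on_compose2[OF that(1)]; use that(2) in \<open>auto intro!: continuous_intros\<close>)+
  have Iy_lim: "Iy \<longlonglongrightarrow> 0"
  proof (rule Lim_null_comparison)
    show "\<forall>\<^sub>F m in sequentially. norm (Iy m) \<le> MB * (2 * E * d m)"
    proof (rule always_eventually, rule allI)
      fix m
      have "norm (Iy m) \<le> MB * (2 * E * d m) * (1 - 0)"
        unfolding Iy_def
      proof (rule integral_bound)
        show "continuous_on {0..1} (\<lambda>y. B (1, y) * G m (1, y) - B (0, y) * G m (0, y))"
          by (intro continuous_intros cedge B_cont cG) auto
        fix y :: real assume y: "y \<in> {0..1}"
        have t: "\<theta> (1, y) = \<theta> (0, y)"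
          unfolding \<theta>_def per(3) using theta_logder_plus_1[OF Im_tau, of "Z (0, y) - z"] by (simp add: algebra_simps)
        have "B (1, y) * G m (1, y) - B (0, y) * G m (0, y) = B (0, y) * ((G m (1, y) - \<theta> (1, y)) - (G m (0, y) - \<theta> (0, y)))"
          unfolding t per(2) by (simp add: algebra_simps)
        also have "cmod \<dots> \<le> MB * (E * d m + E * d m)"
          unfolding norm_mult
          using norm_triangle_ineq4[of "G m (1, y) - \<theta> (1, y)" "G m (0, y) - \<theta> (0, y)"]
            err[OF corner(1)[OF y], of m] err[OF corner(2)[OF y], of m] corner(2)[OF y] MB
          by (intro mult_mono) auto
        finally show "norm (B (1, y) * G m (1, y) - B (0, y) * G m (0, y)) \<le> MB * (2 * E * d m)" by simp
      qed simp
      then show "norm (Iy m) \<le> MB * (2 * E * d m)" by simp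
    qed
    have "(\<lambda>m. MB * (2 * E * d m)) \<longlonglongrightarrow> MB * (2 * E * 0)"
      unfolding d_def by (intro tendsto_intros LIMSEQ_inverse_real_of_nat)
    then show "(\<lambda>m. MB * (2 * E * d m)) \<longlonglongrightarrow> 0" by simp
  qed
  have A1: "((\<lambda>x. A (x, 0)) has_integral 1) {0..1}"
  proof -
    have "((\<lambda>x. A (x, 0)) has_integral (Z (1, 0) - Z (0, 0))) {0..1}"
    proof (rule fundamental_theorem_of_calculus)
      fix x :: real
      have "((\<lambda>x. (x, 0)) has_vector_derivative (1, 0)) (at x within {0..1})"
        by (intro has_vector_derivative_Pair) (auto intro!: derivative_eq_intros)
      from vector_derivative_diff_chain_within[OF this has_derivative_at_withinI[OF Z_deriv]]
      show "((\<lambda>x. Z (x, 0)) has_vector_derivative A (x, 0)) (at x within {0..1})" by (simp add: o_def)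
    qed simp
    then show ?thesis using Z_periodic(1)[of 0 0] by simp
  qed
  have "(\<lambda>m. Ix m - (- (2 * of_real pi * \<i>))) \<longlonglongrightarrow> 0"
  proof (rule Lim_null_comparison)
    show "\<forall>\<^sub>F m in sequentially. norm (Ix m - (- (2 * of_real pi * \<i>))) \<le> MA * (2 * E * d m)"
    proof (rule always_eventually, rule allI)
      fix m
      define g where "g = (\<lambda>x. A (x, 1) * G m (x, 1) - A (x, 0) * G m (x, 0))"
      have cg: "continuous_on {0..1} g"
        unfolding g_def by (intro continuous_intros cedge A_cont cG) auto
      have cA0: "continuous_on {0..1} (\<lambda>x. A (x, 0) * (2 * of_real pi * \<i>))"
        by (intro continuous_intros cedge A_cont) auto
      have "integral {0..1} (\<lambda>x. A (x, 0) * (2 * of_real pi * \<i>)) = 1 * (2 * of_real pi * \<i>)"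
        by (rule integral_unique[OF has_integral_mult_left[OF A1]])
      moreover have "integral {0..1} (\<lambda>x. g x + A (x, 0) * (2 * of_real pi * \<i>)) =
          Ix m + integral {0..1} (\<lambda>x. A (x, 0) * (2 * of_real pi * \<i>))"
        unfolding Ix_def g_def[symmetric]
        by (rule Henstock_Kurzweil_Integration.integral_add) (intro integrable_continuous_interval cg cA0)+
      ultimately have "Ix m - (- (2 * of_real pi * \<i>)) = integral {0..1} (\<lambda>x. g x + A (x, 0) * (2 * of_real pi * \<i>))"
        by (simp only: mult_1 diff_minus_eq_add)
      also have "norm \<dots> \<le> MA * (2 * E * d m) * (1 - 0)"
      proof (rule integral_bound)
        show "continuous_on {0..1} (\<lambda>x. g x + A (x, 0) * (2 * of_real pi * \<i>))"
          by (intro continuous_on_add cg cA0)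
        fix x :: real assume x: "x \<in> {0..1}"
        have "theta_logder \<tau> ((Z (x, 0) - z) + \<tau>) = theta_logder \<tau> (Z (x, 0) - z) - 2 * of_real pi * \<i>"
          by (rule theta_logder_plus_tau[OF Im_tau nl[OF corner(4)[OF x]]])
        then have t: "\<theta> (x, 1) = \<theta> (x, 0) - 2 * of_real pi * \<i>"
          unfolding \<theta>_def per(4) by (simp add: algebra_simps)
        have "g x + A (x, 0) * (2 * of_real pi * \<i>) = A (x, 0) * ((G m (x, 1) - \<theta> (x, 1)) - (G m (x, 0) - \<theta> (x, 0)))"
          unfolding t per(1) g_def by (simp add: algebra_simps)
        also have "cmod \<dots> \<le> MA * (E * d m + E * d m)"
          unfolding norm_mult
          using norm_triangle_ineq4[of "G m (x, 1) - \<theta> (x, 1)" "G m (x, 0) - \<theta> (x, 0)"]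
            err[OF corner(3)[OF x], of m] err[OF corner(4)[OF x], of m] corner(4)[OF x] MA
          by (intro mult_mono) auto
        finally show "norm (g x + A (x, 0) * (2 * of_real pi * \<i>)) \<le> MA * (2 * E * d m)" by simp
      qed simp
      finally show "norm (Ix m - (- (2 * of_real pi * \<i>))) \<le> MA * (2 * E * d m)" by simp
    qed
    have "(\<lambda>m. MA * (2 * E * d m)) \<longlonglongrightarrow> MA * (2 * E * 0)"
      unfolding d_def by (intro tendsto_intros LIMSEQ_inverse_real_of_nat)
    then show "(\<lambda>m. MA * (2 * E * d m)) \<longlonglongrightarrow> 0" by simp
  qed
  then have Ix_lim: "Ix \<longlonglongrightarrow> - (2 * of_real pi * \<i>)" by (rule LIM_zero_cancel)
  define M where "M = (\<lambda>l m. LINT p|lborel. indicator ?S p * jacobian p * reg_mass (d m) (Z p - z - l))"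
  have Meq: "M l m = integral ?S (\<lambda>p. 1 * jacobian p * reg_mass (d m) (Z p - z - l))" for l m
  proof -
    have "continuous_on ?S (\<lambda>p. 1 * jacobian p * reg_mass (d m) (Z p - z - l))"
      by (intro continuous_intros jacobian_cont continuous_on_compose2[OF reg_mass_cont[OF d, of UNIV]] Z_cont) auto
    from lborel_integral_cbox_eq(2)[OF this] show ?thesis by (simp add: M_def mult.assoc)
  qed
  \<comment> \<open>The field annihilates the constant 1, so the left side of Green's formula is 0
    and the masses balance the boundary terms.\<close>
  have "(\<Sum>l\<in>F. M l m) = Ix m - Iy m" for m
  proof -
    have f0: "field (\<lambda>_. 1) p = 0" for p by (simp add: field_def C1_on_const)
    have "integral ?S (\<lambda>p. G m p * field (\<lambda>_. 1) p) = (\<Sum>l\<in>F. M l m) + Iy m - Ix m"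
      unfolding Meq Iy_def Ix_def G_def
      using green_regularised[OF F(1) d[of m] k(1) open_ball RS C1_on_const(1)[of _ 1]] by simp
    then show ?thesis by (simp add: f0 algebra_simps)
  qed
  then have sum_lim: "(\<lambda>m. \<Sum>l\<in>F. M l m) \<longlonglongrightarrow> - (2 * of_real pi * \<i>)"
    using tendsto_diff[OF Ix_lim Iy_lim] by simp
  \<comment> \<open>Only the pole with l = 0 sits in the open square, so it alone carries the total
    mass.\<close>
  have other: "(\<lambda>m. M l m) \<longlonglongrightarrow> 0" if "l \<in> F - {0}" for l
  proof -
    have "l \<in> range lattice_point" unfolding range_lattice_point using that F(2) by blast
    then obtain n where n: "l = lattice_point n" by blast
    then have "n \<noteq> (0, 0)" using that by (auto simp: lattice_point_def)
    from mass_other_periods[OF p0 this] show ?thesis unfolding M_def n z_def d_def .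
  qed
  have "(\<lambda>m. (\<Sum>l\<in>F. M l m) - (\<Sum>l\<in>F - {0}. M l m)) \<longlonglongrightarrow> - (2 * of_real pi * \<i>) - (\<Sum>l\<in>F - {0}. 0)"
    by (intro tendsto_diff sum_lim tendsto_sum other)
  moreover have "(\<Sum>l\<in>F. M l m) - (\<Sum>l\<in>F - {0}. M l m) = M 0 m" for m
    using F by (simp add: sum.remove)
  ultimately show ?thesis by (simp add: M_def z_def d_def)
qed

end

section \<open>The theta kernel as a fundamental solution\<close>

context periodic_primitive
begin

lemma field_continuous:
  assumes "C1_on UNIV \<phi>"
  shows "continuous_on S (field \<phi>)"
  unfolding field_def using assms
  by (intro continuous_intros A_cont B_cont) (auto simp: C1_on_def intro: continuous_on_subset)

lemma AE_Z_diff_notin_lattice: "AE p in lborel. Z p - Z p0 \<notin> period_lattice \<tau>"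
proof -
  have "{p. Z p - Z p0 \<in> period_lattice \<tau>} = range (\<lambda>n. int_vec n + p0)"
    unfolding Z_diff_in_lattice_iff by auto
  then have "countable {p. Z p - Z p0 \<in> period_lattice \<tau>}" by simp
  then have "{p. Z p - Z p0 \<in> period_lattice \<tau>} \<in> null_sets lborel" by (rule countable_imp_null_set_lborel)
  then show ?thesis by (rule AE_I') auto
qed

text \<open>The translated \<phi> is compared with its value at \<open>p0\<close> times the
  indicator of the unit square. The difference is O(|q - p0|) and disappears by
  \<open>concentration\<close>; the indicator has the mass found in
  \<open>mass_limit\<close>.\<close>

lemma mass_at_point:
  assumes p0: "p0 \<in> box (0, 0) (1, 1)" "jacobian p0 \<noteq> 0"
    and \<phi>: "C1_on UNIV \<phi>" and Q: "compact Q" and supp: "\<And>p. p \<notin> Q \<Longrightarrow> \<phi> p = 0"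
  shows "(\<lambda>m. LINT p|lborel. \<phi> p * jacobian p * reg_mass (inverse (real (Suc m))) (Z p - Z p0 - lattice_point n))
    \<longlonglongrightarrow> - (2 * of_real pi * \<i>) * \<phi> (int_vec n + p0)"
proof -
  let ?S = "cbox (0, 0) (1, 1) :: (real \<times> real) set"
  define d where "d = (\<lambda>m. inverse (real (Suc m)))"
  have d: "0 < d m" for m by (simp add: d_def)
  define c where "c = \<phi> (int_vec n + p0)"
  define Q' where "Q' = (\<lambda>p. - int_vec n + p) ` Q"
  have Q': "compact Q'" unfolding Q'_def by (intro compact_continuous_image continuous_intros Q)
  have supp': "\<phi> (int_vec n + q) = 0" if "q \<notin> Q'" for q
  proof (rule supp, rule notI)
    assume "int_vec n + q \<in> Q"
    then have "- int_vec n + (int_vec n + q) \<in> Q'" unfolding Q'_def by (rule imageI)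
    then show False using that by simp
  qed
  have c\<phi>: "continuous_on S \<phi>" for S
    using C1_on_imp_continuous_on[OF \<phi>] by (rule continuous_on_subset) simp
  have c\<phi>': "continuous_on S (\<lambda>q. \<phi> (int_vec n + q))" for S
    by (rule continuous_on_compose2[OF c\<phi>[of UNIV]]) (auto intro!: continuous_intros)
  have [measurable]: "\<phi> \<in> borel_measurable borel" "(\<lambda>q. \<phi> (int_vec n + q)) \<in> borel_measurable borel"
    using c\<phi> c\<phi>' by (auto intro: borel_measurable_continuous_onI)
  obtain L where L: "0 \<le> L" "\<And>p q. cmod (\<phi> p - \<phi> q) \<le> L * norm (p - q)"
    using C1_compact_support_Lipschitz[OF \<phi> Q supp] by blast
  obtain \<eta> where \<eta>: "0 < \<eta>" "\<And>q. q \<notin> box (0, 0) (1, 1) \<Longrightarrow> \<eta> \<le> norm (q - p0)"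
    using unit_box_margin[OF p0(1)] by blast
  \<comment> \<open>Inside the square the Lipschitz constant of \<phi> controls \<open>f\<close>.
    Outside, the missing value c is bounded by |c| / \<eta> times |q - p0|, as \<open>p0\<close> has
    distance at least \<eta> from there.\<close>
  define f where "f = (\<lambda>q. \<phi> (int_vec n + q) - c * indicator ?S q)"
  have f_lim: "(\<lambda>m. LINT q|lborel. f q * jacobian q * reg_mass (d m) (Z q - Z p0)) \<longlonglongrightarrow> 0"
    unfolding d_def
  proof (rule concentration[where K = "Q' \<union> ?S" and C = "L + cmod c / \<eta>", OF _ p0(2)])
    show "compact (Q' \<union> ?S)" using Q' by (rule compact_Un) (rule compact_cbox)
    show "f \<in> borel_measurable borel" unfolding f_def by measurable
    show "f q = 0" if "q \<notin> Q' \<union> ?S" for q using that supp' by (simp add: f_def)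
    show "cmod (f q) \<le> (L + cmod c / \<eta>) * norm (q - p0)" for q
    proof -
      have 1: "cmod (\<phi> (int_vec n + q) - c) \<le> L * norm (q - p0)"
        using L(2)[of "int_vec n + q" "int_vec n + p0"] by (simp add: c_def)
      have 2: "cmod (c - c * indicator ?S q) \<le> cmod c / \<eta> * norm (q - p0)"
      proof (cases "q \<in> ?S")
        case False
        then have "q \<notin> box (0, 0) (1, 1)" using box_subset_cbox by blast
        then have "cmod c * \<eta> \<le> cmod c * norm (q - p0)" by (intro mult_left_mono \<eta>(2)) auto
        then show ?thesis using False \<eta>(1) by (simp add: field_simps)
      qed (use \<eta>(1) in simp)
      have "f q = (\<phi> (int_vec n + q) - c) + (c - c * indicator ?S q)" by (simp add: f_def)
      then have "cmod (f q) \<le> cmod (\<phi> (int_vec n + q) - c) + cmod (c - c * indicator ?S q)"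
        using norm_triangle_ineq by metis
      then show ?thesis using 1 2 by (simp add: algebra_simps)
    qed
  qed
  have m_lim: "(\<lambda>m. LINT q|lborel. indicator ?S q * jacobian q * reg_mass (d m) (Z q - Z p0)) \<longlonglongrightarrow> - (2 * of_real pi * \<i>)"
    unfolding d_def by (rule mass_limit[OF p0])
  have cm: "continuous_on S (\<lambda>q. jacobian q * reg_mass (d m) (Z q - Z p0))" for S m
    by (intro continuous_intros jacobian_cont continuous_on_compose2[OF reg_mass_cont[OF d, of UNIV]] Z_cont) auto
  have i1: "integrable lborel (\<lambda>q. \<phi> (int_vec n + q) * jacobian q * reg_mass (d m) (Z q - Z p0))" for m
  proof -
    have "integrable lborel (\<lambda>q. indicator Q' q *\<^sub>R (\<phi> (int_vec n + q) * (jacobian q * reg_mass (d m) (Z q - Z p0))))"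
      by (intro borel_integrable_compact Q' continuous_intros c\<phi>' cm)
    also have "(\<lambda>q. indicator Q' q *\<^sub>R (\<phi> (int_vec n + q) * (jacobian q * reg_mass (d m) (Z q - Z p0)))) =
        (\<lambda>q. \<phi> (int_vec n + q) * jacobian q * reg_mass (d m) (Z q - Z p0))"
      using supp' by (auto simp: fun_eq_iff split: split_indicator)
    finally show ?thesis .
  qed
  have i2: "integrable lborel (\<lambda>q. indicator ?S q * jacobian q * reg_mass (d m) (Z q - Z p0))" for m
    using lborel_integral_cbox_eq(1)[OF cm] by (simp add: mult.assoc)
  have "(LINT q|lborel. \<phi> (int_vec n + q) * jacobian q * reg_mass (d m) (Z q - Z p0)) =
     (LINT q|lborel. f q * jacobian q * reg_mass (d m) (Z q - Z p0)) +
     c * (LINT q|lborel. indicator ?S q * jacobian q * reg_mass (d m) (Z q - Z p0))" for m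
  proof -
    have "(LINT q|lborel. f q * jacobian q * reg_mass (d m) (Z q - Z p0)) =
        (LINT q|lborel. \<phi> (int_vec n + q) * jacobian q * reg_mass (d m) (Z q - Z p0) -
          c * (indicator ?S q * jacobian q * reg_mass (d m) (Z q - Z p0)))"
      by (rule Bochner_Integration.integral_cong) (simp_all add: f_def algebra_simps)
    also have "\<dots> = (LINT q|lborel. \<phi> (int_vec n + q) * jacobian q * reg_mass (d m) (Z q - Z p0)) -
        (LINT q|lborel. c * (indicator ?S q * jacobian q * reg_mass (d m) (Z q - Z p0)))"
      by (rule Bochner_Integration.integral_diff[OF i1 integrable_mult_right[OF i2]])
    also have "(LINT q|lborel. c * (indicator ?S q * jacobian q * reg_mass (d m) (Z q - Z p0))) =
        c * (LINT q|lborel. indicator ?S q * jacobian q * reg_mass (d m) (Z q - Z p0))"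
      by (rule integral_mult_right_zero)
    finally show ?thesis by simp
  qed
  moreover have "(\<lambda>m. (LINT q|lborel. f q * jacobian q * reg_mass (d m) (Z q - Z p0)) +
     c * (LINT q|lborel. indicator ?S q * jacobian q * reg_mass (d m) (Z q - Z p0))) \<longlonglongrightarrow> 0 + c * (- (2 * of_real pi * \<i>))"
    by (intro tendsto_add tendsto_mult tendsto_const f_lim m_lim)
  ultimately show ?thesis
    by (simp add: mass_translate d_def c_def mult.commute)
qed

text \<open>In the language of distributions, the field applied to the kernel in its first argument
  is 2 pi i times the sum of the point masses at the integer translates of \<open>p0\<close>. On a
  box containing the support of \<phi> the boundary terms of Green's formula vanish.\<close>

theorem theta_pairing:
  assumes p0: "p0 \<in> box (0, 0) (1, 1)" "jacobian p0 \<noteq> 0"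
    and \<phi>: "C1_on UNIV \<phi>" and supp: "\<And>p. \<phi> p \<noteq> 0 \<Longrightarrow> p \<in> box (- M, - M) (M, M)"
    and N: "finite N" "\<And>n. \<phi> (int_vec n + p0) \<noteq> 0 \<Longrightarrow> n \<in> N"
  shows "(LINT p|lborel. theta_logder \<tau> (Z p - Z p0) * field \<phi> p) = - (2 * of_real pi * \<i>) * (\<Sum>n\<in>N. \<phi> (int_vec n + p0))"
proof (cases "M > 0")
  case False
  have "p \<notin> box (- M, - M) (M, M)" for p :: "real \<times> real"
    using False by (cases p) (auto simp: mem_box Basis_prod_def)
  then have z: "\<phi> p = 0" for p using supp by blast
  have "dx \<phi> p = 0" "dy \<phi> p = 0" for p using dx_dy_eq_0[OF open_UNIV UNIV_I z] by auto
  then show ?thesis by (simp add: field_def z)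
next
  case M: True
  let ?Q = "cbox (- M, - M) (M, M) :: (real \<times> real) set"
  define z where "z = Z p0"
  define d where "d = (\<lambda>m. inverse (real (Suc m)))"
  have d: "0 < d m" for m by (simp add: d_def)
  have suppQ: "\<phi> p = 0" if "p \<notin> ?Q" for p using supp[of p] that box_subset_cbox by blast
  have field0: "field \<phi> p = 0" if "p \<notin> ?Q" for p
    using dx_dy_eq_0[of "- ?Q" p \<phi>] suppQ that by (simp add: field_def open_Compl closed_cbox)
  have cf: "continuous_on S (field \<phi>)" for S by (rule field_continuous[OF \<phi>])
  have [measurable]: "field \<phi> \<in> borel_measurable borel" using cf by (rule borel_measurable_continuous_onI)
  have cZ: "continuous_on ?Q (\<lambda>p. Z p - z)" by (intro continuous_intros Z_cont)
  obtain R0 where R0: "0 < R0" "\<And>p. p \<in> ?Q \<Longrightarrow> cmod (Z p - z) \<le> R0"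
    using continuous_on_compact_norm_bound[OF compact_cbox cZ] by blast
  \<comment> \<open>The sum makes the disc large enough to contain the lattice points of all indices
    in \<open>N\<close>, so that N is a subset of N'; further indices in N' contribute 0.\<close>
  define R where "R = R0 + 1 + (\<Sum>n\<in>N. cmod (lattice_point n))"
  have RS: "Z p - z \<in> ball 0 R" if "p \<in> ?Q" for p
    using R0(2)[OF that] sum_nonneg[of N "\<lambda>n. cmod (lattice_point n)"] by (simp add: R_def)
  define F where "F = {l \<in> period_lattice \<tau>. cmod l \<le> R}"
  have F: "finite F" unfolding F_def by (rule finite_period_lattice[OF Im_tau])
  define N' where "N' = {n. cmod (lattice_point n) \<le> R}"
  have FN: "F = lattice_point ` N'" unfolding F_def N'_def range_lattice_point[symmetric] by auto
  have injN: "inj_on lattice_point N'" using inj_lattice_point by (rule inj_on_subset) simp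
  have finN: "finite N'" using F injN unfolding FN by (simp add: finite_image_iff)
  have NN: "N \<subseteq> N'"
  proof
    fix n assume n: "n \<in> N"
    have "cmod (lattice_point n) \<le> (\<Sum>n\<in>N. cmod (lattice_point n))"
      using n N(1) by (intro member_le_sum) auto
    then show "n \<in> N'" using R0(1) by (simp add: N'_def R_def)
  qed
  obtain k where k: "k holomorphic_on ball 0 R"
    "\<And>w. w \<in> ball 0 R - period_lattice \<tau> \<Longrightarrow> theta_logder \<tau> w = (\<Sum>l\<in>F. 1 / (w - l)) + k w"
    using theta_logder_partial_fractions[OF Im_tau, of R] unfolding F_def by blast
  define G where "G = (\<lambda>m p. reg_kernel F k (d m) (Z p - z))"
  have cG: "continuous_on ?Q (G m)" for m
    unfolding G_def by (rule C1_on_imp_continuous_on[OF reg_kernel_Z(1)[OF F d k(1) open_ball RS]])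
  have ck: "continuous_on ?Q (\<lambda>p. k (Z p - z))"
    by (rule continuous_on_compose2[OF holomorphic_on_imp_continuous_on[OF k(1)] cZ]) (use RS in blast)
  obtain K0 where K0: "0 < K0" "\<And>p. p \<in> ?Q \<Longrightarrow> cmod (k (Z p - z)) \<le> K0"
    using continuous_on_compact_norm_bound[OF compact_cbox ck] by blast
  obtain \<Phi> where \<Phi>: "0 < \<Phi>" "\<And>p. p \<in> ?Q \<Longrightarrow> cmod (field \<phi> p) \<le> \<Phi>"
    using continuous_on_compact_norm_bound[OF compact_cbox cf] by blast
  have lim: "(\<lambda>m. LINT p|lborel. indicator ?Q p * (G m p * field \<phi> p)) \<longlonglongrightarrow>
      (LINT p|lborel. indicator ?Q p * (theta_logder \<tau> (Z p - z) * field \<phi> p))"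
  proof (rule integral_dominated_convergence[where w = "\<lambda>p. (\<Sum>l\<in>F. indicator ?Q p * cmod (1 / (z + l - Z p))) * \<Phi> + indicator ?Q p * (K0 * \<Phi>)"])
    have i: "integrable lborel (\<lambda>p. indicator ?Q p * c)" for c :: real
      using emeasure_compact_finite[OF compact_cbox, of "(- M, - M)" "(M, M)"]
      by (intro integrable_mult_left integrable_real_indicator) auto
    show "integrable lborel (\<lambda>p. (\<Sum>l\<in>F. indicator ?Q p * cmod (1 / (z + l - Z p))) * \<Phi> + indicator ?Q p * (K0 * \<Phi>))"
      by (intro Bochner_Integration.integrable_add integrable_mult_left Bochner_Integration.integrable_sum inverse_Z_integrable compact_cbox i)
    show "(\<lambda>p. indicator ?Q p * (theta_logder \<tau> (Z p - z) * field \<phi> p)) \<in> borel_measurable lborel"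
      using theta_logder_measurable[OF Im_tau] by measurable
    show "(\<lambda>p. indicator ?Q p * (G m p * field \<phi> p)) \<in> borel_measurable lborel" for m
      by (rule borel_measurable_integrable[OF lborel_integral_cbox_eq(1)]) (intro continuous_intros cG cf)
    show "AE p in lborel. (\<lambda>m. indicator ?Q p * (G m p * field \<phi> p)) \<longlonglongrightarrow> indicator ?Q p * (theta_logder \<tau> (Z p - z) * field \<phi> p)"
      using AE_Z_diff_notin_lattice[of p0]
    proof eventually_elim
      case (elim p)
      show ?case
      proof (cases "p \<in> ?Q")
        case True
        then have "Z p - z \<in> ball 0 R - period_lattice \<tau>" using RS elim by (simp add: z_def)
        from k(2)[OF this] have t: "theta_logder \<tau> (Z p - z) = (\<Sum>l\<in>F. 1 / (Z p - z - l)) + k (Z p - z)" .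
        show ?thesis
          unfolding t G_def reg_kernel_def d_def by (intro tendsto_intros cauchy_reg_tendsto)
      qed simp
    qed
    show "AE p in lborel. norm (indicator ?Q p * (G m p * field \<phi> p)) \<le>
        (\<Sum>l\<in>F. indicator ?Q p * cmod (1 / (z + l - Z p))) * \<Phi> + indicator ?Q p * (K0 * \<Phi>)" for m
    proof (rule AE_I2)
      fix p
      show "norm (indicator ?Q p * (G m p * field \<phi> p)) \<le>
        (\<Sum>l\<in>F. indicator ?Q p * cmod (1 / (z + l - Z p))) * \<Phi> + indicator ?Q p * (K0 * \<Phi>)"
      proof (cases "p \<in> ?Q")
        case True
        have "cmod (G m p) \<le> cmod (\<Sum>l\<in>F. cauchy_reg (d m) (Z p - z - l)) + cmod (k (Z p - z))"
          unfolding G_def reg_kernel_def by (rule norm_triangle_ineq)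
        also have "\<dots> \<le> (\<Sum>l\<in>F. cmod (1 / (z + l - Z p))) + K0"
        proof (intro add_mono K0(2) True order_trans[OF norm_sum] sum_mono)
          fix l
          have "cmod (1 / (Z p - z - l)) = cmod (1 / (z + l - Z p))"
            unfolding norm_divide by (metis diff_diff_eq norm_minus_commute)
          then show "cmod (cauchy_reg (d m) (Z p - z - l)) \<le> cmod (1 / (z + l - Z p))"
            using norm_cauchy_reg_le[OF d[of m], of "Z p - z - l"] by simp
        qed
        finally have g: "cmod (G m p) \<le> (\<Sum>l\<in>F. cmod (1 / (z + l - Z p))) + K0" .
        have "cmod (G m p) * cmod (field \<phi> p) \<le> ((\<Sum>l\<in>F. cmod (1 / (z + l - Z p))) + K0) * \<Phi>"
          by (rule mult_mono[OF g \<Phi>(2)[OF True] order_trans[OF norm_ge_zero g]]) simp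
        then show ?thesis using True by (simp add: norm_mult algebra_simps)
      qed simp
    qed
  qed
  have green: "(LINT p|lborel. indicator ?Q p * (G m p * field \<phi> p)) =
      (\<Sum>n\<in>N'. LINT p|lborel. \<phi> p * jacobian p * reg_mass (d m) (Z p - z - lattice_point n))" for m
  proof -
    have cm: "continuous_on S (\<lambda>p. \<phi> p * jacobian p * reg_mass (d m) (Z p - z - l))" for l S
      using C1_on_imp_continuous_on[OF \<phi>]
      by (intro continuous_intros jacobian_cont continuous_on_compose2[OF reg_mass_cont[OF d, of UNIV]] Z_cont)
         (auto intro: continuous_on_subset)
    have edge: "\<phi> (M, y) = 0" "\<phi> (- M, y) = 0" "\<phi> (y, M) = 0" "\<phi> (y, - M) = 0" for y
      using supp[of "(M, y)"] supp[of "(- M, y)"] supp[of "(y, M)"] supp[of "(y, - M)"]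
      by (auto simp: mem_box Basis_prod_def)
    have "(LINT p|lborel. indicator ?Q p * (G m p * field \<phi> p)) = integral ?Q (\<lambda>p. G m p * field \<phi> p)"
      by (rule lborel_integral_cbox_eq(2)) (intro continuous_intros cG cf)
    also have "\<dots> = (\<Sum>l\<in>F. integral ?Q (\<lambda>p. \<phi> p * jacobian p * reg_mass (d m) (Z p - z - l)))"
      unfolding G_def
      using green_regularised[OF F d[of m] k(1) open_ball RS C1_on_subset[OF \<phi> subset_UNIV]] M by (simp add: edge)
    also have "\<dots> = (\<Sum>l\<in>F. LINT p|lborel. \<phi> p * jacobian p * reg_mass (d m) (Z p - z - l))"
    proof (rule sum.cong[OF refl])
      fix l
      have "integral ?Q (\<lambda>p. \<phi> p * jacobian p * reg_mass (d m) (Z p - z - l)) =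
          (LINT p|lborel. indicator ?Q p * (\<phi> p * jacobian p * reg_mass (d m) (Z p - z - l)))"
        by (rule lborel_integral_cbox_eq(2)[OF cm, symmetric])
      also have "\<dots> = (LINT p|lborel. \<phi> p * jacobian p * reg_mass (d m) (Z p - z - l))"
        by (rule Bochner_Integration.integral_cong) (auto simp: suppQ split: split_indicator)
      finally show "integral ?Q (\<lambda>p. \<phi> p * jacobian p * reg_mass (d m) (Z p - z - l)) =
        (LINT p|lborel. \<phi> p * jacobian p * reg_mass (d m) (Z p - z - l))" .
    qed
    also have "\<dots> = (\<Sum>n\<in>N'. LINT p|lborel. \<phi> p * jacobian p * reg_mass (d m) (Z p - z - lattice_point n))"
      unfolding FN by (subst sum.reindex[OF injN]) simp
    finally show ?thesis .
  qed
  have "(\<lambda>m. \<Sum>n\<in>N'. LINT p|lborel. \<phi> p * jacobian p * reg_mass (d m) (Z p - z - lattice_point n)) \<longlonglongrightarrow>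
      (\<Sum>n\<in>N'. - (2 * of_real pi * \<i>) * \<phi> (int_vec n + p0))"
    unfolding d_def z_def by (intro tendsto_sum mass_at_point[OF p0 \<phi> compact_cbox suppQ])
  then have "(LINT p|lborel. indicator ?Q p * (theta_logder \<tau> (Z p - z) * field \<phi> p)) =
      (\<Sum>n\<in>N'. - (2 * of_real pi * \<i>) * \<phi> (int_vec n + p0))"
    using LIMSEQ_unique[OF lim] unfolding green by blast
  also have "\<dots> = - (2 * of_real pi * \<i>) * (\<Sum>n\<in>N'. \<phi> (int_vec n + p0))"
    by (rule sum_distrib_left[symmetric])
  also have "(\<Sum>n\<in>N'. \<phi> (int_vec n + p0)) = (\<Sum>n\<in>N. \<phi> (int_vec n + p0))"
    by (rule sum.mono_neutral_right[OF finN NN]) (use N(2) in blast)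
  also have "(LINT p|lborel. indicator ?Q p * (theta_logder \<tau> (Z p - z) * field \<phi> p)) =
      (LINT p|lborel. theta_logder \<tau> (Z p - Z p0) * field \<phi> p)"
    by (rule Bochner_Integration.integral_cong) (auto simp: field0 z_def split: split_indicator)
  finally show ?thesis .
qed

end

section \<open>The integral operator\<close>

lemma holomorphic_Lipschitz_cball:
  assumes k: "k holomorphic_on ball 0 R" and R': "R' < R"
  shows "\<exists>L\<ge>0. \<forall>w\<in>cball 0 R'. \<forall>w'\<in>cball 0 R'. cmod (k w - k w') \<le> L * cmod (w - w')"
proof -
  have sub: "cball 0 R' \<subseteq> ball (0 :: complex) R" using R' by auto
  have "continuous_on (ball 0 R) (deriv k)"
    using holomorphic_deriv[OF k open_ball] by (rule holomorphic_on_imp_continuous_on)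
  then have "continuous_on (cball 0 R') (deriv k)" using sub by (rule continuous_on_subset)
  from continuous_on_compact_norm_bound[OF compact_cball this]
  obtain L where L: "0 < L" "\<And>w. w \<in> cball 0 R' \<Longrightarrow> cmod (deriv k w) \<le> L" by blast
  have "cmod (k w - k w') \<le> L * cmod (w - w')" if "w \<in> cball 0 R'" "w' \<in> cball 0 R'" for w w'
  proof (rule field_differentiable_bound[OF convex_cball _ L(2) that])
    fix w :: complex assume "w \<in> cball 0 R'"
    then show "(k has_field_derivative deriv k w) (at w within cball 0 R')"
      using holomorphic_derivI[OF k open_ball] sub by (blast intro: has_field_derivative_at_within)
  qed
  then show ?thesis using L(1) by (intro exI[of _ L]) auto
qed

locale theta_potential = periodic_primitive +
  fixes q r :: real and g :: "real \<times> real \<Rightarrow> complex"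
  assumes exponents: "1 < r" "1 < q" "1 / r + 1 / q = 1" "r < \<beta>" "\<beta> < 2 * r"
    and g_measurable [measurable]: "g \<in> borel_measurable borel"
    and g_power: "integrable (restrict_space lborel (cbox (0, 0) (1, 1))) (\<lambda>s. cmod (g s) powr q)"
begin

abbreviation US :: "(real \<times> real) measure" where
  "US \<equiv> restrict_space lborel (cbox (0, 0) (1, 1))"

abbreviation \<kappa> :: "real \<times> real \<Rightarrow> real \<times> real \<Rightarrow> complex" where
  "\<kappa> p s \<equiv> theta_logder \<tau> (Z p - Z s)"

definition T :: "real \<times> real \<Rightarrow> complex" where
  "T p = 1 / (2 * of_real pi * \<i>) * (LINT s|US. \<kappa> p s * g s)"

lemma US_measurable: "f \<in> borel_measurable borel \<Longrightarrow> f \<in> borel_measurable US"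
  by (rule measurable_restrict_space1) simp

lemma US_measurable_continuous:
  fixes f :: "real \<times> real \<Rightarrow> complex"
  assumes "continuous_on (cbox (0, 0) (1, 1)) f"
  shows "f \<in> borel_measurable US"
proof -
  have "f \<in> borel_measurable (restrict_space borel (cbox (0, 0) (1, 1)))"
    by (rule borel_measurable_continuous_on_restrict[OF assms])
  also have "borel_measurable (restrict_space borel (cbox (0, 0) (1, 1))) = (borel_measurable US :: (real \<times> real \<Rightarrow> complex) set)"
    by (rule measurable_cong_sets) (auto simp: sets_restrict_space)
  finally show ?thesis .
qed

lemma US_finite: "emeasure US (space US) < \<infinity>"
  using emeasure_compact_finite[OF compact_cbox, of "(0, 0)" "(1, 1)"]
  by (simp add: emeasure_restrict_space space_restrict_space)

lemma AE_US: "AE s in lborel. P s \<Longrightarrow> AE s in US. P s"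
  by (subst AE_restrict_space_iff) (auto elim: eventually_mono)

lemma kappa_measurable [measurable]: "\<kappa> p \<in> borel_measurable borel"
  using theta_logder_measurable[OF Im_tau] by measurable

lemma g_integrable: "integrable US g"
proof (rule Bochner_Integration.integrable_bound)
  show "integrable US (\<lambda>s. 1 + cmod (g s) powr q)"
    using US_finite by (intro Bochner_Integration.integrable_add g_power)
      (auto simp: integrable_iff_bounded ennreal_mult_less_top)
  show "g \<in> borel_measurable US" by (rule US_measurable) simp
  have "cmod (g s) \<le> 1 + cmod (g s) powr q" for s
  proof (cases "cmod (g s) \<le> 1")
    case False
    then have "cmod (g s) powr 1 \<le> cmod (g s) powr q" using exponents by (intro powr_mono) auto
    then show ?thesis using False by simp
  qed (simp add: add_increasing2)
  then show "AE s in US. norm (g s) \<le> norm (1 + cmod (g s) powr q)" by (intro AE_I2) simp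
qed

text \<open>For p in a compact set and s in the unit square the differences Z p - Z s stay in one
  disc, so a single partial fraction expansion serves all of them. The margin 1 in its radius keeps
  the remainder and its derivative bounded.\<close>

lemma kernel_decomposition:
  assumes K: "compact K"
  obtains F k D L where "finite F" "0 < D" "0 \<le> L"
    "\<And>p. p \<in> K \<Longrightarrow> continuous_on (cbox (0, 0) (1, 1)) (\<lambda>s. k (Z p - Z s))"
    "\<And>p s. p \<in> K \<Longrightarrow> s \<in> cbox (0, 0) (1, 1) \<Longrightarrow> Z p - Z s \<notin> period_lattice \<tau> \<Longrightarrow>
      \<kappa> p s = (\<Sum>l\<in>F. 1 / (Z p - Z s - l)) + k (Z p - Z s)"
    "\<And>p s. p \<in> K \<Longrightarrow> s \<in> cbox (0, 0) (1, 1) \<Longrightarrow> cmod (k (Z p - Z s)) \<le> D"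
    "\<And>p p' s. p \<in> K \<Longrightarrow> p' \<in> K \<Longrightarrow> s \<in> cbox (0, 0) (1, 1) \<Longrightarrow> cmod (k (Z p - Z s) - k (Z p' - Z s)) \<le> L * cmod (Z p - Z p')"
proof -
  let ?S = "cbox (0, 0) (1, 1) :: (real \<times> real) set"
  obtain R1 where R1: "0 < R1" "\<And>p. p \<in> K \<Longrightarrow> cmod (Z p) \<le> R1"
    using continuous_on_compact_norm_bound[OF K Z_cont] by blast
  obtain R2 where R2: "0 < R2" "\<And>s. s \<in> ?S \<Longrightarrow> cmod (Z s) \<le> R2"
    using continuous_on_compact_norm_bound[OF compact_cbox Z_cont] by blast
  define R' where "R' = R1 + R2"
  have in_cball: "Z p - Z s \<in> cball 0 R'" if "p \<in> K" "s \<in> ?S" for p s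
    using norm_triangle_ineq4[of "Z p" "Z s"] R1(2)[OF that(1)] R2(2)[OF that(2)] by (simp add: R'_def)
  have in_ball: "Z p - Z s \<in> ball 0 (R' + 1)" if "p \<in> K" "s \<in> ?S" for p s
    using in_cball[OF that] by simp
  define F where "F = {l \<in> period_lattice \<tau>. cmod l \<le> R' + 1}"
  have F: "finite F" unfolding F_def by (rule finite_period_lattice[OF Im_tau])
  obtain k where k: "k holomorphic_on ball 0 (R' + 1)"
    "\<And>w. w \<in> ball 0 (R' + 1) - period_lattice \<tau> \<Longrightarrow> theta_logder \<tau> w = (\<Sum>l\<in>F. 1 / (w - l)) + k w"
    using theta_logder_partial_fractions[OF Im_tau, of "R' + 1"] unfolding F_def by blast
  note ck = holomorphic_on_imp_continuous_on[OF k(1)]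
  have "continuous_on (cball 0 R') k" by (rule continuous_on_subset[OF ck]) auto
  from continuous_on_compact_norm_bound[OF compact_cball this]
  obtain D where D: "0 < D" "\<And>w. w \<in> cball 0 R' \<Longrightarrow> cmod (k w) \<le> D" by blast
  obtain L where L: "0 \<le> L" "\<And>w w'. w \<in> cball 0 R' \<Longrightarrow> w' \<in> cball 0 R' \<Longrightarrow> cmod (k w - k w') \<le> L * cmod (w - w')"
    using holomorphic_Lipschitz_cball[OF k(1), of R'] by auto
  show thesis
  proof (rule that[OF F D(1) L(1)])
    show "continuous_on ?S (\<lambda>s. k (Z p - Z s))" if "p \<in> K" for p
      by (rule continuous_on_compose2[OF ck])
         (intro continuous_intros Z_cont image_subsetI in_ball that; assumption)+
    show "\<kappa> p s = (\<Sum>l\<in>F. 1 / (Z p - Z s - l)) + k (Z p - Z s)"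
      if "p \<in> K" "s \<in> ?S" "Z p - Z s \<notin> period_lattice \<tau>" for p s
      using k(2) in_ball[OF that(1,2)] that(3) by blast
    show "cmod (k (Z p - Z s)) \<le> D" if "p \<in> K" "s \<in> ?S" for p s
      by (rule D(2)[OF in_cball[OF that]])
    show "cmod (k (Z p - Z s) - k (Z p' - Z s)) \<le> L * cmod (Z p - Z p')"
      if "p \<in> K" "p' \<in> K" "s \<in> ?S" for p p' s
      using L(2)[OF in_cball[OF that(1,3)] in_cball[OF that(2,3)]] by simp
  qed
qed

text \<open>The lattice point is absorbed into the evaluation point Z p - l, so that every singular
  term becomes a Cauchy potential to which the estimates uniform in z apply. The exceptional set of
  s is countable.\<close>

lemma kernel_split:
  assumes K: "compact K"
  obtains F k L where "finite F" "0 \<le> L"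
    "\<And>p. p \<in> K \<Longrightarrow> continuous_on (cbox (0, 0) (1, 1)) (\<lambda>s. k (Z p - Z s))"
    "\<And>p. p \<in> K \<Longrightarrow> AE s in US. \<kappa> p s * g s = (\<Sum>l\<in>F. g s / ((Z p - l) - Z s)) + k (Z p - Z s) * g s"
    "\<And>p p' s. p \<in> K \<Longrightarrow> p' \<in> K \<Longrightarrow> s \<in> cbox (0, 0) (1, 1) \<Longrightarrow> cmod (k (Z p - Z s) - k (Z p' - Z s)) \<le> L * cmod (Z p - Z p')"
proof (rule kernel_decomposition[OF K])
  fix F :: "complex set" and k :: "complex \<Rightarrow> complex" and D L :: real
  assume F: "finite F" and L: "0 \<le> L"
    and k: "\<And>p. p \<in> K \<Longrightarrow> continuous_on (cbox (0, 0) (1, 1)) (\<lambda>s. k (Z p - Z s))"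
    and decomposition: "\<And>p s. p \<in> K \<Longrightarrow> s \<in> cbox (0, 0) (1, 1) \<Longrightarrow> Z p - Z s \<notin> period_lattice \<tau> \<Longrightarrow>
      \<kappa> p s = (\<Sum>l\<in>F. 1 / (Z p - Z s - l)) + k (Z p - Z s)"
    and lip: "\<And>p p' s. p \<in> K \<Longrightarrow> p' \<in> K \<Longrightarrow> s \<in> cbox (0, 0) (1, 1) \<Longrightarrow> cmod (k (Z p - Z s) - k (Z p' - Z s)) \<le> L * cmod (Z p - Z p')"
  show thesis
  proof (rule that[OF F L k _ lip])
    fix p assume p: "p \<in> K"
    have "AE s in US. Z s - Z p \<notin> period_lattice \<tau>" by (rule AE_US[OF AE_Z_diff_notin_lattice])
    moreover have "AE s in US. s \<in> cbox (0, 0) (1, 1)" by (intro AE_I2) (simp add: space_restrict_space)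
    ultimately show "AE s in US. \<kappa> p s * g s = (\<Sum>l\<in>F. g s / ((Z p - l) - Z s)) + k (Z p - Z s) * g s"
    proof eventually_elim
      case (elim s)
      have "Z p - Z s \<notin> period_lattice \<tau>"
        using elim(1) period_lattice_uminus[of "Z p - Z s" \<tau>] by auto
      from decomposition[OF p elim(2) this]
      have "\<kappa> p s = (\<Sum>l\<in>F. 1 / (Z p - Z s - l)) + k (Z p - Z s)" .
      also have "(\<Sum>l\<in>F. 1 / (Z p - Z s - l)) = (\<Sum>l\<in>F. 1 / ((Z p - l) - Z s))"
        by (intro sum.cong refl) (simp add: diff_diff_eq add.commute)
      finally show ?case by (simp add: distrib_right sum_distrib_right)
    qed
  qed
qed

lemma remainder_integrable:
  assumes "continuous_on (cbox (0, 0) (1, 1)) k"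
  shows "integrable US (\<lambda>s. k s * g s)"
proof -
  obtain M where M: "0 < M" "\<And>s. s \<in> cbox (0, 0) (1, 1) \<Longrightarrow> cmod (k s) \<le> M"
    using continuous_on_compact_norm_bound[OF compact_cbox assms] by blast
  show ?thesis
  proof (rule Bochner_Integration.integrable_bound[OF integrable_mult_right[OF integrable_norm[OF g_integrable], of M]])
    show "(\<lambda>s. k s * g s) \<in> borel_measurable US"
      using US_measurable_continuous[OF assms] US_measurable[OF g_measurable] by (rule borel_measurable_times)
    show "AE s in US. norm (k s * g s) \<le> norm (M * norm (g s))"
      using M by (intro AE_I2) (auto simp: space_restrict_space norm_mult intro!: mult_right_mono)
  qed
qed

lemma cauchy_integrable: "integrable US (\<lambda>s. g s / (z - Z s))"
  and cauchy_holder: "\<exists>K\<ge>0. \<forall>z z'. cmod ((LINT s|US. g s / (z - Z s)) - (LINT s|US. g s / (z' - Z s))) \<le> K * cmod (z - z') powr ((\<beta> - r) / r)"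
proof -
  obtain C0 where "upper_regular_map US Z C0 \<beta>" using upper_regular_map_compact[OF compact_cbox] by blast
  then interpret R: upper_regular_map US Z C0 \<beta> .
  note c = R.cauchy_potential[OF exponents US_measurable[OF g_measurable] g_power]
  show "integrable US (\<lambda>s. g s / (z - Z s))" by (rule c(1))
  show "\<exists>K\<ge>0. \<forall>z z'. cmod ((LINT s|US. g s / (z - Z s)) - (LINT s|US. g s / (z' - Z s))) \<le> K * cmod (z - z') powr ((\<beta> - r) / r)"
    by (rule c(2))
qed

lemma kernel_integral_split:
  assumes F: "finite F" and k: "continuous_on (cbox (0, 0) (1, 1)) (\<lambda>s. k (Z p - Z s))"
    and ae: "AE s in US. \<kappa> p s * g s = (\<Sum>l\<in>F. g s / ((Z p - l) - Z s)) + k (Z p - Z s) * g s"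
  shows "integrable US (\<lambda>s. \<kappa> p s * g s)"
    and "(LINT s|US. \<kappa> p s * g s) = (\<Sum>l\<in>F. (LINT s|US. g s / ((Z p - l) - Z s))) + (LINT s|US. k (Z p - Z s) * g s)"
proof -
  have i1: "integrable US (\<lambda>s. \<Sum>l\<in>F. g s / ((Z p - l) - Z s))"
    by (intro Bochner_Integration.integrable_sum cauchy_integrable)
  have i2: "integrable US (\<lambda>s. k (Z p - Z s) * g s)" by (rule remainder_integrable[OF k])
  note i = Bochner_Integration.integrable_add[OF i1 i2]
  have m: "(\<lambda>s. \<kappa> p s * g s) \<in> borel_measurable US" by (rule US_measurable) measurable
  show "integrable US (\<lambda>s. \<kappa> p s * g s)"
    by (rule integrable_cong_AE_imp[OF i m]) (use ae in \<open>auto elim: eventually_mono\<close>)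
  have "(LINT s|US. \<kappa> p s * g s) = (LINT s|US. (\<Sum>l\<in>F. g s / ((Z p - l) - Z s)) + k (Z p - Z s) * g s)"
    by (rule integral_cong_AE[OF m borel_measurable_integrable[OF i] ae])
  also have "\<dots> = (LINT s|US. (\<Sum>l\<in>F. g s / ((Z p - l) - Z s))) + (LINT s|US. k (Z p - Z s) * g s)"
    by (rule Bochner_Integration.integral_add[OF i1 i2])
  also have "(LINT s|US. (\<Sum>l\<in>F. g s / ((Z p - l) - Z s))) = (\<Sum>l\<in>F. (LINT s|US. g s / ((Z p - l) - Z s)))"
    by (rule Bochner_Integration.integral_sum) (rule cauchy_integrable)
  finally show "(LINT s|US. \<kappa> p s * g s) = (\<Sum>l\<in>F. (LINT s|US. g s / ((Z p - l) - Z s))) + (LINT s|US. k (Z p - Z s) * g s)" .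
qed

lemma kernel_integrable: "integrable US (\<lambda>s. \<kappa> p s * g s)"
proof (rule kernel_split[of "{p}"])
  fix F :: "complex set" and k :: "complex \<Rightarrow> complex" and L :: real
  assume "finite F"
    and "\<And>x. x \<in> {p} \<Longrightarrow> continuous_on (cbox (0, 0) (1, 1)) (\<lambda>s. k (Z x - Z s))"
    and "\<And>x. x \<in> {p} \<Longrightarrow> AE s in US. \<kappa> x s * g s = (\<Sum>l\<in>F. g s / ((Z x - l) - Z s)) + k (Z x - Z s) * g s"
  then show ?thesis using kernel_integral_split(1)[of F k p] by blast
qed simp

lemma Z_Lipschitz_compact:
  assumes K: "compact K"
  shows "\<exists>L\<ge>0. \<forall>p\<in>K. \<forall>p'\<in>K. cmod (Z p - Z p') \<le> L * norm (p - p')"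
proof -
  \<comment> \<open>The mean value inequality wants a convex set, which \<open>K\<close> need not
    be.\<close>
  obtain D where D: "K \<subseteq> cball 0 D"
    using compact_imp_bounded[OF K] by (metis bounded_iff dist_0_norm mem_cball subsetI)
  obtain MA where MA: "0 < MA" "\<And>p. p \<in> cball 0 D \<Longrightarrow> cmod (A p) \<le> MA"
    using continuous_on_compact_norm_bound[OF compact_cball A_cont] by blast
  obtain MB where MB: "0 < MB" "\<And>p. p \<in> cball 0 D \<Longrightarrow> cmod (B p) \<le> MB"
    using continuous_on_compact_norm_bound[OF compact_cball B_cont] by blast
  have bound: "cmod (Z p - Z p') \<le> (MA + MB) * norm (p - p')" if "p \<in> cball 0 D" "p' \<in> cball 0 D" for p p'
  proof (rule differentiable_bound[OF convex_cball has_derivative_at_withinI[OF Z_deriv] _ that])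
    fix x :: "real \<times> real" assume x: "x \<in> cball 0 D"
    show "onorm (\<lambda>h. of_real (fst h) * A x + of_real (snd h) * B x) \<le> MA + MB"
    proof (rule onorm_bound)
      fix h :: "real \<times> real"
      have "norm (of_real (fst h) * A x + of_real (snd h) * B x) \<le>
          norm (of_real (fst h) * A x) + norm (of_real (snd h) * B x)" by (rule norm_triangle_ineq)
      also have "\<dots> \<le> norm h * MA + norm h * MB"
        unfolding norm_mult norm_of_real
        using norm_fst_le[of "fst h" "snd h"] norm_snd_le[of "snd h" "fst h"] MA(2)[OF x] MB(2)[OF x]
        by (intro add_mono mult_mono) auto
      finally show "norm (of_real (fst h) * A x + of_real (snd h) * B x) \<le> (MA + MB) * norm h"
        by (simp add: algebra_simps)
    qed (use MA MB in simp)
  qed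
  show ?thesis
  proof (intro exI[of _ "MA + MB"] conjI ballI)
    show "0 \<le> MA + MB" using MA(1) MB(1) by simp
  qed (intro bound subsetD[OF D])
qed

text \<open>The Cauchy terms inherit their exponent because Z is Lipschitz on compact sets. The
  remainder is even Lipschitz in p, and on a bounded set this is stronger than Hoelder continuity
  with an exponent below 1.\<close>

theorem T_holder: "holder_on ((\<beta> - r) / r) UNIV T"
  unfolding holder_on_def
proof (intro allI impI)
  fix K :: "(real \<times> real) set" assume "compact K \<and> K \<subseteq> UNIV"
  then have K: "compact K" by simp
  define \<alpha> where "\<alpha> = (\<beta> - r) / r"
  have \<alpha>: "0 < \<alpha>" "\<alpha> < 1" using exponents by (auto simp: \<alpha>_def)
  obtain F k L where F: "finite F" and L: "0 \<le> L"
    and k: "\<And>p. p \<in> K \<Longrightarrow> continuous_on (cbox (0, 0) (1, 1)) (\<lambda>s. k (Z p - Z s))"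
    and ae: "\<And>p. p \<in> K \<Longrightarrow> AE s in US. \<kappa> p s * g s = (\<Sum>l\<in>F. g s / ((Z p - l) - Z s)) + k (Z p - Z s) * g s"
    and lip: "\<And>p p' s. p \<in> K \<Longrightarrow> p' \<in> K \<Longrightarrow> s \<in> cbox (0, 0) (1, 1) \<Longrightarrow> cmod (k (Z p - Z s) - k (Z p' - Z s)) \<le> L * cmod (Z p - Z p')"
    by (rule kernel_split[OF K]) (rule that)
  obtain C where C: "0 \<le> C" "\<And>z z'. cmod ((LINT s|US. g s / (z - Z s)) - (LINT s|US. g s / (z' - Z s))) \<le> C * cmod (z - z') powr \<alpha>"
    using cauchy_holder unfolding \<alpha>_def by blast
  obtain D where D: "0 \<le> D" "\<And>p p'. p \<in> K \<Longrightarrow> p' \<in> K \<Longrightarrow> cmod (Z p - Z p') \<le> D * norm (p - p')"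
    using Z_Lipschitz_compact[OF K] by blast
  obtain E where E: "0 < E" "\<And>p. p \<in> K \<Longrightarrow> norm p \<le> E"
    using compact_imp_bounded[OF K] unfolding bounded_pos by blast
  define I where "I = (LINT s|US. cmod (g s))"
  have I: "0 \<le> I" unfolding I_def by (rule integral_nonneg_AE) simp
  define c where "c = cmod (1 / (2 * of_real pi * \<i>))"
  define Q where "Q = c * (of_nat (card F) * (C * D powr \<alpha>) + L * D * (2 * E) powr (1 - \<alpha>) * I)"
  have "cmod (T p - T p') \<le> Q * dist p p' powr \<alpha>" if p: "p \<in> K" "p' \<in> K" for p p'
  proof -
    define h where "h = norm (p - p')"
    have h: "0 \<le> h" "h \<le> 2 * E"
      using norm_triangle_ineq4[of p p'] E(2)[OF p(1)] E(2)[OF p(2)] by (auto simp: h_def)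
    have hZ: "cmod (Z p - Z p') \<le> D * h" unfolding h_def by (rule D(2)[OF p])
    \<comment> \<open>Turns the Lipschitz bound into a Hoelder bound: h = h^(1 - \<alpha>)
      h^\<alpha>, and h is at most the diameter bound 2 E.\<close>
    have hh: "h \<le> (2 * E) powr (1 - \<alpha>) * h powr \<alpha>"
    proof (cases "h = 0")
      case False
      have "h = h powr (1 - \<alpha>) * h powr \<alpha>" using False h by (simp add: powr_add[symmetric])
      also have "\<dots> \<le> (2 * E) powr (1 - \<alpha>) * h powr \<alpha>"
        using h \<alpha> by (intro mult_right_mono powr_mono2) auto
      finally show ?thesis .
    qed simp
    have 1: "cmod ((LINT s|US. g s / ((Z p - l) - Z s)) - (LINT s|US. g s / ((Z p' - l) - Z s))) \<le> C * D powr \<alpha> * h powr \<alpha>" for l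
    proof -
      have "cmod ((Z p - l) - (Z p' - l)) powr \<alpha> \<le> (D * h) powr \<alpha>"
        using hZ \<alpha> by (intro powr_mono2) auto
      also have "\<dots> = D powr \<alpha> * h powr \<alpha>" by (rule powr_mult)
      finally have "C * cmod ((Z p - l) - (Z p' - l)) powr \<alpha> \<le> C * (D powr \<alpha> * h powr \<alpha>)"
        using C(1) by (rule mult_left_mono)
      then show ?thesis using C(2)[of "Z p - l" "Z p' - l"] by (simp only: mult.assoc)
    qed
    have i: "integrable US (\<lambda>s. k (Z x - Z s) * g s)" if "x \<in> K" for x
      by (rule remainder_integrable[OF k[OF that]])
    have "(LINT s|US. k (Z p - Z s) * g s) - (LINT s|US. k (Z p' - Z s) * g s) =
        (LINT s|US. k (Z p - Z s) * g s - k (Z p' - Z s) * g s)"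
      by (rule Bochner_Integration.integral_diff[symmetric]) (intro i p)+
    also have "cmod \<dots> \<le> (LINT s|US. L * (D * h) * cmod (g s))"
    proof (rule Bochner_Integration.integral_norm_bound_integral)
      show "integrable US (\<lambda>s. k (Z p - Z s) * g s - k (Z p' - Z s) * g s)"
        by (intro Bochner_Integration.integrable_diff i p)
      show "integrable US (\<lambda>s. L * (D * h) * cmod (g s))"
        by (intro integrable_mult_right integrable_norm g_integrable)
      fix s assume "s \<in> space US"
      then have s: "s \<in> cbox (0, 0) (1, 1)" by (simp add: space_restrict_space)
      have "cmod (k (Z p - Z s) - k (Z p' - Z s)) \<le> L * (D * h)"
        using lip[OF p s] mult_left_mono[OF hZ L] by linarith
      then have "cmod (k (Z p - Z s) - k (Z p' - Z s)) * cmod (g s) \<le> L * (D * h) * cmod (g s)"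
        by (rule mult_right_mono) simp
      then show "norm (k (Z p - Z s) * g s - k (Z p' - Z s) * g s) \<le> L * (D * h) * cmod (g s)"
        by (simp add: norm_mult[symmetric] left_diff_distrib)
    qed
    also have "\<dots> = L * D * h * I" by (simp add: I_def)
    also have "\<dots> \<le> L * D * ((2 * E) powr (1 - \<alpha>) * h powr \<alpha>) * I"
      using hh L D(1) I by (intro mult_right_mono mult_left_mono) auto
    finally have 2: "cmod ((LINT s|US. k (Z p - Z s) * g s) - (LINT s|US. k (Z p' - Z s) * g s)) \<le>
        L * D * (2 * E) powr (1 - \<alpha>) * I * h powr \<alpha>" by (simp add: mult_ac)
    have "T p - T p' = 1 / (2 * of_real pi * \<i>) * ((\<Sum>l\<in>F. (LINT s|US. g s / ((Z p - l) - Z s)) - (LINT s|US. g s / ((Z p' - l) - Z s))) +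
        ((LINT s|US. k (Z p - Z s) * g s) - (LINT s|US. k (Z p' - Z s) * g s)))"
      unfolding T_def kernel_integral_split(2)[OF F k[OF p(1)] ae[OF p(1)]] kernel_integral_split(2)[OF F k[OF p(2)] ae[OF p(2)]]
      by (simp add: sum_subtractf diff_divide_distrib add_divide_distrib)
    also have "cmod \<dots> \<le> c * ((\<Sum>l\<in>F. C * D powr \<alpha> * h powr \<alpha>) + L * D * (2 * E) powr (1 - \<alpha>) * I * h powr \<alpha>)"
      unfolding norm_mult c_def[symmetric]
      by (intro mult_left_mono order_trans[OF norm_triangle_ineq] add_mono order_trans[OF norm_sum] sum_mono 1 2) (simp add: c_def)
    also have "\<dots> = Q * h powr \<alpha>" by (simp add: Q_def algebra_simps)
    finally show ?thesis by (simp add: h_def dist_norm)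
  qed
  then show "\<exists>C. \<forall>p\<in>K. \<forall>q\<in>K. cmod (T p - T q) \<le> C * dist p q powr ((\<beta> - r) / r)"
    unfolding \<alpha>_def by blast
qed

lemma T_plus_x: "T (x + 1, y) = T (x, y)"
proof -
  have "\<kappa> (x + 1, y) s = \<kappa> (x, y) s" for s
    using theta_logder_plus_1[OF Im_tau, of "Z (x, y) - Z s"] by (simp add: Z_periodic diff_add_eq)
  then show ?thesis by (simp add: T_def)
qed

text \<open>The jump -2 pi i of the logarithmic derivative is cancelled by the prefactor 1 / (2 pi
  i). It is available only off the poles, which for fixed (x, y) form a null set of s.\<close>

lemma T_plus_y: "T (x, y + 1) = T (x, y) - (LINT s|US. g s)"
proof -
  have "AE s in US. Z s - Z (x, y) \<notin> period_lattice \<tau>" by (rule AE_US[OF AE_Z_diff_notin_lattice])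
  then have ae: "AE s in US. \<kappa> (x, y + 1) s * g s = \<kappa> (x, y) s * g s - 2 * of_real pi * \<i> * g s"
  proof eventually_elim
    case (elim s)
    have "Z (x, y) - Z s \<notin> period_lattice \<tau>"
      using elim period_lattice_uminus[of "Z (x, y) - Z s" \<tau>] by auto
    from theta_logder_plus_tau[OF Im_tau this]
    have "\<kappa> (x, y + 1) s = \<kappa> (x, y) s - 2 * of_real pi * \<i>" by (simp add: Z_periodic diff_add_eq)
    then show ?case by (simp add: left_diff_distrib)
  qed
  have i2: "integrable US (\<lambda>s. 2 * of_real pi * \<i> * g s)" by (intro integrable_mult_right g_integrable)
  note i = Bochner_Integration.integrable_diff[OF kernel_integrable[of "(x, y)"] i2]
  have "(LINT s|US. \<kappa> (x, y + 1) s * g s) = (LINT s|US. \<kappa> (x, y) s * g s - 2 * of_real pi * \<i> * g s)"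
    by (rule integral_cong_AE[OF borel_measurable_integrable[OF kernel_integrable] borel_measurable_integrable[OF i] ae])
  also have "\<dots> = (LINT s|US. \<kappa> (x, y) s * g s) - (LINT s|US. 2 * of_real pi * \<i> * g s)"
    by (rule Bochner_Integration.integral_diff[OF kernel_integrable i2])
  also have "(LINT s|US. 2 * of_real pi * \<i> * g s) = 2 * of_real pi * \<i> * (LINT s|US. g s)"
    by (rule integral_mult_right_zero)
  finally show ?thesis by (simp add: T_def field_simps)
qed

end

section \<open>Fubini's theorem and unfolding over the translates of the square\<close>

lemma AE_lborel_translate:
  fixes c :: "'a::euclidean_space"
  assumes P: "AE p in lborel. P p"
  shows "AE p in lborel. P (c + p)"
proof -
  obtain N where "{p \<in> space lborel. \<not> P p} \<subseteq> N" "emeasure lborel N = 0" "N \<in> sets lborel"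
    by (rule AE_E[OF P])
  then have N: "{p. \<not> P p} \<subseteq> N" "N \<in> null_sets lborel" by (simp_all add: null_sets_def)
  have "AE p in distr lborel borel ((+) c). p \<notin> N"
    unfolding lborel_distr_plus by (rule AE_not_in[OF N(2)])
  then have "AE p in lborel. c + p \<notin> N"
    by (subst (asm) AE_distr_iff) (use N(2) in \<open>auto simp: null_sets_def\<close>)
  then show ?thesis by (rule AE_mp) (use N(1) in auto)
qed

lemma lborel_integrable_translate:
  fixes g :: "'a::euclidean_space \<Rightarrow> 'b::{banach, second_countable_topology}"
  assumes "g \<in> borel_measurable borel"
  shows "integrable lborel (\<lambda>q. g (c + q)) \<longleftrightarrow> integrable lborel g"
proof -
  have "integrable (distr lborel borel ((+) c)) g \<longleftrightarrow> integrable lborel (\<lambda>q. g (c + q))"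
    by (rule integrable_distr_eq) (use assms in auto)
  then show ?thesis unfolding lborel_distr_plus by simp
qed

text \<open>The vectors under which \<open>g\<close> is invariant almost everywhere form a group,
  because null sets are translation invariant; it contains both unit vectors.\<close>

lemma AE_translation_invariant_int_vec:
  fixes g :: "real \<times> real \<Rightarrow> complex"
  assumes x: "AE p in lborel. g (fst p + 1, snd p) = g p" and y: "AE p in lborel. g (fst p, snd p + 1) = g p"
  shows "AE p in lborel. g (int_vec n + p) = g p"
proof -
  define per where "per = (\<lambda>c. AE p in lborel. g (c + p) = g p)"
  have shift: "AE p in lborel. g (c + (d + p)) = g (d + p)" if "per c" for c d
    using AE_lborel_translate[OF that[unfolded per_def]] .
  have plus: "per (c + d)" if "per c" "per d" for c d
    using shift[OF that(1), of d] that(2) unfolding per_def by eventually_elim (simp add: add.assoc)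
  have minus: "per (- c)" if "per c" for c
    using shift[OF that, of "- c"] unfolding per_def by eventually_elim simp
  have int: "per (of_int k *\<^sub>R e)" if e: "per e" for k :: int and e
  proof (induction k rule: int_induct[where k = 0])
    case base
    show ?case by (simp add: per_def)
  next
    case (step1 i)
    then show ?case using plus[OF e step1(2)] by (simp add: scaleR_left_distrib add.commute)
  next
    case (step2 i)
    then show ?case using plus[OF step2(2) minus[OF e]] by (simp add: scaleR_left_diff_distrib)
  qed
  have "per (1, 0)" "per (0, 1)"
    using x y unfolding per_def by (auto elim!: eventually_mono simp: plus_prod_def add.commute)
  from plus[OF int[OF this(1), of "fst n"] int[OF this(2), of "snd n"]]
  show ?thesis by (simp add: per_def int_vec_def)
qed

lemma AE_cbox_in_box:
  fixes a b :: "'a::euclidean_space"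
  shows "AE s in lborel. s \<in> cbox a b \<longrightarrow> s \<in> box a b"
proof -
  have "cbox a b - box a b \<in> null_sets lborel"
    using negligible_frontier_interval[of a b] by (simp add: negligible_iff_null_sets null_sets_completion_iff)
  then show ?thesis by (rule AE_I') auto
qed

text \<open>Half-open, so that the integer translates tile the plane without overlap; it differs
  from the closed unit square by a null set.\<close>

definition half_open_square :: "(real \<times> real) set" where
  "half_open_square = {0..<1} \<times> {0..<1}"

lemma half_open_square_measurable [measurable]: "half_open_square \<in> sets borel"
  unfolding half_open_square_def by (intro borel_Times) auto

lemma translated_square_iff:
  "- int_vec n + p \<in> half_open_square \<longleftrightarrow> n = (\<lfloor>fst p\<rfloor>, \<lfloor>snd p\<rfloor>)"
  by (cases n, cases p) (auto simp: half_open_square_def int_vec_def floor_eq_iff; linarith)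

context theta_potential
begin

text \<open>Integration is now over p, with singularities at Z p = Z s + l. The area bound is
  uniform in the centre of the disc, so the constant does not depend on s; this is the integrability
  that Fubini's theorem asks for.\<close>

lemma kappa_integral_bound:
  assumes K: "compact K"
  shows "\<exists>C\<ge>0. \<forall>s\<in>cbox (0, 0) (1, 1). (\<integral>\<^sup>+ p. ennreal (cmod (\<kappa> p s)) * indicator K p \<partial>lborel) \<le> ennreal C"
proof -
  let ?S = "cbox (0, 0) (1, 1) :: (real \<times> real) set"
  have [measurable]: "K \<in> sets borel" using K by (simp add: compact_imp_closed)
  obtain F k D L where F: "finite F" and D: "0 < D"
    and decomposition: "\<And>p s. p \<in> K \<Longrightarrow> s \<in> ?S \<Longrightarrow> Z p - Z s \<notin> period_lattice \<tau> \<Longrightarrow>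
      \<kappa> p s = (\<Sum>l\<in>F. 1 / (Z p - Z s - l)) + k (Z p - Z s)"
    and k: "\<And>p s. p \<in> K \<Longrightarrow> s \<in> ?S \<Longrightarrow> cmod (k (Z p - Z s)) \<le> D"
    by (rule kernel_decomposition[OF K]) (rule that)
  obtain C where C: "0 \<le> C" "\<And>z. (\<integral>\<^sup>+ p. ennreal (cmod (1 / (z - Z p))) * indicator K p \<partial>lborel) \<le> ennreal C"
    using inverse_Z_bound[OF K] by blast
  have mK: "emeasure lborel K = ennreal (measure lborel K)"
    using emeasure_compact_finite[OF K] by (simp add: emeasure_eq_ennreal_measure)
  have "(\<integral>\<^sup>+ p. ennreal (cmod (\<kappa> p s)) * indicator K p \<partial>lborel) \<le> ennreal (real (card F) * C + D * measure lborel K)"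
    if s: "s \<in> ?S" for s
  proof -
    have "AE p in lborel. ennreal (cmod (\<kappa> p s)) * indicator K p \<le>
        (\<Sum>l\<in>F. ennreal (cmod (1 / ((Z s + l) - Z p))) * indicator K p) + ennreal D * indicator K p"
      using AE_Z_diff_notin_lattice[of s]
    proof eventually_elim
      case (elim p)
      show ?case
      proof (cases "p \<in> K")
        case True
        have "\<kappa> p s = (\<Sum>l\<in>F. 1 / (Z p - Z s - l)) + k (Z p - Z s)" by (rule decomposition[OF True s elim])
        also have "cmod \<dots> \<le> (\<Sum>l\<in>F. cmod (1 / (Z p - Z s - l))) + D"
          by (intro order_trans[OF norm_triangle_ineq] add_mono norm_sum k[OF True s])
        also have "(\<Sum>l\<in>F. cmod (1 / (Z p - Z s - l))) = (\<Sum>l\<in>F. cmod (1 / ((Z s + l) - Z p)))"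
          by (intro sum.cong refl) (simp add: norm_divide norm_minus_commute diff_diff_eq)
        finally have "ennreal (cmod (\<kappa> p s)) \<le> ennreal ((\<Sum>l\<in>F. cmod (1 / ((Z s + l) - Z p))) + D)"
          by (rule ennreal_leI)
        also have "\<dots> = (\<Sum>l\<in>F. ennreal (cmod (1 / ((Z s + l) - Z p)))) + ennreal D"
          using D by (subst ennreal_plus) (auto simp: sum_nonneg sum_ennreal)
        finally show ?thesis using True by simp
      qed simp
    qed
    then have "(\<integral>\<^sup>+ p. ennreal (cmod (\<kappa> p s)) * indicator K p \<partial>lborel) \<le>
        (\<integral>\<^sup>+ p. (\<Sum>l\<in>F. ennreal (cmod (1 / ((Z s + l) - Z p))) * indicator K p) + ennreal D * indicator K p \<partial>lborel)"
      by (rule nn_integral_mono_AE)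
    also have "\<dots> = (\<Sum>l\<in>F. (\<integral>\<^sup>+ p. ennreal (cmod (1 / ((Z s + l) - Z p))) * indicator K p \<partial>lborel)) + ennreal D * emeasure lborel K"
      by (subst nn_integral_add) (auto simp: nn_integral_sum nn_integral_cmult_indicator)
    also have "\<dots> \<le> (\<Sum>l\<in>F. ennreal C) + ennreal D * ennreal (measure lborel K)"
      unfolding mK by (intro add_mono sum_mono C(2) order_refl)
    also have "\<dots> = ennreal (real (card F) * C + D * measure lborel K)"
      using C(1) D by (simp add: ennreal_plus ennreal_mult ennreal_of_nat_eq_real_of_nat)
    finally show ?thesis .
  qed
  then show ?thesis using C(1) D
    by (intro exI[of _ "real (card F) * C + D * measure lborel K"]) auto
qed

lemma kappa_pair_measurable [measurable]: "(\<lambda>(p, s). \<kappa> p s) \<in> borel_measurable (borel \<Otimes>\<^sub>M borel)"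
  using theta_logder_measurable[OF Im_tau] by measurable

lemma g_square_integrable: "integrable lborel (\<lambda>s. indicator (cbox (0, 0) (1, 1)) s *\<^sub>R g s)"
  using g_integrable by (subst (asm) integrable_restrict_space) auto

lemma Fubini_T:
  assumes \<psi>: "continuous_on UNIV \<psi>" and K: "compact K" and supp: "\<And>p. p \<notin> K \<Longrightarrow> \<psi> p = 0"
  shows "(LINT p|lborel. T p * \<psi> p) =
    1 / (2 * of_real pi * \<i>) * (LINT s|lborel. indicator (cbox (0, 0) (1, 1)) s *\<^sub>R (g s * (LINT p|lborel. \<kappa> p s * \<psi> p)))"
proof -
  let ?S = "cbox (0, 0) (1, 1) :: (real \<times> real) set"
  have [measurable]: "\<psi> \<in> borel_measurable borel" by (rule borel_measurable_continuous_onI[OF \<psi>])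
  have [measurable]: "K \<in> sets borel" using K by (simp add: compact_imp_closed)
  obtain M where M: "0 < M" "\<And>p. p \<in> K \<Longrightarrow> cmod (\<psi> p) \<le> M"
    using continuous_on_compact_norm_bound[OF K continuous_on_subset[OF \<psi> subset_UNIV]] by blast
  obtain C where C: "0 \<le> C" "\<And>s. s \<in> ?S \<Longrightarrow> (\<integral>\<^sup>+ p. ennreal (cmod (\<kappa> p s)) * indicator K p \<partial>lborel) \<le> ennreal C"
    using kappa_integral_bound[OF K] by blast
  define f where "f = (\<lambda>p s. indicator ?S s *\<^sub>R (\<kappa> p s * g s) * \<psi> p)"
  have fm [measurable]: "(\<lambda>(p, s). f p s) \<in> borel_measurable (borel \<Otimes>\<^sub>M borel)"
    unfolding f_def by measurable
  \<comment> \<open>The integral over p is bounded uniformly in s, which leaves the integrable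
    function |g| for the outer integral.\<close>
  have inner: "(\<integral>\<^sup>+ p. ennreal (cmod (f p s)) \<partial>lborel) \<le> ennreal (M * C) * ennreal (cmod (indicator ?S s *\<^sub>R g s))" for s
  proof (cases "s \<in> ?S")
    case True
    have "(\<integral>\<^sup>+ p. ennreal (cmod (f p s)) \<partial>lborel) \<le>
        (\<integral>\<^sup>+ p. ennreal (M * cmod (g s)) * (ennreal (cmod (\<kappa> p s)) * indicator K p) \<partial>lborel)"
    proof (rule nn_integral_mono)
      fix p
      show "ennreal (cmod (f p s)) \<le> ennreal (M * cmod (g s)) * (ennreal (cmod (\<kappa> p s)) * indicator K p)"
      proof (cases "p \<in> K")
        case pK: True
        have "cmod (f p s) = cmod (\<psi> p) * (cmod (g s) * cmod (\<kappa> p s))" using True by (simp add: f_def norm_mult)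
        also have "\<dots> \<le> M * (cmod (g s) * cmod (\<kappa> p s))" by (intro mult_right_mono M(2) pK) simp
        finally show ?thesis using pK M(1) by (simp add: ennreal_mult[symmetric] mult.assoc ennreal_leI)
      qed (simp add: f_def supp)
    qed
    also have "\<dots> = ennreal (M * cmod (g s)) * (\<integral>\<^sup>+ p. ennreal (cmod (\<kappa> p s)) * indicator K p \<partial>lborel)"
      by (rule nn_integral_cmult) measurable
    also have "\<dots> \<le> ennreal (M * cmod (g s)) * ennreal C" by (intro mult_left_mono C(2) True) simp
    also have "\<dots> = ennreal (M * C) * ennreal (cmod (indicator ?S s *\<^sub>R g s))"
      using True M(1) C(1) by (simp add: ennreal_mult[symmetric] mult_ac)
    finally show ?thesis .
  qed (simp add: f_def)
  have int: "integrable (lborel \<Otimes>\<^sub>M lborel) (\<lambda>(p, s). f p s)"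
  proof (rule integrableI_bounded)
    show "(\<lambda>(p, s). f p s) \<in> borel_measurable (lborel \<Otimes>\<^sub>M lborel)" using fm by simp
    have "(\<integral>\<^sup>+ x. ennreal (norm (case x of (p, s) \<Rightarrow> f p s)) \<partial>(lborel \<Otimes>\<^sub>M lborel)) =
        (\<integral>\<^sup>+ s. \<integral>\<^sup>+ p. ennreal (cmod (f p s)) \<partial>lborel \<partial>lborel)"
      by (subst lborel_pair.nn_integral_snd[symmetric]) (auto simp: split_beta')
    also have "\<dots> \<le> (\<integral>\<^sup>+ s. ennreal (M * C) * ennreal (cmod (indicator ?S s *\<^sub>R g s)) \<partial>lborel)"
      by (rule nn_integral_mono) (rule inner)
    also have "\<dots> = ennreal (M * C) * (\<integral>\<^sup>+ s. ennreal (cmod (indicator ?S s *\<^sub>R g s)) \<partial>lborel)"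
      by (rule nn_integral_cmult) measurable
    also have "\<dots> < \<infinity>"
      using g_square_integrable by (auto simp: integrable_iff_bounded ennreal_mult_less_top)
    finally show "(\<integral>\<^sup>+ x. ennreal (norm (case x of (p, s) \<Rightarrow> f p s)) \<partial>(lborel \<Otimes>\<^sub>M lborel)) < \<infinity>" .
  qed
  have "T p * \<psi> p = 1 / (2 * of_real pi * \<i>) * (LINT s|lborel. f p s)" for p
  proof -
    have "(LINT s|US. \<kappa> p s * g s) = (LINT s|lborel. indicator ?S s *\<^sub>R (\<kappa> p s * g s))"
      by (rule integral_restrict_space) simp
    then show ?thesis unfolding T_def f_def by (simp only: integral_mult_left_zero mult.assoc)
  qed
  then have "(LINT p|lborel. T p * \<psi> p) = 1 / (2 * of_real pi * \<i>) * (LINT p|lborel. (LINT s|lborel. f p s))"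
    by (simp only: integral_mult_right_zero)
  also have "(LINT p|lborel. (LINT s|lborel. f p s)) = (LINT s|lborel. (LINT p|lborel. f p s))"
    by (rule lborel_pair.Fubini_integral[OF int, symmetric])
  also have "\<dots> = (LINT s|lborel. indicator ?S s *\<^sub>R (g s * (LINT p|lborel. \<kappa> p s * \<psi> p)))"
  proof (rule Bochner_Integration.integral_cong[OF refl])
    fix s
    have "f p s = (indicator ?S s *\<^sub>R g s) * (\<kappa> p s * \<psi> p)" for p by (simp add: f_def mult_ac scaleR_conv_of_real)
    then have "(LINT p|lborel. f p s) = (LINT p|lborel. (indicator ?S s *\<^sub>R g s) * (\<kappa> p s * \<psi> p))" by simp
    also have "\<dots> = (indicator ?S s *\<^sub>R g s) * (LINT p|lborel. \<kappa> p s * \<psi> p)" by (rule integral_mult_right_zero)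
    finally show "(LINT p|lborel. f p s) = indicator ?S s *\<^sub>R (g s * (LINT p|lborel. \<kappa> p s * \<psi> p))" by simp
  qed
  finally show ?thesis .
qed

text \<open>Each translate of \<phi> over the fundamental square is \<phi> over a translated square,
  with \<open>g\<close> carried along by periodicity. Since these squares tile the plane,
  \<open>N\<close> has only to contain the integer parts of all points where \<phi> is
  nonzero.\<close>

lemma unfold_square:
  assumes \<phi>: "continuous_on UNIV \<phi>" and supp: "\<And>p. \<phi> p \<noteq> 0 \<Longrightarrow> p \<in> box (- M, - M) (M, M)"
    and N: "finite N" "\<And>p. \<phi> p \<noteq> 0 \<Longrightarrow> (\<lfloor>fst p\<rfloor>, \<lfloor>snd p\<rfloor>) \<in> N"
    and per: "AE p in lborel. g (fst p + 1, snd p) = g p" "AE p in lborel. g (fst p, snd p + 1) = g p"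
  shows "(LINT s|lborel. indicator (cbox (0, 0) (1, 1)) s *\<^sub>R (g s * (\<Sum>n\<in>N. \<phi> (int_vec n + s)))) = (LINT p|lborel. g p * \<phi> p)"
proof -
  let ?S = "cbox (0, 0) (1, 1) :: (real \<times> real) set"
  let ?H = half_open_square
  have m\<phi> [measurable]: "\<phi> \<in> borel_measurable borel" by (rule borel_measurable_continuous_onI[OF \<phi>])
  have mS [measurable]: "?S \<in> sets borel" by simp
  obtain D where D: "0 < D" "\<And>p. p \<in> cbox (- M, - M) (M, M) \<Longrightarrow> cmod (\<phi> p) \<le> D"
    using continuous_on_compact_norm_bound[OF compact_cbox continuous_on_subset[OF \<phi> subset_UNIV]] by blast
  have D': "cmod (\<phi> p) \<le> D" for p
  proof (cases "\<phi> p = 0")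
    case False
    show ?thesis by (rule D(2)[OF subsetD[OF box_subset_cbox supp[OF False]]])
  qed (use D(1) in simp)
  have HS: "?H \<subseteq> ?S" by (auto simp: half_open_square_def)
  have SH: "AE s in lborel. indicator ?S s = (indicator ?H s :: real)"
    using AE_cbox_in_box[of "(0, 0) :: real \<times> real" "(1, 1)"]
  proof eventually_elim
    case (elim s)
    have "box (0, 0) (1, 1) \<subseteq> ?H" by (auto simp: half_open_square_def mem_box Basis_prod_def)
    then show ?case using elim HS by (auto simp: indicator_def)
  qed
  have i: "integrable lborel (\<lambda>s. indicator ?H s *\<^sub>R (g s * \<phi> (int_vec n + s)))" for n
  proof (rule Bochner_Integration.integrable_bound[OF integrable_mult_right[OF integrable_norm[OF g_square_integrable], of D]])
    show "AE s in lborel. norm (indicator ?H s *\<^sub>R (g s * \<phi> (int_vec n + s))) \<le> norm (D * norm (indicator ?S s *\<^sub>R g s))"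
    proof (rule AE_I2)
      fix s
      have "norm (g s * \<phi> (int_vec n + s)) \<le> D * norm (g s)"
        using mult_right_mono[OF D'[of "int_vec n + s"], of "norm (g s)"] by (simp add: norm_mult mult.commute)
      then show "norm (indicator ?H s *\<^sub>R (g s * \<phi> (int_vec n + s))) \<le> norm (D * norm (indicator ?S s *\<^sub>R g s))"
        using HS D(1) by (cases "s \<in> ?H") auto
    qed
  qed measurable
  have ae: "AE s in lborel. indicator ?H s *\<^sub>R (g s * \<phi> (int_vec n + s)) =
      indicator ?H (- int_vec n + (int_vec n + s)) *\<^sub>R (g (int_vec n + s) * \<phi> (int_vec n + s))" for n
    using AE_translation_invariant_int_vec[OF per, of n] by eventually_elim simp
  have i': "integrable lborel (\<lambda>p. indicator ?H (- int_vec n + p) *\<^sub>R (g p * \<phi> p))" for n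
  proof (subst lborel_integrable_translate[symmetric, of _ "int_vec n"])
    show "integrable lborel (\<lambda>s. indicator ?H (- int_vec n + (int_vec n + s)) *\<^sub>R (g (int_vec n + s) * \<phi> (int_vec n + s)))"
      by (rule integrable_cong_AE_imp[OF i[of n] _ ae[of n]]) measurable
  qed measurable
  have "(LINT s|lborel. indicator ?S s *\<^sub>R (g s * (\<Sum>n\<in>N. \<phi> (int_vec n + s)))) =
      (LINT s|lborel. (\<Sum>n\<in>N. indicator ?H s *\<^sub>R (g s * \<phi> (int_vec n + s))))"
  proof (rule integral_cong_AE)
    show "AE s in lborel. indicator ?S s *\<^sub>R (g s * (\<Sum>n\<in>N. \<phi> (int_vec n + s))) =
        (\<Sum>n\<in>N. indicator ?H s *\<^sub>R (g s * \<phi> (int_vec n + s)))"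
      using SH by eventually_elim (simp add: sum_distrib_left scaleR_sum_right)
  qed measurable
  also have "\<dots> = (\<Sum>n\<in>N. (LINT s|lborel. indicator ?H s *\<^sub>R (g s * \<phi> (int_vec n + s))))"
    by (rule Bochner_Integration.integral_sum) (rule i)
  also have "\<dots> = (\<Sum>n\<in>N. (LINT p|lborel. indicator ?H (- int_vec n + p) *\<^sub>R (g p * \<phi> p)))"
  proof (rule sum.cong[OF refl])
    fix n
    have "(LINT s|lborel. indicator ?H s *\<^sub>R (g s * \<phi> (int_vec n + s))) =
        (LINT s|lborel. indicator ?H (- int_vec n + (int_vec n + s)) *\<^sub>R (g (int_vec n + s) * \<phi> (int_vec n + s)))"
      by (rule integral_cong_AE[OF _ _ ae]) measurable
    also have "\<dots> = (LINT p|lborel. indicator ?H (- int_vec n + p) *\<^sub>R (g p * \<phi> p))"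
      by (rule lborel_integral_translate) measurable
    finally show "(LINT s|lborel. indicator ?H s *\<^sub>R (g s * \<phi> (int_vec n + s))) =
        (LINT p|lborel. indicator ?H (- int_vec n + p) *\<^sub>R (g p * \<phi> p))" .
  qed
  also have "\<dots> = (LINT p|lborel. (\<Sum>n\<in>N. indicator ?H (- int_vec n + p) *\<^sub>R (g p * \<phi> p)))"
    by (rule Bochner_Integration.integral_sum[symmetric]) (rule i')
  also have "\<dots> = (LINT p|lborel. g p * \<phi> p)"
  proof (rule Bochner_Integration.integral_cong[OF refl])
    fix p
    show "(\<Sum>n\<in>N. indicator ?H (- int_vec n + p) *\<^sub>R (g p * \<phi> p)) = g p * \<phi> p"
    proof (cases "\<phi> p = 0")
      case False
      have "(\<Sum>n\<in>N. indicator ?H (- int_vec n + p) *\<^sub>R (g p * \<phi> p)) =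
          (\<Sum>n\<in>N. if n = (\<lfloor>fst p\<rfloor>, \<lfloor>snd p\<rfloor>) then g p * \<phi> p else 0)"
        unfolding indicator_def translated_square_iff by (intro sum.cong refl) simp
      then show ?thesis using N(1) N(2)[OF False] by simp
    qed simp
  qed
  finally show ?thesis .
qed

text \<open>After Fubini the inner integral over p is the pairing of the kernel with the field of
  \<phi>; its factor -2 pi i and the prefactor 1 / (2 pi i) leave -1, the sign in the weak
  formulation.\<close>

theorem T_weak_solution:
  assumes \<phi>: "C1_on UNIV \<phi>" and supp: "\<And>p. \<phi> p \<noteq> 0 \<Longrightarrow> p \<in> box (- M, - M) (M, M)"
    and per: "AE p in lborel. g (fst p + 1, snd p) = g p" "AE p in lborel. g (fst p, snd p + 1) = g p"
    and jac: "AE p in lborel. jacobian p \<noteq> 0"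
  shows "- (LINT p|lborel. T p * field \<phi> p) = (LINT p|lborel. g p * \<phi> p)"
proof -
  let ?S = "cbox (0, 0) (1, 1) :: (real \<times> real) set"
  let ?Q = "cbox (- M, - M) (M, M) :: (real \<times> real) set"
  \<comment> \<open>If p lies within M of the origin in each coordinate and n within 1 of p, then
    |n| < M + 1 in each coordinate. This covers both uses of \<open>N\<close>: p = n + s with s in
    the unit square, and n the integer part of p.\<close>
  define m where "m = \<lceil>M\<rceil> + 1"
  define N where "N = {- m..m} \<times> {- m..m}"
  have N: "finite N" by (simp add: N_def)
  have N_mem: "n \<in> N" if "\<bar>fst p - of_int (fst n)\<bar> \<le> 1" "\<bar>snd p - of_int (snd n)\<bar> \<le> 1" "\<phi> p \<noteq> 0" for n p
  proof -
    have "- M < fst p" "fst p < M" "- M < snd p" "snd p < M"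
      using supp[OF that(3)] by (cases p, auto simp: mem_box Basis_prod_def)+
    moreover have "M \<le> of_int \<lceil>M\<rceil>" by simp
    ultimately have "- of_int m \<le> real_of_int (fst n)" "real_of_int (fst n) \<le> of_int m"
      "- of_int m \<le> real_of_int (snd n)" "real_of_int (snd n) \<le> of_int m"
      using that(1,2) unfolding m_def by simp_all linarith+
    then show ?thesis by (simp add: N_def mem_Times_iff)
  qed
  have c\<phi>: "continuous_on UNIV \<phi>" by (rule C1_on_imp_continuous_on[OF \<phi>])
  have field_0: "field \<phi> p = 0" if "p \<notin> ?Q" for p
  proof -
    have "\<phi> x = 0" if "x \<in> - ?Q" for x
      using supp[of x] that box_subset_cbox[of "(- M, - M)" "(M, M)"] by blast
    from dx_dy_eq_0[of "- ?Q", OF _ _ this] that show ?thesis by (simp add: field_def open_Compl closed_cbox)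
  qed
  \<comment> \<open>The pairing formula needs s in the open square and off the degeneracy set; both
    hold for almost every s in the square.\<close>
  have ae: "AE s in lborel. indicator ?S s *\<^sub>R (g s * (LINT p|lborel. \<kappa> p s * field \<phi> p)) =
      - (2 * of_real pi * \<i>) * (indicator ?S s *\<^sub>R (g s * (\<Sum>n\<in>N. \<phi> (int_vec n + s))))"
    using AE_cbox_in_box[of "(0, 0) :: real \<times> real" "(1, 1)"] jac
  proof eventually_elim
    case (elim s)
    show ?case
    proof (cases "s \<in> ?S")
      case True
      then have s: "s \<in> box (0, 0) (1, 1)" using elim(1) by blast
      have "n \<in> N" if "\<phi> (int_vec n + s) \<noteq> 0" for n
        using s by (intro N_mem[OF _ _ that]) (cases s, auto simp: int_vec_def mem_box Basis_prod_def)+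
      from theta_pairing[OF s elim(2) \<phi> supp N this] show ?thesis by simp
    qed simp
  qed
  have [measurable]: "?S \<in> sets borel" "field \<phi> \<in> borel_measurable borel" "\<phi> \<in> borel_measurable borel"
    using borel_measurable_continuous_onI[OF field_continuous[OF \<phi>]] borel_measurable_continuous_onI[OF c\<phi>] by auto
  have eq: "(LINT s|lborel. indicator ?S s *\<^sub>R (g s * (LINT p|lborel. \<kappa> p s * field \<phi> p))) =
      (LINT s|lborel. - (2 * of_real pi * \<i>) * (indicator ?S s *\<^sub>R (g s * (\<Sum>n\<in>N. \<phi> (int_vec n + s)))))"
  proof (rule integral_cong_AE[OF _ _ ae])
    show "(\<lambda>s. indicator ?S s *\<^sub>R (g s * (LINT p|lborel. \<kappa> p s * field \<phi> p))) \<in> borel_measurable lborel"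
      by measurable
  qed measurable
  have "(LINT p|lborel. T p * field \<phi> p) =
      1 / (2 * of_real pi * \<i>) * (LINT s|lborel. indicator ?S s *\<^sub>R (g s * (LINT p|lborel. \<kappa> p s * field \<phi> p)))"
    by (rule Fubini_T[OF field_continuous[OF \<phi>] compact_cbox field_0])
  also have "\<dots> = 1 / (2 * of_real pi * \<i>) * (- (2 * of_real pi * \<i>) * (LINT s|lborel. indicator ?S s *\<^sub>R (g s * (\<Sum>n\<in>N. \<phi> (int_vec n + s)))))"
    unfolding eq by (simp only: integral_mult_right_zero)
  also have "(LINT s|lborel. indicator ?S s *\<^sub>R (g s * (\<Sum>n\<in>N. \<phi> (int_vec n + s)))) = (LINT p|lborel. g p * \<phi> p)"
  proof (rule unfold_square[OF c\<phi> supp N _ per])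
    show "(\<lfloor>fst p\<rfloor>, \<lfloor>snd p\<rfloor>) \<in> N" if "\<phi> p \<noteq> 0" for p
      using that by (intro N_mem[of p]) (simp_all, linarith+)
  qed
  finally show ?thesis by simp
qed

end

lemma (in theta_potential) T_measurable: "T \<in> borel_measurable borel"
proof -
  have "T = (\<lambda>p. 1 / (2 * of_real pi * \<i>) * (LINT s|lborel. indicator (cbox (0, 0) (1, 1)) s *\<^sub>R (\<kappa> p s * g s)))"
    by (rule ext) (simp add: T_def integral_restrict_space)
  also have "\<dots> \<in> borel_measurable borel" by measurable
  finally show ?thesis .
qed

section \<open>Transfer of the result to the torus data and to Lebesgue measure\<close>

lemma lift_torus_periodic:
  "lift_torus f (x + 1, y) = lift_torus f (x, y)" "lift_torus f (x, y + 1) = lift_torus f (x, y)"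
  using cis_multiple_2pi[of 1] by (simp_all add: lift_torus_def torus_cover_def distrib_left cis_mult[symmetric])

text \<open>The factor |m|^2, the weight and the Jacobian of the coordinates separate. With the
  first and the last nonzero, the degeneracy is that of the weight |t|^\<sigma> alone.\<close>

lemma normal_form_wedge:
  assumes "A = m * (of_real x + \<i> * of_real w * of_real x')" "B = m * (of_real y + \<i> * of_real w * of_real y')"
  shows "A * cnj B - B * cnj A = - (2 * \<i>) * (m * cnj m) * of_real (w * (x * y' - y * x'))"
  unfolding assms by (simp add: algebra_simps)

lemma lebesgue_Borel_representative:
  fixes f :: "'a::euclidean_space \<Rightarrow> complex"
  assumes "f \<in> borel_measurable lebesgue"
  obtains g where "g \<in> borel_measurable borel" "AE x in lborel. f x = g x"
proof -
  have "(\<lambda>x. Re (f x)) \<in> borel_measurable lebesgue" "(\<lambda>x. Im (f x)) \<in> borel_measurable lebesgue"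
    using assms by measurable
  then obtain u v where u: "u \<in> borel_measurable lborel" "AE x in lborel. Re (f x) = u x"
    and v: "v \<in> borel_measurable lborel" "AE x in lborel. Im (f x) = v x"
    using completion_ex_borel_measurable_real[of "\<lambda>x. Re (f x)" lborel]
      completion_ex_borel_measurable_real[of "\<lambda>x. Im (f x)" lborel] by metis
  show thesis
  proof
    show "(\<lambda>x. of_real (u x) + \<i> * of_real (v x)) \<in> borel_measurable borel" using u v by simp
    show "AE x in lborel. f x = of_real (u x) + \<i> * of_real (v x)"
      using u(2) v(2) by eventually_elim (simp add: complex_eq_iff)
  qed
qed

lemma test_function_imp_C1:
  assumes "test_function \<phi>"
  shows "C1_on UNIV \<phi>" and "\<exists>M. \<forall>p. \<phi> p \<noteq> 0 \<longrightarrow> p \<in> box (- M, - M) (M, M)"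
proof -
  have "Ck (Suc 0) \<phi>" using assms unfolding test_function_def by blast
  then show "C1_on UNIV \<phi>" by (simp add: C1_on_def)
  have "bounded {p. \<phi> p \<noteq> 0}"
    using bounded_subset[OF compact_imp_bounded closure_subset] assms unfolding test_function_def by simp
  then obtain e where e: "\<And>p. \<phi> p \<noteq> 0 \<Longrightarrow> norm p \<le> e" unfolding bounded_iff by blast
  have "p \<in> box (- (e + 1), - (e + 1)) (e + 1, e + 1)" if "\<phi> p \<noteq> 0" for p
  proof -
    obtain x y where p: "p = (x, y)" by fastforce
    have "\<bar>x\<bar> \<le> e" "\<bar>y\<bar> \<le> e"
      using e[OF that] norm_fst_le[of x y] norm_snd_le[of y x] by (simp_all add: p)
    then show ?thesis by (simp add: p mem_box Basis_prod_def) linarith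
  qed
  then show "\<exists>M. \<forall>p. \<phi> p \<noteq> 0 \<longrightarrow> p \<in> box (- M, - M) (M, M)" by blast
qed

text \<open>By the normal forms, the degeneracy set is locally \<open>t = 0\<close>.\<close>

lemma primitive_locally_regular:
  assumes a: "C1_on UNIV (lift_torus a)" and b: "C1_on UNIV (lift_torus b)" and closed: "closed_form a b"
    and cover: "\<And>p. p \<in> degeneracy_set a b \<Longrightarrow> \<exists>i\<in>I. p \<in> \<Sigma> i"
    and sig: "\<And>i. i \<in> I \<Longrightarrow> 0 < sig i" "\<And>i. i \<in> I \<Longrightarrow> sig i \<le> \<sigma>"
    and nf: "\<And>i. i \<in> I \<Longrightarrow> has_normal_form a b (\<Sigma> i) (sig i)" and \<sigma>: "0 < \<sigma>"
  shows "locally_regular (primitive a b) (2 - \<sigma> / (\<sigma> + 1)) p"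
    and "negligible {p. wedge_conj a b (torus_cover p) = 0}"
proof -
  let ?A = "lift_torus a" and ?B = "lift_torus b" and ?Z = "primitive a b"
  let ?\<beta> = "2 - \<sigma> / (\<sigma> + 1)"
  have wedge: "wedge_conj a b (torus_cover p) = ?A p * cnj (?B p) - ?B p * cnj (?A p)" for p
    by (simp add: wedge_conj_def lift_torus_def)
  note cA = C1_on_imp_continuous_on[OF a] and cB = C1_on_imp_continuous_on[OF b]
  note der = primitive_has_derivative[OF a b closed]
  have deg: "locally_regular ?Z ?\<beta> p \<and>
      (\<exists>V. open V \<and> p \<in> V \<and> negligible (V \<inter> {p. wedge_conj a b (torus_cover p) = 0}))"
    if "wedge_conj a b (torus_cover p) = 0" for p
  proof -
    have "torus_cover p \<in> degeneracy_set a b" using that by (simp add: degeneracy_set_def torus_def)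
    from cover[OF this] obtain i where i: "i \<in> I" "torus_cover p \<in> \<Sigma> i" by blast
    from nf[OF i(1), unfolded has_normal_form_def, rule_format, OF i(2)]
    obtain U s t m where U: "p \<in> U" "C1_coordinates U s t"
      and "\<forall>u\<in>U. m u \<noteq> 0 \<and>
        ?A u = m u * (of_real (dx s u) + \<i> * of_real (\<bar>t u\<bar> powr sig i) * of_real (dx t u)) \<and>
        ?B u = m u * (of_real (dy s u) + \<i> * of_real (\<bar>t u\<bar> powr sig i) * of_real (dy t u))" by blast
    then have m: "\<And>u. u \<in> U \<Longrightarrow> m u \<noteq> 0"
      and nA: "\<And>u. u \<in> U \<Longrightarrow> ?A u = m u * (of_real (dx s u) + \<i> * of_real (\<bar>t u\<bar> powr sig i) * of_real (dx t u))"
      and nB: "\<And>u. u \<in> U \<Longrightarrow> ?B u = m u * (of_real (dy s u) + \<i> * of_real (\<bar>t u\<bar> powr sig i) * of_real (dy t u))"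
      by blast+
    have t0: "t u = 0" if u: "u \<in> U" "wedge_conj a b (torus_cover u) = 0" for u
    proof -
      have "dx s u * dy t u - dy s u * dx t u \<noteq> 0" using U(2) u(1) unfolding C1_coordinates_def by blast
      moreover have "- (2 * \<i>) * (m u * cnj (m u)) *
          of_real (\<bar>t u\<bar> powr sig i * (dx s u * dy t u - dy s u * dx t u)) = 0"
        using u(2) unfolding wedge normal_form_wedge[OF nA[OF u(1)] nB[OF u(1)]] .
      ultimately show ?thesis using m[OF u(1)] by (simp del: of_real_mult of_real_diff)
    qed
    \<comment> \<open>The function x / (x + 1) is increasing, so the component of largest order
      dictates the exponent.\<close>
    have le: "?\<beta> \<le> 2 - sig i / (sig i + 1)"
      using sig(1)[OF i(1)] sig(2)[OF i(1)] by (simp add: field_simps)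
    note nf_reg = normal_form_locally_regular[OF sig(1)[OF i(1)] U(2) U(1) t0[OF U(1) that]
        continuous_on_subset[OF cA] continuous_on_subset[OF cB] der m nA nB le]
    obtain V where V: "open V" "p \<in> V" "V \<subseteq> U" "negligible {p \<in> V. t p = 0}"
      using nf_reg(2) by auto
    have "negligible (V \<inter> {p. wedge_conj a b (torus_cover p) = 0})"
      by (rule negligible_subset[OF V(4)]) (use t0 V(3) in auto)
    then show ?thesis using nf_reg(1) V(1,2) by blast
  qed
  show "locally_regular ?Z ?\<beta> p"
  proof (cases "wedge_conj a b (torus_cover p) = 0")
    case False
    then show ?thesis
      using \<sigma> by (intro nondegenerate_locally_regular[OF cA cB der]) (auto simp: wedge)
  qed (use deg in blast)
  \<comment> \<open>Every point of the set has a neighbourhood whose part of the set is contained in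
    a curve t = 0; local negligibility then implies negligibility.\<close>
  show "negligible {p. wedge_conj a b (torus_cover p) = 0}"
    unfolding locally_negligible_alt[of "{p. wedge_conj a b (torus_cover p) = 0}"]
  proof
    fix p assume p: "p \<in> {p. wedge_conj a b (torus_cover p) = 0}"
    then obtain V where "open V" "p \<in> V" "negligible (V \<inter> {p. wedge_conj a b (torus_cover p) = 0})"
      using deg[of p] by blast
    then show "\<exists>W. openin (top_of_set {p. wedge_conj a b (torus_cover p) = 0}) W \<and> p \<in> W \<and> negligible W"
      using p by (intro exI[of _ "V \<inter> {p. wedge_conj a b (torus_cover p) = 0}"])
        (auto simp: openin_open Int_commute)
  qed
qed

theorem theorem3p1:
  fixes a b :: "complex \<times> complex \<Rightarrow> complex"
    and \<epsilon> q \<sigma> r \<mu> \<alpha> :: real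
    and N :: nat
    and \<Sigma> :: "nat \<Rightarrow> (complex \<times> complex) set"
    and sig :: "nat \<Rightarrow> real"
    and \<tau> :: complex
    and P :: "real \<times> real \<Rightarrow> complex"
  assumes "0 < \<epsilon>" and "\<epsilon> < 1"
    and "C1_holder_on \<epsilon> UNIV (lift_torus a)"
    and "C1_holder_on \<epsilon> UNIV (lift_torus b)"
    and "nowhere_vanishing_form a b"
    and "closed_form a b"
    and "embedded_curve (degeneracy_set a b)"
    and "N \<ge> 1"
    and "bij_betw \<Sigma> {1..N} (components (degeneracy_set a b))"
    and "\<And>i. i \<in> {1..N} \<Longrightarrow> sig i > 0"
    and "\<And>i. i \<in> {1..N} \<Longrightarrow> vanishes_to_order a b (\<Sigma> i) (sig i)"
    and "hypocomplex a b \<epsilon>"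
    and "\<And>i. i \<in> {1..N} \<Longrightarrow> has_normal_form a b (\<Sigma> i) (sig i)"
    and "Im \<tau> > 0"
    and "\<And>x y. primitive a b (x + 1, y) = primitive a b (x, y) + 1"
    and "\<And>x y. primitive a b (x, y + 1) = primitive a b (x, y) + \<tau>"
    and "\<sigma> = Max (sig ` {1..N})"
    and "q > 2 + \<sigma>"
    and "Lq_loc q P"
    and "r = q / (q - 1)"
    and "\<mu> = \<sigma> / (\<sigma> + 1)"
    and "\<alpha> = (2 - r - \<mu>) / r"
  shows "(\<forall>p. set_integrable lebesgue unit_square (\<lambda>s. theta_kernel a b \<tau> p s * P s)) \<and>
    holder_on \<alpha> UNIV (T_op a b \<tau> P) \<and>
    (\<forall>x y. T_op a b \<tau> P (x + 1, y) = T_op a b \<tau> P (x, y)) \<and>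
    (\<forall>x y. T_op a b \<tau> P (x, y + 1) =
       T_op a b \<tau> P (x, y) - (LINT s:unit_square|lebesgue. P s)) \<and>
    ((AE p in lebesgue. P (fst p + 1, snd p) = P p) \<and>
     (AE p in lebesgue. P (fst p, snd p + 1) = P p) \<longrightarrow>
       distributional_solution a b (T_op a b \<tau> P) P)"
proof -
  let ?A = "lift_torus a" and ?B = "lift_torus b" and ?Z = "primitive a b"
  let ?S = "cbox (0, 0) (1, 1) :: (real \<times> real) set"
  define \<beta> where "\<beta> = 2 - \<mu>"
  note periods = assms(15,16)
  have a: "C1_on UNIV ?A" and b: "C1_on UNIV ?B" using assms(3,4) by (auto simp: C1_holder_on_def)
  note closed = assms(6)
  note der = primitive_has_derivative[OF a b closed]
  have cZ: "continuous_on UNIV ?Z"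
    using der by (intro continuous_at_imp_continuous_on ballI has_derivative_continuous)
  have sig_le: "sig i \<le> \<sigma>" if "i \<in> {1..N}" for i unfolding assms(17) using that by simp
  have \<sigma>: "0 < \<sigma>" using assms(8) assms(10)[of 1] sig_le[of 1] by simp
  have cover: "\<exists>i\<in>{1..N}. p \<in> \<Sigma> i" if "p \<in> degeneracy_set a b" for p
  proof -
    have "p \<in> \<Union> (components (degeneracy_set a b))" using that by simp
    also have "components (degeneracy_set a b) = \<Sigma> ` {1..N}" using assms(9) by (simp add: bij_betw_def)
    finally show ?thesis by blast
  qed
  note local_regular = primitive_locally_regular[OF a b closed cover assms(10) sig_le assms(13) \<sigma>]
  have reg: "locally_regular ?Z \<beta> p" for p using local_regular(1)[of p] by (simp add: \<beta>_def assms(21))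
  \<comment> \<open>Local injectivity comes with \<open>locally_regular\<close>, also across the
    degeneracy set, and properness from the two periods.\<close>
  have inj: "inj ?Z"
  proof (rule proper_locally_injective_imp_inj[OF cZ])
    show "\<exists>V. open V \<and> p \<in> V \<and> inj_on ?Z V" for p using reg[of p] unfolding locally_regular_def by blast
    show "compact (?Z -` K)" if "compact K" for K
      by (rule quasi_periodic_proper[OF cZ assms(14) periods that])
  qed simp
  have \<beta>: "1 < \<beta>" "\<beta> < 2" using \<sigma> by (auto simp: \<beta>_def assms(21) field_simps)
  have q: "2 < q" using assms(18) \<sigma> by simp
  have r: "1 < r" "1 / r + 1 / q = 1" using q by (auto simp: assms(20) field_simps)
  \<comment> \<open>\<beta> = (\<sigma> + 2) / (\<sigma> + 1) has the conjugate exponent \<sigma> +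
    2, so this is q > 2 + \<sigma> read for the conjugate exponents.\<close>
  have r\<beta>: "r < \<beta>"
    unfolding assms(20) \<beta>_def assms(21) using \<sigma> q assms(18) by (simp add: field_simps)
  \<comment> \<open>P is only Lebesgue measurable. Fubini's theorem and the translations are applied
    to a Borel representative, which changes none of the integrals.\<close>
  obtain g where g: "g \<in> borel_measurable borel" "AE s in lborel. P s = g s"
    using lebesgue_Borel_representative assms(19) unfolding Lq_loc_def by blast
  have P_meas: "P \<in> borel_measurable lebesgue" using assms(19) unfolding Lq_loc_def by blast
  have gL: "g \<in> borel_measurable lebesgue" by (rule measurable_completion) (use g(1) in simp)
  have ae: "AE s in lebesgue. P s = g s" using g(2) by (simp add: AE_completion_iff)
  have "set_integrable lebesgue ?S (\<lambda>s. cmod (P s) powr q)" using assms(19) unfolding Lq_loc_def by simp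
  then have "integrable lebesgue (\<lambda>s. indicator ?S s *\<^sub>R cmod (P s) powr q)" by (simp add: set_integrable_def)
  then have "integrable lebesgue (\<lambda>s. indicator ?S s *\<^sub>R cmod (g s) powr q)"
  proof (rule integrable_cong_AE_imp)
    show "(\<lambda>s. indicator ?S s *\<^sub>R cmod (g s) powr q) \<in> borel_measurable lebesgue"
      by (rule measurable_completion) (use g(1) in measurable)
    show "AE s in lebesgue. indicator ?S s *\<^sub>R cmod (P s) powr q = indicator ?S s *\<^sub>R cmod (g s) powr q"
      using ae by eventually_elim simp
  qed
  then have "integrable lborel (\<lambda>s. indicator ?S s *\<^sub>R cmod (g s) powr q)"
    by (subst (asm) integrable_completion) (use g(1) in measurable)
  then have g_power: "integrable (restrict_space lborel ?S) (\<lambda>s. cmod (g s) powr q)"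
    by (subst integrable_restrict_space) auto
  interpret theta_potential ?A ?B ?Z \<tau> \<beta> q r g
  proof unfold_locales
    show "dx ?B p = dy ?A p" for p using closed unfolding closed_form_def by blast
    show "\<exists>C\<ge>0. \<forall>z \<delta>. 0 < \<delta> \<longrightarrow> emeasure lborel {p \<in> K. cmod (?Z p - z) < \<delta>} \<le> ennreal (C * \<delta> powr \<beta>)"
      if "compact K" for K
      by (rule locally_regular_compact[OF that reg _ cZ]) (use \<beta> in simp)
  qed (use a b der assms(14) periods inj \<beta> q r r\<beta> g(1) g_power lift_torus_periodic in auto)
  have square: "unit_square = ?S" by (auto simp: unit_square_def)
  have kernel: "theta_kernel a b \<tau> p s = \<kappa> p s" for p s
    by (simp add: theta_kernel_def theta_logder_def Let_def)
  \<comment> \<open>Needed for two choices of \<open>k\<close>: the kernel itself, and the constant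
    1 for the integral of P in the second period relation.\<close>
  have transfer: "integrable lebesgue (\<lambda>s. indicator unit_square s *\<^sub>R (k s * P s)) \<longleftrightarrow> integrable US (\<lambda>s. k s * g s)"
    "(LINT s|lebesgue. indicator unit_square s *\<^sub>R (k s * P s)) = (LINT s|US. k s * g s)"
    if [measurable]: "k \<in> borel_measurable borel" for k :: "real \<times> real \<Rightarrow> complex"
  proof -
    have [measurable]: "?S \<in> sets borel" by simp
    have m: "(\<lambda>s. indicator ?S s *\<^sub>R (k s * g s)) \<in> borel_measurable lborel" using g(1) by measurable
    have kL: "k \<in> borel_measurable lebesgue" by (rule measurable_completion) simp
    have SL: "?S \<in> sets lebesgue" by simp
    have mP: "(\<lambda>s. indicator ?S s *\<^sub>R (k s * P s)) \<in> borel_measurable lebesgue"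
      using kL P_meas SL by measurable
    have e: "AE s in lebesgue. indicator ?S s *\<^sub>R (k s * P s) = indicator ?S s *\<^sub>R (k s * g s)"
      using ae by eventually_elim simp
    show "integrable lebesgue (\<lambda>s. indicator unit_square s *\<^sub>R (k s * P s)) \<longleftrightarrow> integrable US (\<lambda>s. k s * g s)"
      unfolding square integrable_cong_AE[OF mP measurable_completion[OF m] e] integrable_completion[OF m]
      by (subst integrable_restrict_space) auto
    show "(LINT s|lebesgue. indicator unit_square s *\<^sub>R (k s * P s)) = (LINT s|US. k s * g s)"
      unfolding square integral_cong_AE[OF mP measurable_completion[OF m] e] integral_completion[OF m]
      by (subst integral_restrict_space) auto
  qed
  have T_eq: "T_op a b \<tau> P = T"
    by (rule ext) (simp add: T_op_def T_def set_lebesgue_integral_def kernel transfer(2)[OF kappa_measurable])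
  have \<alpha>: "\<alpha> = (\<beta> - r) / r" by (simp add: assms(22) \<beta>_def)
  have total: "(LINT s:unit_square|lebesgue. P s) = (LINT s|US. g s)"
    using transfer(2)[of "\<lambda>s. 1"] by (simp add: set_lebesgue_integral_def)
  have solution: "distributional_solution a b T P"
    if per: "AE p in lebesgue. P (fst p + 1, snd p) = P p" "AE p in lebesgue. P (fst p, snd p + 1) = P p"
    unfolding distributional_solution_def
  proof (intro allI impI)
    fix \<phi> assume \<phi>: "test_function \<phi>"
    note C1 = test_function_imp_C1(1)[OF \<phi>]
    obtain M where M: "\<And>p. \<phi> p \<noteq> 0 \<Longrightarrow> p \<in> box (- M, - M) (M, M)" using test_function_imp_C1(2)[OF \<phi>] by blast
    have [measurable]: "\<phi> \<in> borel_measurable borel"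
      by (rule borel_measurable_continuous_onI[OF C1_on_imp_continuous_on[OF C1]])
    have [measurable]: "field \<phi> \<in> borel_measurable borel"
      by (rule borel_measurable_continuous_onI[OF field_continuous[OF C1]])
    have shift: "AE p in lborel. P (c + p) = g (c + p)" for c by (rule AE_lborel_translate[OF g(2)])
    have gx: "AE p in lborel. g (fst p + 1, snd p) = g p"
      using shift[of "(1, 0)"] g(2) per(1)[unfolded AE_completion_iff]
      by eventually_elim (simp add: plus_prod_def add.commute)
    have gy: "AE p in lborel. g (fst p, snd p + 1) = g p"
      using shift[of "(0, 1)"] g(2) per(2)[unfolded AE_completion_iff]
      by eventually_elim (simp add: plus_prod_def add.commute)
    \<comment> \<open>The Jacobian is the wedge coefficient lifted to the plane, so its zeros are
      the preimage of the degeneracy set.\<close>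
    have "{p. jacobian p = 0} \<in> null_sets lebesgue"
      using local_regular(2) unfolding jacobian_def
      by (simp add: wedge_conj_def lift_torus_def negligible_iff_null_sets)
    then have "AE p in lebesgue. p \<notin> {p. jacobian p = 0}" by (rule AE_not_in)
    then have jac: "AE p in lborel. jacobian p \<noteq> 0" unfolding AE_completion_iff by simp
    have "(LINT p|lebesgue. T p * vector_field a b \<phi> p) = (LINT p|lebesgue. T p * field \<phi> p)"
      by (simp add: vector_field_def field_def)
    also have "\<dots> = (LINT p|lborel. T p * field \<phi> p)"
      by (rule integral_completion) (use T_measurable in measurable)
    finally have "- (LINT p|lebesgue. T p * vector_field a b \<phi> p) = (LINT p|lborel. g p * \<phi> p)"
      using T_weak_solution[OF C1 M gx gy jac] by simp
    also have "\<dots> = (LINT p|lebesgue. g p * \<phi> p)"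
      by (rule integral_completion[symmetric]) (use g(1) in measurable)
    also have "\<dots> = (LINT p|lebesgue. P p * \<phi> p)"
    proof (rule integral_cong_AE)
      have \<phi>L: "\<phi> \<in> borel_measurable lebesgue" by (rule measurable_completion) simp
      show "(\<lambda>p. g p * \<phi> p) \<in> borel_measurable lebesgue" "(\<lambda>p. P p * \<phi> p) \<in> borel_measurable lebesgue"
        using \<phi>L gL P_meas by auto
      show "AE p in lebesgue. g p * \<phi> p = P p * \<phi> p" using ae by eventually_elim simp
    qed
    finally show "- (LINT p|lebesgue. T p * vector_field a b \<phi> p) = (LINT p|lebesgue. P p * \<phi> p)" .
  qed
  show ?thesis
    unfolding T_eq \<alpha> total set_integrable_def kernel transfer(1)[OF kappa_measurable]
    using kernel_integrable T_holder T_plus_x T_plus_y solution by blast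
qed

end
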